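(* Let $0\to\mathfrak n\xrightarrow{\iota}\hat{\mathfrak g}\xrightarrow{\pi}\mathfrak g\to0$ be an extension of $L_\infty$-algebras, let $\mathfrak h$ be an $L_\infty$-algebra, let $(\mathbb V,\rho)$ and $(\mathbb W,\tau)$ be representations up to homotopy of $\mathfrak g$ and $\mathfrak h$, respectively, and let $(T,t):(\mathbb W,\tau)\to(\mathbb V,\rho)$ be a ruth morphism. Let $0\to\mathfrak n\to\hat{\mathfrak h}\to\mathfrak h\to0$ be the associated pullback extension along $T:\mathfrak h\to\mathfrak g$. Then for every $k\ge1$ the following diagram commutes: $$\begin{array}{ccc}\underline{\mathrm{Hom}}^{\bullet}(\wedge^k\mathfrak n[1],\mathbb V)^{\hat{\mathfrak g}}&\xrightarrow{\ cw\ }&H^{k+\bullet}(\mathfrak g,\mathbb V)\\ {\scriptstyle t^\sharp}\downarrow&&\downarrow{\scriptstyle T^*}\\ \underline{\mathrm{Hom}}^{\bullet}(\wedge^k\mathfrak n[1],\mathbb W)^{\hat{\mathfrak h}}&\xrightarrow{\ cw\ }&H^{k+\bullet}(\mathfrak h,\mathbb W)\end{array}$$ where $t^\sharp(f)=t\circ f$ and $T^*[\alpha]=[t\circ\alpha\circ T]$.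
   Context: Vector spaces are over $\mathbb R$. For graded vector spaces $V,W$, $\underline{\mathrm{Hom}}^p(V,W)$ is the space of linear maps homogeneous of degree $p$; $(f\otimes g)(v\otimes w)=(-1)^{|g||v|}f(v)\otimes g(w)$; $V[1]_n=V_{n+1}$. $S(V)=\bigoplus_{n\ge0}S^n(V)$ is the graded symmetric algebra with product $\vee$ (also $\mu$) and coproduct $$\Delta(v_1\vee\cdots\vee v_n)=\sum_{k=0}^n\sum_{\sigma\in Sh(k,n-k)}\epsilon(\sigma)(v_{\sigma(1)}\vee\cdots\vee v_{\sigma(k)})\otimes(v_{\sigma(k+1)}\vee\cdots\vee v_{\sigma(n)}),$$ with $Sh(k,n-k)$ the permutations increasing on $\{1,\dots,k\}$ and on $\{k+1,\dots,n\}$, $\epsilon(\sigma)$ the Koszul sign. $\wedge^kV$ is the quotient of $V^{\otimes k}$ by the span of all $v_1\otimes\cdots\otimes v_k-\mathrm{sgn}(\sigma)\epsilon(\sigma)v_{\sigma(1)}\otimes\cdots\otimes v_{\sigma(k)}$. An $L_\infty$-algebra is a graded vector space $\mathfrak g=\bigoplus_{n\le 0}\mathfrak g_n$ with degree 1 maps $\lambda_k:S^k(\mathfrak g[1])\to\mathfrak g[1]$, $k\ge1$, such that with $\lambda=\sum_k\lambda_k$ ($\lambda(1)=0$) the coderivation $d_\lambda=\mu\circ(\lambda\otimes\mathrm{Id})\circ\Delta$ satisfies $d_\lambda^2=0$. An $L_\infty$-morphism $F:\mathfrak g\to\mathfrak g'$ is a degree 0 coalgebra morphism $F:S(\mathfrak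 g[1])\to S(\mathfrak g'[1])$, $F(1)=1$, commuting with the coderivations; it is determined by its components $F^1_n:S^n(\mathfrak g[1])\to\mathfrak g'[1]$, and is strict if $F^1_n=0$ for $n\ge2$, i.e. $F=S(F^1_1)$. A representation up to homotopy (ruth) of $(\mathfrak g,\lambda)$ on $\mathbb V$ is a degree 1 map $\rho:S(\mathfrak g[1])\otimes\mathbb V\to\mathbb V$ with $\rho\circ(d_\lambda\otimes\mathrm{Id})+\rho\circ(\mathrm{Id}\otimes\rho)\circ(\Delta\otimes\mathrm{Id})=0$. $C^p(\mathfrak g,\mathbb V)=\underline{\mathrm{Hom}}^p(S(\mathfrak g[1]),\mathbb V)$, $D_\rho\alpha=\rho\circ(\mathrm{Id}\otimes\alpha)\circ\Delta-(-1)^p\alpha\circ d_\lambda$ for $\alpha\in C^p$; $H(\mathfrak g,\mathbb V)$ is its cohomology. A ruth morphism $(T,t):(\mathbb W,\tau)\to(\mathbb V,\rho)$ between ruths of $\mathfrak h$ and $\mathfrak g$ is an $L_\infty$-morphism $T:\mathfrak h\to\mathfrak g$ and a degree preserving map $t:\mathbb V\to\mathbb W$ with $t\circ\rho\circ(T\otimes\mathrm{Id}_{\mathbb V})=\tau\circ(\mathrm{Id}\otimes t)$; then $\alpha\mapsto t\circ\alpha\circ T$ is a cochain map. An extension is a short exact sequence $0\to\mathfrak n\xrightarrow{\iota}\hat{\mathfrak g}\xrightarrow{\pi}\mathfrak g\to0$ with $\iota,\pi$ strict; $\mathfrak n$ is identified with its image. A section is a degree 0 linear map $h:\mathfrak g[1]\to\hat{\mathfrak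 g}[1]$ with $\pi^1_1\circ h=\mathrm{Id}$; its curvature is $K_h=\hat\lambda\circ S(h)-h\circ\lambda:S(\mathfrak g[1])\to\mathfrak n[1]$. $\mathrm{ad}|_{\mathfrak n}(x\otimes y)=\hat\lambda(x\vee y)$ is a ruth of $\hat{\mathfrak g}$ on $\mathfrak n[1]$; the induced ruth $\wedge^k\mathrm{ad}|_{\mathfrak n}$ on $\wedge^k\mathfrak n[1]$ comes from $x\otimes v_1\otimes\cdots\otimes v_k\mapsto\sum_i(-1)^{(|x|+1)(|v_1|+\cdots+|v_{i-1}|)}v_1\otimes\cdots\otimes\mathrm{ad}|_{\mathfrak n}(x\otimes v_i)\otimes\cdots\otimes v_k$. With $\pi^*\rho=\rho\circ(\pi\otimes\mathrm{Id})$, $\underline{\mathrm{Hom}}^{p}(\wedge^k\mathfrak n[1],\mathbb V)^{\hat{\mathfrak g}}$ is the space of degree $p$ linear maps $f$ with $f\circ(\wedge^k\mathrm{ad}|_{\mathfrak n})=(-1)^p\pi^*\rho\circ(\mathrm{Id}\otimes f)$ (and analogously for $\hat{\mathfrak h}$, $\mathbb W$). The Chern-Weil-Lecomte map is $cw(f)=[f\circ K_h^{\wedge k}]$, where $K_h^{\wedge k}=(K_h\otimes\cdots\otimes K_h)\circ\Delta^{k-1}$ ($\Delta^{k-1}$ the iterated coproduct $S(\mathfrak g[1])\to S(\mathfrak g[1])^{\otimes k}$, composed with $\mathfrak n[1]^{\otimes k}\to\wedge^k\mathfrak n[1]$); it is well defined and independent of the section $h$. Pullback extension: $\hat{\mathfrak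 h}=\mathfrak h\times_{\mathfrak g}\hat{\mathfrak g}$ is the pullback of $\pi$ and $T$ in $L_\infty$-algebras. Explicit model: fix a section $h$ of $\pi$, put $\hat{\mathfrak h}=\mathfrak h\oplus\mathfrak n$ as a graded vector space, let $\pi_\bullet=S(\mathrm{pr}_{\mathfrak h[1]})$ and $\iota_\bullet$ be the strict maps given by projection and inclusion, and let $T_\bullet:S(\hat{\mathfrak h}[1])\to S(\hat{\mathfrak g}[1])$ be the coalgebra morphism with components $(T_\bullet)^1_1(x,\nu)=h(T^1_1x)+\nu$ and $(T_\bullet)^1_n=h\circ T^1_n\circ S^n(\mathrm{pr}_{\mathfrak h[1]})$ for $n\ge2$. The $L_\infty$-structure on $\hat{\mathfrak h}$ is the unique one making $\pi_\bullet$ and $T_\bullet$ $L_\infty$-morphisms: its structure map has $\mathfrak h[1]$-component $\lambda^{\mathfrak h}\circ\pi_\bullet$ and $\mathfrak n[1]$-component $\hat\lambda\circ T_\bullet-h\circ\lambda^{\mathfrak g}\circ T\circ\pi_\bullet$. One has $\pi\circ T_\bullet=T\circ\pi_\bullet$ and $T_\bullet\circ\iota_\bullet=\iota$. *)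

theory Defs
  imports "HOL-Analysis.Analysis" "HOL-Analysis.Finite_Function_Topology" "HOL-Combinatorics.Permutations"
begin

section \<open>Graded vector spaces\<close>

(* The class grading only records a family of subsets. It is what the constructions below need;
   graded_vector adds that the family is a direct sum decomposition. *)

class grading = real_vector +
  fixes gr :: "int \<Rightarrow> 'a set"

class graded_vector = grading +
  assumes zero_gr: "0 \<in> gr n"
    and add_gr: "v \<in> gr n \<Longrightarrow> w \<in> gr n \<Longrightarrow> v + w \<in> gr n"
    and scaleR_gr: "v \<in> gr n \<Longrightarrow> a *\<^sub>R v \<in> gr n"
    and direct_sum_gr:
      "\<exists>!c. finite {n. c n \<noteq> 0} \<and> (\<forall>n. c n \<in> gr n) \<and> v = (\<Sum>n | c n \<noteq> 0. c n)"

definition Hom :: "int \<Rightarrow> ('a::grading \<Rightarrow> 'b::grading) set" where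
  "Hom p = {f. linear f \<and> (\<forall>n. \<forall>v\<in>gr n. f v \<in> gr (n + p))}"

typedef 'a shift = "UNIV :: 'a set" morphisms unshift shift ..

setup_lifting type_definition_shift

instantiation shift :: (real_vector) real_vector
begin

lift_definition zero_shift :: "'a shift" is 0 .
lift_definition plus_shift :: "'a shift \<Rightarrow> 'a shift \<Rightarrow> 'a shift" is "(+)" .
lift_definition minus_shift :: "'a shift \<Rightarrow> 'a shift \<Rightarrow> 'a shift" is "(-)" .
lift_definition uminus_shift :: "'a shift \<Rightarrow> 'a shift" is uminus .
lift_definition scaleR_shift :: "real \<Rightarrow> 'a shift \<Rightarrow> 'a shift" is scaleR .

instance
  by standard (transfer, simp add: algebra_simps; fail)+

end

lemma linear_unshift: "linear unshift" and linear_shift: "linear shift"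
  by (auto intro!: linearI simp: plus_shift.rep_eq scaleR_shift.rep_eq
      plus_shift.abs_eq scaleR_shift.abs_eq)

instantiation shift :: (grading) grading
begin

definition gr_shift :: "int \<Rightarrow> 'a shift set" where
  "gr_shift n = {x. unshift x \<in> gr (n + 1)}"

instance ..

end

instance shift :: (graded_vector) graded_vector
proof
  fix n :: int and v :: "'a shift"
  show "0 \<in> (gr n :: 'a shift set)"
    by (simp add: gr_shift_def zero_shift.rep_eq zero_gr)
  show "v + w \<in> gr n" if "v \<in> gr n" "w \<in> gr n" for w
    using that by (simp add: gr_shift_def plus_shift.rep_eq add_gr)
  show "a *\<^sub>R v \<in> gr n" if "v \<in> gr n" for a
    using that by (simp add: gr_shift_def scaleR_shift.rep_eq scaleR_gr)
  have eq0: "shift x = 0 \<longleftrightarrow> x = 0" and ueq0: "unshift y = 0 \<longleftrightarrow> y = 0" for x :: 'a and y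
    by (metis shift_inverse UNIV_I unshift_inverse zero_shift.rep_eq)+
  have fin: "finite {n. c (n + a) \<noteq> (0::'b::zero)} \<longleftrightarrow> finite {n. c n \<noteq> 0}" for c and a :: int
  proof -
    have eq: "{n. c n \<noteq> 0} = (\<lambda>n. n + a) ` {n. c (n + a) \<noteq> 0}"
      by (auto simp: image_iff) (metis diff_add_cancel)
    show ?thesis unfolding eq by (simp add: finite_image_iff inj_on_def)
  qed
  have sm: "(\<Sum>n | c (n + a) \<noteq> 0. c (n + a)) = (\<Sum>n | c n \<noteq> 0. c n)"
    for c :: "int \<Rightarrow> 'b::real_vector" and a :: int
    by (rule sum.reindex_bij_witness[where i="\<lambda>n. n - a" and j="\<lambda>n. n + a"]) auto
  have us: "unshift (\<Sum>n | c n \<noteq> 0. c n) = (\<Sum>n | unshift (c n) \<noteq> 0. unshift (c n))"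
    for c :: "int \<Rightarrow> 'a shift"
    by (simp add: linear_sum[OF linear_unshift] ueq0)
  have ss: "(v = (\<Sum>n | c n \<noteq> 0. c n)) =
      (unshift v = (\<Sum>n | unshift (c n) \<noteq> 0. unshift (c n)))" for c :: "int \<Rightarrow> 'a shift"
    by (simp add: unshift_inject flip: us)
  let ?P = "\<lambda>c. finite {n. c n \<noteq> 0} \<and> (\<forall>n. c n \<in> gr n) \<and> unshift v = (\<Sum>n | c n \<noteq> 0. c n)"
  let ?Q = "\<lambda>c. finite {n. c n \<noteq> 0} \<and> (\<forall>n. c n \<in> gr n) \<and> v = (\<Sum>n | c n \<noteq> 0. c n)"
  have QP: "?P (\<lambda>n. unshift (c (n - 1)))" if "?Q c" for c :: "int \<Rightarrow> 'a shift"
    using that fin[of "\<lambda>n. unshift (c n)" "-1"] sm[of "\<lambda>n. unshift (c n)" "-1"]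
    by (auto simp: ss ueq0 gr_shift_def) (metis diff_add_cancel)
  have PQ: "?Q (\<lambda>n. shift (c (n + 1)))" if "?P c" for c :: "int \<Rightarrow> 'a"
    using that fin[of c 1] sm[of c 1]
    by (simp add: eq0 gr_shift_def shift_inverse flip: linear_sum[OF linear_shift])
      (metis unshift_inverse)
  have ex1: "\<exists>!c. ?P c" by (rule direct_sum_gr)
  show "\<exists>!c. ?Q c"
  proof (rule ex_ex1I)
    obtain c where "?P c" using ex1 by (elim ex1E) (rule that, assumption)
    then show "\<exists>c. ?Q c" by (intro exI[where x="\<lambda>n. shift (c (n + 1))"] PQ)
    fix c d assume c: "?Q c" and d: "?Q d"
    have "(\<lambda>n. unshift (c (n - 1))) = (\<lambda>n. unshift (d (n - 1)))"
      using ex1 QP[OF c] QP[OF d] unfolding Ex1_def by metis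
    then have "unshift (c (n + 1 - 1)) = unshift (d (n + 1 - 1))" for n by metis
    then show "c = d" by (auto simp: unshift_inject)
  qed
qed

instantiation prod :: (grading, grading) grading
begin

definition gr_prod :: "int \<Rightarrow> ('a \<times> 'b) set" where
  "gr_prod n = gr n \<times> gr n"

instance ..

end

lemma direct_sum_superset:
  assumes "finite A" "{n. c n \<noteq> (0::'a::real_vector)} \<subseteq> A"
  shows "(\<Sum>n | c n \<noteq> 0. c n) = (\<Sum>n\<in>A. c n)"
  using assms by (intro sum.mono_neutral_left) auto

instance prod :: (graded_vector, graded_vector) graded_vector
proof
  fix n :: int and v :: "'a \<times> 'b"
  show "0 \<in> (gr n :: ('a \<times> 'b) set)"
    by (simp add: gr_prod_def zero_prod_def zero_gr)
  show "v + w \<in> gr n" if "v \<in> gr n" "w \<in> gr n" for w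
    using that by (auto simp: gr_prod_def add_gr)
  show "a *\<^sub>R v \<in> gr n" if "v \<in> gr n" for a
    using that by (auto simp: gr_prod_def scaleR_gr)
  let ?P = "\<lambda>c x. finite {n. c n \<noteq> 0} \<and> (\<forall>n. c n \<in> gr n) \<and> x = (\<Sum>n | c n \<noteq> 0. c n)"
  have split: "?P c v \<longleftrightarrow> ?P (fst \<circ> c) (fst v) \<and> ?P (snd \<circ> c) (snd v)" for c :: "int \<Rightarrow> 'a \<times> 'b"
  proof -
    have U: "{n. c n \<noteq> 0} = {n. (fst \<circ> c) n \<noteq> 0} \<union> {n. (snd \<circ> c) n \<noteq> 0}"
      by (auto simp: prod_eq_iff)
    have "(v = (\<Sum>n | c n \<noteq> 0. c n)) \<longleftrightarrow> fst v = (\<Sum>n | (fst \<circ> c) n \<noteq> 0. (fst \<circ> c) n) \<and>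
        snd v = (\<Sum>n | (snd \<circ> c) n \<noteq> 0. (snd \<circ> c) n)" if "finite {n. c n \<noteq> 0}"
    proof -
      have "(\<Sum>n | (fst \<circ> c) n \<noteq> 0. (fst \<circ> c) n) = (\<Sum>n | c n \<noteq> 0. fst (c n))"
        using direct_sum_superset[OF that, of "fst \<circ> c"] unfolding U by simp
      moreover have "(\<Sum>n | (snd \<circ> c) n \<noteq> 0. (snd \<circ> c) n) = (\<Sum>n | c n \<noteq> 0. snd (c n))"
        using direct_sum_superset[OF that, of "snd \<circ> c"] unfolding U by simp
      ultimately show ?thesis by (simp add: prod_eq_iff fst_sum snd_sum)
    qed
    moreover have "finite {n. c n \<noteq> 0} \<longleftrightarrow>
        finite {n. (fst \<circ> c) n \<noteq> 0} \<and> finite {n. (snd \<circ> c) n \<noteq> 0}"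
      unfolding U by simp
    ultimately show ?thesis
      by (auto simp: gr_prod_def mem_Times_iff simp del: comp_apply simp: comp_def)
  qed
  have ea: "\<exists>!c. ?P c (fst v)" and eb: "\<exists>!c. ?P c (snd v)"
    by (rule direct_sum_gr)+
  show "\<exists>!c. ?P c v"
  proof (rule ex_ex1I)
    obtain a b where ab: "?P a (fst v)" "?P b (snd v)" using ea eb by blast
    have "fst \<circ> (\<lambda>n. (a n, b n)) = a" "snd \<circ> (\<lambda>n. (a n, b n)) = b" by auto
    then have "?P (\<lambda>n. (a n, b n)) v" unfolding split using ab by (simp only:) simp
    then show "\<exists>c. ?P c v" by (rule exI[where x="\<lambda>n. (a n, b n)"])
    fix c d assume "?P c v" "?P d v"
    then have "?P (fst \<circ> c) (fst v)" "?P (snd \<circ> c) (snd v)"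
        "?P (fst \<circ> d) (fst v)" "?P (snd \<circ> d) (snd v)"
      unfolding split by blast+
    with ea eb have "fst \<circ> c = fst \<circ> d" "snd \<circ> c = snd \<circ> d" by blast+
    then show "c = d" by (metis comp_apply prod_eq_iff ext)
  qed
qed


section \<open>Tensor products\<close>

definition span_cong :: "'a::real_vector set \<Rightarrow> 'a \<Rightarrow> 'a \<Rightarrow> bool" where
  "span_cong R x y \<longleftrightarrow> x - y \<in> span R"

lemma equivp_span_cong: "equivp (span_cong R)"
proof (rule equivpI)
  show "reflp (span_cong R)" by (simp add: reflp_def span_cong_def span_zero)
  show "symp (span_cong R)"
    unfolding symp_def span_cong_def by (metis minus_diff_eq span_neg)
  show "transp (span_cong R)"
    unfolding transp_def span_cong_def by (metis diff_add_cancel add_diff_eq span_add)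
qed

lemma span_cong_refl: "span_cong R x x"
  by (simp add: span_cong_def span_zero)

lemma span_cong_add:
  "span_cong R x x' \<Longrightarrow> span_cong R y y' \<Longrightarrow> span_cong R (x + y) (x' + y')"
  unfolding span_cong_def by (metis add_diff_add span_add)

lemma span_cong_diff:
  "span_cong R x x' \<Longrightarrow> span_cong R y y' \<Longrightarrow> span_cong R (x - y) (x' - y')"
  unfolding span_cong_def using span_diff[of "x - x'" R "y - y'"] by (simp add: algebra_simps)

lemma span_cong_uminus: "span_cong R x x' \<Longrightarrow> span_cong R (- x) (- x')"
  unfolding span_cong_def using span_neg[of "x - x'" R] by (simp add: algebra_simps)

lemma span_cong_scaleR: "span_cong R x x' \<Longrightarrow> span_cong R (c *\<^sub>R x) (c *\<^sub>R x')"
  unfolding span_cong_def by (metis span_mul scaleR_diff_right)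

abbreviation gen :: "'x \<Rightarrow> 'x \<Rightarrow>\<^sub>0 real" where
  "gen x \<equiv> Poly_Mapping.single x 1"

definition tensor_rel :: "(('a::real_vector \<times> 'b::real_vector) \<Rightarrow>\<^sub>0 real) set" where
  "tensor_rel =
     {gen (v + v', w) - gen (v, w) - gen (v', w) | v v' w. True} \<union>
     {gen (v, w + w') - gen (v, w) - gen (v, w') | v w w'. True} \<union>
     {gen (c *\<^sub>R v, w) - c *\<^sub>R gen (v, w) | c v w. True} \<union>
     {gen (v, c *\<^sub>R w) - c *\<^sub>R gen (v, w) | c v w. True}"

quotient_type (overloaded) ('a, 'b) tensor =
  "('a::real_vector \<times> 'b::real_vector) \<Rightarrow>\<^sub>0 real" / "span_cong tensor_rel"
  by (rule equivp_span_cong)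

instantiation tensor :: (real_vector, real_vector) real_vector
begin

lift_definition zero_tensor :: "('a, 'b) tensor" is 0 .

lift_definition plus_tensor :: "('a, 'b) tensor \<Rightarrow> ('a, 'b) tensor \<Rightarrow> ('a, 'b) tensor" is "(+)"
  by (rule span_cong_add)

lift_definition minus_tensor :: "('a, 'b) tensor \<Rightarrow> ('a, 'b) tensor \<Rightarrow> ('a, 'b) tensor" is "(-)"
  by (rule span_cong_diff)

lift_definition uminus_tensor :: "('a, 'b) tensor \<Rightarrow> ('a, 'b) tensor" is uminus
  by (rule span_cong_uminus)

lift_definition scaleR_tensor :: "real \<Rightarrow> ('a, 'b) tensor \<Rightarrow> ('a, 'b) tensor" is scaleR
  by (rule span_cong_scaleR)

instance
  by standard
    (transfer, simp add: algebra_simps span_cong_refl; fail)+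

end

definition tensor :: "'a::real_vector \<Rightarrow> 'b::real_vector \<Rightarrow> ('a, 'b) tensor"
    (infixr "\<otimes>\<^sub>\<real>" 71) where
  "v \<otimes>\<^sub>\<real> w = abs_tensor (gen (v, w))"

instantiation tensor :: (grading, grading) grading
begin

definition gr_tensor :: "int \<Rightarrow> ('a, 'b) tensor set" where
  "gr_tensor n = span {v \<otimes>\<^sub>\<real> w | v w i j. v \<in> gr i \<and> w \<in> gr j \<and> i + j = n}"

instance ..

end

(* From here on a linear map out of a tensor product, tensor algebra, symmetric or exterior algebra
   is given by its values on a spanning set, as the unique linear map with these values. *)

definition tensor_lift ::
    "('a::real_vector \<Rightarrow> 'b::real_vector \<Rightarrow> 'c::real_vector) \<Rightarrow> ('a, 'b) tensor \<Rightarrow> 'c" where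
  "tensor_lift B = (THE L. linear L \<and> (\<forall>v w. L (v \<otimes>\<^sub>\<real> w) = B v w))"

(* f \<otimes> g, where q is the degree of g, with the Koszul sign (-1)^(|g||v|). *)
definition tensor_map ::
    "int \<Rightarrow> ('a::grading \<Rightarrow> 'c::real_vector) \<Rightarrow> ('b::real_vector \<Rightarrow> 'd::real_vector)
      \<Rightarrow> ('a, 'b) tensor \<Rightarrow> ('c, 'd) tensor" where
  "tensor_map q f g = (THE L. linear L \<and>
     (\<forall>n. \<forall>v\<in>gr n. \<forall>w. L (v \<otimes>\<^sub>\<real> w) = ((-1) powi (q * n)) *\<^sub>R (f v \<otimes>\<^sub>\<real> g w)))"

definition tensor_assoc ::
    "(('a::real_vector, 'b::real_vector) tensor, 'c::real_vector) tensor
      \<Rightarrow> ('a, ('b, 'c) tensor) tensor" where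
  "tensor_assoc = (THE L. linear L \<and>
     (\<forall>u v w. L ((u \<otimes>\<^sub>\<real> v) \<otimes>\<^sub>\<real> w) = u \<otimes>\<^sub>\<real> (v \<otimes>\<^sub>\<real> w)))"


section \<open>Tensor, symmetric and exterior algebra\<close>

definition tens_rel :: "('a::real_vector list \<Rightarrow>\<^sub>0 real) set" where
  "tens_rel =
     {gen (us @ [v + v'] @ ws) - gen (us @ [v] @ ws) - gen (us @ [v'] @ ws) | us v v' ws. True} \<union>
     {gen (us @ [c *\<^sub>R v] @ ws) - c *\<^sub>R gen (us @ [v] @ ws) | us c v ws. True}"

(* The tensor algebra: the direct sum over k of the k-fold tensor powers. *)
quotient_type (overloaded) 'a tens = "'a::real_vector list \<Rightarrow>\<^sub>0 real" / "span_cong tens_rel"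
  by (rule equivp_span_cong)

instantiation tens :: (real_vector) real_vector
begin

lift_definition zero_tens :: "'a tens" is 0 .

lift_definition plus_tens :: "'a tens \<Rightarrow> 'a tens \<Rightarrow> 'a tens" is "(+)"
  by (rule span_cong_add)

lift_definition minus_tens :: "'a tens \<Rightarrow> 'a tens \<Rightarrow> 'a tens" is "(-)"
  by (rule span_cong_diff)

lift_definition uminus_tens :: "'a tens \<Rightarrow> 'a tens" is uminus
  by (rule span_cong_uminus)

lift_definition scaleR_tens :: "real \<Rightarrow> 'a tens \<Rightarrow> 'a tens" is scaleR
  by (rule span_cong_scaleR)

instance
  by standard
    (transfer, simp add: algebra_simps span_cong_refl; fail)+

end

definition tens :: "'a::real_vector list \<Rightarrow> 'a tens" where
  "tens vs = abs_tens (gen vs)"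

definition tens_mult :: "'a::real_vector tens \<Rightarrow> 'a tens \<Rightarrow> 'a tens" where
  "tens_mult = (THE m. bilinear m \<and> (\<forall>vs ws. m (tens vs) (tens ws) = tens (vs @ ws)))"

(* homs ds vs: the i-th vector is homogeneous of degree ds ! i. *)
definition homs :: "int list \<Rightarrow> 'a::grading list \<Rightarrow> bool" where
  "homs ds vs \<longleftrightarrow> list_all2 (\<lambda>d v. v \<in> gr d) ds vs"

(* The k-fold tensor power of f, for all k at once, where q is the degree of f; the sign is the one
   obtained by iterating tensor_map. *)
definition tens_map :: "int \<Rightarrow> ('a::grading \<Rightarrow> 'b::real_vector) \<Rightarrow> 'a tens \<Rightarrow> 'b tens" where
  "tens_map q f = (THE L. linear L \<and> (\<forall>ds vs. homs ds vs \<longrightarrow>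
     L (tens vs) =
       ((-1) powi (q * (\<Sum>i<length vs. int (length vs - 1 - i) * ds ! i))) *\<^sub>R tens (map f vs)))"

definition koszul :: "(nat \<Rightarrow> nat) \<Rightarrow> int list \<Rightarrow> real" where
  "koszul \<sigma> ds = (\<Prod>(i, j) | i < j \<and> j < length ds \<and> \<sigma> j < \<sigma> i.
     (-1) powi (ds ! (\<sigma> i) * ds ! (\<sigma> j)))"

definition sym_rel :: "'a::grading tens set" where
  "sym_rel = {tens vs - koszul \<sigma> ds *\<^sub>R tens (permute_list \<sigma> vs) | vs ds \<sigma>.
     homs ds vs \<and> \<sigma> permutes {..<length vs}}"

definition ext_rel :: "'a::grading tens set" where
  "ext_rel = {tens vs - (of_int (sign \<sigma>) * koszul \<sigma> ds) *\<^sub>R tens (permute_list \<sigma> vs) | vs ds \<sigma>.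
     homs ds vs \<and> \<sigma> permutes {..<length vs}}"

quotient_type (overloaded) 'a sym = "'a::grading tens" / "span_cong sym_rel"
  by (rule equivp_span_cong)

instantiation sym :: (grading) real_vector
begin

lift_definition zero_sym :: "'a sym" is 0 .

lift_definition plus_sym :: "'a sym \<Rightarrow> 'a sym \<Rightarrow> 'a sym" is "(+)"
  by (rule span_cong_add)

lift_definition minus_sym :: "'a sym \<Rightarrow> 'a sym \<Rightarrow> 'a sym" is "(-)"
  by (rule span_cong_diff)

lift_definition uminus_sym :: "'a sym \<Rightarrow> 'a sym" is uminus
  by (rule span_cong_uminus)

lift_definition scaleR_sym :: "real \<Rightarrow> 'a sym \<Rightarrow> 'a sym" is scaleR
  by (rule span_cong_scaleR)

instance
  by standard
    (transfer, simp add: algebra_simps span_cong_refl; fail)+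

end

quotient_type (overloaded) 'a ext = "'a::grading tens" / "span_cong ext_rel"
  by (rule equivp_span_cong)

instantiation ext :: (grading) real_vector
begin

lift_definition zero_ext :: "'a ext" is 0 .

lift_definition plus_ext :: "'a ext \<Rightarrow> 'a ext \<Rightarrow> 'a ext" is "(+)"
  by (rule span_cong_add)

lift_definition minus_ext :: "'a ext \<Rightarrow> 'a ext \<Rightarrow> 'a ext" is "(-)"
  by (rule span_cong_diff)

lift_definition uminus_ext :: "'a ext \<Rightarrow> 'a ext" is uminus
  by (rule span_cong_uminus)

lift_definition scaleR_ext :: "real \<Rightarrow> 'a ext \<Rightarrow> 'a ext" is scaleR
  by (rule span_cong_scaleR)

instance
  by standard
    (transfer, simp add: algebra_simps span_cong_refl; fail)+

end

definition sprod :: "'a::grading list \<Rightarrow> 'a sym" where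
  "sprod vs = abs_sym (tens vs)"

definition wprod :: "'a::grading list \<Rightarrow> 'a ext" where
  "wprod vs = abs_ext (tens vs)"

instantiation sym :: (grading) grading
begin

definition gr_sym :: "int \<Rightarrow> 'a sym set" where
  "gr_sym n = span {sprod vs | vs ds. homs ds vs \<and> sum_list ds = n}"

instance ..

end

instantiation ext :: (grading) grading
begin

definition gr_ext :: "int \<Rightarrow> 'a ext set" where
  "gr_ext n = span {wprod vs | vs ds. homs ds vs \<and> sum_list ds = n}"

instance ..

end

definition sym_pow :: "nat \<Rightarrow> 'a::grading sym set" where
  "sym_pow k = span {sprod vs | vs. length vs = k}"

definition ext_pow :: "nat \<Rightarrow> 'a::grading ext set" where
  "ext_pow k = span {wprod vs | vs. length vs = k}"

definition vee :: "'a::grading sym \<Rightarrow> 'a sym \<Rightarrow> 'a sym" (infixl "\<or>\<^sub>S" 72) where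
  "vee = (THE m. bilinear m \<and> (\<forall>vs ws. m (sprod vs) (sprod ws) = sprod (vs @ ws)))"

definition mu :: "('a::grading sym, 'a sym) tensor \<Rightarrow> 'a sym" where
  "mu = tensor_lift (\<or>\<^sub>S)"

definition Sh :: "nat \<Rightarrow> nat \<Rightarrow> (nat \<Rightarrow> nat) set" where
  "Sh k n = {\<sigma>. \<sigma> permutes {..<n} \<and> strict_mono_on {..<k} \<sigma> \<and> strict_mono_on {k..<n} \<sigma>}"

definition coprod :: "'a::grading sym \<Rightarrow> ('a sym, 'a sym) tensor" where
  "coprod = (THE D. linear D \<and> (\<forall>ds vs. homs ds vs \<longrightarrow>
     D (sprod vs) = (\<Sum>k\<le>length vs. \<Sum>\<sigma>\<in>Sh k (length vs).
       koszul \<sigma> ds *\<^sub>R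
         (sprod (take k (permute_list \<sigma> vs)) \<otimes>\<^sub>\<real> sprod (drop k (permute_list \<sigma> vs))))))"

(* iter_coprod m is the m-fold iterated coproduct, with values in the (m+1)-st tensor power. *)
primrec iter_coprod :: "nat \<Rightarrow> 'a::grading sym \<Rightarrow> 'a sym tens" where
  "iter_coprod 0 x = tens [x]"
| "iter_coprod (Suc m) x = tensor_lift (\<lambda>a b. tens_mult (tens [a]) (iter_coprod m b)) (coprod x)"

definition sym_map :: "('a::grading \<Rightarrow> 'b::grading) \<Rightarrow> 'a sym \<Rightarrow> 'b sym" where
  "sym_map f = (THE L. linear L \<and> (\<forall>vs. L (sprod vs) = sprod (map f vs)))"

definition sym_incl :: "'a::grading \<Rightarrow> 'a sym" where
  "sym_incl v = sprod [v]"

definition sym_proj :: "'a::grading sym \<Rightarrow> 'a" where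
  "sym_proj = (THE L. linear L \<and>
     (\<forall>v. L (sprod [v]) = v) \<and> (\<forall>vs. length vs \<noteq> 1 \<longrightarrow> L (sprod vs) = 0))"


section \<open>L-infinity algebras\<close>

(* The structure maps lambda_k on S^k(g[1]), k >= 1, are the restrictions of one linear map that
   vanishes on S^0(g[1]). *)

definition codiff :: "('a::grading sym \<Rightarrow> 'a) \<Rightarrow> 'a sym \<Rightarrow> 'a sym" where
  "codiff lam = mu \<circ> tensor_map 0 (sym_incl \<circ> lam) id \<circ> coprod"

definition Linfty_algebra :: "('g::graded_vector shift sym \<Rightarrow> 'g shift) \<Rightarrow> bool" where
  "Linfty_algebra lam \<longleftrightarrow>
     (\<forall>n>0. gr n = {0::'g}) \<and> lam \<in> Hom 1 \<and> lam (sprod []) = 0 \<and> (\<forall>x. codiff lam (codiff lam x) = 0)"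

(* Compatibility with the counits follows from the conditions below. *)
definition coalgebra_morphism :: "('a::grading sym \<Rightarrow> 'b::grading sym) \<Rightarrow> bool" where
  "coalgebra_morphism F \<longleftrightarrow>
     F \<in> Hom 0 \<and> F (sprod []) = sprod [] \<and> coprod \<circ> F = tensor_map 0 F F \<circ> coprod"

definition Linfty_morphism ::
    "('a::grading sym \<Rightarrow> 'a) \<Rightarrow> ('b::grading sym \<Rightarrow> 'b) \<Rightarrow> ('a sym \<Rightarrow> 'b sym) \<Rightarrow> bool" where
  "Linfty_morphism lam lam' F \<longleftrightarrow> coalgebra_morphism F \<and> F \<circ> codiff lam = codiff lam' \<circ> F"

(* The component F^1_n is the restriction of sym_proj o F to S^n; comp1 F is F^1_1. *)
definition comp1 :: "('a::grading sym \<Rightarrow> 'b::grading sym) \<Rightarrow> 'a \<Rightarrow> 'b" where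
  "comp1 F = sym_proj \<circ> F \<circ> sym_incl"

definition strict :: "('a::grading sym \<Rightarrow> 'b::grading sym) \<Rightarrow> bool" where
  "strict F \<longleftrightarrow> (\<forall>n\<ge>2. \<forall>x\<in>sym_pow n. sym_proj (F x) = 0)"


section \<open>Representations up to homotopy\<close>

definition ruth ::
    "('g::graded_vector shift sym \<Rightarrow> 'g shift) \<Rightarrow> (('g shift sym, 'v::graded_vector) tensor \<Rightarrow> 'v) \<Rightarrow> bool"
  where
  "ruth lam \<rho> \<longleftrightarrow> \<rho> \<in> Hom 1 \<and>
     (\<forall>x. \<rho> (tensor_map 0 (codiff lam) id x)
        + \<rho> (tensor_map 1 id \<rho> (tensor_assoc (tensor_map 0 coprod id x))) = 0)"

definition ruth_morphism ::
    "('h::graded_vector shift sym \<Rightarrow> 'h shift) \<Rightarrow> (('h shift sym, 'w::graded_vector) tensor \<Rightarrow> 'w)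
      \<Rightarrow> ('g::graded_vector shift sym \<Rightarrow> 'g shift) \<Rightarrow> (('g shift sym, 'v::graded_vector) tensor \<Rightarrow> 'v)
      \<Rightarrow> ('h shift sym \<Rightarrow> 'g shift sym) \<Rightarrow> ('v \<Rightarrow> 'w) \<Rightarrow> bool" where
  "ruth_morphism lamh \<tau> lamg \<rho> T t \<longleftrightarrow>
     Linfty_morphism lamh lamg T \<and> t \<in> Hom 0 \<and> t \<circ> \<rho> \<circ> tensor_map 0 T id = \<tau> \<circ> tensor_map 0 id t"

definition ruth_diff ::
    "('g::graded_vector shift sym \<Rightarrow> 'g shift) \<Rightarrow> (('g shift sym, 'v::graded_vector) tensor \<Rightarrow> 'v)
      \<Rightarrow> int \<Rightarrow> ('g shift sym \<Rightarrow> 'v) \<Rightarrow> 'g shift sym \<Rightarrow> 'v" where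
  "ruth_diff lam \<rho> p \<alpha> =
     (\<lambda>x. \<rho> (tensor_map p id \<alpha> (coprod x)) - ((-1) powi p) *\<^sub>R \<alpha> (codiff lam x))"

definition cocycles ::
    "('g::graded_vector shift sym \<Rightarrow> 'g shift) \<Rightarrow> (('g shift sym, 'v::graded_vector) tensor \<Rightarrow> 'v)
      \<Rightarrow> int \<Rightarrow> ('g shift sym \<Rightarrow> 'v) set" where
  "cocycles lam \<rho> p = {\<alpha> \<in> Hom p. \<forall>x. ruth_diff lam \<rho> p \<alpha> x = 0}"

definition coboundaries ::
    "('g::graded_vector shift sym \<Rightarrow> 'g shift) \<Rightarrow> (('g shift sym, 'v::graded_vector) tensor \<Rightarrow> 'v)
      \<Rightarrow> int \<Rightarrow> ('g shift sym \<Rightarrow> 'v) set" where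
  "coboundaries lam \<rho> p = ruth_diff lam \<rho> (p - 1) ` Hom (p - 1)"

definition cohomologous ::
    "('g::graded_vector shift sym \<Rightarrow> 'g shift) \<Rightarrow> (('g shift sym, 'v::graded_vector) tensor \<Rightarrow> 'v)
      \<Rightarrow> int \<Rightarrow> (('g shift sym \<Rightarrow> 'v) \<times> ('g shift sym \<Rightarrow> 'v)) set" where
  "cohomologous lam \<rho> p = {(\<alpha>, \<beta>). \<alpha> \<in> cocycles lam \<rho> p \<and> \<beta> \<in> cocycles lam \<rho> p \<and>
     (\<lambda>x. \<alpha> x - \<beta> x) \<in> coboundaries lam \<rho> p}"

definition cohomology ::
    "('g::graded_vector shift sym \<Rightarrow> 'g shift) \<Rightarrow> (('g shift sym, 'v::graded_vector) tensor \<Rightarrow> 'v)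
      \<Rightarrow> int \<Rightarrow> ('g shift sym \<Rightarrow> 'v) set set" where
  "cohomology lam \<rho> p = cocycles lam \<rho> p // cohomologous lam \<rho> p"

(* This is the empty set, hence not an element of the cohomology, if alpha is not a cocycle. *)
definition coho_class ::
    "('g::graded_vector shift sym \<Rightarrow> 'g shift) \<Rightarrow> (('g shift sym, 'v::graded_vector) tensor \<Rightarrow> 'v)
      \<Rightarrow> int \<Rightarrow> ('g shift sym \<Rightarrow> 'v) \<Rightarrow> ('g shift sym \<Rightarrow> 'v) set" where
  "coho_class lam \<rho> p \<alpha> = cohomologous lam \<rho> p `` {\<alpha>}"

(* T^*[\<alpha>] = [t o \<alpha> o T]; the union is over the representatives of the class c. *)
definition coho_pullback ::
    "('h::graded_vector shift sym \<Rightarrow> 'h shift) \<Rightarrow> (('h shift sym, 'w::graded_vector) tensor \<Rightarrow> 'w)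
      \<Rightarrow> ('h shift sym \<Rightarrow> 'g::graded_vector shift sym) \<Rightarrow> ('v::graded_vector \<Rightarrow> 'w)
      \<Rightarrow> int \<Rightarrow> ('g shift sym \<Rightarrow> 'v) set \<Rightarrow> ('h shift sym \<Rightarrow> 'w) set" where
  "coho_pullback lamh \<tau> T t p c = (\<Union>\<alpha>\<in>c. coho_class lamh \<tau> p (t \<circ> \<alpha> \<circ> T))"


section \<open>Extensions and the Chern-Weil-Lecomte map\<close>

definition extension ::
    "('n::graded_vector shift sym \<Rightarrow> 'n shift) \<Rightarrow> ('e::graded_vector shift sym \<Rightarrow> 'e shift)
      \<Rightarrow> ('g::graded_vector shift sym \<Rightarrow> 'g shift)
      \<Rightarrow> ('n shift sym \<Rightarrow> 'e shift sym) \<Rightarrow> ('e shift sym \<Rightarrow> 'g shift sym) \<Rightarrow> bool" where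
  "extension lamn lame lamg \<iota> \<pi> \<longleftrightarrow>
     Linfty_algebra lamn \<and> Linfty_algebra lame \<and> Linfty_algebra lamg \<and>
     Linfty_morphism lamn lame \<iota> \<and> strict \<iota> \<and> Linfty_morphism lame lamg \<pi> \<and> strict \<pi> \<and>
     inj (comp1 \<iota>) \<and> range (comp1 \<iota>) = {x. comp1 \<pi> x = 0} \<and> surj (comp1 \<pi>)"

definition is_section ::
    "('e::grading sym \<Rightarrow> 'g::grading sym) \<Rightarrow> ('g \<Rightarrow> 'e) \<Rightarrow> bool" where
  "is_section \<pi> h \<longleftrightarrow> h \<in> Hom 0 \<and> comp1 \<pi> \<circ> h = id"

(* Below, inv (comp1 \<iota>) is the identification of the image of n[1] with n[1]. *)

definition curvature ::
    "('e::grading sym \<Rightarrow> 'e) \<Rightarrow> ('g::grading sym \<Rightarrow> 'g) \<Rightarrow> ('n::grading sym \<Rightarrow> 'e sym)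
      \<Rightarrow> ('g \<Rightarrow> 'e) \<Rightarrow> 'g sym \<Rightarrow> 'n" where
  "curvature lame lamg \<iota> h = (\<lambda>x. inv (comp1 \<iota>) (lame (sym_map h x) - h (lamg x)))"

definition ad ::
    "('e::grading sym \<Rightarrow> 'e) \<Rightarrow> ('n::grading sym \<Rightarrow> 'e sym) \<Rightarrow> ('e sym, 'n) tensor \<Rightarrow> 'n" where
  "ad lame \<iota> = tensor_lift (\<lambda>x y. inv (comp1 \<iota>) (lame (x \<or>\<^sub>S sym_incl (comp1 \<iota> y))))"

definition ext_ad ::
    "(('e::grading sym, 'n::grading) tensor \<Rightarrow> 'n) \<Rightarrow> ('e sym, 'n ext) tensor \<Rightarrow> 'n ext" where
  "ext_ad a = (THE L. linear L \<and> (\<forall>m ds x vs. x \<in> gr m \<and> homs ds vs \<longrightarrow>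
     L (x \<otimes>\<^sub>\<real> wprod vs) = (\<Sum>i<length vs.
       ((-1) powi ((m + 1) * sum_list (take i ds))) *\<^sub>R wprod (vs[i := a (x \<otimes>\<^sub>\<real> (vs ! i))]))))"

(* A linear map on the k-th exterior power is encoded as a linear map on the whole exterior algebra
   that vanishes on the other exterior powers. *)
definition Hom_ext :: "nat \<Rightarrow> int \<Rightarrow> ('n::grading ext \<Rightarrow> 'v::grading) set" where
  "Hom_ext k p = {f \<in> Hom p. \<forall>j. j \<noteq> k \<longrightarrow> (\<forall>x\<in>ext_pow j. f x = 0)}"

definition invariants ::
    "('e::grading sym \<Rightarrow> 'e) \<Rightarrow> ('n::grading sym \<Rightarrow> 'e sym) \<Rightarrow> ('e sym \<Rightarrow> 'g::grading sym)
      \<Rightarrow> (('g sym, 'v::grading) tensor \<Rightarrow> 'v) \<Rightarrow> nat \<Rightarrow> int \<Rightarrow> ('n ext \<Rightarrow> 'v) set" where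
  "invariants lame \<iota> \<pi> \<rho> k p = {f \<in> Hom_ext k p. \<forall>x.
     f (ext_ad (ad lame \<iota>) x) =
       ((-1) powi p) *\<^sub>R \<rho> (tensor_map 0 \<pi> id (tensor_map p id f x))}"

(* K^(wedge k) for K of degree 1 and k >= 1. *)
definition wedge_power :: "('g::grading sym \<Rightarrow> 'n::grading) \<Rightarrow> nat \<Rightarrow> 'g sym \<Rightarrow> 'n ext" where
  "wedge_power K k = abs_ext \<circ> tens_map 1 K \<circ> iter_coprod (k - 1)"

definition cw ::
    "('e::graded_vector shift sym \<Rightarrow> 'e shift) \<Rightarrow> ('g::graded_vector shift sym \<Rightarrow> 'g shift)
      \<Rightarrow> ('n::graded_vector shift sym \<Rightarrow> 'e shift sym)
      \<Rightarrow> (('g shift sym, 'v::graded_vector) tensor \<Rightarrow> 'v)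
      \<Rightarrow> ('g shift \<Rightarrow> 'e shift) \<Rightarrow> nat \<Rightarrow> int \<Rightarrow> ('n shift ext \<Rightarrow> 'v) \<Rightarrow> ('g shift sym \<Rightarrow> 'v) set" where
  "cw lame lamg \<iota> \<rho> h k p f =
     coho_class lamg \<rho> (int k + p) (f \<circ> wedge_power (curvature lame lamg \<iota> h) k)"


section \<open>The pullback extension\<close>

(* The explicit model on h \<oplus> n attached to a section s of the given extension. *)

definition pb_fst :: "('h::real_vector \<times> 'n::real_vector) shift \<Rightarrow> 'h shift" where
  "pb_fst x = shift (fst (unshift x))"

definition pb_snd :: "('h::real_vector \<times> 'n::real_vector) shift \<Rightarrow> 'n shift" where
  "pb_snd x = shift (snd (unshift x))"

definition pb_pair :: "'h::real_vector shift \<Rightarrow> 'n::real_vector shift \<Rightarrow> ('h \<times> 'n) shift" where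
  "pb_pair x \<nu> = shift (unshift x, unshift \<nu>)"

definition pb_proj :: "('h::grading \<times> 'n::grading) shift sym \<Rightarrow> 'h shift sym" where
  "pb_proj = sym_map pb_fst"

definition pb_incl :: "'n::grading shift sym \<Rightarrow> ('h::grading \<times> 'n) shift sym" where
  "pb_incl = sym_map (pb_pair 0)"

(* The coalgebra morphism with (T_pb)^1_1(x, \<nu>) = s(T^1_1 x) + \<nu> and, for n >= 2,
   (T_pb)^1_n = s o T^1_n o S^n(pr); the second summand below vanishes unless n = 1. *)
definition pb_T ::
    "('n::grading shift sym \<Rightarrow> 'e::grading shift sym) \<Rightarrow> ('g::grading shift \<Rightarrow> 'e shift)
      \<Rightarrow> ('h::grading shift sym \<Rightarrow> 'g shift sym) \<Rightarrow> ('h \<times> 'n) shift sym \<Rightarrow> 'e shift sym" where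
  "pb_T \<iota> s T = (THE F. coalgebra_morphism F \<and>
     (\<forall>x. sym_proj (F x) = s (sym_proj (T (pb_proj x))) + comp1 \<iota> (pb_snd (sym_proj x))))"

definition pb_lam ::
    "('e::grading shift sym \<Rightarrow> 'e shift) \<Rightarrow> ('g::grading shift sym \<Rightarrow> 'g shift)
      \<Rightarrow> ('n::grading shift sym \<Rightarrow> 'e shift sym) \<Rightarrow> ('g shift \<Rightarrow> 'e shift)
      \<Rightarrow> ('h::grading shift sym \<Rightarrow> 'h shift) \<Rightarrow> ('h shift sym \<Rightarrow> 'g shift sym)
      \<Rightarrow> ('h \<times> 'n) shift sym \<Rightarrow> ('h \<times> 'n) shift" where
  "pb_lam lame lamg \<iota> s lamh T = (\<lambda>x. pb_pair (lamh (pb_proj x))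
     (inv (comp1 \<iota>) (lame (pb_T \<iota> s T x) - s (lamg (T (pb_proj x))))))"

end

theory Submission
  imports Defs
begin

text \<open>
A section of \<open>\<pi>\<close>, composed with \<open>T\<close>, is a special lift \<open>\<phi>\<close> of the projection of \<open>T\<close> to \<open>g[1]\<close>: a linear map
\<open>S(h[1]) \<rightarrow> g'[1]\<close> of degree 0. Such a lift generates a coalgebra morphism \<open>F\<close>, the convolution exponential
of \<open>\<phi>\<close>, with \<open>\<pi> \<circ> F = T\<close>, and has a curvature \<open>K = \<lambda>' \<circ> F - \<phi> \<circ> d\<close> with values in \<open>n[1]\<close>. The Bianchi
identity says that \<open>K\<close> is closed for the differential twisted by \<open>F\<close>, so that invariance of \<open>f\<close> makes
\<open>t \<circ> f \<circ> K^k\<close> a cocycle. For two lifts, integrating along the segment joining them shows that the two cocycles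
differ by a coboundary. Both ways around the square are represented by such cocycles: one by the lift
that comes from a section of \<open>\<pi>\<close> and \<open>T\<close>, the other by the lift that comes from a section of the pullback extension
and the morphism to \<open>g'\<close>. In this way the differential of the pullback extension is never needed.

Maps out of \<open>S(V)\<close> are compared on products of homogeneous vectors. Koszul signs of the form
\<open>(-1)^(r|x|)\<close> are absorbed in the linear operator \<open>kp r\<close>.
\<close>

section \<open>Linear algebra\<close>

text \<open>The sections \<open>s\<close>, \<open>s1\<close> and \<open>s2\<close> are unrelated,
  and the two ways around the square use curvatures on different extensions. The invariance of f
  sees a lift only through \<pi> F = T, which is the same for all lifts. Hence one differential,
  that of (W, \<tau>), serves along a whole segment of lifts, and integration over the segment
  commutes with it. F need not commute with the codifferentials. Its curvature measures the failure:
  the difference of the two composites is the convolution of K with F. Applying \<lambda>' to this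
  identity gives Bianchi. The exponential form is chosen because it is easy to differentiate: the
  derivative of exp(\<phi> + u a) is the convolution of a with exp(\<phi> + u a). On words of
  bounded length only finitely many powers survive, so all curves are polynomial in u and the
  integral is purely algebraic; the target spaces carry no topology. The second obstacle is that
  maps are described by their values on homogeneous vectors. Each existence is proved by descent to
  a quotient, and signs are made linear so that they can stand under a Sweedler sum.\<close>

named_theorems linear_rules

lemma linear_app: "linear F \<Longrightarrow> linear f \<Longrightarrow> linear (\<lambda>x. F (f x))"
  using linear_compose[of f F] by (simp add: o_def)

declare linear_ident [linear_rules] linear_zero [linear_rules] linear_compose_add [linear_rules]
  linear_compose_sub [linear_rules] linear_compose_neg [linear_rules]

lemma linear_sum_fun [linear_rules]: "(\<And>i. i \<in> A \<Longrightarrow> linear (f i)) \<Longrightarrow> linear (\<lambda>x. \<Sum>i\<in>A. f i x)"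
  by (rule linear_compose_sum) blast

lemma linear_scaleR_fun [linear_rules]: "linear f \<Longrightarrow> linear (\<lambda>x. c *\<^sub>R f x)"
  by (rule linear_compose_scale_right)

lemma linear_scaleR_left [linear_rules]:
  fixes f :: "'a::real_vector \<Rightarrow> real"
  shows "linear f \<Longrightarrow> linear (\<lambda>x. f x *\<^sub>R v)"
  by (rule linearI) (simp_all add: linear_add linear_scale scaleR_add_left)

lemma bilinearI:
  "(\<And>y. linear (\<lambda>x. b x y)) \<Longrightarrow> (\<And>x. linear (\<lambda>y. b x y)) \<Longrightarrow> bilinear b"
  by (simp add: bilinear_def)

lemma bilinear_left: "bilinear b \<Longrightarrow> linear f \<Longrightarrow> linear (\<lambda>x. b (f x) y)"
  using linear_app[of "\<lambda>x. b x y" f] by (simp add: bilinear_def)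

lemma bilinear_right: "bilinear b \<Longrightarrow> linear f \<Longrightarrow> linear (\<lambda>x. b y (f x))"
  using linear_app[of "b y" f] by (simp add: bilinear_def)

lemma linear_ext_span:
  assumes "linear f" "linear g" "span S = UNIV" "\<And>x. x \<in> S \<Longrightarrow> f x = g x"
  shows "f x = g x"
  using linear_eq_on[OF assms(1,2), of x S] assms(3,4) by auto

lemma span_image_UNIV:
  assumes "linear f" "surj f" "span S = UNIV"
  shows "span (f ` S) = UNIV"
  by (metis assms linear_span_image)

text \<open>Linear functionals reduce the calculus of vector-valued curves to real
  functions.\<close>

lemma linear_separates:
  fixes v :: "'a::real_vector"
  assumes "v \<noteq> 0"
  obtains g :: "'a \<Rightarrow> real" where "linear g" "g v \<noteq> 0"
proof -
  have "independent {v}" using assms by simp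
  from linear_independent_extend[OF this, of "\<lambda>_. 1::real"] show ?thesis
    using that by auto
qed

text \<open>For a map out of a quotient in its first argument: extend from the generators
  \<open>g i\<close> for each fixed y. Linearity in y is then an identity between linear maps in x,
  so it can be checked on the generators, where it is \<open>L\<close>.\<close>

lemma bilinear_exists_two_step:
  fixes g :: "'i \<Rightarrow> 'x::real_vector" and L :: "'i \<Rightarrow> 'y::real_vector \<Rightarrow> 'z::real_vector"
  assumes L: "\<And>i. linear (L i)" and M: "\<And>y. \<exists>M. linear M \<and> (\<forall>i. M (g i) = L i y)"
    and g: "span (range g) = UNIV"
  shows "\<exists>m. bilinear m \<and> (\<forall>i y. m (g i) y = L i y)"
proof -
  obtain M where M: "\<And>y. linear (M y)" "\<And>y i. M y (g i) = L i y"
    using M by metis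
  have "linear (\<lambda>y. M y x)" for x
  proof (rule linearI)
    show "M (a + b) x = M a x + M b x" for a b
      by (rule linear_ext_span[OF _ _ g]) (auto intro: linear_rules M simp: M linear_add[OF L])
    show "M (c *\<^sub>R a) x = c *\<^sub>R M a x" for a c
      by (rule linear_ext_span[OF _ _ g]) (auto intro: linear_rules M simp: M linear_scale[OF L])
  qed
  then have "bilinear (\<lambda>x y. M y x)" by (intro bilinearI M)
  then show ?thesis using M by blast
qed

text \<open>Universal property of a quotient by a span. The lift evaluates \<open>L\<close> at a
  chosen representative, and \<open>L\<close> does not see the choice because it vanishes on the
  relations.\<close>

lemma quotient_lift:
  fixes abs :: "'a::real_vector \<Rightarrow> 'q::real_vector" and L :: "'a \<Rightarrow> 'b::real_vector"
  assumes abs: "linear abs" "surj abs" and eq: "\<And>x y. abs x = abs y \<longleftrightarrow> span_cong R x y"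
    and L: "linear L" "\<And>r. r \<in> R \<Longrightarrow> L r = 0"
  shows "\<exists>M. linear M \<and> (\<forall>x. M (abs x) = L x)"
proof -
  have L0: "L r = 0" if "r \<in> span R" for r
    using linear_eq_on[OF L(1) linear_zero that] L(2) by simp
  have LL: "L x = L y" if "abs x = abs y" for x y
    using that L0[of "x - y"] by (simp add: eq span_cong_def linear_diff[OF L(1)])
  define M where "M q = L (inv abs q)" for q
  have M: "M (abs x) = L x" for x
    unfolding M_def by (rule LL) (rule surj_f_inv_f[OF abs(2)])
  have "linear M"
  proof (rule linearI)
    fix p q c
    obtain x y where [simp]: "p = abs x" "q = abs y" using abs(2) by (metis surjD)
    show "M (p + q) = M p + M q"
      by (simp add: M linear_add[OF L(1)] flip: linear_add[OF abs(1)])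
    show "M (c *\<^sub>R p) = c *\<^sub>R M p"
      by (simp add: M linear_scale[OF L(1)] flip: linear_scale[OF abs(1)])
  qed
  then show ?thesis using M by blast
qed

section \<open>The free vector space on a set and its universal property\<close>

definition free_lift :: "('x \<Rightarrow> 'y::real_vector) \<Rightarrow> ('x \<Rightarrow>\<^sub>0 real) \<Rightarrow> 'y" where
  "free_lift g p = (\<Sum>x\<in>Poly_Mapping.keys p. Poly_Mapping.lookup p x *\<^sub>R g x)"

lemma free_lift_superset:
  assumes "finite A" "Poly_Mapping.keys p \<subseteq> A"
  shows "free_lift g p = (\<Sum>x\<in>A. Poly_Mapping.lookup p x *\<^sub>R g x)"
  unfolding free_lift_def using assms
  by (intro sum.mono_neutral_left) (auto simp: in_keys_iff)

lemma lookup_scaleR: "Poly_Mapping.lookup (c *\<^sub>R p) x = c *\<^sub>R Poly_Mapping.lookup (p :: 'x \<Rightarrow>\<^sub>0 real) x"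
  by (simp add: scaleR_poly_mapping_def)

lemma linear_free_lift: "linear (free_lift g)"
proof (rule linearI)
  fix p q :: "'a \<Rightarrow>\<^sub>0 real" and c :: real
  let ?A = "Poly_Mapping.keys p \<union> Poly_Mapping.keys q"
  have "free_lift g (p + q) = (\<Sum>x\<in>?A. Poly_Mapping.lookup (p + q) x *\<^sub>R g x)"
    by (rule free_lift_superset) (auto dest: subsetD[OF Poly_Mapping.keys_add])
  also have "\<dots> = free_lift g p + free_lift g q"
    by (simp add: lookup_add scaleR_add_left sum.distrib free_lift_superset[of ?A])
  finally show "free_lift g (p + q) = free_lift g p + free_lift g q" .
  have "free_lift g (c *\<^sub>R p) = (\<Sum>x\<in>Poly_Mapping.keys p. Poly_Mapping.lookup (c *\<^sub>R p) x *\<^sub>R g x)"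
    by (rule free_lift_superset) (auto simp: in_keys_iff lookup_scaleR)
  then show "free_lift g (c *\<^sub>R p) = c *\<^sub>R free_lift g p"
    by (simp add: free_lift_def lookup_scaleR scaleR_sum_right)
qed

lemma free_lift_gen: "free_lift g (gen x) = g x"
  by (simp add: free_lift_def)

lemma span_range_gen: "span (range (gen :: 'x \<Rightarrow> _)) = UNIV"
proof -
  have "p \<in> span (range gen)" for p :: "'x \<Rightarrow>\<^sub>0 real"
  proof -
    have "p = free_lift gen p"
    proof (rule poly_mapping_eqI)
      fix k
      have "Poly_Mapping.lookup (free_lift gen p) k = (\<Sum>x\<in>Poly_Mapping.keys p. Poly_Mapping.lookup p x *\<^sub>R Poly_Mapping.lookup (gen x) k)"
        by (simp add: free_lift_def lookup_sum lookup_scaleR)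
      also have "\<dots> = (\<Sum>x\<in>Poly_Mapping.keys p. if x = k then Poly_Mapping.lookup p k else 0)"
        by (rule sum.cong) (auto simp: lookup_single when_def)
      also have "\<dots> = Poly_Mapping.lookup p k"
        by (simp add: in_keys_iff)
      finally show "Poly_Mapping.lookup p k = Poly_Mapping.lookup (free_lift gen p) k" ..
    qed
    also have "\<dots> \<in> span (range gen)"
      unfolding free_lift_def by (intro span_sum span_mul span_base) auto
    finally show ?thesis .
  qed
  then show ?thesis by auto
qed


subsection \<open>Tensor products\<close>

lemma linear_abs_tensor: "linear abs_tensor"
  by (rule linearI) (simp_all add: plus_tensor.abs_eq scaleR_tensor.abs_eq)

lemma surj_abs_tensor: "surj abs_tensor"
  by (metis Quotient3_abs_rep Quotient3_tensor surjI)

lemma tensor_exists: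
  assumes "bilinear b"
  shows "\<exists>L. linear L \<and> (\<forall>v w. L (v \<otimes>\<^sub>\<real> w) = b v w)"
proof -
  let ?L = "free_lift (\<lambda>(v, w). b v w)"
  have "?L r = 0" if "r \<in> tensor_rel" for r
    using that unfolding tensor_rel_def
    by (auto simp: linear_diff[OF linear_free_lift] linear_scale[OF linear_free_lift] free_lift_gen
        bilinear_ladd[OF assms] bilinear_radd[OF assms] bilinear_lmul[OF assms] bilinear_rmul[OF assms])
  from quotient_lift[OF linear_abs_tensor surj_abs_tensor tensor.abs_eq_iff linear_free_lift this]
  show ?thesis by (auto simp: tensor_def free_lift_gen)
qed

lemma span_tensor:
  "span (range (\<lambda>(v :: 'a::real_vector, w :: 'b::real_vector). v \<otimes>\<^sub>\<real> w)) = UNIV"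
proof -
  have "range (\<lambda>(v :: 'a, w :: 'b). v \<otimes>\<^sub>\<real> w) = abs_tensor ` range gen"
    by (auto simp: tensor_def image_def)
  then show ?thesis
    by (simp only: span_image_UNIV[OF linear_abs_tensor surj_abs_tensor span_range_gen])
qed

lemma tensor_ext:
  assumes "linear L" "linear L'" "\<And>v w. L (v \<otimes>\<^sub>\<real> w) = L' (v \<otimes>\<^sub>\<real> w)"
  shows "L = L'"
  by (rule ext, rule linear_ext_span[OF assms(1,2) span_tensor]) (auto simp: assms(3))

lemma bilinear_tensor: "bilinear (\<otimes>\<^sub>\<real>)"
proof -
  have z: "abs_tensor r = 0" if "r \<in> tensor_rel" for r
    using that by (simp add: zero_tensor_def tensor.abs_eq_iff span_cong_def span_base)
  note d = linear_diff[OF linear_abs_tensor] linear_scale[OF linear_abs_tensor]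
    linear_add[OF linear_abs_tensor]
  show ?thesis
  proof (intro bilinearI linearI)
    fix x x' y y' c
    show "(x + x') \<otimes>\<^sub>\<real> y = x \<otimes>\<^sub>\<real> y + x' \<otimes>\<^sub>\<real> y"
    proof -
      have "gen (x + x', y) - gen (x, y) - gen (x', y) \<in> tensor_rel"
        unfolding tensor_rel_def by blast
      from z[OF this] show ?thesis by (simp add: tensor_def d diff_diff_eq)
    qed
    show "x \<otimes>\<^sub>\<real> (y + y') = x \<otimes>\<^sub>\<real> y + x \<otimes>\<^sub>\<real> y'"
    proof -
      have "gen (x, y + y') - gen (x, y) - gen (x, y') \<in> tensor_rel"
        unfolding tensor_rel_def by blast
      from z[OF this] show ?thesis by (simp add: tensor_def d diff_diff_eq)
    qed
    show "(c *\<^sub>R x) \<otimes>\<^sub>\<real> y = c *\<^sub>R (x \<otimes>\<^sub>\<real> y)"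
    proof -
      have "gen (c *\<^sub>R x, y) - c *\<^sub>R gen (x, y) \<in> tensor_rel"
        unfolding tensor_rel_def by blast
      from z[OF this] show ?thesis by (simp add: tensor_def d)
    qed
    show "x \<otimes>\<^sub>\<real> (c *\<^sub>R y) = c *\<^sub>R (x \<otimes>\<^sub>\<real> y)"
    proof -
      have "gen (x, c *\<^sub>R y) - c *\<^sub>R gen (x, y) \<in> tensor_rel"
        unfolding tensor_rel_def by blast
      from z[OF this] show ?thesis by (simp add: tensor_def d)
    qed
  qed
qed

lemma tensor_lift_unique: "bilinear b \<Longrightarrow> \<exists>!L. linear L \<and> (\<forall>v w. L (v \<otimes>\<^sub>\<real> w) = b v w)"
proof (rule ex_ex1I)
  assume "bilinear b"
  then show "\<exists>L. linear L \<and> (\<forall>v w. L (v \<otimes>\<^sub>\<real> w) = b v w)" by (rule tensor_exists)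
next
  fix L L' assume "linear L \<and> (\<forall>v w. L (v \<otimes>\<^sub>\<real> w) = b v w)" "linear L' \<and> (\<forall>v w. L' (v \<otimes>\<^sub>\<real> w) = b v w)"
  then show "L = L'" by (intro tensor_ext) auto
qed

lemma linear_tensor_lift: "bilinear b \<Longrightarrow> linear (tensor_lift b)"
  and tensor_lift_tensor: "bilinear b \<Longrightarrow> tensor_lift b (v \<otimes>\<^sub>\<real> w) = b v w"
  using theI'[OF tensor_lift_unique, of b] unfolding tensor_lift_def by simp_all

text \<open>Linearity of \<open>L\<close> forces \<open>b\<close> to be bilinear, so an equation
  with a known linear map is reduced to pure tensors in one step.\<close>

lemma tensor_lift_eqI:
  "linear L \<Longrightarrow> (\<And>v w. L (v \<otimes>\<^sub>\<real> w) = b v w) \<Longrightarrow> tensor_lift b t = L t"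
proof -
  assume L: "linear L" "\<And>v w. L (v \<otimes>\<^sub>\<real> w) = b v w"
  have "bilinear (\<lambda>v w. L (v \<otimes>\<^sub>\<real> w))"
    by (intro bilinearI linear_app[OF L(1)] bilinear_left[OF bilinear_tensor]
        bilinear_right[OF bilinear_tensor] linear_ident)
  then have "bilinear b" by (simp add: L(2))
  then have "tensor_lift b = L"
    by (intro tensor_ext linear_tensor_lift L(1)) (simp_all add: tensor_lift_tensor L(2))
  then show ?thesis by simp
qed

lemma tensor_induct [case_names tensor add scale]:
  assumes "\<And>v w. P (v \<otimes>\<^sub>\<real> w)" "\<And>s t. P s \<Longrightarrow> P t \<Longrightarrow> P (s + t)" "\<And>c t. P t \<Longrightarrow> P (c *\<^sub>R t)"
  shows "P t"
proof -
  have P0: "P 0" using assms(3)[of "0 \<otimes>\<^sub>\<real> 0" 0, OF assms(1)] by simp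
  have "t \<in> span (range (\<lambda>(v, w). v \<otimes>\<^sub>\<real> w))" by (simp add: span_tensor)
  then show ?thesis
    by (induction rule: span_induct_alt) (auto intro!: assms P0)
qed


subsection \<open>Multilinear functions of lists\<close>

text \<open>One function of lists stands for a whole family of k-linear maps, one for each length k,
  because \<open>tens\<close> is the sum of all tensor powers.\<close>

definition multilinear :: "('a::real_vector list \<Rightarrow> 'b::real_vector) \<Rightarrow> bool" where
  "multilinear \<Phi> \<longleftrightarrow> (\<forall>us ws. linear (\<lambda>v. \<Phi> (us @ v # ws)))"

lemma multilinearD: "multilinear \<Phi> \<Longrightarrow> linear (\<lambda>v. \<Phi> (us @ v # ws))"
  by (simp add: multilinear_def)

lemma multilinear_Cons:
  assumes "\<And>ws. linear (\<lambda>v. \<Phi> (v # ws))" "\<And>u. multilinear (\<lambda>vs. \<Phi> (u # vs))"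
  shows "multilinear \<Phi>"
  unfolding multilinear_def
proof (intro allI)
  fix us ws
  show "linear (\<lambda>v. \<Phi> (us @ v # ws))"
    using assms by (cases us) (auto simp: multilinear_def)
qed

lemma multilinear_app: "linear L \<Longrightarrow> multilinear \<Phi> \<Longrightarrow> multilinear (\<lambda>vs. L (\<Phi> vs))"
  by (auto simp: multilinear_def intro: linear_app)

lemma multilinear_append:
  "multilinear \<Phi> \<Longrightarrow> multilinear (\<lambda>vs. \<Phi> (us @ vs))"
  "multilinear \<Phi> \<Longrightarrow> multilinear (\<lambda>vs. \<Phi> (vs @ us))"
proof -
  assume \<Phi>: "multilinear \<Phi>"
  show "multilinear (\<lambda>vs. \<Phi> (us @ vs))" "multilinear (\<lambda>vs. \<Phi> (vs @ us))"
    using multilinearD[OF \<Phi>, of "us @ _"] multilinearD[OF \<Phi>, of _ "_ @ us"]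
    by (simp_all add: multilinear_def)
qed

text \<open>The entries are replaced by elements of \<open>S\<close> from left to right; the prefix
  \<open>us\<close> in the induction is the part already replaced.\<close>

lemma multilinear_eqI:
  assumes \<Phi>: "multilinear \<Phi>" and \<Psi>: "multilinear \<Psi>" and S: "span S = UNIV"
    and eq: "\<And>vs. set vs \<subseteq> S \<Longrightarrow> \<Phi> vs = \<Psi> vs"
  shows "\<Phi> vs = \<Psi> vs"
proof -
  have "set us \<subseteq> S \<Longrightarrow> \<Phi> (us @ vs) = \<Psi> (us @ vs)" for us
  proof (induction vs arbitrary: us)
    case Nil
    then show ?case by (simp add: eq)
  next
    case (Cons v vs)
    show ?case
    proof (rule linear_ext_span[OF multilinearD[OF \<Phi>] multilinearD[OF \<Psi>] S])
      fix x assume "x \<in> S"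
      then show "\<Phi> (us @ x # vs) = \<Psi> (us @ x # vs)"
        using Cons.IH[of "us @ [x]"] Cons.prems by simp
    qed
  qed
  from this[of "[]"] show ?thesis by simp
qed

lemma linear_abs_tens: "linear abs_tens"
  by (rule linearI) (simp_all add: plus_tens.abs_eq scaleR_tens.abs_eq)

lemma surj_abs_tens: "surj abs_tens"
  by (metis Quotient3_abs_rep Quotient3_tens surjI)

lemma span_tens: "span (range (tens :: 'a::real_vector list \<Rightarrow> _)) = UNIV"
proof -
  have "range (tens :: 'a list \<Rightarrow> _) = abs_tens ` range gen"
    by (auto simp: tens_def image_def)
  then show ?thesis
    using span_image_UNIV[OF linear_abs_tens surj_abs_tens span_range_gen] by simp
qed

lemma multilinear_tens: "multilinear tens"
proof -
  have z: "abs_tens r = 0" if "r \<in> tens_rel" for r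
    using that by (simp add: zero_tens_def tens.abs_eq_iff span_cong_def span_base)
  note d = linear_diff[OF linear_abs_tens] linear_scale[OF linear_abs_tens]
    linear_add[OF linear_abs_tens]
  show ?thesis unfolding multilinear_def
  proof (intro allI linearI)
    fix us ws :: "'a list" and x y c
    show "tens (us @ (x + y) # ws) = tens (us @ x # ws) + tens (us @ y # ws)"
    proof -
      have "gen (us @ [x + y] @ ws) - gen (us @ [x] @ ws) - gen (us @ [y] @ ws) \<in> tens_rel"
        unfolding tens_rel_def by blast
      from z[OF this] show ?thesis by (simp add: tens_def d diff_diff_eq)
    qed
    show "tens (us @ (c *\<^sub>R x) # ws) = c *\<^sub>R tens (us @ x # ws)"
    proof -
      have "gen (us @ [c *\<^sub>R x] @ ws) - c *\<^sub>R gen (us @ [x] @ ws) \<in> tens_rel"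
        unfolding tens_rel_def by blast
      from z[OF this] show ?thesis by (simp add: tens_def d)
    qed
  qed
qed

lemma tens_exists:
  assumes "multilinear \<Phi>"
  shows "\<exists>L. linear L \<and> (\<forall>vs. L (tens vs) = \<Phi> vs)"
proof -
  have "free_lift \<Phi> r = 0" if "r \<in> tens_rel" for r
    using that unfolding tens_rel_def
    by (auto simp: linear_diff[OF linear_free_lift] linear_scale[OF linear_free_lift] free_lift_gen
        linear_add[OF multilinearD[OF assms]] linear_scale[OF multilinearD[OF assms]])
  from quotient_lift[OF linear_abs_tens surj_abs_tens tens.abs_eq_iff linear_free_lift this]
  show ?thesis by (auto simp: tens_def free_lift_gen)
qed

lemma tens_ext:
  assumes "linear L" "linear L'" "\<And>vs. L (tens vs) = L' (tens vs)"
  shows "L = L'"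
  by (rule ext, rule linear_ext_span[OF assms(1,2) span_tens]) (auto simp: assms(3))

lemma tens_mult_unique:
  "\<exists>!m :: 'a::real_vector tens \<Rightarrow> _. bilinear m \<and> (\<forall>vs ws. m (tens vs) (tens ws) = tens (vs @ ws))"
proof (rule ex_ex1I)
  have "\<exists>L. linear L \<and> (\<forall>ws. L (tens ws) = tens (vs @ ws))" for vs :: "'a list"
    by (rule tens_exists) (rule multilinear_append[OF multilinear_tens])
  then obtain L :: "'a list \<Rightarrow> 'a tens \<Rightarrow> 'a tens"
    where L: "\<And>vs. linear (L vs)" "\<And>vs ws. L vs (tens ws) = tens (vs @ ws)"
    by metis
  have "multilinear (\<lambda>vs. L vs y)" for y
    unfolding multilinear_def
  proof (intro allI linearI)
    fix us ws :: "'a list" and v v' c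
    have *: "linear (\<lambda>v. tens (us @ v # ws @ ws'))" for ws'
      by (rule multilinearD[OF multilinear_tens])
    show "L (us @ (v + v') # ws) y = L (us @ v # ws) y + L (us @ v' # ws) y"
      by (rule fun_cong[OF tens_ext]) (auto intro: linear_rules L simp: L linear_add[OF *])
    show "L (us @ (c *\<^sub>R v) # ws) y = c *\<^sub>R L (us @ v # ws) y"
      by (rule fun_cong[OF tens_ext]) (auto intro: linear_rules L simp: L linear_scale[OF *])
  qed
  then have "\<exists>M. linear M \<and> (\<forall>vs. M (tens vs) = L vs y)" for y
    by (rule tens_exists)
  from bilinear_exists_two_step[OF L(1) this span_tens]
  show "\<exists>m :: 'a tens \<Rightarrow> _. bilinear m \<and> (\<forall>vs ws. m (tens vs) (tens ws) = tens (vs @ ws))"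
    using L(2) by auto
  fix m m' :: "'a tens \<Rightarrow> 'a tens \<Rightarrow> 'a tens"
  assume m: "bilinear m \<and> (\<forall>vs ws. m (tens vs) (tens ws) = tens (vs @ ws))"
    and m': "bilinear m' \<and> (\<forall>vs ws. m' (tens vs) (tens ws) = tens (vs @ ws))"
  have "m x y = m' x y" for x y
  proof -
    have "m (tens vs) = m' (tens vs)" for vs
      by (rule tens_ext) (use m m' in \<open>auto simp: bilinear_def\<close>)
    then have "(\<lambda>x. m x y) = (\<lambda>x. m' x y)"
      by (intro tens_ext) (use m m' in \<open>auto simp: bilinear_def\<close>)
    then show ?thesis by (rule fun_cong)
  qed
  then show "m = m'" by blast
qed

lemma bilinear_tens_mult: "bilinear (tens_mult :: 'a::real_vector tens \<Rightarrow> _)"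
  and tens_mult_tens: "tens_mult (tens (vs :: 'a::real_vector list)) (tens ws) = tens (vs @ ws)"
  using theI'[OF tens_mult_unique[where 'a='a]] unfolding tens_mult_def by blast+


section \<open>Gradings and Koszul signs\<close>

definition sg :: "int \<Rightarrow> real" where
  "sg n = (if even n then 1 else -1)"

lemma powi_sg: "(-1 :: real) powi n = sg n"
  by (simp add: sg_def power_int_minus_left)

lemma sg_add: "sg (m + n) = sg m * sg n"
  by (simp add: sg_def)

lemma sg_square [simp]: "sg n * sg n = 1" "sg n * (sg n * c) = c"
  by (simp_all add: sg_def)

lemma sg_0 [simp]: "sg 0 = 1" and sg_1 [simp]: "sg 1 = -1"
  by (simp_all add: sg_def)

text \<open>What the sign calculus asks of a grading: homogeneous vectors span, and some linear
  operator acts as (-1)^n in degree n. This is weaker than a direct sum decomposition, so S(V)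
  becomes an instance without a proof that it is the direct sum of its degrees.\<close>

class koszul_grading = grading +
  assumes gr_0: "0 \<in> gr n"
    and gr_add: "v \<in> gr n \<Longrightarrow> w \<in> gr n \<Longrightarrow> v + w \<in> gr n"
    and gr_scaleR: "v \<in> gr n \<Longrightarrow> a *\<^sub>R v \<in> gr n"
    and sum_gr: "\<exists>vs. set vs \<subseteq> (\<Union>n. gr n) \<and> v = sum_list vs"
    and parity_ex: "\<exists>L. (\<forall>v w. L (v + w) = L v + L w) \<and> (\<forall>a v. L (a *\<^sub>R v) = a *\<^sub>R L v) \<and>
      (\<forall>n. \<forall>v\<in>gr n. L v = ((-1) powi n) *\<^sub>R v)"

lemma subspace_gr: "subspace (gr n :: 'a::koszul_grading set)"
  by (simp add: subspace_def gr_0 gr_add gr_scaleR)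

lemma gr_diff: "v \<in> gr n \<Longrightarrow> w \<in> gr n \<Longrightarrow> v - w \<in> gr n" for v :: "'a::koszul_grading"
  by (rule subspace_diff[OF subspace_gr])

lemma span_gr: "span (\<Union>n. gr n) = (UNIV :: 'a::koszul_grading set)"
proof -
  have "sum_list vs \<in> span (\<Union>n. gr n)" if "set vs \<subseteq> (\<Union>n. gr n)" for vs :: "'a list"
    using that by (induction vs) (auto intro: span_add span_base simp: span_zero)
  then have "v \<in> span (\<Union>n. gr n)" for v :: 'a using sum_gr[of v] by auto
  then show ?thesis by auto
qed

lemma parity_exists:
  "\<exists>L :: 'a::koszul_grading \<Rightarrow> 'a. linear L \<and> (\<forall>n. \<forall>v\<in>gr n. L v = ((-1) powi n) *\<^sub>R v)"
proof -
  obtain L :: "'a \<Rightarrow> 'a" where "\<forall>v w. L (v + w) = L v + L w" "\<forall>a v. L (a *\<^sub>R v) = a *\<^sub>R L v"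
      "\<forall>n. \<forall>v\<in>gr n. L v = ((-1) powi n) *\<^sub>R v"
    using parity_ex[where 'a='a] by blast
  then show ?thesis by (intro exI[of _ L] conjI linearI) simp_all
qed

lemma koszul_gradingI:
  assumes "\<And>n. subspace (gr n :: 'a::grading set)" "span (\<Union>n. gr n) = (UNIV :: 'a set)"
    and "\<exists>L :: 'a \<Rightarrow> 'a. linear L \<and> (\<forall>n. \<forall>v\<in>gr n. L v = ((-1) powi n) *\<^sub>R v)"
  shows "OFCLASS('a, koszul_grading_class)"
proof
  fix n :: int and v w :: 'a and a :: real
  show "0 \<in> (gr n :: 'a set)" "v \<in> gr n \<Longrightarrow> w \<in> gr n \<Longrightarrow> v + w \<in> gr n" "v \<in> gr n \<Longrightarrow> a *\<^sub>R v \<in> gr n"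
    using assms(1)[of n] by (simp_all add: subspace_def)
  have "v \<in> span (\<Union>n. gr n)" using assms(2) by simp
  then show "\<exists>vs. set vs \<subseteq> (\<Union>n. gr n) \<and> v = sum_list vs"
  proof (induction rule: span_induct_alt)
    case base
    show ?case by (rule exI[of _ "[]"]) simp
  next
    case (step c x y)
    then obtain vs n where "set vs \<subseteq> (\<Union>n. gr n)" "y = sum_list vs" "x \<in> gr n" by auto
    then show ?case
      using subspace_scale[OF assms(1), of x n c] by (intro exI[of _ "(c *\<^sub>R x) # vs"]) auto
  qed
  show "\<exists>L :: 'a \<Rightarrow> 'a. (\<forall>v w. L (v + w) = L v + L w) \<and> (\<forall>a v. L (a *\<^sub>R v) = a *\<^sub>R L v) \<and>
      (\<forall>n. \<forall>v\<in>gr n. L v = ((-1) powi n) *\<^sub>R v)"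
    using assms(3) by (blast intro: linear_add linear_scale)
qed

definition parity :: "'a::koszul_grading \<Rightarrow> 'a" where
  "parity = (SOME L. linear L \<and> (\<forall>n. \<forall>v\<in>gr n. L v = ((-1) powi n) *\<^sub>R v))"

definition kp :: "int \<Rightarrow> 'a::koszul_grading \<Rightarrow> 'a" where
  "kp r v = (if even r then v else parity v)"

lemma linear_parity [linear_rules]: "linear (parity :: 'a::koszul_grading \<Rightarrow> 'a)"
  and parity_gr: "(v :: 'a) \<in> gr n \<Longrightarrow> parity v = sg n *\<^sub>R v"
proof -
  have "linear (parity :: 'a \<Rightarrow> 'a) \<and> (\<forall>n. \<forall>v\<in>gr n. parity (v :: 'a) = ((-1) powi n) *\<^sub>R v)"
    unfolding parity_def by (rule someI_ex[OF parity_exists])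
  then show "linear (parity :: 'a \<Rightarrow> 'a)" "(v :: 'a) \<in> gr n \<Longrightarrow> parity v = sg n *\<^sub>R v"
    by (simp_all add: powi_sg)
qed

lemma linear_kp: "linear (kp r)"
  by (cases "even r") (simp_all add: kp_def[abs_def] linear_rules)

lemma kp_gr: "v \<in> gr n \<Longrightarrow> kp r v = sg (r * n) *\<^sub>R v"
  by (auto simp: kp_def parity_gr sg_def)

lemma kp_0 [simp]: "kp 0 v = v"
  by (simp add: kp_def)

lemma hom_ext:
  fixes f :: "'a::koszul_grading \<Rightarrow> 'b::real_vector"
  assumes "linear f" "linear g" "\<And>n v. v \<in> gr n \<Longrightarrow> f v = g v"
  shows "f = g"
proof
  fix x :: 'a
  show "f x = g x"
    by (rule linear_ext_span[OF assms(1,2) span_gr]) (use assms(3) in auto)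
qed

lemma kp_kp: "kp r (kp s v) = kp (r + s) v"
proof -
  have "(\<lambda>v :: 'a. parity (parity v)) = (\<lambda>v. v)"
    by (rule hom_ext) (auto intro!: linear_rules linear_app[OF linear_parity]
        simp: parity_gr linear_scale[OF linear_parity])
  then have "parity (parity v) = v" by meson
  then show ?thesis by (auto simp: kp_def)
qed

lemma kp_mem_gr: "v \<in> gr n \<Longrightarrow> kp r v \<in> gr n"
  by (simp add: kp_gr gr_scaleR)

lemma HomD: "f \<in> Hom p \<Longrightarrow> linear f" "f \<in> Hom p \<Longrightarrow> v \<in> gr n \<Longrightarrow> f v \<in> gr (n + p)"
  by (auto simp: Hom_def)

text \<open>In degree n + p the sign (-1)^(r(n+p)) splits into the sign of the argument and the
  constant (-1)^(rp).\<close>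

lemma Hom_kp:
  fixes f :: "'a::koszul_grading \<Rightarrow> 'b::koszul_grading"
  assumes f: "f \<in> Hom p"
  shows "kp r (f v) = sg (r * p) *\<^sub>R f (kp r v)"
proof -
  have "(\<lambda>v. kp r (f v)) = (\<lambda>v. sg (r * p) *\<^sub>R f (kp r v))"
  proof (rule hom_ext)
    show "kp r (f v) = sg (r * p) *\<^sub>R f (kp r v)" if "v \<in> gr n" for n v
      by (auto simp: kp_gr[OF HomD(2)[OF f that]] kp_gr[OF that] linear_scale[OF HomD(1)[OF f]]
          distrib_left sg_add)
  qed (intro linear_rules linear_app[OF linear_kp] linear_app[OF HomD(1)[OF f]] linear_kp HomD(1)[OF f])+
  then show ?thesis by meson
qed


subsection \<open>Components of a graded vector\<close>

definition component :: "int \<Rightarrow> 'a::graded_vector \<Rightarrow> 'a" where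
  "component n v =
     (THE c. finite {n. c n \<noteq> 0} \<and> (\<forall>n. c n \<in> gr n) \<and> v = (\<Sum>n | c n \<noteq> 0. c n)) n"

lemma finite_component: "finite {n. component n v \<noteq> 0}"
  and component_gr: "component n v \<in> gr n"
  and sum_component: "(\<Sum>n | component n v \<noteq> 0. component n v) = v"
  using theI'[OF direct_sum_gr[of v]] by (simp_all add: component_def)

lemma component_eqI:
  assumes "finite A" "\<And>n. c n \<in> gr n" "\<And>n. n \<notin> A \<Longrightarrow> c n = 0" "v = (\<Sum>n\<in>A. c n)"
  shows "component n v = c n"
proof -
  have sub: "{n. c n \<noteq> 0} \<subseteq> A" using assms(3) by blast
  then have "finite {n. c n \<noteq> 0} \<and> (\<forall>n. c n \<in> gr n) \<and> v = (\<Sum>n | c n \<noteq> 0. c n)"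
    using assms finite_subset[OF sub] direct_sum_superset[OF assms(1) sub] by simp
  then have "(THE c. finite {n. c n \<noteq> 0} \<and> (\<forall>n. c n \<in> gr n) \<and> v = (\<Sum>n | c n \<noteq> 0. c n)) = c"
    by (rule the1_equality[OF direct_sum_gr])
  then show ?thesis by (simp add: component_def)
qed

lemma sum_component_superset:
  "finite A \<Longrightarrow> {n. component n v \<noteq> 0} \<subseteq> A \<Longrightarrow> (\<Sum>n\<in>A. component n v) = v"
  using direct_sum_superset[of A "\<lambda>n. component n v"] by (simp add: sum_component)

lemma linear_component: "linear (component n)"
proof (rule linearI)
  fix v w :: 'a and c
  let ?A = "{n. component n v \<noteq> 0} \<union> {n. component n w \<noteq> 0}"
  show "component n (v + w) = component n v + component n w"
    by (rule component_eqI[of ?A])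
      (auto simp: finite_component sum.distrib sum_component_superset intro: add_gr component_gr)
  show "component n (c *\<^sub>R v) = c *\<^sub>R component n v"
    by (rule component_eqI[of ?A])
      (auto simp: finite_component sum_component_superset simp flip: scaleR_sum_right
        intro: scaleR_gr component_gr)
qed

lemma component_of_gr: "v \<in> gr m \<Longrightarrow> component n v = (if n = m then v else 0)"
  by (rule component_eqI[of "{m}"]) (auto simp: zero_gr)

text \<open>Membership in a degree becomes the vanishing of linear maps. These commute with
  integrals and with degree-preserving maps, which gives \<open>pint_gr\<close> and
  \<open>inj_Hom_gr\<close>.\<close>

lemma gr_iff_component: "v \<in> gr n \<longleftrightarrow> (\<forall>m. m \<noteq> n \<longrightarrow> component m v = 0)"
proof
  assume *: "\<forall>m. m \<noteq> n \<longrightarrow> component m v = 0"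
  have "v = (\<Sum>m\<in>{n}. component m v)"
    by (rule sum_component_superset[symmetric]) (use * in auto)
  then show "v \<in> gr n" using component_gr[of n v] by simp
qed (simp add: component_of_gr)

instance graded_vector \<subseteq> koszul_grading
proof (rule koszul_gradingI)
  fix n :: int
  show "subspace (gr n :: 'a set)"
    by (simp add: subspace_def zero_gr add_gr scaleR_gr)
  have "v \<in> span (\<Union>n. gr n)" for v :: 'a
    by (subst sum_component[symmetric], rule span_sum, rule span_base) (use component_gr in blast)
  then show "span (\<Union>n. gr n) = (UNIV :: 'a set)" by auto
  \<comment> \<open>The range of summation depends on v. The next fact enlarges it to any finite
    superset, so that two vectors can be compared over a common range.\<close>
  define L :: "'a \<Rightarrow> 'a" where "L v = (\<Sum>n | component n v \<noteq> 0. ((-1) powi n) *\<^sub>R component n v)" for v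
  have L: "L v = (\<Sum>n\<in>A. ((-1) powi n) *\<^sub>R component n v)"
    if "finite A" "{n. component n v \<noteq> 0} \<subseteq> A" for v A
    unfolding L_def using that by (intro sum.mono_neutral_left) auto
  have "linear L"
  proof (rule linearI)
    fix v w :: 'a and c
    let ?A = "{n. component n v \<noteq> 0} \<union> {n. component n w \<noteq> 0}"
    have fin: "finite ?A" by (simp add: finite_component)
    have A: "{n. component n (v + w) \<noteq> 0} \<subseteq> ?A" "{n. component n (c *\<^sub>R v) \<noteq> 0} \<subseteq> ?A"
      by (auto simp: linear_add[OF linear_component] linear_scale[OF linear_component])
    show "L (v + w) = L v + L w"
      using L[OF fin A(1)] L[OF fin, of v] L[OF fin, of w]
      by (simp add: linear_add[OF linear_component] scaleR_add_right sum.distrib)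
    show "L (c *\<^sub>R v) = c *\<^sub>R L v"
      using L[OF fin A(2)] L[OF fin, of v]
      by (simp add: linear_scale[OF linear_component] scaleR_sum_right mult.commute)
  qed
  moreover have "L v = ((-1) powi n) *\<^sub>R v" if "v \<in> gr n" for v n
  proof -
    have "{m. component m v \<noteq> 0} \<subseteq> {n}" using that by (auto simp: component_of_gr)
    from L[OF _ this] show ?thesis using that by (simp add: component_of_gr)
  qed
  ultimately show "\<exists>L :: 'a \<Rightarrow> 'a. linear L \<and> (\<forall>n. \<forall>v\<in>gr n. L v = ((-1) powi n) *\<^sub>R v)"
    by blast
qed


subsection \<open>Homogeneous lists\<close>

lemma homs_simps [simp]:
  "homs ds [] \<longleftrightarrow> ds = []" "homs [] vs \<longleftrightarrow> vs = []"
  "homs (d # ds) (v # vs) \<longleftrightarrow> v \<in> gr d \<and> homs ds vs"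
  by (auto simp: homs_def)

lemma homs_length: "homs ds vs \<Longrightarrow> length ds = length vs"
  by (simp add: homs_def list_all2_lengthD)

lemma homs_nth: "homs ds vs \<Longrightarrow> i < length vs \<Longrightarrow> vs ! i \<in> gr (ds ! i)"
  by (auto simp: homs_def list_all2_conv_all_nth)

lemma homs_append: "homs ds vs \<Longrightarrow> homs es ws \<Longrightarrow> homs (ds @ es) (vs @ ws)"
  by (simp add: homs_def list_all2_appendI)

lemma homs_ConsE:
  assumes "homs ds (v # vs)"
  obtains e es where "ds = e # es" "v \<in> gr e" "homs es vs"
  using assms by (cases ds) (auto simp: homs_def)

lemma homs_exists: "set vs \<subseteq> (\<Union>n. gr n) \<Longrightarrow> \<exists>ds. homs ds vs"
proof (induction vs)
  case (Cons v vs)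
  then obtain n ds where "v \<in> gr n" "homs ds vs" by auto
  then show ?case by (intro exI[of _ "n # ds"]) simp
qed simp

lemma multilinear_hom_eqI:
  fixes \<Phi> :: "'a::koszul_grading list \<Rightarrow> 'b::real_vector"
  assumes "multilinear \<Phi>" "multilinear \<Psi>" "\<And>ds vs. homs ds vs \<Longrightarrow> \<Phi> vs = \<Psi> vs"
  shows "\<Phi> vs = \<Psi> vs"
  by (rule multilinear_eqI[OF assms(1,2) span_gr]) (use homs_exists assms(3) in blast)


section \<open>Inversions\<close>

text \<open>The product of \<open>c\<close> over the inversions of a list, in the order in which
  insertion sort removes them. Koszul signs and signs of permutations are both of this form.\<close>

fun inv_factor :: "(nat \<Rightarrow> nat \<Rightarrow> real) \<Rightarrow> nat list \<Rightarrow> real" where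
  "inv_factor c [] = 1"
| "inv_factor c (j # js) = (\<Prod>i\<in>{i \<in> set js. i < j}. c j i) * inv_factor c js"

text \<open>Insertion sort uses adjacent transpositions only. Moving \<open>j\<close> past a smaller
  \<open>i\<close> costs \<open>c j i\<close>, so sorting collects one factor for each
  inversion.\<close>

lemma sort_factor:
  fixes \<Phi> :: "nat list \<Rightarrow> 'x::real_vector"
  assumes swap: "\<And>us i j ws. distinct (us @ i # j # ws) \<Longrightarrow> set (us @ i # j # ws) = A \<Longrightarrow>
      \<Phi> (us @ i # j # ws) = c i j *\<^sub>R \<Phi> (us @ j # i # ws)"
  shows "distinct (us @ js) \<Longrightarrow> set (us @ js) = A \<Longrightarrow>
      \<Phi> (us @ js) = inv_factor c js *\<^sub>R \<Phi> (us @ sort js)"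
proof (induction js arbitrary: us)
  case Nil
  then show ?case by simp
next
  case (Cons j js)
  have ins: "\<Phi> (us @ j # ks) = (\<Prod>i\<in>{i \<in> set ks. i < j}. c j i) *\<^sub>R \<Phi> (us @ insort j ks)"
    if "distinct (us @ j # ks)" "set (us @ j # ks) = A" "sorted ks" for us ks
    using that
  proof (induction ks arbitrary: us)
    case Nil
    then show ?case by simp
  next
    case (Cons k ks)
    show ?case
    proof (cases "j \<le> k")
      case True
      then have "{i \<in> set (k # ks). i < j} = {}" using Cons.prems(3) by fastforce
      with True show ?thesis by (simp only: prod.empty) simp
    next
      case False
      have "{i \<in> set (k # ks). i < j} = insert k {i \<in> set ks. i < j}" using False by auto
      moreover have "k \<notin> set ks" using Cons.prems(1) by simp
      ultimately have "(\<Prod>i\<in>{i \<in> set (k # ks). i < j}. c j i) = c j k * (\<Prod>i\<in>{i \<in> set ks. i < j}. c j i)"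
        by simp
      moreover have "\<Phi> (us @ j # k # ks) = c j k *\<^sub>R \<Phi> ((us @ [k]) @ j # ks)"
        using swap[OF Cons.prems(1,2)] by simp
      moreover have "\<Phi> ((us @ [k]) @ j # ks) =
          (\<Prod>i\<in>{i \<in> set ks. i < j}. c j i) *\<^sub>R \<Phi> ((us @ [k]) @ insort j ks)"
        by (rule Cons.IH) (use Cons.prems in auto)
      ultimately show ?thesis using False by simp
    qed
  qed
  have "\<Phi> ((us @ [j]) @ js) = inv_factor c js *\<^sub>R \<Phi> ((us @ [j]) @ sort js)"
    by (rule Cons.IH) (use Cons.prems in auto)
  moreover have "\<Phi> (us @ j # sort js) =
      (\<Prod>i\<in>{i \<in> set (sort js). i < j}. c j i) *\<^sub>R \<Phi> (us @ insort j (sort js))"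
    by (rule ins) (use Cons.prems in auto)
  ultimately show ?case by (simp add: mult.commute)
qed

lemma inv_factor_prod:
  assumes "distinct js"
  shows "inv_factor c js = (\<Prod>(i, j) | i < j \<and> j < length js \<and> js ! j < js ! i. c (js ! i) (js ! j))"
  using assms
proof (induction js)
  case Nil
  then show ?case by simp
next
  case (Cons k js)
  let ?I = "\<lambda>js. {(i, j). i < j \<and> j < length js \<and> js ! j < js ! i}"
  let ?J = "{j. j < length js \<and> js ! j < k}"
  have fin: "finite (?I js)" for js :: "nat list"
    by (rule finite_subset[of _ "{..<length js} \<times> {..<length js}"]) auto
  have I: "?I (k # js) = (\<lambda>j. (0, Suc j)) ` ?J \<union> (\<lambda>(i, j). (Suc i, Suc j)) ` ?I js"
  proof (intro set_eqI iffI)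
    fix x assume "x \<in> ?I (k # js)"
    then show "x \<in> (\<lambda>j. (0, Suc j)) ` ?J \<union> (\<lambda>(i, j). (Suc i, Suc j)) ` ?I js"
      by (cases x; cases "fst x"; cases "snd x") (auto simp: image_iff)
  qed auto
  have "(\<Prod>(i, j)\<in>?I (k # js). c ((k # js) ! i) ((k # js) ! j)) =
      (\<Prod>(i, j)\<in>(\<lambda>j. (0, Suc j)) ` ?J. c ((k # js) ! i) ((k # js) ! j)) *
      (\<Prod>(i, j)\<in>(\<lambda>(i, j). (Suc i, Suc j)) ` ?I js. c ((k # js) ! i) ((k # js) ! j))"
    unfolding I by (rule prod.union_disjoint) (auto intro: fin)
  also have "(\<Prod>(i, j)\<in>(\<lambda>j. (0, Suc j)) ` ?J. c ((k # js) ! i) ((k # js) ! j)) = (\<Prod>j\<in>?J. c k (js ! j))"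
    by (subst prod.reindex) (auto simp: inj_on_def)
  also have "\<dots> = (\<Prod>i\<in>(!) js ` ?J. c k i)"
    by (subst prod.reindex) (use Cons.prems in \<open>auto simp: inj_on_def nth_eq_iff_index_eq\<close>)
  also have "(!) js ` ?J = {i \<in> set js. i < k}"
    by (auto simp: in_set_conv_nth image_iff)
  also have "(\<Prod>(i, j)\<in>(\<lambda>(i, j). (Suc i, Suc j)) ` ?I js. c ((k # js) ! i) ((k # js) ! j)) =
      (\<Prod>(i, j)\<in>?I js. c (js ! i) (js ! j))"
    by (subst prod.reindex) (auto simp: inj_on_def case_prod_beta)
  also have "\<dots> = inv_factor c js" using Cons by simp
  finally show ?case by simp
qed

lemma inv_factor_mult: "inv_factor (\<lambda>a b. c a b * d a b) js = inv_factor c js * inv_factor d js"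
  by (induction js) (auto simp: prod.distrib)

lemma distinct_map_permutes: "\<sigma> permutes {..<n} \<Longrightarrow> distinct (map \<sigma> [0..<n])"
  by (simp add: distinct_map permutes_inj_on)

lemma set_map_permutes: "\<sigma> permutes {..<n} \<Longrightarrow> set (map \<sigma> [0..<n]) = {..<n}"
  by (simp add: permutes_image atLeast_upt)

lemma sort_map_permutes: "\<sigma> permutes {..<n} \<Longrightarrow> sort (map \<sigma> [0..<n]) = [0..<n]"
  by (rule sorted_distinct_set_unique) (auto simp del: set_map distinct_map map_map
      simp: set_map_permutes distinct_map_permutes)

lemma koszul_inv_factor:
  assumes "\<sigma> permutes {..<length ds}"
  shows "koszul \<sigma> ds = inv_factor (\<lambda>a b. sg (ds ! a * ds ! b)) (map \<sigma> [0..<length ds])"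
  unfolding koszul_def inv_factor_prod[OF distinct_map_permutes[OF assms]] powi_sg
  by (rule prod.cong) auto

text \<open>\<open>sort_factor\<close> is applied to the sign of the permutation \<open>P js\<close>
  whose one-line notation is \<open>js\<close>. Exchanging neighbours composes \<open>P js\<close>
  with a transposition, and sorting ends at the identity.\<close>

lemma sign_inv_factor:
  assumes "\<sigma> permutes {..<n}"
  shows "of_int (sign \<sigma>) = inv_factor (\<lambda>_ _. -1) (map \<sigma> [0..<n])"
proof -
  define P where "P js = (\<lambda>i. if i < n then js ! i else i)" for js :: "nat list"
  have P: "P js permutes {..<n}" if "distinct js" "set js = {..<n}" for js
  proof -
    have n: "length js = n" using distinct_card[OF that(1)] that(2) by simp
    show ?thesis
    proof (rule bij_imp_permutes)
      have "bij_betw ((!) js) {..<n} {..<n}"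
        using bij_betw_nth[OF that(1)] that(2) n by simp
      then show "bij_betw (P js) {..<n} {..<n}"
        by (rule bij_betw_cong[THEN iffD1, rotated]) (simp add: P_def)
    qed (simp add: P_def)
  qed
  have swap: "real_of_int (sign (P (us @ i # j # ws))) = (-1) *\<^sub>R real_of_int (sign (P (us @ j # i # ws)))"
    if "distinct (us @ i # j # ws)" "set (us @ i # j # ws) = {..<n}" for us i j ws
  proof -
    let ?l = "length us"
    have n: "length (us @ i # j # ws) = n"
      using distinct_card[OF that(1)] that(2) by simp
    have "P (us @ i # j # ws) = P (us @ j # i # ws) \<circ> Transposition.transpose ?l (Suc ?l)"
    proof
      fix x
      consider "x < ?l" | "x = ?l" | "x = Suc ?l" | "x > Suc ?l" by linarith
      then show "P (us @ i # j # ws) x = (P (us @ j # i # ws) \<circ> Transposition.transpose ?l (Suc ?l)) x"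
      proof cases
        case 4
        then obtain y where "x = Suc (Suc (?l + y))" by (metis add_Suc_right less_iff_Suc_add add.commute)
        then show ?thesis by (simp add: P_def nth_append Transposition.transpose_def)
      qed (use n in \<open>auto simp: P_def nth_append Transposition.transpose_def\<close>)
    qed
    moreover have "permutation (P (us @ j # i # ws))"
      using P[of "us @ j # i # ws"] that by (auto simp: permutation_permutes insert_commute)
    ultimately show ?thesis
      by (simp add: sign_compose permutation_swap_id sign_swap_id)
  qed
  have "real_of_int (sign (P (map \<sigma> [0..<n]))) =
      inv_factor (\<lambda>_ _. -1) (map \<sigma> [0..<n]) *\<^sub>R real_of_int (sign (P (sort (map \<sigma> [0..<n]))))"
    using sort_factor[of "{..<n}" "\<lambda>js. real_of_int (sign (P js))" "\<lambda>_ _. -1" "[]" "map \<sigma> [0..<n]"]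
      swap assms distinct_map_permutes set_map_permutes by simp
  moreover have "P (map \<sigma> [0..<n]) = \<sigma>"
    using assms by (auto simp: P_def fun_eq_iff permutes_def)
  moreover have "P (sort (map \<sigma> [0..<n])) = id"
    using assms by (auto simp: P_def fun_eq_iff sort_map_permutes)
  ultimately show ?thesis by simp
qed


section \<open>Symmetric and exterior algebra\<close>

text \<open>Graded symmetry for \<open>e = 1\<close>, graded antisymmetry for \<open>e = -1\<close>.
  Only neighbours are exchanged; \<open>swap_rule_permute\<close> recovers the relation for all
  permutations.\<close>

definition swap_rule :: "real \<Rightarrow> ('a::grading list \<Rightarrow> 'b::real_vector) \<Rightarrow> bool" where
  "swap_rule e \<Phi> \<longleftrightarrow> (\<forall>us x y ws i j. x \<in> gr i \<longrightarrow> y \<in> gr j \<longrightarrow>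
     \<Phi> (us @ x # y # ws) = (e * sg (i * j)) *\<^sub>R \<Phi> (us @ y # x # ws))"

lemma swap_ruleD: "swap_rule e \<Phi> \<Longrightarrow> x \<in> gr i \<Longrightarrow> y \<in> gr j \<Longrightarrow>
    \<Phi> (us @ x # y # ws) = (e * sg (i * j)) *\<^sub>R \<Phi> (us @ y # x # ws)"
  unfolding swap_rule_def by blast

lemma swap_rule_append:
  fixes \<Phi> :: "'a::grading list \<Rightarrow> 'b::real_vector"
  assumes "swap_rule e \<Phi>"
  shows "swap_rule e (\<lambda>vs. \<Phi> (us @ vs))" "swap_rule e (\<lambda>vs. \<Phi> (vs @ us))"
proof -
  show "swap_rule e (\<lambda>vs. \<Phi> (us @ vs))"
    unfolding swap_rule_def
  proof (intro allI impI)
    fix us' ws and x y :: 'a and i j assume "x \<in> gr i" "y \<in> gr j"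
    from swap_ruleD[OF assms this, of "us @ us'" ws]
    show "\<Phi> (us @ us' @ x # y # ws) = (e * sg (i * j)) *\<^sub>R \<Phi> (us @ us' @ y # x # ws)" by simp
  qed
  show "swap_rule e (\<lambda>vs. \<Phi> (vs @ us))"
    unfolding swap_rule_def
  proof (intro allI impI)
    fix us' ws and x y :: 'a and i j assume "x \<in> gr i" "y \<in> gr j"
    from swap_ruleD[OF assms this, of us' "ws @ us"]
    show "\<Phi> ((us' @ x # y # ws) @ us) = (e * sg (i * j)) *\<^sub>R \<Phi> ((us' @ y # x # ws) @ us)" by simp
  qed
qed

lemma swap_rule_app: "linear L \<Longrightarrow> swap_rule e \<Phi> \<Longrightarrow> swap_rule e (\<lambda>vs. L (\<Phi> vs))"
  unfolding swap_rule_def by (metis linear_scale)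

lemma multilinear_add:
  "multilinear \<Phi> \<Longrightarrow> multilinear \<Psi> \<Longrightarrow> multilinear (\<lambda>vs. \<Phi> vs + \<Psi> vs)"
  by (simp add: multilinear_def linear_compose_add)

lemma swap_rule_add:
  "swap_rule e \<Phi> \<Longrightarrow> swap_rule e \<Psi> \<Longrightarrow> swap_rule e (\<lambda>vs. \<Phi> vs + \<Psi> vs)"
  unfolding swap_rule_def by (metis scaleR_add_right)

text \<open>By multilinearity the surrounding entries may be taken homogeneous, which the relations
  of \<open>sym\<close> and \<open>ext\<close> require of the whole list.\<close>

lemma swap_rule_hom:
  fixes \<Phi> :: "'a::koszul_grading list \<Rightarrow> 'b::real_vector"
  assumes \<Phi>: "multilinear \<Phi>" and swap: "\<And>ds us x y ws i j es. homs ds us \<Longrightarrow> homs es ws \<Longrightarrow> x \<in> gr i \<Longrightarrow>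
      y \<in> gr j \<Longrightarrow> \<Phi> (us @ x # y # ws) = (e * sg (i * j)) *\<^sub>R \<Phi> (us @ y # x # ws)"
  shows "swap_rule e \<Phi>"
  unfolding swap_rule_def
proof (intro allI impI)
  fix us ws and x y :: 'a and i j assume xy: "x \<in> gr i" "y \<in> gr j"
  have m: "multilinear (\<lambda>us. \<Phi> (us @ x # y # ws))" for x y ws
    by (rule multilinear_append[OF \<Phi>])
  have m': "multilinear (\<lambda>ws. \<Phi> (us @ x # y # ws))" for x y us
    using multilinear_append(1)[OF \<Phi>, of "us @ [x, y]"] by simp
  have s: "linear (\<lambda>z :: 'b. c *\<^sub>R z)" for c by (rule linear_scaleR)
  have "\<Phi> (us @ x # y # ws) = (e * sg (i * j)) *\<^sub>R \<Phi> (us @ y # x # ws)" if "homs es ws" for es ws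
    by (rule multilinear_hom_eqI[OF m multilinear_app[OF s m]]) (use swap that xy in blast)
  then show "\<Phi> (us @ x # y # ws) = (e * sg (i * j)) *\<^sub>R \<Phi> (us @ y # x # ws)"
    by (rule multilinear_hom_eqI[OF m' multilinear_app[OF s m']])
qed

lemma swap_rule_permute:
  assumes sw: "swap_rule e \<Phi>" and e: "e * e = 1" and h: "homs ds vs" and \<sigma>: "\<sigma> permutes {..<length vs}"
  shows "\<Phi> vs = inv_factor (\<lambda>a b. e * sg (ds ! a * ds ! b)) (map \<sigma> [0..<length vs]) *\<^sub>R \<Phi> (permute_list \<sigma> vs)"
proof -
  let ?c = "\<lambda>a b. e * sg (ds ! a * ds ! b)"
  let ?js = "map \<sigma> [0..<length vs]"
  have "\<Phi> (map ((!) vs) ([] @ ?js)) = inv_factor ?c ?js *\<^sub>R \<Phi> (map ((!) vs) ([] @ sort ?js))"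
  proof (rule sort_factor[where A="{..<length vs}"])
    fix us i j ws assume "set (us @ i # j # ws) = {..<length vs}"
    then have "i < length vs" "j < length vs" by auto
    then show "\<Phi> (map ((!) vs) (us @ i # j # ws)) = ?c i j *\<^sub>R \<Phi> (map ((!) vs) (us @ j # i # ws))"
      using swap_ruleD[OF sw homs_nth[OF h] homs_nth[OF h], of i j "map ((!) vs) us" "map ((!) vs) ws"]
      by simp
  qed (use \<sigma> in \<open>simp_all only: append_Nil distinct_map_permutes set_map_permutes\<close>)
  then have "\<Phi> (permute_list \<sigma> vs) = inv_factor ?c ?js *\<^sub>R \<Phi> vs"
    by (simp only: append_Nil sort_map_permutes[OF \<sigma>]) (simp add: permute_list_def map_nth o_def)
  \<comment> \<open>Sorting expresses the permuted list through \<open>vs\<close>. Every factor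
    squares to 1, so the equation can be read in the other direction.\<close>
  moreover have "inv_factor ?c js * inv_factor ?c js = 1" for js
  proof -
    have "inv_factor (\<lambda>_ _. 1) js = 1" by (induction js) simp_all
    moreover have "?c a b * ?c a b = 1" for a b
    proof -
      have "?c a b * ?c a b = (e * e) * (sg (ds ! a * ds ! b) * sg (ds ! a * ds ! b))"
        by (simp only: mult_ac)
      then show ?thesis by (simp only: e sg_square mult_1)
    qed
    ultimately show ?thesis by (simp only: inv_factor_mult[symmetric])
  qed
  ultimately show ?thesis by (simp only: scaleR_scaleR scaleR_one)
qed

lemma permute_list_swap:
  "permute_list (Transposition.transpose (length us) (Suc (length us))) (us @ x # y # ws) = us @ y # x # ws"
proof (rule nth_equalityI)
  let ?l = "length us"
  have p: "Transposition.transpose ?l (Suc ?l) permutes {..<length (us @ x # y # ws)}"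
    by (rule permutes_swap_id) auto
  fix k assume "k < length (permute_list (Transposition.transpose ?l (Suc ?l)) (us @ x # y # ws))"
  then have k: "k < length (us @ x # y # ws)" by simp
  consider "k < ?l" | "k = ?l" | "k = Suc ?l" | j where "k = Suc (Suc (?l + j))"
    by (metis add_Suc_right less_iff_Suc_add linorder_neqE_nat not_less_eq)
  then show "permute_list (Transposition.transpose ?l (Suc ?l)) (us @ x # y # ws) ! k = (us @ y # x # ws) ! k"
    unfolding permute_list_nth[OF p k] by cases (auto simp: nth_append Transposition.transpose_def)
qed simp

text \<open>An adjacent transposition has exactly one inversion.\<close>

lemma koszul_swap:
  assumes "length ds = length us"
  shows "koszul (Transposition.transpose (length us) (Suc (length us))) (ds @ i # j # es) = sg (i * j)"
proof -
  let ?l = "length us"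
  let ?t = "Transposition.transpose ?l (Suc ?l)"
  have "{(a, b). a < b \<and> b < length (ds @ i # j # es) \<and> ?t b < ?t a} = {(?l, Suc ?l)}"
    using assms by (auto simp: Transposition.transpose_def split: if_splits)
  then show ?thesis
    using assms by (simp add: koszul_def nth_append powi_sg mult.commute)
qed

section \<open>Universal properties of the symmetric and exterior algebra\<close>

lemma linear_abs_sym: "linear abs_sym"
  by (rule linearI) (simp_all add: plus_sym.abs_eq scaleR_sym.abs_eq)

lemma surj_abs_sym: "surj abs_sym"
  by (metis Quotient3_abs_rep Quotient3_sym surjI)

lemma linear_abs_ext: "linear abs_ext"
  by (rule linearI) (simp_all add: plus_ext.abs_eq scaleR_ext.abs_eq)

lemma surj_abs_ext: "surj abs_ext"
  by (metis Quotient3_abs_rep Quotient3_ext surjI)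

lemma multilinear_sprod: "multilinear sprod"
  unfolding sprod_def by (rule multilinear_app[OF linear_abs_sym multilinear_tens])

lemma multilinear_wprod: "multilinear wprod"
  unfolding wprod_def by (rule multilinear_app[OF linear_abs_ext multilinear_tens])

lemma swap_rule_sprod: "swap_rule 1 (sprod :: 'a::koszul_grading list \<Rightarrow> _)"
proof (rule swap_rule_hom[OF multilinear_sprod])
  fix ds es and us ws :: "'a list" and x y :: 'a and i j
  assume h: "homs ds us" "homs es ws" "x \<in> gr i" "y \<in> gr j"
  let ?t = "Transposition.transpose (length us) (Suc (length us))"
  have "tens (us @ x # y # ws) - koszul ?t (ds @ i # j # es) *\<^sub>R tens (permute_list ?t (us @ x # y # ws)) \<in> sym_rel"
    unfolding sym_rel_def using h by (force intro!: homs_append permutes_swap_id)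
  then have "abs_sym (tens (us @ x # y # ws)) = abs_sym (sg (i * j) *\<^sub>R tens (us @ y # x # ws))"
    using h by (simp add: koszul_swap homs_length permute_list_swap sym.abs_eq_iff span_cong_def span_base)
  then show "sprod (us @ x # y # ws) = (1 * sg (i * j)) *\<^sub>R sprod (us @ y # x # ws)"
    by (simp add: sprod_def linear_scale[OF linear_abs_sym])
qed

lemma swap_rule_wprod: "swap_rule (-1) (wprod :: 'a::koszul_grading list \<Rightarrow> _)"
proof (rule swap_rule_hom[OF multilinear_wprod])
  fix ds es and us ws :: "'a list" and x y :: 'a and i j
  assume h: "homs ds us" "homs es ws" "x \<in> gr i" "y \<in> gr j"
  let ?t = "Transposition.transpose (length us) (Suc (length us))"
  have "tens (us @ x # y # ws) - (of_int (sign ?t) * koszul ?t (ds @ i # j # es)) *\<^sub>R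
      tens (permute_list ?t (us @ x # y # ws)) \<in> ext_rel"
    unfolding ext_rel_def using h by (force intro!: homs_append permutes_swap_id)
  then have "abs_ext (tens (us @ x # y # ws)) = abs_ext ((- sg (i * j)) *\<^sub>R tens (us @ y # x # ws))"
    using h by (simp add: koszul_swap homs_length permute_list_swap sign_swap_id ext.abs_eq_iff
        span_cong_def span_base)
  then show "wprod (us @ x # y # ws) = (-1 * sg (i * j)) *\<^sub>R wprod (us @ y # x # ws)"
    by (simp add: wprod_def linear_scale[OF linear_abs_ext] linear_neg[OF linear_abs_ext])
qed

text \<open>\<open>swap_rule_permute\<close> is the vanishing on \<open>sym_rel\<close>. Thus a map
  out of S(V) is well defined as soon as it respects exchanges of homogeneous neighbours.\<close>

lemma sym_exists:
  fixes \<Phi> :: "'a::koszul_grading list \<Rightarrow> 'b::real_vector"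
  assumes "multilinear \<Phi>" "swap_rule 1 \<Phi>"
  shows "\<exists>L. linear L \<and> (\<forall>vs. L (sprod vs) = \<Phi> vs)"
proof -
  obtain L where L: "linear L" "\<And>vs. L (tens vs) = \<Phi> vs" using tens_exists[OF assms(1)] by blast
  have "L r = 0" if "r \<in> sym_rel" for r
    using that unfolding sym_rel_def
  proof (clarify)
    fix vs :: "'a list" and ds \<sigma> assume h: "homs ds vs" "\<sigma> permutes {..<length vs}"
    from swap_rule_permute[OF assms(2) _ h]
    show "L (tens vs - koszul \<sigma> ds *\<^sub>R tens (permute_list \<sigma> vs)) = 0"
      using h by (simp add: linear_diff[OF L(1)] linear_scale[OF L(1)] L(2) koszul_inv_factor homs_length)
  qed
  from quotient_lift[OF linear_abs_sym surj_abs_sym sym.abs_eq_iff L(1) this]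
  show ?thesis by (auto simp: sprod_def L(2))
qed

lemma ext_exists:
  fixes \<Phi> :: "'a::koszul_grading list \<Rightarrow> 'b::real_vector"
  assumes "multilinear \<Phi>" "swap_rule (-1) \<Phi>"
  shows "\<exists>L. linear L \<and> (\<forall>vs. L (wprod vs) = \<Phi> vs)"
proof -
  obtain L where L: "linear L" "\<And>vs. L (tens vs) = \<Phi> vs" using tens_exists[OF assms(1)] by blast
  have "L r = 0" if "r \<in> ext_rel" for r
    using that unfolding ext_rel_def
  proof (clarify)
    fix vs :: "'a list" and ds \<sigma> assume h: "homs ds vs" "\<sigma> permutes {..<length vs}"
    have "of_int (sign \<sigma>) * koszul \<sigma> ds =
        inv_factor (\<lambda>a b. -1 * sg (ds ! a * ds ! b)) (map \<sigma> [0..<length vs])"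
      unfolding inv_factor_mult using h by (simp add: koszul_inv_factor homs_length sign_inv_factor)
    with swap_rule_permute[OF assms(2) _ h]
    show "L (tens vs - (of_int (sign \<sigma>) * koszul \<sigma> ds) *\<^sub>R tens (permute_list \<sigma> vs)) = 0"
      by (simp add: linear_diff[OF L(1)] linear_scale[OF L(1)] L(2))
  qed
  from quotient_lift[OF linear_abs_ext surj_abs_ext ext.abs_eq_iff L(1) this]
  show ?thesis by (auto simp: wprod_def L(2))
qed

lemma span_sprod: "span (range (sprod :: 'a::grading list \<Rightarrow> _)) = UNIV"
  using span_image_UNIV[OF linear_abs_sym surj_abs_sym span_tens]
  by (simp add: sprod_def[abs_def] image_image)

lemma span_wprod: "span (range (wprod :: 'a::grading list \<Rightarrow> _)) = UNIV"
  using span_image_UNIV[OF linear_abs_ext surj_abs_ext span_tens]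
  by (simp add: wprod_def[abs_def] image_image)

lemma sym_hom_ext:
  fixes L :: "'a::koszul_grading sym \<Rightarrow> 'b::real_vector"
  assumes "linear L" "linear L'" "\<And>ds vs. homs ds vs \<Longrightarrow> L (sprod vs) = L' (sprod vs)"
  shows "L = L'"
proof
  fix x
  have "L (sprod vs) = L' (sprod vs)" for vs
    by (rule multilinear_hom_eqI[OF multilinear_app[OF assms(1) multilinear_sprod]
          multilinear_app[OF assms(2) multilinear_sprod] assms(3)])
  note eq = this
  show "L x = L' x"
    by (rule linear_ext_span[OF assms(1,2) span_sprod]) (use eq in auto)
qed

lemma ext_hom_ext:
  fixes L :: "'a::koszul_grading ext \<Rightarrow> 'b::real_vector"
  assumes "linear L" "linear L'" "\<And>ds vs. homs ds vs \<Longrightarrow> L (wprod vs) = L' (wprod vs)"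
  shows "L = L'"
proof
  fix x
  have "L (wprod vs) = L' (wprod vs)" for vs
    by (rule multilinear_hom_eqI[OF multilinear_app[OF assms(1) multilinear_wprod]
          multilinear_app[OF assms(2) multilinear_wprod] assms(3)])
  note eq = this
  show "L x = L' x"
    by (rule linear_ext_span[OF assms(1,2) span_wprod]) (use eq in auto)
qed

lemma span_hom_sprod: "span {sprod vs |vs ds. homs ds vs} = (UNIV :: 'a::koszul_grading sym set)"
proof -
  have "sprod vs \<in> span {sprod vs |vs ds. homs ds vs}" for vs :: "'a list"
  proof -
    have "sprod (us @ vs) \<in> span {sprod vs |vs ds. homs ds vs}" if "set us \<subseteq> (\<Union>n. gr n)" for us
      using that
    proof (induction vs arbitrary: us)
      case Nil
      then show ?case using homs_exists[of us] by (auto intro: span_base)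
    next
      case (Cons v vs)
      have "v \<in> span (\<Union>n. gr n)" by (simp add: span_gr)
      then show ?case
      proof (induction rule: span_induct_alt)
        case base
        show ?case by (simp add: linear_0[OF multilinearD[OF multilinear_sprod]] span_zero)
      next
        case (step c x y)
        have "sprod ((us @ [x]) @ vs) \<in> span {sprod vs |vs ds. homs ds vs}"
          by (rule Cons.IH) (use step Cons.prems in auto)
        with step(2) show ?case
          by (simp add: linear_add[OF multilinearD[OF multilinear_sprod]]
              linear_scale[OF multilinearD[OF multilinear_sprod]] span_add span_mul)
      qed
    qed
    from this[of "[]"] show ?thesis by simp
  qed
  then have "range sprod \<subseteq> span {sprod vs |vs ds. homs ds (vs :: 'a list)}" by auto
  from span_mono[OF this] show ?thesis by (simp only: span_sprod span_span) auto
qed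


subsection \<open>Products\<close>

lemma vee_unique:
  "\<exists>!m :: 'a::koszul_grading sym \<Rightarrow> _. bilinear m \<and> (\<forall>vs ws. m (sprod vs) (sprod ws) = sprod (vs @ ws))"
proof (rule ex_ex1I)
  have "\<exists>L. linear L \<and> (\<forall>ws. L (sprod ws) = sprod (vs @ ws))" for vs :: "'a list"
    by (rule sym_exists) (rule multilinear_append[OF multilinear_sprod] swap_rule_append[OF swap_rule_sprod])+
  then obtain L :: "'a list \<Rightarrow> 'a sym \<Rightarrow> 'a sym"
    where L: "\<And>vs. linear (L vs)" "\<And>vs ws. L vs (sprod ws) = sprod (vs @ ws)"
    by metis
  have M: "\<exists>M. linear M \<and> (\<forall>vs. M (sprod vs) = L vs y)" for y
  proof (rule sym_exists)
    \<comment> \<open>Both properties of \<open>vs\<close> mapped to \<open>L vs y\<close> are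
      stable under linear combinations in y, so the case of a product y suffices.\<close>
    have "y \<in> span (range sprod)" by (simp add: span_sprod)
    then have "multilinear (\<lambda>vs. L vs y) \<and> swap_rule 1 (\<lambda>vs. L vs y)"
    proof (induction rule: span_induct_alt)
      case base
      show ?case by (simp add: linear_0[OF L(1)] multilinear_def swap_rule_def linear_zero)
    next
      case (step c x y)
      obtain ws where x: "x = sprod ws" using step(1) by auto
      have eq: "(\<lambda>vs. L vs (c *\<^sub>R x + y)) = (\<lambda>vs. c *\<^sub>R sprod (vs @ ws) + L vs y)"
        by (simp add: x linear_add[OF L(1)] linear_scale[OF L(1)] L(2))
      have "multilinear (\<lambda>vs. sprod (vs @ ws))" "swap_rule 1 (\<lambda>vs. sprod (vs @ ws))"
        by (rule multilinear_append[OF multilinear_sprod] swap_rule_append[OF swap_rule_sprod])+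
      with step(2) show ?case unfolding eq
        using multilinear_add[OF multilinear_app[OF linear_scaleR]]
          swap_rule_add[OF swap_rule_app[OF linear_scaleR]] by blast
    qed
    then show "multilinear (\<lambda>vs. L vs y)" "swap_rule 1 (\<lambda>vs. L vs y)" by blast+
  qed
  from bilinear_exists_two_step[OF L(1) M span_sprod]
  show "\<exists>m :: 'a sym \<Rightarrow> _. bilinear m \<and> (\<forall>vs ws. m (sprod vs) (sprod ws) = sprod (vs @ ws))"
    using L(2) by auto
  fix m m' :: "'a sym \<Rightarrow> 'a sym \<Rightarrow> 'a sym"
  assume m: "bilinear m \<and> (\<forall>vs ws. m (sprod vs) (sprod ws) = sprod (vs @ ws))"
    and m': "bilinear m' \<and> (\<forall>vs ws. m' (sprod vs) (sprod ws) = sprod (vs @ ws))"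
  have "m x y = m' x y" for x y
  proof -
    have "m (sprod vs) = m' (sprod vs)" for vs
      by (rule sym_hom_ext) (use m m' in \<open>auto simp: bilinear_def\<close>)
    then have "(\<lambda>x. m x y) = (\<lambda>x. m' x y)"
      by (intro sym_hom_ext) (use m m' in \<open>auto simp: bilinear_def\<close>)
    then show ?thesis by (rule fun_cong)
  qed
  then show "m = m'" by blast
qed

lemma bilinear_vee: "bilinear ((\<or>\<^sub>S) :: 'a::koszul_grading sym \<Rightarrow> _)"
  and vee_sprod: "sprod vs \<or>\<^sub>S sprod ws = sprod (vs @ ws :: 'a list)"
  using theI'[OF vee_unique[where 'a='a]] unfolding vee_def by blast+

abbreviation vcons :: "'a::koszul_grading \<Rightarrow> 'a sym \<Rightarrow> 'a sym" (infixr "\<rhd>" 72) where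
  "v \<rhd> x \<equiv> sym_incl v \<or>\<^sub>S x"

lemma linear_sym_incl: "linear (sym_incl :: 'a::grading \<Rightarrow> _)"
  using multilinearD[OF multilinear_sprod, of "[]" "[]"] by (simp add: sym_incl_def[abs_def])

lemma linear_vee_left [linear_rules]: "linear f \<Longrightarrow> linear (\<lambda>u. f u \<or>\<^sub>S y)"
  for y :: "'a::koszul_grading sym"
  by (fact bilinear_left[OF bilinear_vee])

lemma linear_vee_right [linear_rules]: "linear f \<Longrightarrow> linear (\<lambda>u. x \<or>\<^sub>S f u)"
  for x :: "'a::koszul_grading sym"
  by (fact bilinear_right[OF bilinear_vee])

lemma linear_vcons_left [linear_rules]: "linear f \<Longrightarrow> linear (\<lambda>u. sym_incl (f u))"
  by (rule linear_app[OF linear_sym_incl])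

lemma vcons_sprod: "v \<rhd> sprod vs = sprod (v # vs)"
  by (simp add: sym_incl_def vee_sprod)

text \<open>S(V) is generated from 1 by left multiplication with homogeneous vectors. With the
  recursion for the coproduct, identities on S(V) follow from this induction without any
  shuffles.\<close>

lemma sym_induct [case_names one vcons add scale]:
  fixes P :: "'a::koszul_grading sym \<Rightarrow> bool"
  assumes one: "P (sprod [])" and vcons: "\<And>i v x. v \<in> gr i \<Longrightarrow> P x \<Longrightarrow> P (v \<rhd> x)"
    and add: "\<And>x y. P x \<Longrightarrow> P y \<Longrightarrow> P (x + y)" and scale: "\<And>c x. P x \<Longrightarrow> P (c *\<^sub>R x)"
  shows "P x"
proof -
  have P: "P (sprod vs)" if "homs ds vs" for ds vs
    using that
  proof (induction vs arbitrary: ds)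
    case (Cons v vs)
    then show ?case by (auto elim!: homs_ConsE simp flip: vcons_sprod intro: vcons)
  qed (rule one)
  have P0: "P 0" using scale[OF one, of 0] by simp
  have "x \<in> span {sprod vs |vs ds. homs ds (vs :: 'a list)}" by (simp only: span_hom_sprod UNIV_I)
  then show ?thesis
    by (induction rule: span_induct_alt) (auto intro!: add scale P P0)
qed

lemma vcons_swap:
  assumes "v \<in> gr i" "w \<in> gr j"
  shows "v \<rhd> w \<rhd> x = sg (i * j) *\<^sub>R (w \<rhd> v \<rhd> x)"
proof -
  have "(\<lambda>x. v \<rhd> w \<rhd> x) = (\<lambda>x. sg (i * j) *\<^sub>R (w \<rhd> v \<rhd> x))"
  proof (rule sym_hom_ext)
    show "v \<rhd> w \<rhd> sprod vs = sg (i * j) *\<^sub>R (w \<rhd> v \<rhd> sprod vs)" for vs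
      using swap_ruleD[OF swap_rule_sprod assms, of "[]" vs] by (simp add: vcons_sprod)
  qed (intro linear_rules)+
  then show ?thesis by meson
qed

lemma vee_one_left: "sprod [] \<or>\<^sub>S x = x" for x :: "'a::koszul_grading sym"
proof -
  have "(\<lambda>x :: 'a sym. sprod [] \<or>\<^sub>S x) = (\<lambda>x. x)"
    by (rule sym_hom_ext) (auto intro!: linear_rules simp: vee_sprod)
  then show ?thesis by meson
qed

lemma vee_one_right: "x \<or>\<^sub>S sprod [] = x" for x :: "'a::koszul_grading sym"
proof -
  have "(\<lambda>x :: 'a sym. x \<or>\<^sub>S sprod []) = (\<lambda>x. x)"
    by (rule sym_hom_ext) (auto intro!: linear_rules simp: vee_sprod)
  then show ?thesis by meson
qed

lemma vee_vcons_left: "(v \<rhd> x) \<or>\<^sub>S y = v \<rhd> (x \<or>\<^sub>S y)"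
proof -
  have "(\<lambda>x. (v \<rhd> x) \<or>\<^sub>S sprod ws) = (\<lambda>x. v \<rhd> (x \<or>\<^sub>S sprod ws))" for ws
    by (rule sym_hom_ext) (intro linear_rules, intro linear_rules, simp add: vcons_sprod vee_sprod)
  then have "(v \<rhd> x) \<or>\<^sub>S sprod ws = v \<rhd> (x \<or>\<^sub>S sprod ws)" for ws by meson
  then have "(\<lambda>y. (v \<rhd> x) \<or>\<^sub>S y) = (\<lambda>y. v \<rhd> (x \<or>\<^sub>S y))"
    by (intro sym_hom_ext linear_rules) auto
  then show ?thesis by meson
qed


subsection \<open>Degrees\<close>

lemma one_gr: "sprod [] \<in> gr 0"
  unfolding gr_sym_def by (rule span_base) force

lemma vcons_gr: "v \<in> gr i \<Longrightarrow> x \<in> gr n \<Longrightarrow> v \<rhd> x \<in> gr (i + n)"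
proof -
  assume v: "v \<in> gr i" and x: "x \<in> gr n"
  have sub: "subspace (gr (i + n) :: 'a sym set)" by (simp add: gr_sym_def)
  have lin: "linear (\<lambda>x. v \<rhd> x)" by (intro linear_rules)
  from x show ?thesis unfolding gr_sym_def[of n]
  proof (induction rule: span_induct_alt)
    case base
    show ?case by (simp add: linear_0[OF lin] subspace_0[OF sub])
  next
    case (step c x y)
    then obtain ds vs where x: "x = sprod vs" "homs ds vs" "sum_list ds = n" by blast
    have "sprod (v # vs) \<in> gr (i + n)"
      unfolding gr_sym_def by (rule span_base) (use x v in \<open>force intro: exI[of _ "i # ds"]\<close>)
    then show ?case using step(2)
      by (simp add: linear_add[OF lin] linear_scale[OF lin] x(1) vcons_sprod
          subspace_add[OF sub] subspace_scale[OF sub])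
  qed
qed

lemma sym_gr_induct [consumes 1, case_names one vcons add scale zero]:
  fixes x :: "'a::koszul_grading sym"
  assumes "x \<in> gr n" and one: "P 0 (sprod [])"
    and vcons: "\<And>i v n x. v \<in> gr i \<Longrightarrow> x \<in> gr n \<Longrightarrow> P n x \<Longrightarrow> P (i + n) (v \<rhd> x)"
    and add: "\<And>n x y. P n x \<Longrightarrow> P n y \<Longrightarrow> P n (x + y)" and scale: "\<And>c n x. P n x \<Longrightarrow> P n (c *\<^sub>R x)"
    and zero: "\<And>n. P n 0"
  shows "P n x"
proof -
  have P: "P (sum_list ds) (sprod vs) \<and> sprod vs \<in> gr (sum_list ds)" if "homs ds vs" for ds vs
    using that
  proof (induction vs arbitrary: ds)
    case (Cons v vs)
    from Cons.prems obtain e es where *: "ds = e # es" "v \<in> gr e" "homs es vs" by (rule homs_ConsE)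
    from Cons.IH[OF *(3)] show ?case
      using vcons[OF *(2)] vcons_gr[OF *(2)] by (simp add: *(1) flip: vcons_sprod)
  qed (simp add: one one_gr)
  from assms(1) have "x \<in> span {sprod vs |vs ds. homs ds (vs :: 'a list) \<and> sum_list ds = n}" by (simp add: gr_sym_def)
  then show ?thesis
    by (induction rule: span_induct_alt) (use P in \<open>auto intro!: add scale zero\<close>)
qed

lemma multilinear_map: "linear f \<Longrightarrow> multilinear \<Phi> \<Longrightarrow> multilinear (\<lambda>vs. \<Phi> (map f vs))"
  unfolding multilinear_def by (simp add: linear_app[of "\<lambda>v. \<Phi> (_ @ v # _)"])

lemma sym_map_unique:
  fixes f :: "'a::koszul_grading \<Rightarrow> 'b::koszul_grading"
  assumes "f \<in> Hom 0"
  shows "\<exists>!L. linear L \<and> (\<forall>vs. L (sprod vs) = sprod (map f vs))"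
proof (rule ex_ex1I)
  have "swap_rule 1 (\<lambda>vs. sprod (map f vs))"
    unfolding swap_rule_def
  proof (intro allI impI)
    fix us ws and x y :: 'a and i j assume "x \<in> gr i" "y \<in> gr j"
    then have "f x \<in> gr i" "f y \<in> gr j" using HomD(2)[OF assms] by fastforce+
    from swap_ruleD[OF swap_rule_sprod this, of "map f us" "map f ws"]
    show "sprod (map f (us @ x # y # ws)) = (1 * sg (i * j)) *\<^sub>R sprod (map f (us @ y # x # ws))"
      by simp
  qed
  then show "\<exists>L. linear L \<and> (\<forall>vs. L (sprod vs) = sprod (map f vs))"
    by (intro sym_exists multilinear_map[OF HomD(1)[OF assms]] multilinear_sprod)
qed (auto intro!: sym_hom_ext)

lemma linear_sym_map: "f \<in> Hom 0 \<Longrightarrow> linear (sym_map f)"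
  and sym_map_sprod: "f \<in> Hom 0 \<Longrightarrow> sym_map f (sprod vs) = sprod (map f vs)"
  for f :: "'a::koszul_grading \<Rightarrow> 'b::koszul_grading"
  using theI'[OF sym_map_unique, of f] unfolding sym_map_def by simp_all

lemma sym_map_vcons:
  fixes f :: "'a::koszul_grading \<Rightarrow> 'b::koszul_grading"
  assumes "f \<in> Hom 0"
  shows "sym_map f (v \<rhd> x) = f v \<rhd> sym_map f x"
proof -
  have "(\<lambda>x. sym_map f (v \<rhd> x)) = (\<lambda>x. f v \<rhd> sym_map f x)"
    by (intro sym_hom_ext linear_rules linear_app[OF linear_sym_map[OF assms]] linear_sym_map[OF assms])
      (simp add: vcons_sprod sym_map_sprod[OF assms])
  then show ?thesis by meson
qed

lemma parity_Hom: "(parity :: 'a::koszul_grading \<Rightarrow> 'a) \<in> Hom 0"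
  by (auto simp: Hom_def linear_parity parity_gr gr_scaleR)

instance sym :: (koszul_grading) koszul_grading
proof (rule koszul_gradingI)
  show "subspace (gr n :: 'a sym set)" for n by (simp add: gr_sym_def)
  have "{sprod vs |vs ds. homs ds (vs :: 'a list)} \<subseteq> (\<Union>n. gr n)"
    unfolding gr_sym_def by (auto intro: span_base)
  from span_mono[OF this] show "span (\<Union>n. gr n) = (UNIV :: 'a sym set)"
    by (simp only: span_hom_sprod) auto
  \<comment> \<open>Degrees add up in products, so the parity operator of S(V) is S of the parity
    operator of V.\<close>
  let ?L = "sym_map (parity :: 'a \<Rightarrow> 'a)"
  have lin: "linear ?L" by (rule linear_sym_map[OF parity_Hom])
  have "?L x = sg n *\<^sub>R x" if "x \<in> gr n" for n and x :: "'a sym"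
    using that
  proof (induction rule: sym_gr_induct)
    case (vcons i v n x)
    have v: "linear (\<lambda>v. v \<rhd> x)" "linear (\<lambda>x. v \<rhd> x)" for v and x :: "'a sym" by (intro linear_rules linear_ident)+
    show ?case
      by (simp add: sym_map_vcons[OF parity_Hom] vcons.IH parity_gr[OF vcons(1)] linear_scale[OF v(1)]
          linear_scale[OF v(2)] sg_add)
  qed (simp_all add: sym_map_sprod[OF parity_Hom] linear_add[OF lin] linear_scale[OF lin] linear_0[OF lin]
      scaleR_add_right mult.commute)
  then show "\<exists>L :: 'a sym \<Rightarrow> 'a sym. linear L \<and> (\<forall>n. \<forall>v\<in>gr n. L v = ((-1) powi n) *\<^sub>R v)"
    using lin by (intro exI[of _ ?L]) (simp add: powi_sg)
qed

lemma kp_one [simp]: "kp r (sprod []) = sprod []"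
  using kp_gr[OF one_gr] by simp

text \<open>The sign (-1)^(rn) is multiplicative in the degree n.\<close>

lemma kp_vcons:
  fixes v :: "'a::koszul_grading"
  shows "kp r (v \<rhd> x) = kp r v \<rhd> kp r x"
proof -
  have "kp r (v \<rhd> x) = kp r v \<rhd> kp r x" if v: "v \<in> gr i" for v :: 'a and i
  proof -
    have "(\<lambda>x. kp r (v \<rhd> x)) = (\<lambda>x. kp r v \<rhd> kp r x)"
    proof (rule hom_ext)
      have l: "linear (\<lambda>v. v \<rhd> x)" "linear (\<lambda>x. v \<rhd> x)" for v and x :: "'a sym"
        by (intro linear_rules linear_ident)+
      show "kp r (v \<rhd> x) = kp r v \<rhd> kp r x" if "x \<in> gr n" for n x
        by (simp add: kp_gr[OF v] kp_gr[OF that] kp_gr[OF vcons_gr[OF v that]] linear_scale[OF l(1)]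
            linear_scale[OF l(2)] distrib_left sg_add)
    qed (intro linear_rules linear_app[OF linear_kp] linear_kp)+
    then show ?thesis by meson
  qed
  then have "(\<lambda>v. kp r (v \<rhd> x)) = (\<lambda>v. kp r v \<rhd> kp r x)"
    by (intro hom_ext linear_rules linear_app[OF linear_kp] linear_kp) auto
  then show ?thesis by meson
qed

text \<open>In \<open>ad\<close> the vector of n stands on the right, while all recursions multiply
  from the left; this converts between them.\<close>

lemma vee_incl_right:
  assumes w: "w \<in> gr j" and x: "x \<in> gr n"
  shows "x \<or>\<^sub>S sym_incl w = sg (n * j) *\<^sub>R (w \<rhd> x)"
  using x
proof (induction rule: sym_gr_induct)
  case one
  then show ?case by (simp add: vee_one_left vee_one_right)
next
  case (vcons i v n x)
  have l: "linear (\<lambda>x. v \<rhd> x)" by (intro linear_rules)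
  show ?case
    by (simp add: vee_vcons_left vcons.IH linear_scale[OF l] vcons_swap[OF w vcons(1)])
      (simp add: sg_def)
qed (simp_all add: bilinear_ladd[OF bilinear_vee] bilinear_radd[OF bilinear_vee] bilinear_lmul[OF bilinear_vee]
    bilinear_rmul[OF bilinear_vee] bilinear_lzero[OF bilinear_vee] bilinear_rzero[OF bilinear_vee]
    scaleR_add_right mult.commute)

lemma sym_map_Hom:
  fixes f :: "'a::koszul_grading \<Rightarrow> 'b::koszul_grading"
  assumes "f \<in> Hom 0"
  shows "sym_map f \<in> Hom 0"
proof -
  have "sym_map f x \<in> gr n" if "x \<in> gr n" for n and x :: "'a sym"
    using that
  proof (induction rule: sym_gr_induct)
    case (vcons i v n x)
    then show ?case using HomD(2)[OF assms vcons(1)] by (auto simp: sym_map_vcons[OF assms] intro: vcons_gr)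
  qed (simp_all add: sym_map_sprod[OF assms] one_gr linear_add[OF linear_sym_map[OF assms]]
      linear_scale[OF linear_sym_map[OF assms]] linear_0[OF linear_sym_map[OF assms]] gr_add gr_scaleR gr_0)
  then show ?thesis by (auto simp: Hom_def linear_sym_map[OF assms])
qed


subsection \<open>Counit and projection\<close>

definition eps :: "'a::koszul_grading sym \<Rightarrow> real" where
  "eps = (SOME L. linear L \<and> (\<forall>vs. L (sprod vs) = (if vs = [] then 1 else 0)))"

lemma linear_eps: "linear (eps :: 'a::koszul_grading sym \<Rightarrow> real)"
  and eps_sprod: "eps (sprod vs) = (if (vs :: 'a list) = [] then 1 else 0)"
proof -
  have "\<exists>L. linear L \<and> (\<forall>vs :: 'a list. L (sprod vs) = (if vs = [] then 1 else 0 :: real))"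
    by (rule sym_exists) (auto simp: multilinear_def swap_rule_def linear_zero)
  from someI_ex[OF this] show "linear (eps :: 'a sym \<Rightarrow> real)" "eps (sprod vs) = (if vs = [] then 1 else 0)"
    unfolding eps_def by blast+
qed

lemma eps_one [simp]: "eps (sprod []) = 1"
  by (simp add: eps_sprod)

lemma eps_vcons [simp]: "eps (v \<rhd> x) = 0"
proof -
  have "(\<lambda>x. eps (v \<rhd> x)) = (\<lambda>x. 0)"
    by (intro sym_hom_ext linear_rules linear_app[OF linear_eps]) (simp add: vcons_sprod eps_sprod)
  then show ?thesis by meson
qed

lemma sym_proj_unique:
  "\<exists>!L :: 'a::koszul_grading sym \<Rightarrow> 'a. linear L \<and>
     (\<forall>v. L (sprod [v]) = v) \<and> (\<forall>vs. length vs \<noteq> 1 \<longrightarrow> L (sprod vs) = 0)"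
proof (rule ex_ex1I)
  let ?\<Phi> = "\<lambda>vs :: 'a list. if length vs = 1 then hd vs else 0"
  have "\<exists>L. linear L \<and> (\<forall>vs. L (sprod vs) = ?\<Phi> vs)"
  proof (rule sym_exists)
    show "multilinear ?\<Phi>"
    proof (rule multilinear_Cons)
      show "linear (\<lambda>v :: 'a. ?\<Phi> (v # ws))" for ws
        by (cases "ws = []") (simp_all add: linear_zero linear_ident)
    qed (simp add: multilinear_def linear_zero)
    show "swap_rule 1 ?\<Phi>" by (simp add: swap_rule_def)
  qed
  then show "\<exists>L :: 'a sym \<Rightarrow> 'a. linear L \<and>
     (\<forall>v. L (sprod [v]) = v) \<and> (\<forall>vs. length vs \<noteq> 1 \<longrightarrow> L (sprod vs) = 0)"
    by fastforce
next
  fix L L' :: "'a sym \<Rightarrow> 'a"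
  assume *: "linear L \<and> (\<forall>v. L (sprod [v]) = v) \<and> (\<forall>vs. length vs \<noteq> 1 \<longrightarrow> L (sprod vs) = 0)"
    "linear L' \<and> (\<forall>v. L' (sprod [v]) = v) \<and> (\<forall>vs. length vs \<noteq> 1 \<longrightarrow> L' (sprod vs) = 0)"
  show "L = L'"
  proof (rule sym_hom_ext)
    show "L (sprod vs) = L' (sprod vs)" for vs
      using * by (cases "length vs = 1") (auto simp: length_Suc_conv)
  qed (use * in auto)
qed

lemma linear_sym_proj: "linear (sym_proj :: 'a::koszul_grading sym \<Rightarrow> 'a)"
  and sym_proj_single: "sym_proj (sprod [v :: 'a]) = v"
  and sym_proj_other: "length vs \<noteq> 1 \<Longrightarrow> sym_proj (sprod vs) = (0 :: 'a)"
  using theI'[OF sym_proj_unique[where 'a='a]] unfolding sym_proj_def by blast+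

lemma sym_proj_one [simp]: "sym_proj (sprod []) = (0 :: 'a::koszul_grading)"
  by (simp add: sym_proj_other)

lemma sym_proj_vcons: "sym_proj (v \<rhd> x) = eps x *\<^sub>R v"
proof -
  have "(\<lambda>x. sym_proj (v \<rhd> x)) = (\<lambda>x. eps x *\<^sub>R v)"
    by (intro sym_hom_ext linear_rules linear_app[OF linear_sym_proj] linear_eps)
      (auto simp: vcons_sprod eps_sprod sym_proj_single sym_proj_other)
  then show ?thesis by meson
qed

lemma eps_gr: "x \<in> gr n \<Longrightarrow> n \<noteq> 0 \<Longrightarrow> eps x = 0"
proof -
  have "n \<noteq> 0 \<longrightarrow> eps x = 0" if "x \<in> gr n"
    using that by (induction rule: sym_gr_induct)
      (auto simp: linear_add[OF linear_eps] linear_scale[OF linear_eps] linear_0[OF linear_eps])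
  then show "x \<in> gr n \<Longrightarrow> n \<noteq> 0 \<Longrightarrow> eps x = 0" by blast
qed

lemma sym_proj_Hom: "(sym_proj :: 'a::koszul_grading sym \<Rightarrow> 'a) \<in> Hom 0"
proof -
  have "sym_proj x \<in> gr n" if "x \<in> gr n" for n and x :: "'a sym"
    using that
  proof (induction rule: sym_gr_induct)
    case (vcons i v n x)
    then show ?case using eps_gr[OF vcons(2)] by (cases "n = 0") (auto simp: sym_proj_vcons gr_scaleR gr_0)
  qed (simp_all add: linear_add[OF linear_sym_proj] linear_scale[OF linear_sym_proj]
      linear_0[OF linear_sym_proj] gr_add gr_scaleR gr_0)
  then show ?thesis by (auto simp: Hom_def linear_sym_proj)
qed

lemma sym_incl_gr: "v \<in> gr n \<Longrightarrow> sym_incl v \<in> gr n" for v :: "'a::koszul_grading"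
  using vcons_gr[OF _ one_gr] by (simp add: vee_one_right)


section \<open>The coproduct\<close>

lemma multilinear_foldr:
  assumes "\<And>v. linear (F v)" "\<And>t. linear (\<lambda>v. F v t)"
  shows "multilinear (\<lambda>vs. foldr F vs e)"
  unfolding multilinear_def
proof (intro allI)
  fix us ws
  show "linear (\<lambda>v. foldr F (us @ v # ws) e)"
    by (induction us) (simp_all add: assms(2) linear_app[OF assms(1)])
qed

lemma swap_rule_foldr:
  fixes F :: "'a::grading \<Rightarrow> 'b::real_vector \<Rightarrow> 'b"
  assumes F: "\<And>v. linear (F v)"
    and swap: "\<And>x y i j t. x \<in> gr i \<Longrightarrow> y \<in> gr j \<Longrightarrow> F x (F y t) = (c * sg (i * j)) *\<^sub>R F y (F x t)"
  shows "swap_rule c (\<lambda>vs. foldr F vs e)"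
  unfolding swap_rule_def
proof (intro allI impI)
  fix us ws and x y :: 'a and i j assume xy: "x \<in> gr i" "y \<in> gr j"
  show "foldr F (us @ x # y # ws) e = (c * sg (i * j)) *\<^sub>R foldr F (us @ y # x # ws) e"
  proof (induction us)
    case Nil
    show ?case using swap[OF xy] by simp
  next
    case (Cons u us)
    then show ?case by (simp add: linear_scale[OF F])
  qed
qed

lemma kp_half: "v \<in> gr i \<Longrightarrow> (1/2) *\<^sub>R (v + parity v) = (if even i then v else 0)"
  "v \<in> gr i \<Longrightarrow> (1/2) *\<^sub>R (v - parity v) = (if even i then 0 else v)"
  by (simp_all add: parity_gr sg_def flip: scaleR_2)

lemma linear_tensor_left [linear_rules]: "linear f \<Longrightarrow> linear (\<lambda>u. f u \<otimes>\<^sub>\<real> y)"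
  by (fact bilinear_left[OF bilinear_tensor])

lemma linear_tensor_right [linear_rules]: "linear f \<Longrightarrow> linear (\<lambda>u. x \<otimes>\<^sub>\<real> f u)"
  by (fact bilinear_right[OF bilinear_tensor])

lemma linear_kp_app [linear_rules]: "linear f \<Longrightarrow> linear (\<lambda>u. kp r (f u))"
  by (rule linear_app[OF linear_kp])

lemma linear_parity_app [linear_rules]: "linear f \<Longrightarrow> linear (\<lambda>u. parity (f u))"
  by (rule linear_app[OF linear_parity])

lemma linear_tensor_lift_param:
  assumes "\<And>u. bilinear (b u)" "\<And>x y. linear (\<lambda>u. b u x y)"
  shows "linear (\<lambda>u. tensor_lift (b u) t)"
proof (induction t rule: tensor_induct)
  case (tensor v w)
  then show ?case by (simp add: tensor_lift_tensor assms)
next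
  case (add s t)
  then show ?case by (simp add: linear_add[OF linear_tensor_lift[OF assms(1)]] linear_rules)
next
  case (scale c t)
  then show ?case by (simp add: linear_scale[OF linear_tensor_lift[OF assms(1)]] linear_rules)
qed

text \<open>Coproduct of a product with one vector. Halving \<open>v \<plusminus> parity v\<close> makes the Koszul sign
  linear in \<open>v\<close>.\<close>

definition cop_step :: "'a::koszul_grading \<Rightarrow> ('a sym, 'a sym) tensor \<Rightarrow> ('a sym, 'a sym) tensor" where
  "cop_step v = tensor_lift (\<lambda>x y. (v \<rhd> x) \<otimes>\<^sub>\<real> y +
     x \<otimes>\<^sub>\<real> (((1/2) *\<^sub>R (v + parity v)) \<rhd> y) + parity x \<otimes>\<^sub>\<real> (((1/2) *\<^sub>R (v - parity v)) \<rhd> y))"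

lemma linear_cop_step: "linear (cop_step v)"
  unfolding cop_step_def by (intro linear_tensor_lift bilinearI linear_rules)

lemma linear_cop_step_left: "linear (\<lambda>v. cop_step v t)"
  unfolding cop_step_def by (intro linear_tensor_lift_param bilinearI linear_rules)

lemma cop_step_tensor:
  assumes "v \<in> gr i"
  shows "cop_step v (x \<otimes>\<^sub>\<real> y) = (v \<rhd> x) \<otimes>\<^sub>\<real> y + kp i x \<otimes>\<^sub>\<real> (v \<rhd> y)"
proof -
  have z: "(0 :: 'a) \<rhd> y = 0" "x \<otimes>\<^sub>\<real> (0 :: 'a sym) = 0" for x y :: "'a sym"
    using linear_0[OF linear_vee_left[OF linear_sym_incl]] bilinear_rzero[OF bilinear_tensor] by auto
  have "bilinear (\<lambda>x y. (v \<rhd> x) \<otimes>\<^sub>\<real> y +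
     x \<otimes>\<^sub>\<real> (((1/2) *\<^sub>R (v + parity v)) \<rhd> y) + parity x \<otimes>\<^sub>\<real> (((1/2) *\<^sub>R (v - parity v)) \<rhd> y))"
    by (intro bilinearI linear_rules)
  then show ?thesis
    by (simp add: cop_step_def tensor_lift_tensor kp_half[OF assms] z kp_def)
qed

text \<open>Both orders produce the same four terms, according to the factors that receive x and y.
  This is the compatibility with the relations of S(V) that the recursive coproduct needs.\<close>

lemma cop_step_swap:
  assumes x: "x \<in> gr i" and y: "y \<in> gr j"
  shows "cop_step x (cop_step y t) = (1 * sg (i * j)) *\<^sub>R cop_step y (cop_step x t)"
proof -
  have "(\<lambda>t. cop_step x (cop_step y t)) = (\<lambda>t. (1 * sg (i * j)) *\<^sub>R cop_step y (cop_step x t))"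
  proof (rule tensor_ext)
    fix a b :: "'a sym"
    have k: "kp i (y \<rhd> a) = sg (i * j) *\<^sub>R (y \<rhd> kp i a)" "kp j (x \<rhd> a) = sg (i * j) *\<^sub>R (x \<rhd> kp j a)"
      by (simp_all add: kp_vcons kp_gr[OF x] kp_gr[OF y] linear_scale[OF linear_vee_left[OF linear_sym_incl]] mult.commute)
    note sc = linear_scale[OF linear_tensor_left[OF linear_ident]] linear_scale[OF linear_tensor_right[OF linear_ident]]
    show "cop_step x (cop_step y (a \<otimes>\<^sub>\<real> b)) = (1 * sg (i * j)) *\<^sub>R cop_step y (cop_step x (a \<otimes>\<^sub>\<real> b))"
      by (simp add: cop_step_tensor[OF x] cop_step_tensor[OF y] linear_add[OF linear_cop_step] k
          vcons_swap[OF x y] sc kp_kp add.commute scaleR_add_right)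
  qed (intro linear_rules linear_app[OF linear_cop_step] linear_cop_step)+
  then show ?thesis by meson
qed

text \<open>The coproduct by recursion on the length. \<open>coprod_eq_cop\<close> identifies it
  with the shuffle formula, which in particular shows that the description of \<open>coprod\<close>
  is satisfied.\<close>

definition cop :: "'a::koszul_grading sym \<Rightarrow> ('a sym, 'a sym) tensor" where
  "cop = (SOME L. linear L \<and> (\<forall>vs. L (sprod vs) = foldr cop_step vs (sprod [] \<otimes>\<^sub>\<real> sprod [])))"

lemma linear_cop: "linear (cop :: 'a::koszul_grading sym \<Rightarrow> _)"
  and cop_sprod: "cop (sprod vs) = foldr cop_step (vs :: 'a list) (sprod [] \<otimes>\<^sub>\<real> sprod [])"
proof -
  have "\<exists>L. linear L \<and> (\<forall>vs :: 'a list. L (sprod vs) = foldr cop_step vs (sprod [] \<otimes>\<^sub>\<real> sprod []))"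
    by (intro sym_exists multilinear_foldr swap_rule_foldr linear_cop_step linear_cop_step_left cop_step_swap)
  from someI_ex[OF this] show "linear (cop :: 'a sym \<Rightarrow> _)"
    "cop (sprod vs) = foldr cop_step vs (sprod [] \<otimes>\<^sub>\<real> sprod [])"
    unfolding cop_def by blast+
qed


subsection \<open>Shuffles and subsets\<close>

abbreviation inside :: "nat set \<Rightarrow> nat \<Rightarrow> nat list" where
  "inside I n \<equiv> filter (\<lambda>i. i \<in> I) [0..<n]"

abbreviation outside :: "nat set \<Rightarrow> nat \<Rightarrow> nat list" where
  "outside I n \<equiv> filter (\<lambda>i. i \<notin> I) [0..<n]"

lemma sorted_strict_mono: "strict_mono_on {a..<b} \<sigma> \<Longrightarrow> sorted (map \<sigma> [a..<b])" for \<sigma> :: "nat \<Rightarrow> nat"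
proof -
  assume *: "strict_mono_on {a..<b} \<sigma>"
  have "\<sigma> (a + i) \<le> \<sigma> (a + j)" if "i < j" "j < b - a" for i j
    using strict_mono_onD[OF *, of "a + i" "a + j"] that by force
  then show ?thesis by (auto simp: sorted_iff_nth_mono_less)
qed

text \<open>A shuffle is determined by the image I of its first block: it lists I and then the
  complement, each in increasing order.\<close>

lemma Sh_inside_outside:
  assumes \<sigma>: "\<sigma> \<in> Sh k n" and k: "k \<le> n"
  shows "map \<sigma> [0..<k] = inside (\<sigma> ` {..<k}) n" "map \<sigma> [k..<n] = outside (\<sigma> ` {..<k}) n"
proof -
  have p: "\<sigma> permutes {..<n}" and m: "strict_mono_on {0..<k} \<sigma>" "strict_mono_on {k..<n} \<sigma>"
    using \<sigma> by (auto simp: Sh_def atLeast0LessThan)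
  have inj: "inj \<sigma>" using p by (rule permutes_inj)
  have im: "\<sigma> ` {..<n} = {..<n}" using p by (rule permutes_image)
  show "map \<sigma> [0..<k] = inside (\<sigma> ` {..<k}) n"
  proof (rule sorted_distinct_set_unique)
    show "set (map \<sigma> [0..<k]) = set (inside (\<sigma> ` {..<k}) n)"
      using im k by (fastforce simp: atLeast0LessThan)
  qed (use inj in \<open>auto simp: sorted_strict_mono[OF m(1)] distinct_map inj_on_def intro: sorted_filter[of id, simplified]\<close>)
  show "map \<sigma> [k..<n] = outside (\<sigma> ` {..<k}) n"
  proof (rule sorted_distinct_set_unique)
    have "\<sigma> ` {k..<n} = \<sigma> ` {..<n} - \<sigma> ` {..<k}"
      unfolding image_set_diff[OF inj, symmetric] by (rule arg_cong[of _ _ "image \<sigma>"]) auto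
    then show "set (map \<sigma> [k..<n]) = set (outside (\<sigma> ` {..<k}) n)"
      by (auto simp: im)
  qed (use inj in \<open>auto simp: sorted_strict_mono[OF m(2)] distinct_map inj_on_def intro: sorted_filter[of id, simplified]\<close>)
qed

text \<open>Choosing a shuffle means choosing the set of positions that go to the left factor. Sums
  over subsets admit an induction on n that shuffles do not offer directly.\<close>

lemma Sh_sum:
  fixes g :: "nat list \<Rightarrow> nat list \<Rightarrow> 'x::real_vector"
  shows "(\<Sum>k\<le>n. \<Sum>\<sigma>\<in>Sh k n. g (map \<sigma> [0..<k]) (map \<sigma> [k..<n])) =
    (\<Sum>I\<in>Pow {..<n}. g (inside I n) (outside I n))"
proof -
  \<comment> \<open>\<open>J I\<close> is the one-line notation of the shuffle belonging to the
    subset I, and \<open>P I\<close> is that shuffle.\<close>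
  define J where "J I = inside I n @ outside I n" for I
  define P where "P I = (\<lambda>i. if i < n then J I ! i else i)" for I
  have J: "length (J I) = n" "distinct (J I)" "set (J I) = {..<n}" for I
    by (auto simp: J_def sum_length_filter_compl[of "\<lambda>i. i \<in> I", simplified])
  have cI: "card I = length (inside I n)" if "I \<subseteq> {..<n}" for I
  proof -
    have "set (inside I n) = I" using that by auto
    then show ?thesis by (metis distinct_card distinct_filter distinct_upt)
  qed
  have P: "P I \<in> Sh (card I) n" and PI: "P I ` {..<card I} = I" and cn: "card I \<le> n"
    if I: "I \<subseteq> {..<n}" for I
  proof -
    show cn: "card I \<le> n" using card_mono[OF _ I] by simp
    have "bij_betw ((!) (J I)) {..<n} {..<n}"
      by (rule bij_betw_nth) (simp_all add: J)
    then have "bij_betw (P I) {..<n} {..<n}"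
      by (rule bij_betw_cong[THEN iffD1, rotated]) (simp add: P_def)
    then have "P I permutes {..<n}"
      by (rule bij_imp_permutes) (simp add: P_def)
    moreover have nth1: "P I i = inside I n ! i" if "i < card I" for i
      using that cn cI[OF I] by (simp add: P_def J_def nth_append)
    moreover have nth2: "P I i = outside I n ! (i - card I)" if "card I \<le> i" "i < n" for i
      using that cI[OF I] by (simp add: P_def J_def nth_append)
    moreover have len: "length (outside I n) = n - card I"
      using J(1)[of I] cI[OF I] by (simp add: J_def)
    moreover have st: "sorted_wrt (<) (inside I n)" "sorted_wrt (<) (outside I n)"
      by (auto intro!: sorted_wrt_filter)
    ultimately have "P I permutes {..<n}" and
      n1: "\<And>i. i < card I \<Longrightarrow> P I i = inside I n ! i" and
      n2: "\<And>i. card I \<le> i \<Longrightarrow> i < n \<Longrightarrow> P I i = outside I n ! (i - card I)" by blast+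
    moreover have "strict_mono_on {..<card I} (P I)"
    proof (rule strict_mono_onI)
      fix r s assume "r \<in> {..<card I}" "s \<in> {..<card I}" "r < s"
      then show "P I r < P I s" using sorted_wrt_nth_less[OF st(1), of r s] cI[OF I] by (simp add: n1)
    qed
    moreover have "strict_mono_on {card I..<n} (P I)"
    proof (rule strict_mono_onI)
      fix r s assume "r \<in> {card I..<n}" "s \<in> {card I..<n}" "r < s"
      then show "P I r < P I s"
        using sorted_wrt_nth_less[OF st(2), of "r - card I" "s - card I"] len by (simp add: n2)
    qed
    ultimately show "P I \<in> Sh (card I) n" by (simp add: Sh_def)
    have "P I ` {..<card I} = (!) (inside I n) ` {..<length (inside I n)}"
      using nth1 cI[OF I] by (intro image_cong) auto
    also have "\<dots> = set (inside I n)" by (auto simp: set_conv_nth)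
    also have "\<dots> = I" using I by auto
    finally show "P I ` {..<card I} = I" .
  qed
  have fin: "finite (Sh k n)" for k
    by (rule finite_subset[OF _ finite_permutations[of "{..<n}"]]) (auto simp: Sh_def)
  have "(\<Sum>k\<le>n. \<Sum>\<sigma>\<in>Sh k n. g (map \<sigma> [0..<k]) (map \<sigma> [k..<n])) =
      (\<Sum>(k, \<sigma>)\<in>Sigma {..n} (\<lambda>k. Sh k n). g (map \<sigma> [0..<k]) (map \<sigma> [k..<n]))"
    by (rule sum.Sigma) (auto simp: fin)
  also have "\<dots> = (\<Sum>I\<in>Pow {..<n}. g (inside I n) (outside I n))"
  proof (rule sum.reindex_bij_witness[where i="\<lambda>I. (card I, P I)" and j="\<lambda>(k, \<sigma>). \<sigma> ` {..<k}"])
    fix a assume "a \<in> Sigma {..n} (\<lambda>k. Sh k n)"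
    then obtain k \<sigma> where a: "a = (k, \<sigma>)" "k \<le> n" "\<sigma> \<in> Sh k n" by auto
    have p: "\<sigma> permutes {..<n}" using a by (simp add: Sh_def)
    have sub: "\<sigma> ` {..<k} \<subseteq> {..<n}" using permutes_image[OF p] a(2) by fastforce
    then show "(case a of (k, \<sigma>) \<Rightarrow> \<sigma> ` {..<k}) \<in> Pow {..<n}" by (simp add: a)
    have c: "card (\<sigma> ` {..<k}) = k" by (simp add: card_image permutes_inj_on[OF p])
    have "P (\<sigma> ` {..<k}) i = \<sigma> i" for i
    proof -
      have "J (\<sigma> ` {..<k}) = map \<sigma> [0..<n]"
        unfolding J_def Sh_inside_outside[OF a(3,2), symmetric] using a(2)
        by (metis map_append upt_add_eq_append le0 le_add_diff_inverse)
      then show ?thesis using p by (auto simp: P_def permutes_def)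
    qed
    then show "(card (case a of (k, \<sigma>) \<Rightarrow> \<sigma> ` {..<k}), P (case a of (k, \<sigma>) \<Rightarrow> \<sigma> ` {..<k})) = a"
      by (auto simp: a c)
    show "g (inside (case a of (k, \<sigma>) \<Rightarrow> \<sigma> ` {..<k}) n) (outside (case a of (k, \<sigma>) \<Rightarrow> \<sigma> ` {..<k}) n) =
        (case a of (k, \<sigma>) \<Rightarrow> g (map \<sigma> [0..<k]) (map \<sigma> [k..<n]))"
      by (simp add: a Sh_inside_outside[OF a(3,2)])
  next
    fix I assume "I \<in> Pow {..<n}"
    then show "(case (card I, P I) of (k, \<sigma>) \<Rightarrow> \<sigma> ` {..<k}) = I" "(card I, P I) \<in> Sigma {..n} (\<lambda>k. Sh k n)"
      using P[of I] PI[of I] cn[of I] by auto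
  qed
  finally show ?thesis .
qed

lemma inv_factor_map_Suc: "inv_factor c (map Suc js) = inv_factor (\<lambda>a b. c (Suc a) (Suc b)) js"
proof (induction js)
  case (Cons j js)
  have "{i \<in> set (map Suc js). i < Suc j} = Suc ` {i \<in> set js. i < j}" by auto
  then have "(\<Prod>i\<in>{i \<in> set (map Suc js). i < Suc j}. c (Suc j) i) = (\<Prod>i\<in>{i \<in> set js. i < j}. c (Suc j) (Suc i))"
    by (simp only: prod.reindex[OF inj_on_subset[OF inj_Suc subset_UNIV]] o_def)
  with Cons show ?case by simp
qed simp

text \<open>The index 0 is smaller than all others and hence forms an inversion with exactly the
  entries in front of it.\<close>

lemma inv_factor_zero:
  assumes "distinct (X @ 0 # Y)"
  shows "inv_factor c (X @ 0 # Y) = (\<Prod>a\<in>set X. c a 0) * inv_factor c (X @ Y)"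
  using assms
proof (induction X)
  case (Cons x X)
  have "{i \<in> set (X @ 0 # Y). i < x} = insert 0 {i \<in> set (X @ Y). i < x}" using Cons.prems by auto
  moreover have "0 \<notin> set (X @ Y)" using Cons.prems by auto
  ultimately have "(\<Prod>i\<in>{i \<in> set (X @ 0 # Y). i < x}. c x i) = c x 0 * (\<Prod>i\<in>{i \<in> set (X @ Y). i < x}. c x i)"
    by simp
  with Cons show ?case by (simp add: mult_ac)
qed simp

lemma Pow_lessThan_Suc_shift:
  "Pow {..<Suc n} = (\<lambda>J. insert 0 (Suc ` J)) ` Pow {..<n} \<union> (\<lambda>J. Suc ` J) ` Pow {..<n}"
proof (intro equalityI subsetI)
  fix I assume I: "I \<in> Pow {..<Suc n}"
  define J where "J = {j. Suc j \<in> I}"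
  have "J \<in> Pow {..<n}" using I by (auto simp: J_def)
  moreover have "I = (if 0 \<in> I then insert 0 (Suc ` J) else Suc ` J)"
  proof -
    have "I - {0} = Suc ` J"
    proof (intro equalityI subsetI)
      fix x assume "x \<in> I - {0}"
      then show "x \<in> Suc ` J" by (cases x) (auto simp: J_def)
    qed (auto simp: J_def)
    then show ?thesis by auto
  qed
  ultimately show "I \<in> (\<lambda>J. insert 0 (Suc ` J)) ` Pow {..<n} \<union> (\<lambda>J. Suc ` J) ` Pow {..<n}"
    by (metis UnCI image_eqI)
qed auto

lemma filter_upt_shift:
  "filter Q [0..<Suc n] = (if Q 0 then [0] else []) @ map Suc (filter (\<lambda>i. Q (Suc i)) [0..<n])"
  by (simp only: upt_conv_Cons[OF zero_less_Suc] map_Suc_upt[symmetric] filter.simps filter_map o_def) simp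

lemma homs_map_nth:
  "homs ds vs \<Longrightarrow> set A \<subseteq> {..<length vs} \<Longrightarrow> homs (map ((!) ds) A) (map ((!) vs) A)"
  by (induction A) (auto intro: homs_nth)

lemma sprod_gr: "homs ds vs \<Longrightarrow> sprod vs \<in> gr (sum_list ds)"
  unfolding gr_sym_def by (rule span_base) blast

definition split_term :: "int list \<Rightarrow> 'a::koszul_grading list \<Rightarrow> nat list \<Rightarrow> nat list \<Rightarrow> ('a sym, 'a sym) tensor" where
  "split_term ds vs A B = inv_factor (\<lambda>a b. sg (ds ! a * ds ! b)) (A @ B) *\<^sub>R
     (sprod (map ((!) vs) A) \<otimes>\<^sub>\<real> sprod (map ((!) vs) B))"

text \<open>Subsets are split according to whether they contain the position 0 of the new vector. If
  they do, no inversion is added. If not, the vector passes the entire left factor, and the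
  resulting sign is \<open>kp d\<close> on that factor.\<close>

lemma cop_subsets:
  "homs ds vs \<Longrightarrow> cop (sprod vs) = (\<Sum>I\<in>Pow {..<length vs}. split_term ds vs (inside I (length vs)) (outside I (length vs)))"
proof (induction vs arbitrary: ds)
  case Nil
  then show ?case by (simp add: cop_sprod split_term_def)
next
  case (Cons v vs)
  from Cons.prems obtain d ds' where ds: "ds = d # ds'" "v \<in> gr d" "homs ds' vs" by (rule homs_ConsE)
  let ?n = "length vs"
  let ?c = "\<lambda>a b. sg (ds' ! a * ds' ! b)"
  have 1: "split_term ds (v # vs) (inside (insert 0 (Suc ` J)) (Suc ?n)) (outside (insert 0 (Suc ` J)) (Suc ?n)) =
      inv_factor ?c (inside J ?n @ outside J ?n) *\<^sub>R
      ((v \<rhd> sprod (map ((!) vs) (inside J ?n))) \<otimes>\<^sub>\<real> sprod (map ((!) vs) (outside J ?n)))" for J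
  proof -
    have "inside (insert 0 (Suc ` J)) (Suc ?n) = 0 # map Suc (inside J ?n)"
      "outside (insert 0 (Suc ` J)) (Suc ?n) = map Suc (outside J ?n)"
      unfolding filter_upt_shift by (simp_all add: inj_image_mem_iff)
    moreover have "inv_factor (\<lambda>a b. sg (ds ! a * ds ! b)) (0 # map Suc (inside J ?n @ outside J ?n)) =
        inv_factor ?c (inside J ?n @ outside J ?n)"
      by (simp only: inv_factor.simps inv_factor_map_Suc) (simp add: ds)
    ultimately show ?thesis
      by (simp add: split_term_def vcons_sprod o_def)
  qed
  have 2: "split_term ds (v # vs) (inside (Suc ` J) (Suc ?n)) (outside (Suc ` J) (Suc ?n)) =
      inv_factor ?c (inside J ?n @ outside J ?n) *\<^sub>R
      (kp d (sprod (map ((!) vs) (inside J ?n))) \<otimes>\<^sub>\<real> (v \<rhd> sprod (map ((!) vs) (outside J ?n))))" for J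
  proof -
    let ?A = "inside J ?n" and ?B = "outside J ?n"
    have io: "inside (Suc ` J) (Suc ?n) = map Suc ?A" "outside (Suc ` J) (Suc ?n) = 0 # map Suc ?B"
      unfolding filter_upt_shift by (auto simp add: inj_image_mem_iff)
    have "inv_factor (\<lambda>a b. sg (ds ! a * ds ! b)) (map Suc ?A @ 0 # map Suc ?B) =
        (\<Prod>a\<in>set (map Suc ?A). sg (ds ! a * ds ! 0)) * inv_factor (\<lambda>a b. sg (ds ! a * ds ! b)) (map Suc (?A @ ?B))"
      by (subst inv_factor_zero) (auto simp: distinct_map)
    also have "inv_factor (\<lambda>a b. sg (ds ! a * ds ! b)) (map Suc (?A @ ?B)) = inv_factor ?c (?A @ ?B)"
      unfolding inv_factor_map_Suc by (simp add: ds)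
    also have "(\<Prod>a\<in>set (map Suc ?A). sg (ds ! a * ds ! 0)) = sg (d * sum_list (map ((!) ds') ?A))"
    proof -
      have *: "(\<Prod>a\<in>set (map Suc A). sg (ds ! a * ds ! 0)) = sg (d * sum_list (map ((!) ds') A))" if "distinct A" for A
        using that
      proof (induction A)
        case (Cons a A)
        have "Suc a \<notin> set (map Suc A)" using Cons.prems by auto
        with Cons show ?case by (simp add: ds distrib_left sg_add mult.commute)
      qed simp
      show ?thesis by (rule *) simp
    qed
    also have "kp d (sprod (map ((!) vs) ?A)) = sg (d * sum_list (map ((!) ds') ?A)) *\<^sub>R sprod (map ((!) vs) ?A)"
      by (rule kp_gr, rule sprod_gr, rule homs_map_nth[OF ds(3)]) auto
    ultimately show ?thesis
      unfolding split_term_def io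
      by (simp add: vcons_sprod o_def bilinear_lmul[OF bilinear_tensor] mult.commute)
  qed
  have "cop (sprod (v # vs)) = cop_step v (cop (sprod vs))" by (simp add: cop_sprod)
  also have "\<dots> = (\<Sum>J\<in>Pow {..<?n}. inv_factor ?c (inside J ?n @ outside J ?n) *\<^sub>R
      ((v \<rhd> sprod (map ((!) vs) (inside J ?n))) \<otimes>\<^sub>\<real> sprod (map ((!) vs) (outside J ?n))))
      + (\<Sum>J\<in>Pow {..<?n}. inv_factor ?c (inside J ?n @ outside J ?n) *\<^sub>R
      (kp d (sprod (map ((!) vs) (inside J ?n))) \<otimes>\<^sub>\<real> (v \<rhd> sprod (map ((!) vs) (outside J ?n)))))"
    unfolding Cons.IH[OF ds(3)]
    by (simp add: split_term_def linear_sum[OF linear_cop_step] linear_scale[OF linear_cop_step]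
        cop_step_tensor[OF ds(2)] scaleR_add_right sum.distrib)
  also have "\<dots> = (\<Sum>I\<in>(\<lambda>J. insert 0 (Suc ` J)) ` Pow {..<?n}. split_term ds (v # vs) (inside I (Suc ?n)) (outside I (Suc ?n)))
      + (\<Sum>I\<in>(\<lambda>J. Suc ` J) ` Pow {..<?n}. split_term ds (v # vs) (inside I (Suc ?n)) (outside I (Suc ?n)))"
  proof -
    have "inj_on (\<lambda>J. insert 0 (Suc ` J)) (Pow {..<?n})"
    proof (rule inj_onI)
      fix J J' :: "nat set" assume "insert 0 (Suc ` J) = insert 0 (Suc ` J')"
      then have "insert 0 (Suc ` J) - {0} = insert 0 (Suc ` J') - {0}" by simp
      then show "J = J'" by (simp add: inj_image_eq_iff)
    qed
    moreover have "inj_on (\<lambda>J. Suc ` J) (Pow {..<?n})"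
      by (rule inj_onI) (simp add: inj_image_eq_iff)
    ultimately show ?thesis by (simp only: sum.reindex o_def 1 2)
  qed
  also have "\<dots> = (\<Sum>I\<in>Pow {..<Suc ?n}. split_term ds (v # vs) (inside I (Suc ?n)) (outside I (Suc ?n)))"
    unfolding Pow_lessThan_Suc_shift by (rule sum.union_disjoint[symmetric]) auto
  finally show ?case by simp
qed

lemma coprod_eq_cop: "(coprod :: 'a::koszul_grading sym \<Rightarrow> _) = cop"
proof -
  let ?Q = "\<lambda>D :: 'a sym \<Rightarrow> _. linear D \<and> (\<forall>ds vs. homs ds vs \<longrightarrow>
     D (sprod vs) = (\<Sum>k\<le>length vs. \<Sum>\<sigma>\<in>Sh k (length vs).
       koszul \<sigma> ds *\<^sub>R
         (sprod (take k (permute_list \<sigma> vs)) \<otimes>\<^sub>\<real> sprod (drop k (permute_list \<sigma> vs)))))"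
  have "?Q cop"
  proof (intro conjI allI impI linear_cop)
    fix ds and vs :: "'a list" assume h: "homs ds vs"
    let ?n = "length vs"
    have "koszul \<sigma> ds *\<^sub>R (sprod (take k (permute_list \<sigma> vs)) \<otimes>\<^sub>\<real> sprod (drop k (permute_list \<sigma> vs))) =
        split_term ds vs (map \<sigma> [0..<k]) (map \<sigma> [k..<?n])" if "k \<le> ?n" "\<sigma> \<in> Sh k ?n" for k \<sigma>
    proof -
      have "[0..<?n] = [0..<k] @ [k..<?n]" using that(1)
        by (metis le0 le_add_diff_inverse upt_add_eq_append)
      then have "map \<sigma> [0..<k] @ map \<sigma> [k..<?n] = map \<sigma> [0..<?n]" by simp
      moreover have "\<sigma> permutes {..<length ds}" using that(2) h by (simp add: Sh_def homs_length)
      ultimately show ?thesis using that(1)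
        by (simp add: split_term_def koszul_inv_factor homs_length[OF h] permute_list_def take_map drop_map
            o_def take_upt)
    qed
    then have "(\<Sum>k\<le>?n. \<Sum>\<sigma>\<in>Sh k ?n. koszul \<sigma> ds *\<^sub>R
        (sprod (take k (permute_list \<sigma> vs)) \<otimes>\<^sub>\<real> sprod (drop k (permute_list \<sigma> vs)))) =
      (\<Sum>k\<le>?n. \<Sum>\<sigma>\<in>Sh k ?n. split_term ds vs (map \<sigma> [0..<k]) (map \<sigma> [k..<?n]))"
      by (intro sum.cong refl) auto
    then show "cop (sprod vs) = (\<Sum>k\<le>?n. \<Sum>\<sigma>\<in>Sh k ?n. koszul \<sigma> ds *\<^sub>R
        (sprod (take k (permute_list \<sigma> vs)) \<otimes>\<^sub>\<real> sprod (drop k (permute_list \<sigma> vs))))"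
      by (simp only: Sh_sum cop_subsets[OF h])
  qed
  moreover have "D = cop" if "?Q D" for D
    using that \<open>?Q cop\<close> by (intro sym_hom_ext) auto
  ultimately show ?thesis unfolding coprod_def by (rule the_equality)
qed

lemma linear_coprod: "linear (coprod :: 'a::koszul_grading sym \<Rightarrow> _)"
  by (simp add: coprod_eq_cop linear_cop)

lemma coprod_one: "coprod (sprod []) = sprod [] \<otimes>\<^sub>\<real> (sprod [] :: 'a::koszul_grading sym)"
  by (simp add: coprod_eq_cop cop_sprod)

lemma coprod_vcons: "coprod (v \<rhd> x) = cop_step v (coprod x)"
proof -
  have "(\<lambda>x. coprod (v \<rhd> x)) = (\<lambda>x. cop_step v (coprod x))"
    unfolding coprod_eq_cop
    by (intro sym_hom_ext linear_app[OF linear_cop] linear_app[OF linear_cop_step] linear_rules linear_cop)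
      (simp add: vcons_sprod cop_sprod)
  then show ?thesis by meson
qed


section \<open>Sweedler calculus\<close>

text \<open>In Sweedler notation, \<open>sw b z\<close> is the sum of the \<open>b z' z''\<close>.\<close>

definition sw :: "('a::koszul_grading sym \<Rightarrow> 'a sym \<Rightarrow> 'c::real_vector) \<Rightarrow> 'a sym \<Rightarrow> 'c" where
  "sw b z = tensor_lift b (coprod z)"

lemma linear_sw_arg: "bilinear b \<Longrightarrow> linear (sw b)"
  unfolding sw_def[abs_def] by (intro linear_app[OF linear_tensor_lift] linear_coprod)

lemma linear_sw_param: "(\<And>u. bilinear (b u)) \<Longrightarrow> (\<And>x y. linear (\<lambda>u. b u x y)) \<Longrightarrow> linear (\<lambda>u. sw (b u) z)"
  unfolding sw_def by (rule linear_tensor_lift_param)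

lemma linear_sw [linear_rules]: "bilinear b \<Longrightarrow> linear f \<Longrightarrow> linear (\<lambda>u. sw b (f u))"
  by (rule linear_app[OF linear_sw_arg])

lemma sw_linear: "bilinear b \<Longrightarrow> linear h \<Longrightarrow> h (sw b z) = sw (\<lambda>x y. h (b x y)) z"
  unfolding sw_def
  by (rule tensor_lift_eqI[symmetric]) (simp_all add: linear_app linear_tensor_lift tensor_lift_tensor)

lemma sw_cong: "(\<And>x y. b x y = b' x y) \<Longrightarrow> sw b z = sw b' z"
  by (metis ext)

lemma sw_one: "bilinear b \<Longrightarrow> sw b (sprod []) = b (sprod []) (sprod [])"
  by (simp add: sw_def coprod_one tensor_lift_tensor)

lemma sw_add: "bilinear b \<Longrightarrow> bilinear b' \<Longrightarrow> sw (\<lambda>x y. b x y + b' x y) z = sw b z + sw b' z"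
  unfolding sw_def
  by (rule tensor_lift_eqI) (simp_all add: linear_compose_add linear_tensor_lift tensor_lift_tensor)

lemma sw_diff: "bilinear b \<Longrightarrow> bilinear b' \<Longrightarrow> sw (\<lambda>x y. b x y - b' x y) z = sw b z - sw b' z"
  unfolding sw_def
  by (rule tensor_lift_eqI) (simp_all add: linear_compose_sub linear_tensor_lift tensor_lift_tensor)

lemma sw_scale: "bilinear b \<Longrightarrow> sw (\<lambda>x y. c *\<^sub>R b x y) z = c *\<^sub>R sw b z"
  by (rule sw_linear[symmetric]) (simp_all add: linear_scaleR)

lemma sw_zero: "sw (\<lambda>x y. 0) z = 0"
  unfolding sw_def by (rule tensor_lift_eqI) (simp_all add: linear_zero)

lemma sw_sum:
  "(\<And>i. i \<in> A \<Longrightarrow> bilinear (b i)) \<Longrightarrow> sw (\<lambda>x y. \<Sum>i\<in>A. b i x y) z = (\<Sum>i\<in>A. sw (b i) z)"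
  unfolding sw_def
  by (rule tensor_lift_eqI) (simp_all add: linear_compose_sum linear_tensor_lift tensor_lift_tensor)

lemma bilinear_hom_eqI:
  fixes b :: "'a::koszul_grading \<Rightarrow> 'd::koszul_grading \<Rightarrow> 'c::real_vector"
  assumes b: "bilinear b" "bilinear b'" and eq: "\<And>i j x y. x \<in> gr i \<Longrightarrow> y \<in> gr j \<Longrightarrow> b x y = b' x y"
  shows "b = b'"
proof -
  have "b x = b' x" if "x \<in> gr i" for x i
    by (rule hom_ext) (use b eq[OF that] in \<open>auto simp: bilinear_def\<close>)
  then have "(\<lambda>x. b x y) = (\<lambda>x. b' x y)" for y
    by (intro hom_ext) (use b in \<open>auto simp: bilinear_def\<close>)
  then show ?thesis by (metis ext)
qed

lemma sw_hom_cong: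
  assumes "bilinear b" "bilinear b'" "\<And>i j x y. x \<in> gr i \<Longrightarrow> y \<in> gr j \<Longrightarrow> b x y = b' x y"
  shows "sw b z = sw b' z"
  using bilinear_hom_eqI[OF assms] by simp

lemma sw_vcons:
  assumes b: "bilinear b" and v: "v \<in> gr i"
  shows "sw b (v \<rhd> z) = sw (\<lambda>x y. b (v \<rhd> x) y + b (kp i x) (v \<rhd> y)) z"
  unfolding sw_def coprod_vcons
proof (rule tensor_lift_eqI[symmetric])
  show "linear (\<lambda>t. tensor_lift b (cop_step v t))"
    by (intro linear_app[OF linear_tensor_lift[OF b]] linear_cop_step)
  show "tensor_lift b (cop_step v (x \<otimes>\<^sub>\<real> y)) = b (v \<rhd> x) y + b (kp i x) (v \<rhd> y)" for x y
    by (simp add: cop_step_tensor[OF v] linear_add[OF linear_tensor_lift[OF b]] tensor_lift_tensor[OF b])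
qed

text \<open>\<open>kp r\<close> is a coalgebra automorphism. The induction is over all
  \<open>b\<close> at once, because the recursion for the coproduct changes
  \<open>b\<close>.\<close>

lemma sw_kp:
  fixes b :: "'a::koszul_grading sym \<Rightarrow> 'a sym \<Rightarrow> 'b::real_vector"
  assumes b: "bilinear b"
  shows "sw b (kp r z) = sw (\<lambda>x y. b (kp r x) (kp r y)) z"
proof -
  have "\<forall>b :: 'a sym \<Rightarrow> 'a sym \<Rightarrow> 'b. bilinear b \<longrightarrow> sw b (kp r z) = sw (\<lambda>x y. b (kp r x) (kp r y)) z"
  proof (induction z rule: sym_induct)
    case one
    show ?case
    proof (intro allI impI)
      fix b :: "'a sym \<Rightarrow> 'a sym \<Rightarrow> 'b" assume b: "bilinear b"
      have "bilinear (\<lambda>x y. b (kp r x) (kp r y))"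
        by (intro bilinearI linear_rules bilinear_left[OF b] bilinear_right[OF b])
      with b show "sw b (kp r (sprod [])) = sw (\<lambda>x y. b (kp r x) (kp r y)) (sprod [])"
        by (simp add: sw_one)
    qed
  next
    case (vcons i v z)
    show ?case
    proof (intro allI impI)
      fix b :: "'a sym \<Rightarrow> 'a sym \<Rightarrow> 'b" assume b: "bilinear b"
      note l = bilinearI linear_rules bilinear_left[OF b] bilinear_right[OF b]
      have "sw b (kp r (v \<rhd> z)) = sw (\<lambda>x y. b (kp r v \<rhd> x) y + b (kp i x) (kp r v \<rhd> y)) (kp r z)"
        unfolding kp_vcons by (rule sw_vcons[OF b kp_mem_gr[OF vcons(1)]])
      also have "\<dots> = sw (\<lambda>x y. b (kp r v \<rhd> kp r x) (kp r y) + b (kp i (kp r x)) (kp r v \<rhd> kp r y)) z"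
        by (rule vcons(2)[rule_format]) (intro l)
      also have "\<dots> = sw (\<lambda>x y. b (kp r x) (kp r y)) (v \<rhd> z)"
        by (subst sw_vcons[OF _ vcons(1)]) (auto intro!: l simp: kp_vcons kp_kp add.commute)
      finally show "sw b (kp r (v \<rhd> z)) = sw (\<lambda>x y. b (kp r x) (kp r y)) (v \<rhd> z)" .
    qed
  next
    case (add x y)
    show ?case
    proof (intro allI impI)
      fix b :: "'a sym \<Rightarrow> 'a sym \<Rightarrow> 'b" assume b: "bilinear b"
      have b': "bilinear (\<lambda>x y. b (kp r x) (kp r y))"
        by (intro bilinearI linear_rules bilinear_left[OF b] bilinear_right[OF b])
      show "sw b (kp r (x + y)) = sw (\<lambda>x y. b (kp r x) (kp r y)) (x + y)"
        using add b by (simp add: linear_add[OF linear_kp] linear_add[OF linear_sw_arg[OF b]]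
            linear_add[OF linear_sw_arg[OF b']])
    qed
  next
    case (scale c x)
    show ?case
    proof (intro allI impI)
      fix b :: "'a sym \<Rightarrow> 'a sym \<Rightarrow> 'b" assume b: "bilinear b"
      have b': "bilinear (\<lambda>x y. b (kp r x) (kp r y))"
        by (intro bilinearI linear_rules bilinear_left[OF b] bilinear_right[OF b])
      show "sw b (kp r (c *\<^sub>R x)) = sw (\<lambda>x y. b (kp r x) (kp r y)) (c *\<^sub>R x)"
        using scale b by (simp add: linear_scale[OF linear_kp] linear_scale[OF linear_sw_arg[OF b]]
            linear_scale[OF linear_sw_arg[OF b']])
    qed
  qed
  then show ?thesis using b by blast
qed

definition trilinear :: "('a::real_vector \<Rightarrow> 'b::real_vector \<Rightarrow> 'c::real_vector \<Rightarrow> 'd::real_vector) \<Rightarrow> bool" where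
  "trilinear t \<longleftrightarrow> (\<forall>y z. linear (\<lambda>x. t x y z)) \<and> (\<forall>x z. linear (\<lambda>y. t x y z)) \<and> (\<forall>x y. linear (\<lambda>z. t x y z))"

lemma trilinearI:
  "(\<And>y z. linear (\<lambda>x. t x y z)) \<Longrightarrow> (\<And>x z. linear (\<lambda>y. t x y z)) \<Longrightarrow> (\<And>x y. linear (\<lambda>z. t x y z)) \<Longrightarrow> trilinear t"
  by (simp add: trilinear_def)

lemma trilinearD:
  assumes "trilinear t"
  shows "linear f \<Longrightarrow> linear (\<lambda>u. t (f u) y z)" "linear f \<Longrightarrow> linear (\<lambda>u. t x (f u) z)"
    "linear f \<Longrightarrow> linear (\<lambda>u. t x y (f u))"
  using assms linear_app[of "\<lambda>x. t x y z" f] linear_app[of "\<lambda>y. t x y z" f] linear_app[of "\<lambda>z. t x y z" f]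
  by (simp_all add: trilinear_def)

text \<open>Coassociativity. Both iterated coproducts of a product with v lead to the same new
  trilinear map, to which the induction hypothesis applies.\<close>

lemma sw_assoc:
  fixes t :: "'a::koszul_grading sym \<Rightarrow> 'a sym \<Rightarrow> 'a sym \<Rightarrow> 'b::real_vector"
  assumes t: "trilinear t"
  shows "sw (\<lambda>x y. sw (\<lambda>y1 y2. t x y1 y2) y) z = sw (\<lambda>x y. sw (\<lambda>x1 x2. t x1 x2 y) x) z"
proof -
  have "\<forall>t :: 'a sym \<Rightarrow> 'a sym \<Rightarrow> 'a sym \<Rightarrow> 'b. trilinear t \<longrightarrow> sw (\<lambda>x y. sw (\<lambda>y1 y2. t x y1 y2) y) z = sw (\<lambda>x y. sw (\<lambda>x1 x2. t x1 x2 y) x) z"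
  proof (induction z rule: sym_induct)
    case one
    show ?case
    proof (intro allI impI)
      fix t :: "'a sym \<Rightarrow> 'a sym \<Rightarrow> 'a sym \<Rightarrow> 'b" assume t: "trilinear t"
      have "sw (\<lambda>x y. sw (\<lambda>y1 y2. t x y1 y2) y) (sprod []) = t (sprod []) (sprod []) (sprod [])"
        by (subst sw_one, (intro bilinearI linear_rules linear_sw_param trilinearD[OF t])[1],
            subst sw_one, (intro bilinearI linear_rules trilinearD[OF t])[1], rule refl)
      moreover have "sw (\<lambda>x y. sw (\<lambda>x1 x2. t x1 x2 y) x) (sprod []) = t (sprod []) (sprod []) (sprod [])"
        by (subst sw_one, (intro bilinearI linear_rules linear_sw_param trilinearD[OF t])[1],
            subst sw_one, (intro bilinearI linear_rules trilinearD[OF t])[1], rule refl)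
      ultimately show "sw (\<lambda>x y. sw (\<lambda>y1 y2. t x y1 y2) y) (sprod []) =
          sw (\<lambda>x y. sw (\<lambda>x1 x2. t x1 x2 y) x) (sprod [])" by simp
    qed
  next
    case (vcons i v z)
    show ?case
    proof (intro allI impI)
      fix t :: "'a sym \<Rightarrow> 'a sym \<Rightarrow> 'a sym \<Rightarrow> 'b" assume t: "trilinear t"
      note l = bilinearI linear_rules linear_sw_param trilinearD[OF t]
      \<comment> \<open>The vector v goes to one of three factors, and \<open>kp i\<close> records
        the factors that it passes.\<close>
      let ?t = "\<lambda>x y w. t (v \<rhd> x) y w + t (kp i x) (v \<rhd> y) w + t (kp i x) (kp i y) (v \<rhd> w)"
      have "sw (\<lambda>x y. sw (\<lambda>y1 y2. t x y1 y2) y) (v \<rhd> z) =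
          sw (\<lambda>x y. sw (\<lambda>y1 y2. t (v \<rhd> x) y1 y2) y + sw (\<lambda>y1 y2. t (kp i x) y1 y2) (v \<rhd> y)) z"
        by (rule sw_vcons[OF _ vcons(1)]) (intro l)
      also have "\<dots> = sw (\<lambda>x y. sw (\<lambda>y1 y2. ?t x y1 y2) y) z"
      proof (rule sw_cong)
        fix x y
        have "sw (\<lambda>y1 y2. t (kp i x) y1 y2) (v \<rhd> y) =
            sw (\<lambda>y1 y2. t (kp i x) (v \<rhd> y1) y2 + t (kp i x) (kp i y1) (v \<rhd> y2)) y"
          by (rule sw_vcons[OF _ vcons(1)]) (intro l)
        moreover have "sw (\<lambda>y1 y2. ?t x y1 y2) y = sw (\<lambda>y1 y2. t (v \<rhd> x) y1 y2) y +
            sw (\<lambda>y1 y2. t (kp i x) (v \<rhd> y1) y2 + t (kp i x) (kp i y1) (v \<rhd> y2)) y"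
          unfolding add.assoc by (rule sw_add) (intro l)+
        ultimately show "sw (\<lambda>y1 y2. t (v \<rhd> x) y1 y2) y + sw (\<lambda>y1 y2. t (kp i x) y1 y2) (v \<rhd> y) =
            sw (\<lambda>y1 y2. ?t x y1 y2) y" by simp
      qed
      also have "\<dots> = sw (\<lambda>x y. sw (\<lambda>x1 x2. ?t x1 x2 y) x) z"
        by (rule vcons(2)[rule_format]) (intro trilinearI l)
      also have "\<dots> = sw (\<lambda>x y. sw (\<lambda>x1 x2. t x1 x2 y) (v \<rhd> x) + sw (\<lambda>x1 x2. t x1 x2 (v \<rhd> y)) (kp i x)) z"
      proof (rule sw_cong)
        fix x y
        have "sw (\<lambda>x1 x2. t x1 x2 y) (v \<rhd> x) = sw (\<lambda>x1 x2. t (v \<rhd> x1) x2 y + t (kp i x1) (v \<rhd> x2) y) x"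
          by (rule sw_vcons[OF _ vcons(1)]) (intro l)
        moreover have "sw (\<lambda>x1 x2. t x1 x2 (v \<rhd> y)) (kp i x) = sw (\<lambda>x1 x2. t (kp i x1) (kp i x2) (v \<rhd> y)) x"
          by (rule sw_kp) (intro l)
        moreover have "sw (\<lambda>x1 x2. ?t x1 x2 y) x = sw (\<lambda>x1 x2. t (v \<rhd> x1) x2 y + t (kp i x1) (v \<rhd> x2) y) x +
            sw (\<lambda>x1 x2. t (kp i x1) (kp i x2) (v \<rhd> y)) x"
          by (rule sw_add) (intro l)+
        ultimately show "sw (\<lambda>x1 x2. ?t x1 x2 y) x =
            sw (\<lambda>x1 x2. t x1 x2 y) (v \<rhd> x) + sw (\<lambda>x1 x2. t x1 x2 (v \<rhd> y)) (kp i x)" by simp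
      qed
      also have "\<dots> = sw (\<lambda>x y. sw (\<lambda>x1 x2. t x1 x2 y) x) (v \<rhd> z)"
        by (rule sw_vcons[OF _ vcons(1), symmetric]) (intro l)
      finally show "sw (\<lambda>x y. sw (\<lambda>y1 y2. t x y1 y2) y) (v \<rhd> z) =
          sw (\<lambda>x y. sw (\<lambda>x1 x2. t x1 x2 y) x) (v \<rhd> z)" .
    qed
  next
    case (add x y)
    have "bilinear (\<lambda>x y. sw (\<lambda>y1 y2. t x y1 y2) y)" "bilinear (\<lambda>x y. sw (\<lambda>x1 x2. t x1 x2 y) x)"
      if "trilinear t" for t :: "'a sym \<Rightarrow> 'a sym \<Rightarrow> 'a sym \<Rightarrow> 'b"
      by (intro bilinearI linear_rules linear_sw_param trilinearD[OF that])+
    then show ?case using add by (simp add: linear_add[OF linear_sw_arg])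
  next
    case (scale c x)
    have "bilinear (\<lambda>x y. sw (\<lambda>y1 y2. t x y1 y2) y)" "bilinear (\<lambda>x y. sw (\<lambda>x1 x2. t x1 x2 y) x)"
      if "trilinear t" for t :: "'a sym \<Rightarrow> 'a sym \<Rightarrow> 'a sym \<Rightarrow> 'b"
      by (intro bilinearI linear_rules linear_sw_param trilinearD[OF that])+
    then show ?case using scale by (simp add: linear_scale[OF linear_sw_arg])
  qed
  then show ?thesis using t by blast
qed

text \<open>Graded cocommutativity. It is stated for a pair of forms that differ by a signed
  exchange, so that no flip map on the tensor product is needed.\<close>

lemma sw_comm:
  fixes b b' :: "'a::koszul_grading sym \<Rightarrow> 'a sym \<Rightarrow> 'b::real_vector"
  assumes b: "bilinear b" "bilinear b'"
    and eq: "\<And>i j x y. x \<in> gr i \<Longrightarrow> y \<in> gr j \<Longrightarrow> b' y x = sg (i * j) *\<^sub>R b x y"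
  shows "sw b z = sw b' z"
proof -
  have "\<forall>b b' :: 'a sym \<Rightarrow> 'a sym \<Rightarrow> 'b. bilinear b \<longrightarrow> bilinear b' \<longrightarrow>
      (\<forall>i j x y. x \<in> gr i \<longrightarrow> y \<in> gr j \<longrightarrow> b' y x = sg (i * j) *\<^sub>R b x y) \<longrightarrow> sw b z = sw b' z"
  proof (induction z rule: sym_induct)
    case one
    show ?case using one_gr by (auto simp: sw_one) fastforce
  next
    case (vcons i v z)
    show ?case
    proof (intro allI impI)
      fix b b' :: "'a sym \<Rightarrow> 'a sym \<Rightarrow> 'b" assume b: "bilinear b" "bilinear b'"
        and eq: "\<forall>i j x y. x \<in> gr i \<longrightarrow> y \<in> gr j \<longrightarrow> b' y x = sg (i * j) *\<^sub>R b x y"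
      note l = bilinearI linear_rules bilinear_left[OF b(1)] bilinear_right[OF b(1)]
        bilinear_left[OF b(2)] bilinear_right[OF b(2)]
      have "sw b (v \<rhd> z) = sw (\<lambda>x y. b (v \<rhd> x) y + b (kp i x) (v \<rhd> y)) z"
        by (rule sw_vcons[OF b(1) vcons(1)])
      also have "\<dots> = sw (\<lambda>x y. b' (v \<rhd> x) y + b' (kp i x) (v \<rhd> y)) z"
      proof (rule vcons(2)[THEN spec, THEN spec, THEN mp, THEN mp, THEN mp], goal_cases)
        case 3
        show ?case
        proof (intro allI impI)
        fix m n and x y :: "'a sym" assume x: "x \<in> gr m" and y: "y \<in> gr n"
        have e: "b' q p = sg (c * d) *\<^sub>R b p q" if "p \<in> gr c" "q \<in> gr d" for c d p q
          using eq that by blast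
        show "b' (v \<rhd> y) x + b' (kp i y) (v \<rhd> x) = sg (m * n) *\<^sub>R (b (v \<rhd> x) y + b (kp i x) (v \<rhd> y))"
          using e[OF x vcons_gr[OF vcons(1) y]] e[OF vcons_gr[OF vcons(1) x] y]
          by (auto simp: kp_gr[OF x] kp_gr[OF y] bilinear_lmul[OF b(1)] bilinear_lmul[OF b(2)]
              scaleR_add_right sg_def)
        qed
      qed (intro l)+
      also have "\<dots> = sw b' (v \<rhd> z)"
        by (rule sw_vcons[OF b(2) vcons(1), symmetric])
      finally show "sw b (v \<rhd> z) = sw b' (v \<rhd> z)" .
    qed
  next
    case (add x y)
    have "sw b (x + y) = sw b' (x + y)" if b: "bilinear b" "bilinear b'"
      "\<forall>i j x y. x \<in> gr i \<longrightarrow> y \<in> gr j \<longrightarrow> b' y x = sg (i * j) *\<^sub>R b x y" for b b' :: "'a sym \<Rightarrow> 'a sym \<Rightarrow> 'b"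
      using add(1)[rule_format, OF b(1,2) b(3)[rule_format]] add(2)[rule_format, OF b(1,2) b(3)[rule_format]]
      by (simp add: linear_add[OF linear_sw_arg[OF b(1)]] linear_add[OF linear_sw_arg[OF b(2)]])
    then show ?case by blast
  next
    case (scale c x)
    have "sw b (c *\<^sub>R x) = sw b' (c *\<^sub>R x)" if b: "bilinear b" "bilinear b'"
      "\<forall>i j x y. x \<in> gr i \<longrightarrow> y \<in> gr j \<longrightarrow> b' y x = sg (i * j) *\<^sub>R b x y" for b b' :: "'a sym \<Rightarrow> 'a sym \<Rightarrow> 'b"
      using scale[rule_format, OF b(1,2) b(3)[rule_format]]
      by (simp add: linear_scale[OF linear_sw_arg[OF b(1)]] linear_scale[OF linear_sw_arg[OF b(2)]])
    then show ?case by blast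
  qed
  then show ?thesis using assms by blast
qed

lemma linear_eps_app [linear_rules]: "linear f \<Longrightarrow> linear (\<lambda>u. eps (f u))"
  by (rule linear_app[OF linear_eps])

lemma eps_kp [simp]: "eps (kp r x) = eps x" for x :: "'a::koszul_grading sym"
proof -
  have "(\<lambda>x :: 'a sym. eps (kp r x)) = (eps :: 'a sym \<Rightarrow> real)"
  proof (rule hom_ext)
    show "eps (kp r v) = eps v" if "v \<in> gr n" for n and v :: "'a sym"
      using eps_gr[OF that] by (cases "n = 0") (simp_all add: kp_gr[OF that] linear_scale[OF linear_eps])
  qed (intro linear_rules linear_eps)+
  then show ?thesis by (rule fun_cong)
qed

lemma sw_counit_left:
  fixes g :: "'a::koszul_grading sym \<Rightarrow> 'b::real_vector"
  shows "linear g \<Longrightarrow> sw (\<lambda>x y. eps x *\<^sub>R g y) z = g z"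
proof (induction z arbitrary: g rule: sym_induct)
    case one
    then show ?case by (subst sw_one) (auto intro!: bilinearI linear_rules)
  next
    case (vcons i v x)
    have "sw (\<lambda>x y. eps x *\<^sub>R g y) (v \<rhd> x) = sw (\<lambda>x y. eps x *\<^sub>R g (v \<rhd> y)) x"
      by (subst sw_vcons[OF _ vcons(1)]) (auto intro!: bilinearI linear_rules vcons.prems)
    also have "\<dots> = g (v \<rhd> x)"
      by (rule vcons.IH) (intro linear_app[OF vcons.prems] linear_rules)
    finally show ?case .
  next
    case (add x y)
    have "bilinear (\<lambda>(x :: 'a sym) y. eps x *\<^sub>R g y)" by (intro bilinearI linear_rules add.prems)
    then show ?case using add by (simp add: linear_add[OF linear_sw_arg] linear_add[OF add.prems])
  next
    case (scale c x)
    have "bilinear (\<lambda>(x :: 'a sym) y. eps x *\<^sub>R g y)" by (intro bilinearI linear_rules scale.prems)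
    then show ?case using scale by (simp add: linear_scale[OF linear_sw_arg] linear_scale[OF scale.prems])
qed

text \<open>By cocommutativity from the left counit law: \<open>eps y\<close> vanishes unless y has
  degree 0, and then the sign is 1.\<close>

lemma sw_counit_right:
  assumes g: "linear g"
  shows "sw (\<lambda>x y. eps y *\<^sub>R g x) z = g z"
proof -
  have "sw (\<lambda>x y. eps y *\<^sub>R g x) z = sw (\<lambda>x y. eps x *\<^sub>R g y) z"
  proof (rule sw_comm)
    show "eps y *\<^sub>R g x = sg (i * j) *\<^sub>R (eps y *\<^sub>R g x)" if "x \<in> gr i" "y \<in> gr j" for i j x y
      using eps_gr[OF that(2)] by (cases "j = 0") simp_all
  qed (intro bilinearI linear_rules g)+
  then show ?thesis by (simp add: sw_counit_left[OF g])
qed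

text \<open>The coproduct preserves the total degree. The target is an arbitrary subspace, so that
  the degrees of \<open>ext\<close> are covered too.\<close>

lemma sw_gr:
  fixes b :: "'a::koszul_grading sym \<Rightarrow> 'a sym \<Rightarrow> 'b::real_vector"
  assumes z: "z \<in> gr n" and b: "bilinear b" and S: "subspace S"
    and mem: "\<And>i j x y. x \<in> gr i \<Longrightarrow> y \<in> gr j \<Longrightarrow> i + j = n \<Longrightarrow> b x y \<in> S"
  shows "sw b z \<in> S"
proof -
  have "\<forall>b :: 'a sym \<Rightarrow> 'a sym \<Rightarrow> 'b. bilinear b \<longrightarrow> (\<forall>i j x y. x \<in> gr i \<longrightarrow> y \<in> gr j \<longrightarrow> i + j = n \<longrightarrow> b x y \<in> S) \<longrightarrow> sw b z \<in> S"
    using z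
  proof (induction rule: sym_gr_induct)
    case one
    show ?case using one_gr by (metis add_0 sw_one)
  next
    case (vcons i v n x)
    show ?case
    proof (intro allI impI)
      fix b :: "'a sym \<Rightarrow> 'a sym \<Rightarrow> 'b" assume b: "bilinear b"
        and mem: "\<forall>j k x y. x \<in> gr j \<longrightarrow> y \<in> gr k \<longrightarrow> j + k = i + n \<longrightarrow> b x y \<in> S"
      have "sw (\<lambda>x y. b (v \<rhd> x) y + b (kp i x) (v \<rhd> y)) x \<in> S"
      proof (rule vcons(3)[rule_format])
        show "bilinear (\<lambda>x y. b (v \<rhd> x) y + b (kp i x) (v \<rhd> y))"
          by (intro bilinearI linear_rules bilinear_left[OF b] bilinear_right[OF b])
        fix j k and x y :: "'a sym" assume xy: "x \<in> gr j" "y \<in> gr k" "j + k = n"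
        show "b (v \<rhd> x) y + b (kp i x) (v \<rhd> y) \<in> S"
          using mem[rule_format, OF vcons_gr[OF vcons(1) xy(1)] xy(2)]
            mem[rule_format, OF kp_mem_gr[OF xy(1)] vcons_gr[OF vcons(1) xy(2)]] xy(3)
          by (intro subspace_add[OF S]) simp_all
      qed
      then show "sw b (v \<rhd> x) \<in> S" by (simp add: sw_vcons[OF b vcons(1)])
    qed
  next
    case (add n x y)
    then show ?case by (auto simp: linear_add[OF linear_sw_arg] intro!: subspace_add[OF S])
  next
    case (scale c n x)
    then show ?case by (auto simp: linear_scale[OF linear_sw_arg] intro!: subspace_scale[OF S])
  next
    case zero
    show ?case by (auto simp: linear_0[OF linear_sw_arg] subspace_0[OF S])
  qed
  then show ?thesis using b mem by blast
qed


subsection \<open>Tensor products of maps, coderivations and coalgebra morphisms\<close>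

text \<open>The Koszul sign becomes precomposition with \<open>kp q\<close>, which turns the
  condition on homogeneous vectors into a bilinear formula.\<close>

lemma tensor_map_eq:
  fixes f :: "'a::koszul_grading \<Rightarrow> 'c::real_vector" and g :: "'b::real_vector \<Rightarrow> 'd::real_vector"
  assumes f: "linear f" and g: "linear g"
  shows "tensor_map q f g = tensor_lift (\<lambda>v w. f (kp q v) \<otimes>\<^sub>\<real> g w)"
proof -
  let ?L = "tensor_lift (\<lambda>v w. f (kp q v) \<otimes>\<^sub>\<real> g w)"
  have b: "bilinear (\<lambda>v w. f (kp q v) \<otimes>\<^sub>\<real> g w)"
    by (intro bilinearI linear_rules linear_app[OF f] g)
  have "linear ?L \<and> (\<forall>n. \<forall>v\<in>gr n. \<forall>w. ?L (v \<otimes>\<^sub>\<real> w) = ((-1) powi (q * n)) *\<^sub>R (f v \<otimes>\<^sub>\<real> g w))"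
    by (simp add: linear_tensor_lift[OF b] tensor_lift_tensor[OF b] kp_gr powi_sg linear_scale[OF f]
        bilinear_lmul[OF bilinear_tensor])
  moreover have "L = ?L" if L: "linear L \<and> (\<forall>n. \<forall>v\<in>gr n. \<forall>w. L (v \<otimes>\<^sub>\<real> w) = ((-1) powi (q * n)) *\<^sub>R (f v \<otimes>\<^sub>\<real> g w))" for L
  proof (rule tensor_ext)
    show "L (v \<otimes>\<^sub>\<real> w) = ?L (v \<otimes>\<^sub>\<real> w)" for v w
    proof -
      have "(\<lambda>v. L (v \<otimes>\<^sub>\<real> w)) = (\<lambda>v. f (kp q v) \<otimes>\<^sub>\<real> g w)"
      proof (rule hom_ext)
        have "linear L" using L by blast
        then show "linear (\<lambda>v. L (v \<otimes>\<^sub>\<real> w))" by (rule linear_app) (intro linear_rules)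
        show "linear (\<lambda>v. f (kp q v) \<otimes>\<^sub>\<real> g w)" by (intro linear_rules linear_app[OF f])
      qed (use L in \<open>simp add: kp_gr powi_sg linear_scale[OF f] bilinear_lmul[OF bilinear_tensor]\<close>)
      then show ?thesis by (simp add: tensor_lift_tensor[OF b] fun_eq_iff)
    qed
  qed (use L linear_tensor_lift[OF b] in auto)
  ultimately show ?thesis unfolding tensor_map_def by (intro the_equality) blast+
qed

lemma tensor_map_tensor:
  fixes f :: "'a::koszul_grading \<Rightarrow> 'c::real_vector"
  assumes "linear f" "linear g"
  shows "tensor_map q f g (v \<otimes>\<^sub>\<real> w) = f (kp q v) \<otimes>\<^sub>\<real> g w"
  unfolding tensor_map_eq[OF assms]
  by (rule tensor_lift_tensor) (intro bilinearI linear_rules linear_app[OF assms(1)] assms(2))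

lemma linear_tensor_map:
  fixes f :: "'a::koszul_grading \<Rightarrow> 'c::real_vector"
  assumes "linear f" "linear g"
  shows "linear (tensor_map q f g)"
  unfolding tensor_map_eq[OF assms]
  by (rule linear_tensor_lift) (intro bilinearI linear_rules linear_app[OF assms(1)] assms(2))

lemma tensor_map_coprod:
  assumes h: "linear h" and f: "linear f" and g: "linear g"
  shows "h (tensor_map q f g (coprod z)) = sw (\<lambda>x y. h (f (kp q x) \<otimes>\<^sub>\<real> g y)) z"
  unfolding sw_def
  by (rule tensor_lift_eqI[symmetric])
    (auto intro!: linear_app[OF h] linear_tensor_map f g simp: tensor_map_tensor[OF f g])

definition sw_morphism :: "('a::koszul_grading sym \<Rightarrow> 'b::koszul_grading sym) \<Rightarrow> bool" where
  "sw_morphism F \<longleftrightarrow> linear F \<and> F (sprod []) = sprod [] \<and> coprod \<circ> F = tensor_map 0 F F \<circ> coprod"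

lemma sw_morphismD:
  assumes F: "sw_morphism F" and b: "bilinear b"
  shows "sw b (F z) = sw (\<lambda>x y. b (F x) (F y)) z"
proof -
  have lin: "linear F" and eq: "coprod (F z) = tensor_map 0 F F (coprod z)" for z
    using F by (auto simp: sw_morphism_def fun_eq_iff)
  have "sw b (F z) = tensor_lift b (tensor_map 0 F F (coprod z))"
    by (simp add: sw_def eq)
  also have "\<dots> = sw (\<lambda>x y. tensor_lift b (F (kp 0 x) \<otimes>\<^sub>\<real> F y)) z"
    by (rule tensor_map_coprod) (intro linear_tensor_lift b lin)+
  finally show ?thesis by (simp add: tensor_lift_tensor[OF b])
qed

lemma coprod_eq_sw: "coprod z = sw (\<otimes>\<^sub>\<real>) z"
  unfolding sw_def by (rule tensor_lift_eqI[symmetric]) (simp_all add: linear_ident)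

lemma sw_morphismI:
  assumes lin: "linear F" and "F (sprod []) = sprod []"
    and eq: "\<And>z. sw (\<otimes>\<^sub>\<real>) (F z) = sw (\<lambda>x y. F x \<otimes>\<^sub>\<real> F y) z"
  shows "sw_morphism F"
proof -
  have "coprod (F z) = tensor_map 0 F F (coprod z)" for z
    using tensor_map_coprod[OF linear_ident lin lin, of 0 z] eq[of z] by (simp add: coprod_eq_sw[of "F z"])
  then show ?thesis using assms by (auto simp: sw_morphism_def)
qed

lemma coalgebra_morphism_iff: "coalgebra_morphism F \<longleftrightarrow> F \<in> Hom 0 \<and> sw_morphism F"
  by (auto simp: coalgebra_morphism_def sw_morphism_def Hom_def)

text \<open>The common form of codifferentials and of left multiplication by a homogeneous vector;
  \<open>expc_coderivation\<close> is applied to both. Vanishing under the counit removes the zeroth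
  power there.\<close>

definition coderivation :: "int \<Rightarrow> ('a::koszul_grading sym \<Rightarrow> 'a sym) \<Rightarrow> bool" where
  "coderivation i \<delta> \<longleftrightarrow> linear \<delta> \<and> (\<forall>z. eps (\<delta> z) = 0) \<and> (\<forall>x n. x \<in> gr n \<longrightarrow> \<delta> x \<in> gr (n + i)) \<and>
     (\<forall>z. coprod (\<delta> z) = sw (\<lambda>x y. \<delta> x \<otimes>\<^sub>\<real> y + kp i x \<otimes>\<^sub>\<real> \<delta> y) z)"

lemma coderivation_linear: "coderivation i \<delta> \<Longrightarrow> linear \<delta>"
  and coderivation_eps: "coderivation i \<delta> \<Longrightarrow> eps (\<delta> z) = 0"
  and coderivation_Hom: "coderivation i \<delta> \<Longrightarrow> \<delta> \<in> Hom i"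
  by (auto simp: coderivation_def Hom_def)

lemma coderivation_sw:
  assumes \<delta>: "coderivation i \<delta>" and b: "bilinear b"
  shows "sw b (\<delta> z) = sw (\<lambda>x y. b (\<delta> x) y + b (kp i x) (\<delta> y)) z"
proof -
  note lin = coderivation_linear[OF \<delta>]
  have "sw b (\<delta> z) = tensor_lift b (sw (\<lambda>x y. \<delta> x \<otimes>\<^sub>\<real> y + kp i x \<otimes>\<^sub>\<real> \<delta> y) z)"
    using \<delta> by (simp add: sw_def[of b] coderivation_def)
  also have "\<dots> = sw (\<lambda>x y. tensor_lift b (\<delta> x \<otimes>\<^sub>\<real> y + kp i x \<otimes>\<^sub>\<real> \<delta> y)) z"
    by (intro sw_linear linear_tensor_lift[OF b] bilinearI linear_rules lin)
  finally show ?thesis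
    by (simp add: linear_add[OF linear_tensor_lift[OF b]] tensor_lift_tensor[OF b])
qed

lemma coderivation_vcons:
  assumes v: "v \<in> gr i"
  shows "coderivation i (\<lambda>x. v \<rhd> x)"
  unfolding coderivation_def
proof (intro conjI allI impI)
  show "linear (\<lambda>x. v \<rhd> x)" by (intro linear_rules)
  show "coprod (v \<rhd> z) = sw (\<lambda>x y. (v \<rhd> x) \<otimes>\<^sub>\<real> y + kp i x \<otimes>\<^sub>\<real> (v \<rhd> y)) z" for z
    unfolding coprod_eq_sw[of "v \<rhd> z"] by (rule sw_vcons[OF bilinear_tensor v])
  show "v \<rhd> x \<in> gr (n + i)" if "x \<in> gr n" for x n
    using vcons_gr[OF v that] by (simp add: add.commute)
qed simp

lemma codiff_sw:
  assumes lam: "linear lam"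
  shows "codiff lam z = sw (\<lambda>x y. lam x \<rhd> y) z"
proof -
  have mu: "linear (mu :: ('a sym, 'a sym) tensor \<Rightarrow> _)" and muT: "mu (x \<otimes>\<^sub>\<real> y) = x \<or>\<^sub>S y" for x y :: "'a sym"
    by (simp_all add: mu_def linear_tensor_lift[OF bilinear_vee] tensor_lift_tensor[OF bilinear_vee])
  have "codiff lam z = sw (\<lambda>x y. mu ((sym_incl \<circ> lam) (kp 0 x) \<otimes>\<^sub>\<real> id y)) z"
    unfolding codiff_def o_apply
    by (rule tensor_map_coprod[OF mu, unfolded o_def])
      (auto intro: linear_app[OF linear_sym_incl] lam simp: linear_ident id_def o_def)
  then show ?thesis by (simp add: muT)
qed

lemma coderivation_codiff:
  assumes lam: "lam \<in> Hom 1"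
  shows "coderivation 1 (codiff lam)"
  unfolding coderivation_def
proof (intro conjI allI impI)
  note lin = HomD(1)[OF lam]
  note eq = codiff_sw[OF lin]
  have b: "bilinear (\<lambda>x y. lam x \<rhd> y)" by (intro bilinearI linear_rules lin)
  show "linear (codiff lam)"
    unfolding eq[abs_def] by (rule linear_sw_arg[OF b])
  show "eps (codiff lam z) = 0" for z
    unfolding eq by (subst sw_linear[OF b linear_eps]) (simp add: sw_zero)
  show "codiff lam x \<in> gr (n + 1)" if "x \<in> gr n" for x n
    unfolding eq
  proof (rule sw_gr[OF that b subspace_gr])
    show "lam x \<rhd> y \<in> gr (n + 1)" if "x \<in> gr i" "y \<in> gr j" "i + j = n" for i j x y
      using vcons_gr[OF HomD(2)[OF lam that(1)] that(2)] that(3) by (simp add: ac_simps)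
  qed
  show "coprod (codiff lam z) = sw (\<lambda>x y. codiff lam x \<otimes>\<^sub>\<real> y + kp 1 x \<otimes>\<^sub>\<real> codiff lam y) z" for z
  proof -
    let ?Q = "\<lambda>v x y. x \<otimes>\<^sub>\<real> (((1/2) *\<^sub>R (v + parity v)) \<rhd> y) + parity x \<otimes>\<^sub>\<real> (((1/2) *\<^sub>R (v - parity v)) \<rhd> y)
      :: ('a sym, 'a sym) tensor"
    note l = bilinearI trilinearI linear_rules linear_sw_param lin linear_app[OF lin]
    have Q: "?Q v x y = kp i x \<otimes>\<^sub>\<real> (v \<rhd> y)" if "v \<in> gr i" for v i and x y :: "'a sym"
      by (simp add: kp_half[OF that] kp_def linear_0[OF linear_vee_left[OF linear_sym_incl]]
          bilinear_rzero[OF bilinear_tensor])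
    have "coprod (codiff lam z) = sw (\<lambda>x y. coprod (lam x \<rhd> y)) z"
      unfolding eq by (rule sw_linear[OF b linear_coprod])
    also have "\<dots> = sw (\<lambda>x y. sw (\<lambda>y1 y2. (lam x \<rhd> y1) \<otimes>\<^sub>\<real> y2) y + sw (\<lambda>y1 y2. ?Q (lam x) y1 y2) y) z"
    proof (rule sw_cong)
      fix x y
      have "coprod (lam x \<rhd> y) = sw (\<lambda>y1 y2. (lam x \<rhd> y1) \<otimes>\<^sub>\<real> y2 + ?Q (lam x) y1 y2) y"
        by (simp add: coprod_vcons cop_step_def sw_def add.assoc)
      also have "\<dots> = sw (\<lambda>y1 y2. (lam x \<rhd> y1) \<otimes>\<^sub>\<real> y2) y + sw (\<lambda>y1 y2. ?Q (lam x) y1 y2) y"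
        by (rule sw_add) (intro l)+
      finally show "coprod (lam x \<rhd> y) =
        sw (\<lambda>y1 y2. (lam x \<rhd> y1) \<otimes>\<^sub>\<real> y2) y + sw (\<lambda>y1 y2. ?Q (lam x) y1 y2) y" .
    qed
    also have "\<dots> = sw (\<lambda>x y. sw (\<lambda>y1 y2. (lam x \<rhd> y1) \<otimes>\<^sub>\<real> y2) y) z + sw (\<lambda>x y. sw (\<lambda>y1 y2. ?Q (lam x) y1 y2) y) z"
      by (rule sw_add) (intro l)+
    also have "sw (\<lambda>x y. sw (\<lambda>y1 y2. (lam x \<rhd> y1) \<otimes>\<^sub>\<real> y2) y) z = sw (\<lambda>x y. sw (\<lambda>x1 x2. (lam x1 \<rhd> x2) \<otimes>\<^sub>\<real> y) x) z"
      by (rule sw_assoc) (intro l)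
    also have "\<dots> = sw (\<lambda>x y. codiff lam x \<otimes>\<^sub>\<real> y) z"
      unfolding eq by (rule sw_cong, rule sw_linear[symmetric]) (intro l)+
    also have "sw (\<lambda>x y. sw (\<lambda>y1 y2. ?Q (lam x) y1 y2) y) z = sw (\<lambda>x y. sw (\<lambda>x1 x2. ?Q (lam x1) x2 y) x) z"
      by (rule sw_assoc) (intro l)
    \<comment> \<open>Cocommutativity exchanges x1 and x2. Of the sign (-1)^((|x1|+1)|x2|) for
      moving \<open>lam x1\<close> past x2 only (-1)^|x2| is left, which is
      \<open>kp 1\<close>.\<close>
    also have "\<dots> = sw (\<lambda>x y. sw (\<lambda>x1 x2. kp 1 x1 \<otimes>\<^sub>\<real> (lam x2 \<rhd> y)) x) z"
    proof (rule sw_cong, rule sw_comm)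
      show "kp 1 x2 \<otimes>\<^sub>\<real> (lam x1 \<rhd> y) = sg (i * j) *\<^sub>R ?Q (lam x1) x2 y" if "x1 \<in> gr i" "x2 \<in> gr j" for x1 x2 y i j
        unfolding Q[OF HomD(2)[OF lam that(1)]]
        by (simp add: kp_gr[OF that(2)] bilinear_lmul[OF bilinear_tensor]) (simp add: sg_def)
    qed (intro l)+
    also have "\<dots> = sw (\<lambda>x y. sw (\<lambda>y1 y2. kp 1 x \<otimes>\<^sub>\<real> (lam y1 \<rhd> y2)) y) z"
      by (rule sw_assoc[symmetric]) (intro l)
    also have "\<dots> = sw (\<lambda>x y. kp 1 x \<otimes>\<^sub>\<real> codiff lam y) z"
      unfolding eq by (rule sw_cong, rule sw_linear[symmetric]) (intro l)+
    finally show ?thesis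
      unfolding eq by (subst sw_add) (intro l)+
  qed
qed


section \<open>Coalgebra morphisms as convolution exponentials\<close>

text \<open>\<open>braid t x y\<close> is \<open>t x y\<close> with the Koszul sign of exchanging \<open>x\<close> and \<open>y\<close>, made linear in both.\<close>

definition braid :: "('a::koszul_grading \<Rightarrow> 'b::koszul_grading \<Rightarrow> 'c::real_vector) \<Rightarrow> 'a \<Rightarrow> 'b \<Rightarrow> 'c" where
  "braid t x y = t ((1/2) *\<^sub>R (x + parity x)) y + t ((1/2) *\<^sub>R (x - parity x)) (parity y)"

lemma braid_gr: "bilinear t \<Longrightarrow> x \<in> gr m \<Longrightarrow> braid t x y = t x (kp m y)"
  by (simp add: braid_def kp_half kp_def bilinear_lzero)

lemma braid_linear_left: "bilinear t \<Longrightarrow> linear f \<Longrightarrow> linear (\<lambda>u. braid t (f u) y)"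
proof -
  assume "bilinear t" "linear f"
  then show ?thesis unfolding braid_def
    by (intro linear_compose_add bilinear_left[OF \<open>bilinear t\<close>] linear_rules)
qed

lemma braid_linear_right: "bilinear t \<Longrightarrow> linear f \<Longrightarrow> linear (\<lambda>u. braid t x (f u))"
proof -
  assume "bilinear t" "linear f"
  then show ?thesis unfolding braid_def
    by (intro linear_compose_add bilinear_right[OF \<open>bilinear t\<close>] linear_rules)
qed

lemma braid_linear_param: "(\<And>x y. linear (\<lambda>u. t u x y)) \<Longrightarrow> linear (\<lambda>u. braid (t u) x y)"
  unfolding braid_def by (intro linear_rules)

lemma sw_braid:
  assumes t: "bilinear t"
  shows "sw (braid t) z = sw (\<lambda>x y. t y x) z"
proof (rule sw_comm)
  show "bilinear (braid t)" "bilinear (\<lambda>x y. t y x)"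
    by (intro bilinearI braid_linear_left[OF t] braid_linear_right[OF t] bilinear_left[OF t]
        bilinear_right[OF t] linear_rules)+
  show "t x y = sg (i * j) *\<^sub>R braid t x y" if "x \<in> gr i" "y \<in> gr j" for i j x y
    by (simp add: braid_gr[OF t that(1)] kp_gr[OF that(2)] bilinear_rmul[OF t])
qed

text \<open>The rule \<open>sw_vcons\<close> without homogeneity of v, for use with v = \<phi> x
  where x is itself a Sweedler factor.\<close>

lemma sw_vcons_braid:
  assumes b: "bilinear b"
  shows "sw b (v \<rhd> z) = sw (\<lambda>x y. b (v \<rhd> x) y + braid (\<lambda>v x. b x (v \<rhd> y)) v x) z"
proof -
  note l = bilinearI linear_rules bilinear_left[OF b] bilinear_right[OF b]
  have t: "bilinear (\<lambda>v x. b x (v \<rhd> y))" for y by (intro l)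
  note l = l braid_linear_left[OF t] braid_linear_right[OF t] braid_linear_param linear_sw_param
  have "(\<lambda>v. sw b (v \<rhd> z)) = (\<lambda>v. sw (\<lambda>x y. b (v \<rhd> x) y + braid (\<lambda>v x. b x (v \<rhd> y)) v x) z)"
  proof (rule hom_ext)
    show "sw b (v \<rhd> z) = sw (\<lambda>x y. b (v \<rhd> x) y + braid (\<lambda>v x. b x (v \<rhd> y)) v x) z" if "v \<in> gr n" for v n
      by (simp add: sw_vcons[OF b that] braid_gr[OF t that])
  qed (intro l)+
  then show ?thesis by (rule fun_cong)
qed


subsection \<open>Filtration by length\<close>

text \<open>Lengths strictly below n, so \<open>Fil 0\<close> is zero and inductions on n start with
  nothing to prove.\<close>

definition Fil :: "nat \<Rightarrow> 'a::koszul_grading sym set" where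
  "Fil n = span {sprod vs |vs. length vs < n}"

lemma subspace_Fil: "subspace (Fil n)"
  by (simp add: Fil_def)

lemma Fil_mono: "m \<le> n \<Longrightarrow> x \<in> Fil m \<Longrightarrow> x \<in> Fil n"
  unfolding Fil_def by (rule subsetD[OF span_mono]) auto

lemma sprod_Fil: "length vs < n \<Longrightarrow> sprod vs \<in> Fil n"
  unfolding Fil_def by (rule span_base) blast

lemma Fil_0: "x \<in> Fil 0 \<Longrightarrow> x = 0"
  by (simp add: Fil_def)

lemma Fil_induct [consumes 1, case_names zero word]:
  assumes "x \<in> Fil n" "P 0" "\<And>c vs y. length vs < n \<Longrightarrow> P y \<Longrightarrow> P (c *\<^sub>R sprod vs + y)"
  shows "P x"
  using assms(1) unfolding Fil_def by (induction rule: span_induct_alt) (auto intro: assms)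

lemma Fil_eqI:
  assumes "linear f" "linear g" "\<And>vs. length vs < n \<Longrightarrow> f (sprod vs) = g (sprod vs)" "z \<in> Fil n"
  shows "f z = g z"
  using assms(4) by (induction rule: Fil_induct)
    (simp_all add: linear_0 linear_add linear_scale assms(1-3))

lemma Fil_exists: "\<exists>n. (x :: 'a::koszul_grading sym) \<in> Fil n"
proof -
  have "x \<in> span (range sprod)" by (simp add: span_sprod)
  then show ?thesis
  proof (induction rule: span_induct_alt)
    case base
    show ?case using subspace_0[OF subspace_Fil] by blast
  next
    case (step c x y)
    then obtain vs n where x: "x = sprod vs" and y: "y \<in> Fil n" by auto
    let ?m = "max n (Suc (length vs))"
    have "x \<in> Fil ?m" unfolding x by (rule sprod_Fil) simp
    moreover have "y \<in> Fil ?m" by (rule Fil_mono[OF _ y]) simp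
    ultimately have "c *\<^sub>R x + y \<in> Fil ?m"
      by (intro subspace_add[OF subspace_Fil] subspace_scale[OF subspace_Fil])
    then show ?case by blast
  qed
qed

lemma vcons_Fil: "x \<in> Fil n \<Longrightarrow> v \<rhd> x \<in> Fil (Suc n)"
proof (induction rule: Fil_induct)
  case zero
  show ?case by (simp add: bilinear_rzero[OF bilinear_vee] subspace_0[OF subspace_Fil])
next
  case (word c vs y)
  then show ?case
    by (simp add: bilinear_radd[OF bilinear_vee] bilinear_rmul[OF bilinear_vee] vcons_sprod
        subspace_add[OF subspace_Fil] subspace_scale[OF subspace_Fil] sprod_Fil)
qed

lemma kp_sprod: "kp r (sprod vs) = sprod (map (kp r) vs)"
  by (induction vs) (simp_all add: kp_vcons flip: vcons_sprod)

lemma kp_Fil: "x \<in> Fil n \<Longrightarrow> kp r x \<in> Fil n"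
proof (induction rule: Fil_induct)
  case zero
  show ?case by (simp add: linear_0[OF linear_kp] subspace_0[OF subspace_Fil])
next
  case (word c vs y)
  then show ?case
    by (simp add: linear_add[OF linear_kp] linear_scale[OF linear_kp] kp_sprod
        subspace_add[OF subspace_Fil] subspace_scale[OF subspace_Fil] sprod_Fil)
qed

text \<open>Both factors in the coproduct of a word are at most as long as the word.\<close>

lemma sw_word_eq_0:
  fixes b :: "'a::koszul_grading sym \<Rightarrow> 'a sym \<Rightarrow> 'b::real_vector"
  assumes "bilinear b" "\<And>x y. x \<in> Fil (Suc (length vs)) \<Longrightarrow> y \<in> Fil (Suc (length vs)) \<Longrightarrow> b x y = 0"
  shows "sw b (sprod vs) = 0"
  using assms
proof (induction vs arbitrary: b)
  case Nil
  then show ?case by (simp add: sw_one sprod_Fil)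
next
  case (Cons v vs)
  note b = Cons.prems(1)
  note l = bilinearI linear_rules bilinear_left[OF b] bilinear_right[OF b]
  have "(\<lambda>v. sw b (v \<rhd> sprod vs)) = (\<lambda>v. 0)"
  proof (rule hom_ext)
    fix n and v :: 'a assume v: "v \<in> gr n"
    have "sw (\<lambda>x y. b (v \<rhd> x) y + b (kp n x) (v \<rhd> y)) (sprod vs) = 0"
    proof (rule Cons.IH)
      fix x y :: "'a sym" assume xy: "x \<in> Fil (Suc (length vs))" "y \<in> Fil (Suc (length vs))"
      have "b (v \<rhd> x) y = 0" "b (kp n x) (v \<rhd> y) = 0"
        by (intro Cons.prems(2); use xy in \<open>auto intro: vcons_Fil kp_Fil Fil_mono[of "Suc (length vs)"]\<close>)+
      then show "b (v \<rhd> x) y + b (kp n x) (v \<rhd> y) = 0" by simp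
    qed (intro l)
    then show "sw b (v \<rhd> sprod vs) = 0" by (simp add: sw_vcons[OF b v])
  qed (intro l b)+
  then show ?case unfolding vcons_sprod[symmetric] by (rule fun_cong)
qed

lemma sw_Fil_eq_0:
  assumes b: "bilinear b" and z: "z \<in> Fil n" and 0: "\<And>x y. x \<in> Fil n \<Longrightarrow> y \<in> Fil n \<Longrightarrow> b x y = 0"
  shows "sw b z = 0"
proof -
  have "sw b (sprod vs) = 0" if "length vs < n" for vs
  proof (rule sw_word_eq_0[OF b])
    fix x y :: "'a sym" assume "x \<in> Fil (Suc (length vs))" "y \<in> Fil (Suc (length vs))"
    then show "b x y = 0" using that by (intro 0) (auto intro: Fil_mono[of "Suc (length vs)"])
  qed
  then show ?thesis
    by (rule Fil_eqI[OF linear_sw_arg[OF b] linear_zero _ z])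
qed

lemma sw_Fil_cong:
  assumes b: "bilinear b" "bilinear b'" and z: "z \<in> Fil n"
    and eq: "\<And>x y. x \<in> Fil n \<Longrightarrow> y \<in> Fil n \<Longrightarrow> b x y = b' x y"
  shows "sw b z = sw b' z"
proof -
  note l = bilinearI linear_rules bilinear_left[OF b(1)] bilinear_right[OF b(1)]
        bilinear_left[OF b(2)] bilinear_right[OF b(2)]
  have "sw (\<lambda>x y. b x y - b' x y) z = 0"
    by (rule sw_Fil_eq_0[OF _ z]) (auto intro!: l simp: eq)
  then show ?thesis by (simp add: sw_diff[OF b])
qed

text \<open>Conilpotence: once the terms with left factor 1 are discarded, the right factor is
  strictly shorter than the word. This drives the inductions on length below.\<close>

lemma sw_word_lower_eq_0:
  fixes b :: "'a::koszul_grading sym \<Rightarrow> 'a sym \<Rightarrow> 'b::real_vector"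
  assumes "bilinear b" "\<And>y. b (sprod []) y = 0" "\<And>x y. y \<in> Fil (length vs) \<Longrightarrow> b x y = 0"
  shows "sw b (sprod vs) = 0"
  using assms
proof (induction vs arbitrary: b)
  case Nil
  then show ?case by (simp add: sw_one)
next
  case (Cons v vs)
  note b = Cons.prems(1)
  note l = bilinearI linear_rules bilinear_left[OF b] bilinear_right[OF b]
  have "(\<lambda>v. sw b (v \<rhd> sprod vs)) = (\<lambda>v. 0)"
  proof (rule hom_ext)
    fix n and v :: 'a assume v: "v \<in> gr n"
    have "sw (\<lambda>x y. b (v \<rhd> x) y) (sprod vs) = 0"
      by (rule sw_word_eq_0) (intro l, use Cons.prems(3) in auto)
    moreover have "sw (\<lambda>x y. b (kp n x) (v \<rhd> y)) (sprod vs) = 0"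
      by (rule Cons.IH) (intro l, use Cons.prems(2,3) in \<open>auto intro: vcons_Fil\<close>)
    moreover have "sw b (v \<rhd> sprod vs) = sw (\<lambda>x y. b (v \<rhd> x) y) (sprod vs) + sw (\<lambda>x y. b (kp n x) (v \<rhd> y)) (sprod vs)"
      unfolding sw_vcons[OF b v] by (rule sw_add) (intro l)+
    ultimately show "sw b (v \<rhd> sprod vs) = 0" by simp
  qed (intro l b)+
  then show ?case unfolding vcons_sprod[symmetric] by (rule fun_cong)
qed

lemma sw_Fil_lower_eq_0:
  assumes b: "bilinear b" and z: "z \<in> Fil (Suc n)" and "\<And>y. b (sprod []) y = 0"
    and 0: "\<And>x y. y \<in> Fil n \<Longrightarrow> b x y = 0"
  shows "sw b z = 0"
proof -
  have "sw b (sprod vs) = 0" if "length vs < Suc n" for vs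
    by (rule sw_word_lower_eq_0[OF b assms(3)]) (use that in \<open>auto intro!: 0 intro: Fil_mono[of "length vs"]\<close>)
  then show ?thesis
    by (rule Fil_eqI[OF linear_sw_arg[OF b] linear_zero _ z])
qed


subsection \<open>Uniqueness\<close>

lemma linear_sym_proj_app [linear_rules]: "linear f \<Longrightarrow> linear (\<lambda>u. sym_proj (f u))"
  for f :: "'u::real_vector \<Rightarrow> 'a::koszul_grading sym"
  by (rule linear_app[OF linear_sym_proj])

text \<open>Multiplication by n on S^n, see \<open>euler_sprod\<close>. In this Sweedler form its
  value at F z, for a coalgebra morphism F, is expressed through \<open>sym_proj (F x)\<close> and F
  y.\<close>

definition euler :: "'a::koszul_grading sym \<Rightarrow> 'a sym" where
  "euler = sw (\<lambda>x y. sym_proj x \<rhd> y)"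

lemma linear_euler: "linear euler"
  unfolding euler_def by (intro linear_sw_arg bilinearI linear_rules)

lemma euler_vcons:
  assumes v: "v \<in> gr i"
  shows "euler (v \<rhd> z) = v \<rhd> z + v \<rhd> euler z"
proof -
  have b: "bilinear (\<lambda>(x :: 'a sym) y. sym_proj x \<rhd> y)" by (intro bilinearI linear_rules)
  have "euler (v \<rhd> z) = sw (\<lambda>x y. sym_proj (v \<rhd> x) \<rhd> y + sym_proj (kp i x) \<rhd> v \<rhd> y) z"
    unfolding euler_def by (rule sw_vcons[OF b v])
  also have "\<dots> = sw (\<lambda>x y. eps x *\<^sub>R (v \<rhd> y) + v \<rhd> sym_proj x \<rhd> y) z"
  proof (rule sw_hom_cong)
    fix m n and x y :: "'a sym" assume x: "x \<in> gr m" and y: "y \<in> gr n"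
    have "sym_proj x \<in> gr m" using HomD(2)[OF sym_proj_Hom x] by simp
    from vcons_swap[OF this v] show "sym_proj (v \<rhd> x) \<rhd> y + sym_proj (kp i x) \<rhd> v \<rhd> y =
        eps x *\<^sub>R (v \<rhd> y) + v \<rhd> sym_proj x \<rhd> y"
      by (simp add: sym_proj_vcons kp_gr[OF x] linear_scale[OF linear_sym_proj]
          linear_scale[OF linear_vee_left[OF linear_sym_incl]] mult.commute)
  qed (intro bilinearI linear_rules)+
  also have "\<dots> = sw (\<lambda>x y. eps x *\<^sub>R (v \<rhd> y)) z + sw (\<lambda>x y. v \<rhd> sym_proj x \<rhd> y) z"
    by (rule sw_add) (intro bilinearI linear_rules)+
  also have "sw (\<lambda>x y. eps x *\<^sub>R (v \<rhd> y)) z = v \<rhd> z"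
    by (rule sw_counit_left) (intro linear_rules)
  also have "sw (\<lambda>x y. v \<rhd> sym_proj x \<rhd> y) z = v \<rhd> euler z"
    unfolding euler_def by (rule sw_linear[symmetric, OF b]) (intro linear_rules)
  finally show ?thesis .
qed

lemma euler_sprod: "homs ds vs \<Longrightarrow> euler (sprod vs) = real (length vs) *\<^sub>R sprod vs"
proof (induction vs arbitrary: ds)
  case Nil
  have "bilinear (\<lambda>(x :: 'a sym) y. sym_proj x \<rhd> y)" by (intro bilinearI linear_rules)
  then show ?case by (simp add: euler_def sw_one linear_0[OF linear_vee_left[OF linear_sym_incl]])
next
  case (Cons v vs)
  from Cons.prems obtain d es where *: "v \<in> gr d" "homs es vs" by (rule homs_ConsE)
  show ?case
    using euler_vcons[OF *(1), of "sprod vs"] Cons.IH[OF *(2)]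
    by (simp add: linear_scale[OF linear_vee_right[OF linear_ident]] vcons_sprod scaleR_add_left)
qed

text \<open>The number n is invertible for n > 0, and the counit controls n = 0. The maps P n are
  the projections to S^n; finitely many of them add up to the identity on a given element.\<close>

lemma euler_eq_0:
  fixes y :: "'a::koszul_grading sym"
  assumes E: "euler y = 0" and eps: "eps y = 0"
  shows "y = 0"
proof -
  have "\<exists>L. linear L \<and> (\<forall>vs :: 'a list. L (sprod vs) = (if length vs = n then sprod vs else 0))" for n
  proof (rule sym_exists)
    show "multilinear (\<lambda>vs :: 'a list. if length vs = n then sprod vs else 0)"
      unfolding multilinear_def
    proof (intro allI)
      fix us ws :: "'a list"
      show "linear (\<lambda>v. if length (us @ v # ws) = n then sprod (us @ v # ws) else 0)"
        using multilinearD[OF multilinear_sprod, of us ws]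
        by (cases "length us + Suc (length ws) = n") (simp_all add: linear_zero)
    qed
    show "swap_rule 1 (\<lambda>vs :: 'a list. if length vs = n then sprod vs else 0)"
      unfolding swap_rule_def
    proof (intro allI impI)
      fix us ws and x y :: 'a and i j assume "x \<in> gr i" "y \<in> gr j"
      from swap_ruleD[OF swap_rule_sprod this, of us ws]
      show "(if length (us @ x # y # ws) = n then sprod (us @ x # y # ws) else 0) =
          (1 * sg (i * j)) *\<^sub>R (if length (us @ y # x # ws) = n then sprod (us @ y # x # ws) else 0)"
        by simp
    qed
  qed
  then obtain P :: "nat \<Rightarrow> 'a sym \<Rightarrow> 'a sym" where P: "\<And>n. linear (P n)"
    "\<And>n vs. P n (sprod vs) = (if length vs = n then sprod vs else 0)" by metis
  have PE: "P n (euler z) = real n *\<^sub>R P n z" for n z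
  proof -
    have "(\<lambda>z. P n (euler z)) = (\<lambda>z. real n *\<^sub>R P n z)"
      by (intro sym_hom_ext linear_rules linear_app[OF P(1)] linear_euler P(1))
        (auto simp: euler_sprod linear_scale[OF P(1)] P(2))
    then show ?thesis by (rule fun_cong)
  qed
  have P0: "P 0 z = eps z *\<^sub>R sprod []" for z
  proof -
    have "P 0 = (\<lambda>z. eps z *\<^sub>R sprod [])"
      by (intro sym_hom_ext linear_rules linear_eps P(1)) (auto simp: P(2) eps_sprod)
    then show ?thesis by (rule fun_cong)
  qed
  have "P n y = 0" for n
    using PE[of n y] E by (cases "n = 0") (simp_all add: P0 eps linear_0[OF P(1)])
  moreover obtain N where "y \<in> Fil N" using Fil_exists by blast
  then have "(\<Sum>n<N. P n y) = y"
  proof (rule Fil_eqI[rotated 3])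
    show "(\<Sum>n<N. P n (sprod vs)) = sprod vs" if "length vs < N" for vs
      using that by (simp add: P(2))
  qed (intro linear_rules P(1))+
  ultimately show ?thesis by simp
qed

lemma sw_morphism_linear: "sw_morphism F \<Longrightarrow> linear F"
  and sw_morphism_one: "sw_morphism F \<Longrightarrow> F (sprod []) = sprod []"
  by (simp_all add: sw_morphism_def)

text \<open>Let D be the difference of the two sides. The counit law gives D = 2 D + D D with the
  convolution product D D. Since D vanishes at 1, the value of D D at z involves D on shorter words
  only, so D = 0 by induction.\<close>

lemma sw_morphism_eps:
  assumes F: "sw_morphism F"
  shows "eps (F z) = eps z"
proof -
  note l = linear_app[OF sw_morphism_linear[OF F]] sw_morphism_linear[OF F]
  let ?D = "\<lambda>z. eps (F z) - eps z"
  have "\<forall>z\<in>Fil n. ?D z = 0" for n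
  proof (induction n)
    case 0
    show ?case by (auto dest!: Fil_0 simp: linear_0[OF linear_eps] linear_0[OF l(2)])
  next
    case (Suc n)
    show ?case
    proof
      fix z :: "'a sym" assume z: "z \<in> Fil (Suc n)"
      have b: "bilinear (\<lambda>x y. eps x *\<^sub>R eps y)" by (intro bilinearI linear_rules)
      have "eps (F z) = sw (\<lambda>x y. eps x *\<^sub>R eps y) (F z)"
        by (rule sw_counit_left[OF linear_eps, symmetric])
      also have "\<dots> = sw (\<lambda>x y. eps (F x) *\<^sub>R eps (F y)) z"
        by (rule sw_morphismD[OF F b])
      also have "\<dots> = sw (\<lambda>x y. (eps x *\<^sub>R eps y + eps y *\<^sub>R ?D x) + (eps x *\<^sub>R ?D y + ?D x *\<^sub>R ?D y)) z"
        by (rule sw_cong) (simp add: algebra_simps)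
      also have "\<dots> = (sw (\<lambda>x y. eps x *\<^sub>R eps y) z + sw (\<lambda>x y. eps y *\<^sub>R ?D x) z) +
          (sw (\<lambda>x y. eps x *\<^sub>R ?D y) z + sw (\<lambda>x y. ?D x *\<^sub>R ?D y) z)"
        by (subst sw_add, (intro bilinearI linear_rules l)+)+ (rule refl)
      also have "sw (\<lambda>x y. eps x *\<^sub>R eps y) z = eps z" by (rule sw_counit_left[OF linear_eps])
      also have "sw (\<lambda>x y. eps y *\<^sub>R ?D x) z = ?D z"
        by (rule sw_counit_right) (intro linear_rules l)
      also have "sw (\<lambda>x y. eps x *\<^sub>R ?D y) z = ?D z"
        by (rule sw_counit_left) (intro linear_rules l)
      also have "sw (\<lambda>x y. ?D x *\<^sub>R ?D y) z = 0"
        by (rule sw_Fil_lower_eq_0[OF _ z])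
          (intro bilinearI linear_rules l, use Suc in \<open>simp_all add: sw_morphism_one[OF F]\<close>)
      finally show "?D z = 0" by simp
    qed
  qed
  then show ?thesis using Fil_exists[of z] by auto
qed

text \<open>Apply \<open>euler\<close> to F z - F' z: the result is the sum of the terms
  \<open>sym_proj (F x)\<close> times F y - F' y. The first factor vanishes at x = 1, so y is
  shorter than z and the induction hypothesis applies; \<open>euler_eq_0\<close> then removes
  \<open>euler\<close>.\<close>

lemma sw_morphism_unique:
  assumes F: "sw_morphism F" "sw_morphism F'" and eq: "\<And>x. sym_proj (F x) = sym_proj (F' x)"
  shows "F = F'"
proof
  fix z
  note l = linear_app[OF sw_morphism_linear[OF F(1)]] linear_app[OF sw_morphism_linear[OF F(2)]] linear_rules
  have "\<forall>z\<in>Fil n. F z = F' z" for n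
  proof (induction n)
    case 0
    show ?case by (auto dest!: Fil_0 simp: linear_0[OF sw_morphism_linear] F)
  next
    case (Suc n)
    show ?case
    proof
      fix z :: "'a sym" assume z: "z \<in> Fil (Suc n)"
      have b: "bilinear (\<lambda>(x :: 'b sym) y. sym_proj x \<rhd> y)" by (intro bilinearI linear_rules)
      have "euler (F z - F' z) = sw (\<lambda>x y. sym_proj (F x) \<rhd> F y) z - sw (\<lambda>x y. sym_proj (F' x) \<rhd> F' y) z"
        by (simp add: linear_diff[OF linear_euler]) (simp add: euler_def sw_morphismD[OF F(1) b] sw_morphismD[OF F(2) b])
      also have "\<dots> = sw (\<lambda>x y. sym_proj (F x) \<rhd> F y - sym_proj (F x) \<rhd> F' y) z"
        unfolding eq[symmetric] by (rule sw_diff[symmetric]) (intro bilinearI l)+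
      also have "\<dots> = 0"
      proof (rule sw_Fil_lower_eq_0[OF _ z])
        show "bilinear (\<lambda>x y. sym_proj (F x) \<rhd> F y - sym_proj (F x) \<rhd> F' y)" by (intro bilinearI l)
        show "sym_proj (F (sprod [])) \<rhd> F y - sym_proj (F (sprod [])) \<rhd> F' y = 0" for y
          by (simp add: sw_morphism_one[OF F(1)] linear_0[OF linear_vee_left[OF linear_sym_incl]])
      qed (use Suc in auto)
      finally have "F z - F' z = 0"
        by (rule euler_eq_0) (simp add: linear_diff[OF linear_eps] sw_morphism_eps F)
      then show "F z = F' z" by simp
    qed
  qed
  then show "F z = F' z" using Fil_exists[of z] by auto
qed


subsection \<open>The exponential\<close>

text \<open>The convolution product of a map into V with a map into S(V).\<close>

definition vconv :: "('a::koszul_grading sym \<Rightarrow> 'b::koszul_grading) \<Rightarrow> ('a sym \<Rightarrow> 'b sym) \<Rightarrow> 'a sym \<Rightarrow> 'b sym" where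
  "vconv \<phi> G z = sw (\<lambda>x y. \<phi> x \<rhd> G y) z"

primrec pw :: "('a::koszul_grading sym \<Rightarrow> 'b::koszul_grading) \<Rightarrow> nat \<Rightarrow> 'a sym \<Rightarrow> 'b sym" where
  "pw \<phi> 0 = (\<lambda>z. eps z *\<^sub>R sprod [])"
| "pw \<phi> (Suc n) = vconv \<phi> (pw \<phi> n)"

text \<open>The sum is locally finite if \<open>\<phi> 1 = 0\<close>.\<close>

definition expc :: "('a::koszul_grading sym \<Rightarrow> 'b::koszul_grading) \<Rightarrow> 'a sym \<Rightarrow> 'b sym" where
  "expc \<phi> z = (\<Sum>n | pw \<phi> n z \<noteq> 0. (1 / fact n) *\<^sub>R pw \<phi> n z)"

lemma linear_vconv:
  assumes "linear \<phi>" "linear G"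
  shows "linear (vconv \<phi> G)"
  unfolding vconv_def[abs_def]
  by (intro linear_sw_arg bilinearI linear_rules linear_app[OF assms(1)] linear_app[OF assms(2)])

lemma linear_pw: "linear \<phi> \<Longrightarrow> linear (pw \<phi> n)"
  by (induction n) (auto intro: linear_rules linear_eps linear_vconv)

lemma pw_Hom:
  assumes "\<phi> \<in> Hom 0"
  shows "pw \<phi> n \<in> Hom 0"
proof (induction n)
  case 0
  have "eps z *\<^sub>R sprod [] \<in> (gr m :: 'b sym set)" if "z \<in> gr m" for m and z :: "'a sym"
    using eps_gr[OF that] by (cases "m = 0") (auto simp: gr_scaleR one_gr gr_0)
  then show ?case by (auto simp: Hom_def intro: linear_rules linear_eps)
next
  case (Suc n)
  note l = linear_app[OF HomD(1)[OF assms]] linear_app[OF HomD(1)[OF Suc]]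
  have "vconv \<phi> (pw \<phi> n) z \<in> gr m" if "z \<in> gr m" for m z
    unfolding vconv_def
  proof (rule sw_gr[OF that _ subspace_gr])
    show "\<phi> x \<rhd> pw \<phi> n y \<in> gr m" if "x \<in> gr i" "y \<in> gr j" "i + j = m" for i j x y
      using vcons_gr[OF HomD(2)[OF assms that(1)] HomD(2)[OF Suc that(2)]] that(3) by simp
  qed (intro bilinearI linear_rules l)
  then show ?case using linear_vconv[OF HomD(1)[OF assms] HomD(1)[OF Suc]] by (auto simp: Hom_def)
qed

text \<open>Convolution is graded commutative because S(V) is commutative and cocommutative. As
  \<phi> has degree 0, the only sign comes from moving \<alpha> past the argument of \<phi>.\<close>

lemma vconv_comm:
  assumes \<phi>: "\<phi> \<in> Hom 0" and \<alpha>: "\<alpha> \<in> Hom i" and G: "linear G"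
  shows "vconv (\<lambda>x. \<phi> (kp i x)) (vconv \<alpha> G) z = vconv \<alpha> (vconv \<phi> G) z"
proof -
  note l = bilinearI trilinearI linear_rules linear_app[OF HomD(1)[OF \<phi>]] linear_app[OF HomD(1)[OF \<alpha>]] linear_app[OF G] linear_sw_param
  have "vconv (\<lambda>x. \<phi> (kp i x)) (vconv \<alpha> G) z = sw (\<lambda>x y. sw (\<lambda>y1 y2. \<phi> (kp i x) \<rhd> \<alpha> y1 \<rhd> G y2) y) z"
    unfolding vconv_def by (rule sw_cong, rule sw_linear) (intro l)+
  also have "\<dots> = sw (\<lambda>x y. sw (\<lambda>x1 x2. \<phi> (kp i x1) \<rhd> \<alpha> x2 \<rhd> G y) x) z"
    by (rule sw_assoc) (intro l)
  also have "\<dots> = sw (\<lambda>x y. sw (\<lambda>x1 x2. \<alpha> x1 \<rhd> \<phi> x2 \<rhd> G y) x) z"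
  proof (rule sw_cong, rule sw_comm)
    fix m n and x1 x2 y :: "'a sym" assume x: "x1 \<in> gr m" "x2 \<in> gr n"
    have "\<phi> x1 \<in> gr m" using HomD(2)[OF \<phi> x(1)] by simp
    from vcons_swap[OF this HomD(2)[OF \<alpha> x(2)]]
    show "\<alpha> x2 \<rhd> \<phi> x1 \<rhd> G y = sg (m * n) *\<^sub>R (\<phi> (kp i x1) \<rhd> \<alpha> x2 \<rhd> G y)"
      by (simp add: kp_gr[OF x(1)] linear_scale[OF HomD(1)[OF \<phi>]]
          linear_scale[OF linear_vee_left[OF linear_sym_incl]]) (simp add: sg_def)
  qed (intro l)+
  also have "\<dots> = sw (\<lambda>x y. sw (\<lambda>y1 y2. \<alpha> x \<rhd> \<phi> y1 \<rhd> G y2) y) z"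
    by (rule sw_assoc[symmetric]) (intro l)
  also have "\<dots> = vconv \<alpha> (vconv \<phi> G) z"
    unfolding vconv_def by (rule sw_cong, rule sw_linear[symmetric]) (intro l)+
  finally show ?thesis .
qed

text \<open>The power rule: a coderivation acts on a convolution power one factor at a time, and
  \<open>vconv_comm\<close> makes the n + 1 summands equal.\<close>

lemma pw_coderivation:
  assumes \<phi>: "\<phi> \<in> Hom 0" and \<delta>: "coderivation i \<delta>"
  shows "pw \<phi> (Suc n) (\<delta> z) = real (Suc n) *\<^sub>R vconv (\<lambda>x. \<phi> (\<delta> x)) (pw \<phi> n) z"
proof (induction n arbitrary: z)
  case 0
  note l = bilinearI linear_rules linear_app[OF HomD(1)[OF \<phi>]] linear_app[OF coderivation_linear[OF \<delta>]]
  have "bilinear (\<lambda>x (y :: 'a sym). \<phi> x \<rhd> eps y *\<^sub>R sprod [])" by (intro l)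
  then show ?case
    by (simp add: vconv_def coderivation_sw[OF \<delta>] coderivation_eps[OF \<delta>]
        linear_0[OF linear_vee_right[OF linear_ident]])
next
  case (Suc n)
  let ?\<alpha> = "\<lambda>x. \<phi> (\<delta> x)"
  have \<alpha>: "?\<alpha> \<in> Hom i"
    using HomD[OF \<phi>] HomD[OF coderivation_Hom[OF \<delta>]] by (auto simp: Hom_def intro: linear_app)
  note pl = linear_pw[OF HomD(1)[OF \<phi>]]
  note l = bilinearI linear_rules linear_app[OF HomD(1)[OF \<phi>]] linear_app[OF coderivation_linear[OF \<delta>]]
    linear_app[OF pl] linear_app[OF linear_vconv[OF HomD(1)[OF \<phi>] pl]] linear_app[OF linear_vconv[OF HomD(1)[OF \<alpha>] pl]]
  have "pw \<phi> (Suc (Suc n)) (\<delta> z) = sw (\<lambda>x y. \<phi> x \<rhd> pw \<phi> (Suc n) y) (\<delta> z)"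
    by (simp add: vconv_def)
  also have "\<dots> = sw (\<lambda>x y. \<phi> (\<delta> x) \<rhd> pw \<phi> (Suc n) y + \<phi> (kp i x) \<rhd> pw \<phi> (Suc n) (\<delta> y)) z"
    by (rule coderivation_sw[OF \<delta>]) (intro l)
  also have "\<dots> = sw (\<lambda>x y. \<phi> (\<delta> x) \<rhd> pw \<phi> (Suc n) y) z + sw (\<lambda>x y. \<phi> (kp i x) \<rhd> pw \<phi> (Suc n) (\<delta> y)) z"
    by (rule sw_add) (intro l)+
  also have "sw (\<lambda>x y. \<phi> (kp i x) \<rhd> pw \<phi> (Suc n) (\<delta> y)) z =
      real (Suc n) *\<^sub>R vconv (\<lambda>x. \<phi> (kp i x)) (vconv ?\<alpha> (pw \<phi> n)) z"
    unfolding Suc.IH linear_scale[OF linear_vee_right[OF linear_ident]] vconv_def[of "\<lambda>x. \<phi> (kp i x)"]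
    by (rule sw_scale) (intro l)
  also have "vconv (\<lambda>x. \<phi> (kp i x)) (vconv ?\<alpha> (pw \<phi> n)) z = vconv ?\<alpha> (pw \<phi> (Suc n)) z"
    unfolding pw.simps by (rule vconv_comm[OF \<phi> \<alpha> pl])
  also have "sw (\<lambda>x y. \<phi> (\<delta> x) \<rhd> pw \<phi> (Suc n) y) z = vconv ?\<alpha> (pw \<phi> (Suc n)) z"
    by (simp add: vconv_def)
  finally show ?case by (simp add: scaleR_add_left scaleR_2 del: pw.simps)
qed

text \<open>Each of the n factors \<phi> kills 1 and so uses up at least one letter.\<close>

lemma pw_Fil: "linear \<phi> \<Longrightarrow> \<phi> (sprod []) = 0 \<Longrightarrow> z \<in> Fil n \<Longrightarrow> pw \<phi> n z = 0"
proof (induction n arbitrary: z)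
  case 0
  then show ?case using Fil_0[OF 0(3)] by (simp add: linear_0[OF linear_eps])
next
  case (Suc n)
  note l = bilinearI linear_rules linear_app[OF Suc.prems(1)] linear_app[OF linear_pw[OF Suc.prems(1)]]
  show ?case unfolding pw.simps vconv_def
    by (rule sw_Fil_lower_eq_0[OF _ Suc.prems(3)])
      (auto intro!: l simp: Suc linear_0[OF linear_vee_left[OF linear_sym_incl]] linear_0[OF linear_vee_right[OF linear_ident]])
qed

locale cogenerator =
  fixes \<phi> :: "'a::koszul_grading sym \<Rightarrow> 'b::koszul_grading"
  assumes \<phi>_Hom: "\<phi> \<in> Hom 0" and \<phi>_one: "\<phi> (sprod []) = 0"
begin

lemmas lin_\<phi> = HomD(1)[OF \<phi>_Hom]
lemmas lin_pw = linear_pw[OF lin_\<phi>]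

lemma pw_eq_0: "z \<in> Fil N \<Longrightarrow> N \<le> n \<Longrightarrow> pw \<phi> n z = 0"
  by (rule pw_Fil[OF lin_\<phi> \<phi>_one]) (rule Fil_mono)

lemma expc_eq:
  assumes "z \<in> Fil N" "N \<le> M"
  shows "expc \<phi> z = (\<Sum>n<M. (1 / fact n) *\<^sub>R pw \<phi> n z)"
  unfolding expc_def
proof (rule sum.mono_neutral_left)
  show "{n. pw \<phi> n z \<noteq> 0} \<subseteq> {..<M}"
    using pw_eq_0[OF assms(1)] assms(2) by (metis (mono_tags, lifting) lessThan_iff linorder_not_less mem_Collect_eq order_trans subsetI)
qed auto

lemma linear_expc: "linear (expc \<phi>)"
proof (rule linearI)
  fix x y :: "'a sym" and c :: real
  obtain m n where xy: "x \<in> Fil m" "y \<in> Fil n" using Fil_exists by blast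
  let ?N = "max m n"
  have N: "x \<in> Fil ?N" "y \<in> Fil ?N" using xy by (auto intro: Fil_mono[of m] Fil_mono[of n])
  then have "x + y \<in> Fil ?N" "c *\<^sub>R x \<in> Fil ?N"
    by (auto intro: subspace_add[OF subspace_Fil] subspace_scale[OF subspace_Fil])
  from this[THEN expc_eq[OF _ order_refl]] N[THEN expc_eq[OF _ order_refl]]
  show "expc \<phi> (x + y) = expc \<phi> x + expc \<phi> y" "expc \<phi> (c *\<^sub>R x) = c *\<^sub>R expc \<phi> x"
    by (simp_all add: linear_add[OF lin_pw] linear_scale[OF lin_pw] scaleR_add_right sum.distrib
        scaleR_sum_right mult.commute)
qed

lemma expc_one: "expc \<phi> (sprod []) = sprod []"
  by (subst expc_eq[OF sprod_Fil[of "[]" 1] order_refl]) simp_all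

lemma expc_Hom: "expc \<phi> \<in> Hom 0"
proof -
  have "expc \<phi> z \<in> gr m" if z: "z \<in> gr m" for z m
  proof -
    obtain N where "z \<in> Fil N" using Fil_exists by blast
    then show ?thesis
      using HomD(2)[OF pw_Hom[OF \<phi>_Hom] z]
      by (subst expc_eq[OF _ order_refl]) (auto intro!: subspace_sum[OF subspace_gr] gr_scaleR)
  qed
  then show ?thesis by (auto simp: Hom_def linear_expc)
qed

lemma vconv_expc:
  assumes \<alpha>: "linear \<alpha>" and z: "z \<in> Fil M"
  shows "vconv \<alpha> (expc \<phi>) z = (\<Sum>n<M. (1 / fact n) *\<^sub>R vconv \<alpha> (pw \<phi> n) z)"
proof -
  note l = bilinearI linear_rules linear_app[OF \<alpha>] linear_app[OF lin_pw] linear_app[OF linear_expc]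
  have "vconv \<alpha> (expc \<phi>) z = sw (\<lambda>x y. \<Sum>n<M. (1 / fact n) *\<^sub>R (\<alpha> x \<rhd> pw \<phi> n y)) z"
    unfolding vconv_def
  proof (rule sw_Fil_cong[OF _ _ z])
    fix x y :: "'a sym" assume "y \<in> Fil M"
    then show "\<alpha> x \<rhd> expc \<phi> y = (\<Sum>n<M. (1 / fact n) *\<^sub>R (\<alpha> x \<rhd> pw \<phi> n y))"
      by (simp add: expc_eq[OF _ order_refl] linear_sum[OF linear_vee_right[OF linear_ident]]
          linear_scale[OF linear_vee_right[OF linear_ident]])
  qed (intro l)+
  also have "\<dots> = (\<Sum>n<M. (1 / fact n) *\<^sub>R vconv \<alpha> (pw \<phi> n) z)"
    unfolding vconv_def by (subst sw_sum, (intro l)[1], subst sw_scale, (intro l)[1], rule refl)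
  finally show ?thesis .
qed

text \<open>The chain rule for the exponential, by termwise use of the power rule.\<close>

lemma expc_coderivation:
  assumes \<delta>: "coderivation i \<delta>"
  shows "expc \<phi> (\<delta> z) = vconv (\<lambda>x. \<phi> (\<delta> x)) (expc \<phi>) z"
proof -
  obtain m n where mn: "z \<in> Fil m" "\<delta> z \<in> Fil n" using Fil_exists by blast
  let ?M = "max m n"
  have z: "z \<in> Fil ?M" by (rule Fil_mono[OF _ mn(1)]) simp
  have "expc \<phi> (\<delta> z) = (\<Sum>n<Suc ?M. (1 / fact n) *\<^sub>R pw \<phi> n (\<delta> z))"
    by (rule expc_eq[OF mn(2)]) simp
  also have "\<dots> = (\<Sum>n<?M. (1 / fact (Suc n)) *\<^sub>R pw \<phi> (Suc n) (\<delta> z))"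
    \<comment> \<open>The term n = 0 is \<open>eps (\<delta> z)\<close>, which is zero.\<close>
    unfolding sum.lessThan_Suc_shift by (simp add: coderivation_eps[OF \<delta>])
  also have "\<dots> = (\<Sum>n<?M. (1 / fact n) *\<^sub>R vconv (\<lambda>x. \<phi> (\<delta> x)) (pw \<phi> n) z)"
  proof (rule sum.cong)
    fix n
    have "1 / fact (Suc n) * real (Suc n) = (1 / fact n :: real)"
      by (simp add: field_simps del: of_nat_Suc)
    then show "(1 / fact (Suc n)) *\<^sub>R pw \<phi> (Suc n) (\<delta> z) = (1 / fact n) *\<^sub>R vconv (\<lambda>x. \<phi> (\<delta> x)) (pw \<phi> n) z"
      by (simp only: pw_coderivation[OF \<phi>_Hom \<delta>] scaleR_scaleR)
  qed simp
  also have "\<dots> = vconv (\<lambda>x. \<phi> (\<delta> x)) (expc \<phi>) z"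
    by (rule vconv_expc[OF linear_app[OF lin_\<phi> coderivation_linear[OF \<delta>]] z, symmetric])
  finally show ?thesis .
qed

text \<open>Only the first power has a component of length one, and by the counit law it is \<phi>.
  The sum is taken up to \<open>Suc (Suc N)\<close> so that the powers 0 and 1 are present for every
  N.\<close>

lemma sym_proj_expc: "sym_proj (expc \<phi> z) = \<phi> z"
proof -
  note l = bilinearI linear_rules linear_app[OF lin_\<phi>] linear_app[OF lin_pw]
  obtain N where z: "z \<in> Fil N" using Fil_exists by blast
  have p: "sym_proj (pw \<phi> (Suc n) z) = sw (\<lambda>x y. eps (pw \<phi> n y) *\<^sub>R \<phi> x) z" for n
    unfolding pw.simps vconv_def
    by (subst sw_linear[OF _ linear_sym_proj]) (auto intro!: l simp: sym_proj_vcons)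
  have e: "eps (pw \<phi> (Suc n) y) = 0" for n y
    unfolding pw.simps vconv_def by (subst sw_linear[OF _ linear_eps]) (auto intro!: l simp: sw_zero)
  have "sym_proj (expc \<phi> z) = (\<Sum>n<Suc (Suc N). (1 / fact n) *\<^sub>R sym_proj (pw \<phi> n z))"
    by (subst expc_eq[OF z, of "Suc (Suc N)"])
      (simp_all add: linear_sum[OF linear_sym_proj] linear_scale[OF linear_sym_proj] linear_add[OF linear_sym_proj])
  also have "\<dots> = sw (\<lambda>x y. eps y *\<^sub>R \<phi> x) z"
    unfolding sum.lessThan_Suc_shift p e
    by (simp add: linear_scale[OF linear_sym_proj] linear_scale[OF linear_eps] sw_zero)
  also have "\<dots> = \<phi> z" by (rule sw_counit_right[OF lin_\<phi>])
  finally show ?thesis .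
qed

text \<open>Vectors are primitive, so the coproduct distributes the n factors of a convolution power
  to the left and to the right in all ways. The induction step is Pascal's rule.\<close>

lemma sw_pw:
  fixes b :: "'b sym \<Rightarrow> 'b sym \<Rightarrow> 'c::real_vector"
  assumes "bilinear b"
  shows "sw b (pw \<phi> n z) = (\<Sum>i\<le>n. real (n choose i) *\<^sub>R sw (\<lambda>x y. b (pw \<phi> i x) (pw \<phi> (n - i) y)) z)"
  using assms
proof (induction n arbitrary: b z)
  case 0
  note b = 0
  have "sw (\<lambda>x y. b (eps x *\<^sub>R sprod []) (eps y *\<^sub>R sprod [])) z = sw (\<lambda>x y. eps x *\<^sub>R (eps y *\<^sub>R b (sprod []) (sprod []))) z"
    by (simp add: bilinear_lmul[OF b] bilinear_rmul[OF b] mult.commute)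
  also have "\<dots> = eps z *\<^sub>R b (sprod []) (sprod [])"
    by (rule sw_counit_left) (intro linear_rules linear_eps)
  finally show ?case by (simp add: linear_scale[OF linear_sw_arg[OF b]] sw_one[OF b])
next
  case (Suc n)
  note b = Suc.prems
  let ?T = "\<lambda>i j. sw (\<lambda>x y. b (pw \<phi> i x) (pw \<phi> j y)) z"
  note l0 = bilinearI trilinearI linear_rules linear_app[OF lin_\<phi>] linear_app[OF lin_pw] linear_sw_param
    bilinear_left[OF b] bilinear_right[OF b]
  have t: "bilinear (\<lambda>v p. b p (v \<rhd> q))" for q by (intro l0)
  have t': "bilinear (\<lambda>x p. b (pw \<phi> i p) (\<phi> x \<rhd> q))" for i q by (intro l0)
  note l = l0 braid_linear_left[OF t] braid_linear_right[OF t] braid_linear_left[OF t'] braid_linear_right[OF t'] braid_linear_param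
  \<comment> \<open>The map \<phi> and its powers have degree 0, so the sign of the exchange can be
    read off from x and p instead of their images.\<close>
  have br: "braid (\<lambda>v p. b p (v \<rhd> q)) (\<phi> x) (pw \<phi> i p) = braid (\<lambda>x p. b (pw \<phi> i p) (\<phi> x \<rhd> q)) x p" for q x p i
  proof -
    have "(\<lambda>x. braid (\<lambda>v p. b p (v \<rhd> q)) (\<phi> x) (pw \<phi> i p)) = (\<lambda>x. braid (\<lambda>x p. b (pw \<phi> i p) (\<phi> x \<rhd> q)) x p)"
    proof (rule hom_ext)
      fix m and x :: "'a sym" assume x: "x \<in> gr m"
      then have "\<phi> x \<in> gr m" using HomD(2)[OF \<phi>_Hom] by fastforce
      then show "braid (\<lambda>v p. b p (v \<rhd> q)) (\<phi> x) (pw \<phi> i p) = braid (\<lambda>x p. b (pw \<phi> i p) (\<phi> x \<rhd> q)) x p"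
        by (simp add: braid_gr[OF t] braid_gr[OF t' x] Hom_kp[OF pw_Hom[OF \<phi>_Hom]])
    qed (intro l)+
    then show ?thesis by (rule fun_cong)
  qed
  have 1: "sw (\<lambda>x y. sw (\<lambda>p q. b (\<phi> x \<rhd> pw \<phi> i p) (pw \<phi> j q)) y) z = ?T (Suc i) j" for i j
  proof -
    have "sw (\<lambda>x y. sw (\<lambda>p q. b (\<phi> x \<rhd> pw \<phi> i p) (pw \<phi> j q)) y) z =
        sw (\<lambda>w q. sw (\<lambda>x p. b (\<phi> x \<rhd> pw \<phi> i p) (pw \<phi> j q)) w) z"
      by (rule sw_assoc) (intro l)
    also have "\<dots> = ?T (Suc i) j"
      unfolding pw.simps vconv_def by (rule sw_cong, rule sw_linear[symmetric]) (intro l)+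
    finally show ?thesis .
  qed
  have 2: "sw (\<lambda>x y. sw (\<lambda>p q. braid (\<lambda>v p. b p (v \<rhd> pw \<phi> j q)) (\<phi> x) (pw \<phi> i p)) y) z = ?T i (Suc j)" for i j
  proof -
    have "sw (\<lambda>x y. sw (\<lambda>p q. braid (\<lambda>v p. b p (v \<rhd> pw \<phi> j q)) (\<phi> x) (pw \<phi> i p)) y) z =
        sw (\<lambda>w q. sw (\<lambda>x p. braid (\<lambda>x p. b (pw \<phi> i p) (\<phi> x \<rhd> pw \<phi> j q)) x p) w) z"
      unfolding br by (rule sw_assoc) (intro l)
    also have "\<dots> = sw (\<lambda>w q. sw (\<lambda>p x. b (pw \<phi> i p) (\<phi> x \<rhd> pw \<phi> j q)) w) z"
      by (rule sw_cong, rule sw_braid[OF t'])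
    also have "\<dots> = sw (\<lambda>p w. sw (\<lambda>x q. b (pw \<phi> i p) (\<phi> x \<rhd> pw \<phi> j q)) w) z"
      by (rule sw_assoc[symmetric]) (intro l)
    also have "\<dots> = ?T i (Suc j)"
      unfolding pw.simps vconv_def by (rule sw_cong, rule sw_linear[symmetric]) (intro l)+
    finally show ?thesis .
  qed
  have "sw b (pw \<phi> (Suc n) z) = sw (\<lambda>x y. sw b (\<phi> x \<rhd> pw \<phi> n y)) z"
    unfolding pw.simps vconv_def by (rule sw_linear[OF _ linear_sw_arg[OF b]]) (intro l)
  also have "\<dots> = sw (\<lambda>x y. \<Sum>i\<le>n. real (n choose i) *\<^sub>R
      (sw (\<lambda>p q. b (\<phi> x \<rhd> pw \<phi> i p) (pw \<phi> (n - i) q)) y +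
       sw (\<lambda>p q. braid (\<lambda>v p. b p (v \<rhd> pw \<phi> (n - i) q)) (\<phi> x) (pw \<phi> i p)) y)) z"
  proof (rule sw_cong)
    fix x y
    have "sw b (\<phi> x \<rhd> pw \<phi> n y) = sw (\<lambda>p q. b (\<phi> x \<rhd> p) q + braid (\<lambda>v p. b p (v \<rhd> q)) (\<phi> x) p) (pw \<phi> n y)"
      by (rule sw_vcons_braid[OF b])
    also have "\<dots> = (\<Sum>i\<le>n. real (n choose i) *\<^sub>R sw (\<lambda>p q. b (\<phi> x \<rhd> pw \<phi> i p) (pw \<phi> (n - i) q) +
        braid (\<lambda>v p. b p (v \<rhd> pw \<phi> (n - i) q)) (\<phi> x) (pw \<phi> i p)) y)"
      by (rule Suc.IH) (intro l)
    finally show "sw b (\<phi> x \<rhd> pw \<phi> n y) = (\<Sum>i\<le>n. real (n choose i) *\<^sub>R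
      (sw (\<lambda>p q. b (\<phi> x \<rhd> pw \<phi> i p) (pw \<phi> (n - i) q)) y +
       sw (\<lambda>p q. braid (\<lambda>v p. b p (v \<rhd> pw \<phi> (n - i) q)) (\<phi> x) (pw \<phi> i p)) y))"
      by (subst (asm) sw_add) (intro l)+
  qed
  also have "\<dots> = (\<Sum>i\<le>n. real (n choose i) *\<^sub>R (?T (Suc i) (n - i) + ?T i (Suc (n - i))))"
    by (subst sw_sum, (intro l)[1], subst sw_scale, (intro l)[1], subst sw_add, (intro l)+) (simp only: 1 2)
  also have "\<dots> = (\<Sum>i\<le>Suc n. real (Suc n choose i) *\<^sub>R ?T i (Suc n - i))"
  proof -
    let ?S = "\<lambda>i. ?T i (Suc n - i)"
    have "(\<Sum>i\<le>n. real (n choose i) *\<^sub>R ?T i (Suc (n - i))) = (\<Sum>i\<le>Suc n. real (n choose i) *\<^sub>R ?S i)"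
      by (simp add: Suc_diff_le del: pw.simps)
    also have "\<dots> = ?S 0 + (\<Sum>i\<le>n. real (n choose Suc i) *\<^sub>R ?S (Suc i))"
      unfolding sum.atMost_Suc_shift by simp
    finally show ?thesis
      unfolding sum.atMost_Suc_shift
      by (simp add: scaleR_add_right scaleR_add_left sum.distrib algebra_simps del: pw.simps)
  qed
  finally show ?case .
qed

text \<open>Dividing the binomial formula by n! separates the two factors, as for the functional
  equation of the exponential.\<close>

lemma expc_sw_morphism: "sw_morphism (expc \<phi>)"
proof (rule sw_morphismI[OF linear_expc expc_one])
  fix z :: "'a sym"
  obtain M where z: "z \<in> Fil M" using Fil_exists by blast
  note l = bilinearI linear_rules linear_app[OF lin_pw] linear_app[OF linear_expc]
  let ?T = "\<lambda>i j. (1 / (fact i * fact j)) *\<^sub>R sw (\<lambda>x y. pw \<phi> i x \<otimes>\<^sub>\<real> pw \<phi> j y) z"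
  have T0: "?T i j = 0" if "M \<le> i \<or> M \<le> j" for i j
  proof -
    have "sw (\<lambda>x y. pw \<phi> i x \<otimes>\<^sub>\<real> pw \<phi> j y) z = 0"
      by (rule sw_Fil_eq_0[OF _ z])
        (use that pw_eq_0[of _ M] in \<open>auto intro!: l simp: bilinear_lzero[OF bilinear_tensor] bilinear_rzero[OF bilinear_tensor]\<close>)
    then show ?thesis by simp
  qed
  \<comment> \<open>The bound 2 M makes the triangle i + j < 2 M contain the square i, j < M;
    outside the square all terms vanish.\<close>
  have "sw (\<otimes>\<^sub>\<real>) (expc \<phi> z) = (\<Sum>n<2 * M. (1 / fact n) *\<^sub>R sw (\<otimes>\<^sub>\<real>) (pw \<phi> n z))"
    by (subst expc_eq[OF z, of "2 * M"])
      (simp_all add: linear_sum[OF linear_sw_arg[OF bilinear_tensor]] linear_scale[OF linear_sw_arg[OF bilinear_tensor]])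
  also have "\<dots> = (\<Sum>n<2 * M. \<Sum>i\<le>n. ?T i (n - i))"
    unfolding sw_pw[OF bilinear_tensor] scaleR_sum_right
    by (intro sum.cong refl) (simp add: binomial_fact)
  also have "\<dots> = (\<Sum>(i, j)\<in>{(i, j). i + j < 2 * M}. ?T i j)"
    by (rule sum.triangle_reindex[symmetric])
  also have "\<dots> = (\<Sum>(i, j)\<in>{..<M} \<times> {..<M}. ?T i j)"
  proof (rule sum.mono_neutral_right)
    show "finite {(i, j). i + j < 2 * M}"
      by (rule finite_subset[of _ "{..<2 * M} \<times> {..<2 * M}"]) auto
    show "\<forall>p\<in>{(i, j). i + j < 2 * M} - {..<M} \<times> {..<M}. (case p of (i, j) \<Rightarrow> ?T i j) = 0"
    proof
      fix p assume "p \<in> {(i, j). i + j < 2 * M} - {..<M} \<times> {..<M}"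
      then obtain i j where "p = (i, j)" "M \<le> i \<or> M \<le> j" by (cases p) auto
      then show "(case p of (i, j) \<Rightarrow> ?T i j) = 0" using T0[of i j] by simp
    qed
  qed auto
  also have "\<dots> = (\<Sum>i<M. \<Sum>j<M. ?T i j)"
    by (rule sum.cartesian_product[symmetric])
  also have "\<dots> = sw (\<lambda>x y. \<Sum>i<M. \<Sum>j<M. (1 / (fact i * fact j)) *\<^sub>R (pw \<phi> i x \<otimes>\<^sub>\<real> pw \<phi> j y)) z"
    by (subst sw_sum, (intro l)[1], subst sw_sum, (intro l)[1], subst sw_scale, (intro l)[1], rule refl)
  also have "\<dots> = sw (\<lambda>x y. expc \<phi> x \<otimes>\<^sub>\<real> expc \<phi> y) z"
  proof (rule sw_Fil_cong[OF _ _ z])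
    fix x y :: "'a sym" assume xy: "x \<in> Fil M" "y \<in> Fil M"
    show "(\<Sum>i<M. \<Sum>j<M. (1 / (fact i * fact j)) *\<^sub>R (pw \<phi> i x \<otimes>\<^sub>\<real> pw \<phi> j y)) = expc \<phi> x \<otimes>\<^sub>\<real> expc \<phi> y"
      unfolding expc_eq[OF xy(1) order_refl] expc_eq[OF xy(2) order_refl]
      by (simp add: bilinear_sum[OF bilinear_tensor] sum.cartesian_product bilinear_lmul[OF bilinear_tensor]
          bilinear_rmul[OF bilinear_tensor] mult.commute)
  qed (intro l)+
  finally show "sw (\<otimes>\<^sub>\<real>) (expc \<phi> z) = sw (\<lambda>x y. expc \<phi> x \<otimes>\<^sub>\<real> expc \<phi> y) z" .
qed

lemma expc_unique: "sw_morphism F \<Longrightarrow> (\<And>x. sym_proj (F x) = \<phi> x) \<Longrightarrow> F = expc \<phi>"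
  by (rule sw_morphism_unique[OF _ expc_sw_morphism]) (simp_all add: sym_proj_expc)

end

lemma sw_morphism_sym_map:
  fixes f :: "'a::koszul_grading \<Rightarrow> 'b::koszul_grading"
  assumes f: "f \<in> Hom 0"
  shows "sw_morphism (sym_map f)"
proof (rule sw_morphismI[OF linear_sym_map[OF f]])
  show "sym_map f (sprod []) = sprod []" by (simp add: sym_map_sprod[OF f])
  note lin = linear_sym_map[OF f]
  have "sw b (sym_map f z) = sw (\<lambda>x y. b (sym_map f x) (sym_map f y)) z"
    if "bilinear b" for b :: "'b sym \<Rightarrow> 'b sym \<Rightarrow> ('b sym, 'b sym) tensor" and z
    using that
  proof (induction z arbitrary: b rule: sym_induct)
    case one
    have "bilinear (\<lambda>x y. b (sym_map f x) (sym_map f y))"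
      by (intro bilinearI linear_rules linear_app[OF lin] lin bilinear_left[OF one] bilinear_right[OF one])
    then show ?case using one by (simp add: sw_one sym_map_sprod[OF f])
  next
    case (vcons i v z)
    note l = bilinearI linear_rules bilinear_left[OF vcons.prems] bilinear_right[OF vcons.prems] linear_app[OF lin] lin
    have fv: "f v \<in> gr i" using HomD(2)[OF f vcons(1)] by simp
    have "sw b (sym_map f (v \<rhd> z)) = sw (\<lambda>x y. b (f v \<rhd> x) y + b (kp i x) (f v \<rhd> y)) (sym_map f z)"
      unfolding sym_map_vcons[OF f] by (rule sw_vcons[OF vcons.prems fv])
    also have "\<dots> = sw (\<lambda>x y. b (f v \<rhd> sym_map f x) (sym_map f y) + b (kp i (sym_map f x)) (f v \<rhd> sym_map f y)) z"
      by (rule vcons.IH) (intro l)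
    also have "\<dots> = sw (\<lambda>x y. b (sym_map f x) (sym_map f y)) (v \<rhd> z)"
      by (subst sw_vcons[OF _ vcons(1)]) (auto intro!: l simp: sym_map_vcons[OF f] Hom_kp[OF sym_map_Hom[OF f]])
    finally show ?case .
  next
    case (add x y)
    have "bilinear (\<lambda>x y. b (sym_map f x) (sym_map f y))"
      by (intro bilinearI linear_rules linear_app[OF lin] lin bilinear_left[OF add.prems] bilinear_right[OF add.prems])
    then show ?case using add by (simp add: linear_add[OF lin] linear_add[OF linear_sw_arg])
  next
    case (scale c x)
    have "bilinear (\<lambda>x y. b (sym_map f x) (sym_map f y))"
      by (intro bilinearI linear_rules linear_app[OF lin] lin bilinear_left[OF scale.prems] bilinear_right[OF scale.prems])
    then show ?case using scale by (simp add: linear_scale[OF lin] linear_scale[OF linear_sw_arg])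
  qed
  from this[OF bilinear_tensor] show "sw (\<otimes>\<^sub>\<real>) (sym_map f z) = sw (\<lambda>x y. sym_map f x \<otimes>\<^sub>\<real> sym_map f y) z" for z .
qed

lemma sym_proj_sym_map:
  fixes f :: "'a::koszul_grading \<Rightarrow> 'b::koszul_grading"
  assumes f: "f \<in> Hom 0"
  shows "sym_proj (sym_map f x) = f (sym_proj x)"
proof -
  have "(\<lambda>x. sym_proj (sym_map f x)) = (\<lambda>x. f (sym_proj x))"
  proof (rule sym_hom_ext)
    show "sym_proj (sym_map f (sprod vs)) = f (sym_proj (sprod vs))" for vs
      by (cases "length vs = 1")
        (auto simp: sym_map_sprod[OF f] sym_proj_other sym_proj_single length_Suc_conv linear_0[OF HomD(1)[OF f]])
  qed (intro linear_rules linear_app[OF HomD(1)[OF f]] linear_sym_map[OF f] linear_sym_proj)+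
  then show ?thesis by (rule fun_cong)
qed

lemma sw_morphism_comp:
  assumes F: "sw_morphism F" and G: "sw_morphism G"
  shows "sw_morphism (\<lambda>x. F (G x))"
proof (rule sw_morphismI)
  show "linear (\<lambda>x. F (G x))" by (rule linear_app[OF sw_morphism_linear[OF F] sw_morphism_linear[OF G]])
  show "F (G (sprod [])) = sprod []" by (simp add: sw_morphism_one F G)
  fix z
  have "bilinear (\<lambda>x y. F x \<otimes>\<^sub>\<real> F y)"
    by (intro bilinearI linear_rules linear_app[OF sw_morphism_linear[OF F]])
  then show "sw (\<otimes>\<^sub>\<real>) (F (G z)) = sw (\<lambda>x y. F (G x) \<otimes>\<^sub>\<real> F (G y)) z"
    by (simp add: sw_morphismD[OF F bilinear_tensor] sw_morphismD[OF G])
qed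


section \<open>Polynomial curves\<close>

text \<open>A polynomial curve in a vector space together with its formal derivative. For n = 0 the
  truncated exponent is harmless, as its coefficient is zero.\<close>

inductive poly_deriv :: "(real \<Rightarrow> 'x::real_vector) \<Rightarrow> (real \<Rightarrow> 'x) \<Rightarrow> bool" where
  monomial: "poly_deriv (\<lambda>u. u ^ n *\<^sub>R c) (\<lambda>u. (real n * u ^ (n - 1)) *\<^sub>R c)"
| add: "poly_deriv P Q \<Longrightarrow> poly_deriv P' Q' \<Longrightarrow> poly_deriv (\<lambda>u. P u + P' u) (\<lambda>u. Q u + Q' u)"

lemma poly_deriv_const: "poly_deriv (\<lambda>u. c) (\<lambda>u. 0)"
  using poly_deriv.monomial[of 0 c] by simp

lemma poly_deriv_line: "poly_deriv (\<lambda>u. c + u *\<^sub>R v) (\<lambda>u. v)"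
  using poly_deriv.add[OF poly_deriv_const[of c] poly_deriv.monomial[of 1 v]] by simp

lemma poly_deriv_linear:
  assumes L: "linear L" and "poly_deriv P Q"
  shows "poly_deriv (\<lambda>u. L (P u)) (\<lambda>u. L (Q u))"
  using assms(2)
proof induction
  case (monomial n c)
  show ?case using poly_deriv.monomial[of n "L c"] by (simp add: linear_scale[OF L])
qed (simp add: linear_add[OF L] poly_deriv.add)

lemma poly_deriv_sum:
  "(\<And>i. i \<in> A \<Longrightarrow> poly_deriv (P i) (Q i)) \<Longrightarrow> poly_deriv (\<lambda>u. \<Sum>i\<in>A. P i u) (\<lambda>u. \<Sum>i\<in>A. Q i u)"
  by (induction A rule: infinite_finite_induct) (auto intro: poly_deriv.add poly_deriv_const)

lemma poly_deriv_diff: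
  assumes "poly_deriv P Q" "poly_deriv P' Q'"
  shows "poly_deriv (\<lambda>u. P u - P' u) (\<lambda>u. Q u - Q' u)"
  using poly_deriv.add[OF assms(1) poly_deriv_linear[OF linear_compose_neg[OF linear_ident] assms(2)]]
  by simp

lemma poly_deriv_bilinear:
  assumes b: "bilinear b" and P: "poly_deriv P Q" and R: "poly_deriv R S"
  shows "poly_deriv (\<lambda>u. b (P u) (R u)) (\<lambda>u. b (Q u) (R u) + b (P u) (S u))"
  using P
proof induction
  case (monomial m c)
  show ?case using R
  proof induction
    case (monomial n d)
    have "real m * u ^ (m - 1) * u ^ n + u ^ m * (real n * u ^ (n - 1)) = real (m + n) * u ^ (m + n - 1)" for u :: real
      by (cases m; cases n) (simp_all add: algebra_simps power_add)
    then have "b ((real m * u ^ (m - 1)) *\<^sub>R c) (u ^ n *\<^sub>R d) + b (u ^ m *\<^sub>R c) ((real n * u ^ (n - 1)) *\<^sub>R d) =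
        (real (m + n) * u ^ (m + n - 1)) *\<^sub>R b c d" for u
      by (simp add: bilinear_lmul[OF b] bilinear_rmul[OF b] mult.commute flip: scaleR_add_left)
    moreover have "b (u ^ m *\<^sub>R c) (u ^ n *\<^sub>R d) = u ^ (m + n) *\<^sub>R b c d" for u
      by (simp add: bilinear_lmul[OF b] bilinear_rmul[OF b] power_add mult.commute)
    ultimately show ?case by (simp only: poly_deriv.monomial)
  next
    case (add P Q P' Q')
    from poly_deriv.add[OF add.IH] show ?case by (simp add: bilinear_radd[OF b] algebra_simps)
  qed
next
  case (add P Q P' Q')
  from poly_deriv.add[OF add.IH] show ?case by (simp add: bilinear_ladd[OF b] algebra_simps)
qed

lemma poly_deriv_sw:
  assumes "\<And>u. bilinear (b u)" "\<And>u. bilinear (b' u)" "\<And>x y. poly_deriv (\<lambda>u. b u x y) (\<lambda>u. b' u x y)"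
  shows "poly_deriv (\<lambda>u. sw (b u) z) (\<lambda>u. sw (b' u) z)"
proof -
  have "poly_deriv (\<lambda>u. tensor_lift (b u) t) (\<lambda>u. tensor_lift (b' u) t)" for t
  proof (induction t rule: tensor_induct)
    case (tensor v w)
    then show ?case by (simp add: tensor_lift_tensor assms)
  next
    case (add s t)
    then show ?case
      by (simp add: linear_add[OF linear_tensor_lift[OF assms(1)]] linear_add[OF linear_tensor_lift[OF assms(2)]]
          poly_deriv.add)
  next
    case (scale c t)
    from poly_deriv_linear[OF linear_scaleR scale] show ?case
      by (simp add: linear_scale[OF linear_tensor_lift[OF assms(1)]] linear_scale[OF linear_tensor_lift[OF assms(2)]])
  qed
  then show ?thesis by (simp add: sw_def)
qed

lemma poly_deriv_real:
  fixes P :: "real \<Rightarrow> real"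
  shows "poly_deriv P Q \<Longrightarrow> (P has_real_derivative Q u) (at u)"
proof (induction rule: poly_deriv.induct)
  case (monomial n c)
  show ?case by (auto intro!: derivative_eq_intros)
next
  case (add P Q P' Q')
  show ?case by (rule DERIV_add[OF add.IH])
qed

text \<open>One curve may arise from different sums of monomials, so it needs proof that
  antiderivatives differ by constants. A linear functional reduces this to real calculus, and
  \<open>pint\<close> becomes well defined.\<close>

lemma poly_deriv_zero:
  assumes "poly_deriv P (\<lambda>u. 0)"
  shows "P 1 = P 0"
proof (rule ccontr)
  assume "P 1 \<noteq> P 0"
  then have "P 1 - P 0 \<noteq> 0" by simp
  then obtain g :: "'a \<Rightarrow> real" where g: "linear g" "g (P 1 - P 0) \<noteq> 0"
    by (rule linear_separates)
  have "((\<lambda>u. g (P u)) has_real_derivative 0) (at u)" for u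
    using poly_deriv_real[OF poly_deriv_linear[OF g(1) assms]] by (simp add: linear_0[OF g(1)])
  then have "g (P 1) = g (P 0)" by (intro DERIV_isconst_all allI)
  then show False using g by (simp add: linear_diff)
qed

definition poly_curve :: "(real \<Rightarrow> 'x::real_vector) \<Rightarrow> bool" where
  "poly_curve Q \<longleftrightarrow> (\<exists>P. poly_deriv P Q)"

lemma poly_curve_linear: "linear L \<Longrightarrow> poly_curve Q \<Longrightarrow> poly_curve (\<lambda>u. L (Q u))"
  unfolding poly_curve_def using poly_deriv_linear by blast

text \<open>The integral over [0, 1], as the difference of values of any polynomial
  antiderivative.\<close>

definition pint :: "(real \<Rightarrow> 'x::real_vector) \<Rightarrow> 'x" where
  "pint Q = (THE y. \<exists>P. poly_deriv P Q \<and> y = P 1 - P 0)"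

lemma pint_eq: "poly_deriv P Q \<Longrightarrow> pint Q = P 1 - P 0"
  unfolding pint_def
proof (rule the_equality)
  assume P: "poly_deriv P Q"
  then show "\<exists>P'. poly_deriv P' Q \<and> P 1 - P 0 = P' 1 - P' 0" by blast
  fix y assume "\<exists>P'. poly_deriv P' Q \<and> y = P' 1 - P' 0"
  then obtain P' where P': "poly_deriv P' Q" "y = P' 1 - P' 0" by blast
  from poly_deriv_zero[of "\<lambda>u. P' u - P u"] poly_deriv_diff[OF P'(1) P]
  show "y = P 1 - P 0" by (simp add: P'(2) algebra_simps)
qed

lemma poly_deriv_curve: "poly_deriv P Q \<Longrightarrow> poly_curve P"
  unfolding poly_curve_def
proof (induction rule: poly_deriv.induct)
  case (monomial n c)
  show ?case
  proof (rule exI)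
    have "real (Suc n) * (1 / real (Suc n)) = 1" by simp
    then show "poly_deriv (\<lambda>u. u ^ Suc n *\<^sub>R ((1 / real (Suc n)) *\<^sub>R c)) (\<lambda>u. u ^ n *\<^sub>R c)"
      using poly_deriv.monomial[of "Suc n" "(1 / real (Suc n)) *\<^sub>R c"] by (simp add: field_simps del: of_nat_Suc)
  qed
next
  case (add P Q P' Q')
  then show ?case using poly_deriv.add by blast
qed

lemma pint_linear:
  assumes "linear L" "poly_curve Q"
  shows "pint (\<lambda>u. L (Q u)) = L (pint Q)"
proof -
  obtain P where P: "poly_deriv P Q" using assms(2) by (auto simp: poly_curve_def)
  from pint_eq[OF poly_deriv_linear[OF assms(1) P]] pint_eq[OF P] show ?thesis
    by (simp add: linear_diff[OF assms(1)])
qed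

lemma pint_add:
  assumes "poly_curve Q" "poly_curve Q'"
  shows "pint (\<lambda>u. Q u + Q' u) = pint Q + pint Q'"
proof -
  obtain P P' where P: "poly_deriv P Q" "poly_deriv P' Q'" using assms by (auto simp: poly_curve_def)
  from pint_eq[OF poly_deriv.add[OF P]] pint_eq[OF P(1)] pint_eq[OF P(2)] show ?thesis by simp
qed

lemma pint_gr:
  fixes Q :: "real \<Rightarrow> 'v::graded_vector"
  assumes "poly_curve Q" "\<And>u. Q u \<in> gr n"
  shows "pint Q \<in> gr n"
  unfolding gr_iff_component
proof (intro allI impI)
  fix m :: int assume "m \<noteq> n"
  then have "(\<lambda>u. component m (Q u)) = (\<lambda>u. 0)" using component_of_gr[OF assms(2)] by simp
  then have "component m (pint Q) = pint (\<lambda>u. 0 :: 'v)"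
    using pint_linear[OF linear_component assms(1), of m] by simp
  also have "\<dots> = 0" using pint_eq[OF poly_deriv_const[of "0 :: 'v"]] by simp
  finally show "component m (pint Q) = 0" .
qed

text \<open>A Sweedler sum is a finite sum, with which the integral commutes. Both claims go through
  one induction, since additivity of \<open>pint\<close> is available for polynomial curves.\<close>

lemma pint_sw:
  assumes lin: "\<And>u. linear (B u)" and curve: "\<And>x. poly_curve (\<lambda>u. B u x)" and b: "bilinear b"
    and f: "linear f" and P: "linear (\<lambda>x. pint (\<lambda>u. B u x))"
  shows "poly_curve (\<lambda>u. sw (\<lambda>x y. b (f x) (B u y)) z) \<and>
    pint (\<lambda>u. sw (\<lambda>x y. b (f x) (B u y)) z) = sw (\<lambda>x y. b (f x) (pint (\<lambda>u. B u y))) z"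
proof -
  have bl: "bilinear (\<lambda>x y. b (f x) (B u y))" for u
    by (intro bilinearI bilinear_left[OF b] bilinear_right[OF b] f lin)
  have bp: "bilinear (\<lambda>x y. b (f x) (pint (\<lambda>u. B u y)))"
    by (intro bilinearI bilinear_left[OF b] bilinear_right[OF b] f P)
  have "poly_curve (\<lambda>u. tensor_lift (\<lambda>x y. b (f x) (B u y)) t) \<and>
    pint (\<lambda>u. tensor_lift (\<lambda>x y. b (f x) (B u y)) t) = tensor_lift (\<lambda>x y. b (f x) (pint (\<lambda>u. B u y))) t" for t
  proof (induction t rule: tensor_induct)
    case (tensor v w)
    have "linear (b (f v))" using b by (simp add: bilinear_def)
    moreover obtain P where "poly_deriv P (\<lambda>u. B u w)" using curve by (auto simp: poly_curve_def)
    ultimately show ?case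
      using pint_linear[OF _ curve, of "b (f v)" w] poly_deriv_linear
      by (auto simp: tensor_lift_tensor bl bp poly_curve_def)
  next
    case (add s t)
    then show ?case
      by (auto simp: linear_add[OF linear_tensor_lift[OF bl]] linear_add[OF linear_tensor_lift[OF bp]] pint_add)
        (auto simp: poly_curve_def intro: poly_deriv.add)
  next
    case (scale c t)
    then show ?case
      using pint_linear[OF linear_scaleR[of c], of "\<lambda>u. tensor_lift (\<lambda>x y. b (f x) (B u y)) t"]
      by (auto simp: linear_scale[OF linear_tensor_lift[OF bl]] linear_scale[OF linear_tensor_lift[OF bp]])
        (auto simp: poly_curve_def intro: poly_deriv_linear[OF linear_scaleR])
  qed
  then show ?thesis by (simp add: sw_def)
qed

text \<open>The product rule gives n summands, made equal by \<open>vconv_comm\<close>; all degrees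
  are 0 here, so there are no signs.\<close>

lemma poly_deriv_pw:
  assumes \<phi>: "\<phi> \<in> Hom 0" and \<alpha>: "\<alpha> \<in> Hom 0"
  shows "poly_deriv (\<lambda>u. pw (\<lambda>x. \<phi> x + u *\<^sub>R \<alpha> x) n z)
    (\<lambda>u. real n *\<^sub>R vconv \<alpha> (pw (\<lambda>x. \<phi> x + u *\<^sub>R \<alpha> x) (n - 1)) z)"
proof (induction n arbitrary: z)
  case 0
  show ?case using poly_deriv_const by simp
next
  case (Suc n)
  let ?\<phi> = "\<lambda>u x. \<phi> x + u *\<^sub>R \<alpha> x"
  have \<phi>u: "?\<phi> u \<in> Hom 0" for u
    using \<phi> \<alpha> by (auto simp: Hom_def intro!: linear_rules gr_add gr_scaleR)
  note lpw = linear_pw[OF HomD(1)[OF \<phi>u]]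
  note l = bilinearI linear_rules linear_app[OF HomD(1)[OF \<phi>]] linear_app[OF HomD(1)[OF \<alpha>]]
    linear_app[OF lpw] linear_app[OF linear_vconv[OF HomD(1)[OF \<alpha>] lpw]]
  have "poly_deriv (\<lambda>u. sw (\<lambda>x y. ?\<phi> u x \<rhd> pw (?\<phi> u) n y) z)
      (\<lambda>u. sw (\<lambda>x y. \<alpha> x \<rhd> pw (?\<phi> u) n y + ?\<phi> u x \<rhd> real n *\<^sub>R vconv \<alpha> (pw (?\<phi> u) (n - 1)) y) z)"
  proof (rule poly_deriv_sw)
    have "bilinear (\<lambda>(v :: 'b) x. v \<rhd> x)" by (intro l)
    from poly_deriv_bilinear[OF this poly_deriv_line Suc.IH]
    show "poly_deriv (\<lambda>u. ?\<phi> u x \<rhd> pw (?\<phi> u) n y)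
      (\<lambda>u. \<alpha> x \<rhd> pw (?\<phi> u) n y + ?\<phi> u x \<rhd> real n *\<^sub>R vconv \<alpha> (pw (?\<phi> u) (n - 1)) y)" for x y .
  qed (intro l)+
  moreover have "sw (\<lambda>x y. \<alpha> x \<rhd> pw (?\<phi> u) n y + ?\<phi> u x \<rhd> real n *\<^sub>R vconv \<alpha> (pw (?\<phi> u) (n - 1)) y) z =
      real (Suc n) *\<^sub>R vconv \<alpha> (pw (?\<phi> u) (Suc n - 1)) z" for u
  proof -
    have "sw (\<lambda>x y. \<alpha> x \<rhd> pw (?\<phi> u) n y + ?\<phi> u x \<rhd> real n *\<^sub>R vconv \<alpha> (pw (?\<phi> u) (n - 1)) y) z =
        vconv \<alpha> (pw (?\<phi> u) n) z + real n *\<^sub>R vconv (?\<phi> u) (vconv \<alpha> (pw (?\<phi> u) (n - 1))) z"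
      unfolding linear_scale[OF linear_vee_right[OF linear_ident]] vconv_def[of "?\<phi> u"] vconv_def[of \<alpha> "pw (?\<phi> u) n"]
      by (subst sw_add, (intro l)+, subst sw_scale, (intro l)[1], rule refl)
    moreover have "real n *\<^sub>R vconv (?\<phi> u) (vconv \<alpha> (pw (?\<phi> u) (n - 1))) z = real n *\<^sub>R vconv \<alpha> (pw (?\<phi> u) n) z"
      using vconv_comm[OF \<phi>u \<alpha> lpw, of u u "n - 1" z] by (cases n) (simp_all del: of_nat_Suc)
    ultimately show ?thesis by (simp add: scaleR_add_left)
  qed
  ultimately show ?case by (simp add: vconv_def[of "?\<phi> _" "pw _ _"])
qed

text \<open>Termwise differentiation. The sum contains one power more than \<open>Fil M\<close>
  requires, because differentiation lowers the exponent by one.\<close>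

lemma poly_deriv_expc:
  assumes "cogenerator \<phi>" and \<alpha>: "\<alpha> \<in> Hom 0" "\<alpha> (sprod []) = 0"
  shows "poly_deriv (\<lambda>u. expc (\<lambda>x. \<phi> x + u *\<^sub>R \<alpha> x) z) (\<lambda>u. vconv \<alpha> (expc (\<lambda>x. \<phi> x + u *\<^sub>R \<alpha> x)) z)"
proof -
  interpret cogenerator \<phi> by fact
  let ?\<phi> = "\<lambda>u x. \<phi> x + u *\<^sub>R \<alpha> x"
  have cu: "cogenerator (?\<phi> u)" for u
  proof
    show "?\<phi> u \<in> Hom 0" using \<phi>_Hom \<alpha> by (auto simp: Hom_def intro!: linear_rules gr_add gr_scaleR)
  qed (simp add: \<phi>_one \<alpha>)
  obtain M where z: "z \<in> Fil M" using Fil_exists by blast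
  have "poly_deriv (\<lambda>u. \<Sum>n<Suc M. (1 / fact n) *\<^sub>R pw (?\<phi> u) n z)
      (\<lambda>u. \<Sum>n<Suc M. (1 / fact n) *\<^sub>R (real n *\<^sub>R vconv \<alpha> (pw (?\<phi> u) (n - 1)) z))"
    by (rule poly_deriv_sum, rule poly_deriv_linear[OF linear_scaleR], rule poly_deriv_pw[OF \<phi>_Hom \<alpha>(1)])
  moreover have "(\<Sum>n<Suc M. (1 / fact n) *\<^sub>R pw (?\<phi> u) n z) = expc (?\<phi> u) z" for u
    by (rule cogenerator.expc_eq[OF cu z, symmetric]) simp
  moreover have "(\<Sum>n<Suc M. (1 / fact n) *\<^sub>R (real n *\<^sub>R vconv \<alpha> (pw (?\<phi> u) (n - 1)) z)) = vconv \<alpha> (expc (?\<phi> u)) z" for u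
  proof -
    have c: "1 / fact (Suc n) * real (Suc n) = (1 / fact n :: real)" for n
      by (simp add: field_simps del: of_nat_Suc)
    show ?thesis
      unfolding sum.lessThan_Suc_shift cogenerator.vconv_expc[OF cu HomD(1)[OF \<alpha>(1)] z]
      by (simp only: scaleR_scaleR c diff_Suc_1) simp
  qed
  ultimately show ?thesis by simp
qed


section \<open>Products and derivations of the exterior algebra\<close>

definition wcons :: "'n::koszul_grading \<Rightarrow> 'n ext \<Rightarrow> 'n ext" where
  "wcons = (SOME m. bilinear m \<and> (\<forall>v vs. m v (wprod vs) = wprod (v # vs)))"

lemma bilinear_wcons: "bilinear (wcons :: 'n::koszul_grading \<Rightarrow> _)"
  and wcons_wprod: "wcons v (wprod vs) = wprod (v # vs :: 'n list)"
proof -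
  have "\<exists>m. bilinear m \<and> (\<forall>vs (v :: 'n). m (wprod vs) v = wprod (v # vs))"
  proof (rule bilinear_exists_two_step[OF _ _ span_wprod])
    show "linear (\<lambda>v :: 'n. wprod (v # vs))" for vs
      using multilinearD[OF multilinear_wprod, of "[]"] by simp
    show "\<exists>M. linear M \<and> (\<forall>vs. M (wprod vs) = wprod (v # vs))" for v :: 'n
      using multilinear_append(1)[OF multilinear_wprod, of "[v]"] swap_rule_append(1)[OF swap_rule_wprod, of "[v]"]
      by (intro ext_exists) simp_all
  qed
  then obtain m where m: "bilinear m" "\<And>vs (v :: 'n). m (wprod vs) v = wprod (v # vs)" by blast
  have "bilinear (\<lambda>v y. m y v)" using m(1) by (simp add: bilinear_def)
  then have "\<exists>m. bilinear m \<and> (\<forall>v vs. m v (wprod vs) = wprod (v # vs :: 'n list))" using m(2) by blast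
  from someI_ex[OF this] show "bilinear (wcons :: 'n \<Rightarrow> _)" "wcons v (wprod vs) = wprod (v # vs)"
    unfolding wcons_def by blast+
qed

lemma linear_wcons_left [linear_rules]: "linear f \<Longrightarrow> linear (\<lambda>u. wcons (f u) y)"
  by (fact bilinear_left[OF bilinear_wcons])

lemma linear_wcons_right [linear_rules]: "linear f \<Longrightarrow> linear (\<lambda>u. wcons v (f u))"
  by (fact bilinear_right[OF bilinear_wcons])

lemma wcons_swap:
  assumes "v \<in> gr i" "w \<in> gr j"
  shows "wcons v (wcons w x) = (- sg (i * j)) *\<^sub>R wcons w (wcons v x)"
proof -
  have "(\<lambda>x. wcons v (wcons w x)) = (\<lambda>x. (- sg (i * j)) *\<^sub>R wcons w (wcons v x))"
  proof (rule ext_hom_ext)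
    show "wcons v (wcons w (wprod vs)) = (- sg (i * j)) *\<^sub>R wcons w (wcons v (wprod vs))" for vs
      using swap_ruleD[OF swap_rule_wprod assms, of "[]" vs] by (simp add: wcons_wprod)
  qed (intro linear_rules)+
  then show ?thesis by (rule fun_cong)
qed

lemma wone_gr: "wprod [] \<in> gr 0"
  unfolding gr_ext_def by (rule span_base) force

lemma wcons_gr: "v \<in> gr i \<Longrightarrow> x \<in> gr n \<Longrightarrow> wcons v x \<in> gr (i + n)"
proof -
  assume v: "v \<in> gr i" and x: "x \<in> gr n"
  have sub: "subspace (gr (i + n) :: 'a ext set)" by (simp add: gr_ext_def)
  have lin: "linear (wcons v)" by (rule linear_wcons_right[OF linear_ident])
  from x show ?thesis unfolding gr_ext_def[of n]
  proof (induction rule: span_induct_alt)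
    case base
    show ?case by (simp add: linear_0[OF lin] subspace_0[OF sub])
  next
    case (step c x y)
    then obtain ds vs where x: "x = wprod vs" "homs ds vs" "sum_list ds = n" by blast
    have "wprod (v # vs) \<in> gr (i + n)"
      unfolding gr_ext_def by (rule span_base) (use x v in \<open>force intro: exI[of _ "i # ds"]\<close>)
    then show ?case using step(2)
      by (simp add: linear_add[OF lin] linear_scale[OF lin] x(1) wcons_wprod
          subspace_add[OF sub] subspace_scale[OF sub])
  qed
qed

text \<open>\<open>wder\<close> extends a bilinear action \<open>A\<close> of degree 1 to the exterior algebra as a graded derivation.\<close>

primrec wder_list :: "('x::koszul_grading \<Rightarrow> 'n::koszul_grading \<Rightarrow> 'n) \<Rightarrow> 'x \<Rightarrow> 'n list \<Rightarrow> 'n ext" where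
  "wder_list A x [] = 0"
| "wder_list A x (v # vs) = wcons (A x v) (wprod vs) + braid (\<lambda>x v. wcons (kp 1 v) (wder_list A x vs)) x v"

definition wder :: "('x::koszul_grading \<Rightarrow> 'n::koszul_grading \<Rightarrow> 'n) \<Rightarrow> 'x \<Rightarrow> 'n ext \<Rightarrow> 'n ext" where
  "wder A = (SOME m. bilinear m \<and> (\<forall>x vs. m x (wprod vs) = wder_list A x vs))"

text \<open>The form of the adjoint action \<open>act\<close>, and also of \<open>act\<close> pulled
  back along a degree 0 map, see \<open>wder_comp\<close>.\<close>

locale degree_one_action =
  fixes A :: "'x::koszul_grading \<Rightarrow> 'n::koszul_grading \<Rightarrow> 'n"
  assumes bil_A: "bilinear A" and A_gr: "\<And>m d x v. x \<in> gr m \<Longrightarrow> v \<in> gr d \<Longrightarrow> A x v \<in> gr (m + d + 1)"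
begin

lemma linear_wder_list: "linear (\<lambda>x. wder_list A x vs)"
proof (induction vs)
  case Nil
  show ?case by (simp add: linear_zero)
next
  case (Cons v vs)
  have "bilinear (\<lambda>x v. wcons (kp 1 v) (wder_list A x vs))"
    by (intro bilinearI linear_rules linear_app[OF Cons])
  then show ?case unfolding wder_list.simps
    by (intro linear_rules bilinear_left[OF bil_A] braid_linear_left)
qed

lemma bilinear_wcons_wder_list: "bilinear (\<lambda>x v. wcons (kp 1 v) (wder_list A x vs))"
  by (intro bilinearI linear_rules linear_app[OF linear_wder_list])

lemma wder_list_Cons:
  assumes "x \<in> gr m"
  shows "wder_list A x (v # vs) = wcons (A x v) (wprod vs) + wcons (kp (m + 1) v) (wder_list A x vs)"
  by (simp add: braid_gr[OF bilinear_wcons_wder_list assms] kp_kp add.commute)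

lemma multilinear_wder_list: "multilinear (wder_list A x)"
proof -
  have "linear (\<lambda>v. wder_list A x (us @ v # ws))" for us ws x
  proof (induction us arbitrary: x)
    case Nil
    show ?case
      using braid_linear_right[OF bilinear_wcons_wder_list, of "\<lambda>v. v"]
      by (simp add: linear_rules bilinear_right[OF bil_A])
  next
    case (Cons u us)
    have "linear (\<lambda>v. wcons (A x u) (wprod (us @ v # ws)))"
      by (intro linear_rules multilinearD[OF multilinear_wprod])
    moreover have "linear (\<lambda>v. braid (\<lambda>x u. wcons (kp 1 u) (wder_list A x (us @ v # ws))) x u)"
      by (intro braid_linear_param linear_rules Cons)
    ultimately show ?case by (simp add: linear_compose_add)
  qed
  then show ?thesis by (simp add: multilinear_def)
qed

lemma swap_rule_wder_list:
  assumes x: "x \<in> gr m"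
  shows "swap_rule (-1) (wder_list A x)"
proof -
  have "wder_list A x (us @ v # w # ws) = (-1 * sg (i * j)) *\<^sub>R wder_list A x (us @ w # v # ws)"
    if v: "v \<in> gr i" and w: "w \<in> gr j" for us v w ws i j
  proof (induction us)
    case Nil
    note sc = bilinear_lmul[OF bilinear_wcons] bilinear_rmul[OF bilinear_wcons] bilinear_radd[OF bilinear_wcons]
    have "wcons (A x v) (wcons w y) = (- sg ((m + i + 1) * j)) *\<^sub>R wcons w (wcons (A x v) y)"
      "wcons (A x w) (wcons v y) = (- sg ((m + j + 1) * i)) *\<^sub>R wcons v (wcons (A x w) y)" for y
      by (rule wcons_swap[OF A_gr[OF x v] w] wcons_swap[OF A_gr[OF x w] v])+
    then show ?case
      by (simp only: append_Nil wder_list_Cons[OF x] kp_gr[OF v] kp_gr[OF w] sc wcons_wprod[symmetric]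
          wcons_swap[OF v w, of "wder_list A x ws"])
        (auto simp: sg_def algebra_simps)
  next
    case (Cons u us)
    have "wcons (A x u) (wprod (us @ v # w # ws)) = (-1 * sg (i * j)) *\<^sub>R wcons (A x u) (wprod (us @ w # v # ws))"
      using swap_ruleD[OF swap_rule_wprod v w, of us ws] by (simp add: bilinear_rneg[OF bilinear_wcons] bilinear_rmul[OF bilinear_wcons])
    then show ?case
      by (simp only: append_Cons wder_list_Cons[OF x] Cons bilinear_rmul[OF bilinear_wcons] scaleR_add_right)
  qed
  then show ?thesis unfolding swap_rule_def by blast
qed

lemma bilinear_wder: "bilinear (wder A)"
  and wder_wprod: "wder A x (wprod vs) = wder_list A x vs"
proof -
  have "swap_rule (-1) (wder_list A x)" for x
  proof -
    have "(\<lambda>x. wder_list A x (us @ v # w # ws)) = (\<lambda>x. (-1 * sg (i * j)) *\<^sub>R wder_list A x (us @ w # v # ws))"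
      if "v \<in> gr i" "w \<in> gr j" for us v w ws i j
    proof (rule hom_ext)
      show "wder_list A x (us @ v # w # ws) = (-1 * sg (i * j)) *\<^sub>R wder_list A x (us @ w # v # ws)"
        if "x \<in> gr n" for x n
        by (rule swap_ruleD[OF swap_rule_wder_list[OF that]]) fact+
    qed (intro linear_rules linear_wder_list)+
    then show ?thesis unfolding swap_rule_def fun_eq_iff by blast
  qed
  then have "\<exists>M. linear M \<and> (\<forall>vs. M (wprod vs) = wder_list A x vs)" for x
    by (intro ext_exists multilinear_wder_list)
  from bilinear_exists_two_step[OF linear_wder_list this span_wprod]
  obtain m where m: "bilinear m" "\<And>vs x. m (wprod vs) x = wder_list A x vs" by blast
  have "bilinear (\<lambda>x y. m y x)" using m(1) by (simp add: bilinear_def)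
  then have "\<exists>m. bilinear m \<and> (\<forall>x vs. m x (wprod vs) = wder_list A x vs)" using m(2) by blast
  from someI_ex[OF this] show "bilinear (wder A)" "wder A x (wprod vs) = wder_list A x vs"
    unfolding wder_def by blast+
qed

lemma wder_one: "wder A x (wprod []) = 0"
  by (simp add: wder_wprod)

lemma bilinear_wcons_wder: "bilinear (\<lambda>x v. wcons (kp 1 v) (wder A x y))"
  by (intro bilinearI linear_rules bilinear_left[OF bilinear_wder])

lemma wder_wcons: "wder A x (wcons v y) = wcons (A x v) y + braid (\<lambda>x v. wcons (kp 1 v) (wder A x y)) x v"
proof -
  have "(\<lambda>y. wder A x (wcons v y)) = (\<lambda>y. wcons (A x v) y + braid (\<lambda>x v. wcons (kp 1 v) (wder A x y)) x v)"
    by (rule ext_hom_ext)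
      (intro linear_rules braid_linear_param bilinear_right[OF bilinear_wder] | simp add: wcons_wprod wder_wprod)+
  then show ?thesis by (rule fun_cong)
qed

end


section \<open>Twisted differentials and the transgression\<close>

text \<open>The formula of D_\<rho> with the action B pulled back along F, for cochains of degree r.
  When F does not commute with the codifferentials the square may be nonzero; the argument rests on
  the Leibniz rule and the Bianchi identity instead.\<close>

definition tdiff :: "('b::koszul_grading sym \<Rightarrow> 'x \<Rightarrow> 'x) \<Rightarrow> ('a::koszul_grading sym \<Rightarrow> 'b sym) \<Rightarrow>
    ('a sym \<Rightarrow> 'a sym) \<Rightarrow> int \<Rightarrow> ('a sym \<Rightarrow> 'x::real_vector) \<Rightarrow> 'a sym \<Rightarrow> 'x" where
  "tdiff B F d r Y z = sw (\<lambda>x y. B (F (kp r x)) (Y y)) z - sg r *\<^sub>R Y (d z)"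

text \<open>The product of cochains induced by the exterior product. Here r is the degree of Y, and
  \<open>kp r\<close> is the Koszul sign of \<alpha> \<otimes> Y.\<close>

definition star :: "('a::koszul_grading sym \<Rightarrow> 'n::koszul_grading) \<Rightarrow> int \<Rightarrow> ('a sym \<Rightarrow> 'n ext) \<Rightarrow> 'a sym \<Rightarrow> 'n ext" where
  "star \<alpha> r Y z = sw (\<lambda>x y. wcons (\<alpha> (kp r x)) (Y y)) z"

text \<open>The powers in \<open>wedge_power\<close>, in recursive form and starting with the counit
  for k = 0, see \<open>wedge_power_eq\<close>. For K of degree 1 the power \<open>wpow K k\<close>
  has degree k.\<close>

primrec wpow :: "('a::koszul_grading sym \<Rightarrow> 'n::koszul_grading) \<Rightarrow> nat \<Rightarrow> 'a sym \<Rightarrow> 'n ext" where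
  "wpow K 0 = (\<lambda>z. eps z *\<^sub>R wprod [])"
| "wpow K (Suc k) = star K (int k) (wpow K k)"

text \<open>\<open>transg a K k\<close> is the alternating sum of the products of \<open>k\<close> factors, one equal to \<open>a\<close> and
  the others to \<open>K\<close>; its twisted differential is the derivative of \<open>wpow K k\<close> in the direction
  of the differential of \<open>a\<close>.\<close>

primrec transg :: "('a::koszul_grading sym \<Rightarrow> 'n::koszul_grading) \<Rightarrow> ('a sym \<Rightarrow> 'n) \<Rightarrow> nat \<Rightarrow> 'a sym \<Rightarrow> 'n ext" where
  "transg a K 0 = (\<lambda>z. 0)"
| "transg a K (Suc k) = (\<lambda>z. star a (int k) (wpow K k) z - star K (int k - 1) (transg a K k) z)"

lemma linear_star:
  assumes "linear \<alpha>" "linear Y"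
  shows "linear (star \<alpha> r Y)"
  unfolding star_def[abs_def]
  by (intro linear_sw_arg bilinearI linear_rules linear_app[OF assms(1)] linear_app[OF assms(2)])

lemma linear_wpow: "linear K \<Longrightarrow> linear (wpow K k)"
  by (induction k) (auto intro: linear_star linear_rules linear_eps)

lemma linear_transg: "linear a \<Longrightarrow> linear K \<Longrightarrow> linear (transg a K k)"
  by (induction k) (auto intro: linear_star linear_wpow linear_compose_sub simp: linear_zero)

lemma star_zero_left: "star (\<lambda>z. 0) r Y z = 0"
  by (simp add: star_def sw_zero bilinear_lzero[OF bilinear_wcons])

lemma star_zero_right: "star \<alpha> r (\<lambda>z. 0) z = 0"
  by (simp add: star_def sw_zero bilinear_rzero[OF bilinear_wcons])

lemma subspace_gr_ext: "subspace (gr n :: 'n::grading ext set)"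
  by (simp add: gr_ext_def)

lemma star_gr:
  assumes \<alpha>: "\<alpha> \<in> Hom q" and Y: "linear Y" "\<And>n z. z \<in> gr n \<Longrightarrow> Y z \<in> gr (n + s)" and z: "z \<in> gr n"
  shows "star \<alpha> r Y z \<in> gr (n + q + s)"
  unfolding star_def
proof (rule sw_gr[OF z _ subspace_gr_ext])
  show "bilinear (\<lambda>x y. wcons (\<alpha> (kp r x)) (Y y))"
    by (intro bilinearI linear_rules linear_app[OF HomD(1)[OF \<alpha>]] linear_app[OF Y(1)])
  show "wcons (\<alpha> (kp r x)) (Y y) \<in> gr (n + q + s)" if "x \<in> gr i" "y \<in> gr j" "i + j = n" for i j x y
    using wcons_gr[OF HomD(2)[OF \<alpha> kp_mem_gr[OF that(1)]] Y(2)[OF that(2)]]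
    by (simp add: that(3)[symmetric] algebra_simps)
qed

lemma wpow_gr:
  assumes K: "K \<in> Hom 1"
  shows "z \<in> gr n \<Longrightarrow> wpow K k z \<in> gr (n + int k)"
proof (induction k arbitrary: n z)
  case 0
  then show ?case using wone_gr eps_gr[OF 0]
    by (cases "n = 0") (auto intro: subspace_scale[OF subspace_gr_ext] subspace_0[OF subspace_gr_ext])
next
  case (Suc k)
  from star_gr[OF K linear_wpow[OF HomD(1)[OF K]] Suc.IH Suc.prems]
  show ?case by (simp add: add.commute add.left_commute)
qed

lemma transg_gr:
  assumes a: "a \<in> Hom 0" and K: "K \<in> Hom 1"
  shows "z \<in> gr n \<Longrightarrow> transg a K k z \<in> gr (n + (int k - 1))"
proof (induction k arbitrary: n z)
  case 0
  show ?case by (simp add: subspace_0[OF subspace_gr_ext])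
next
  case (Suc k)
  from star_gr[OF a linear_wpow[OF HomD(1)[OF K]] wpow_gr[OF K] Suc.prems, where r="int k"]
    star_gr[OF K linear_transg[OF HomD(1)[OF a] HomD(1)[OF K]] Suc.IH Suc.prems, where r="int k - 1"]
  show ?case by (auto intro: subspace_diff[OF subspace_gr_ext])
qed

lemma poly_deriv_star:
  assumes lin: "\<And>u. linear (\<alpha> u)" "\<And>u. linear (\<alpha>' u)" "\<And>u. linear (Y u)" "\<And>u. linear (Y' u)"
    and \<alpha>: "\<And>x. poly_deriv (\<lambda>u. \<alpha> u x) (\<lambda>u. \<alpha>' u x)" and Y: "\<And>x. poly_deriv (\<lambda>u. Y u x) (\<lambda>u. Y' u x)"
  shows "poly_deriv (\<lambda>u. star (\<alpha> u) r (Y u) z) (\<lambda>u. star (\<alpha>' u) r (Y u) z + star (\<alpha> u) r (Y' u) z)"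
proof -
  note l = bilinearI linear_rules lin[THEN linear_app]
  have "poly_deriv (\<lambda>u. star (\<alpha> u) r (Y u) z)
      (\<lambda>u. sw (\<lambda>x y. wcons (\<alpha>' u (kp r x)) (Y u y) + wcons (\<alpha> u (kp r x)) (Y' u y)) z)"
    unfolding star_def
    by (rule poly_deriv_sw, (intro l)+, rule poly_deriv_bilinear[OF bilinear_wcons \<alpha> Y])
  moreover have "sw (\<lambda>x y. wcons (\<alpha>' u (kp r x)) (Y u y) + wcons (\<alpha> u (kp r x)) (Y' u y)) z =
      star (\<alpha>' u) r (Y u) z + star (\<alpha> u) r (Y' u) z" for u
    unfolding star_def by (rule sw_add) (intro l)+
  ultimately show ?thesis by simp
qed

text \<open>In the application \<open>lam\<close> is the structure map of the extension g',
  \<open>d\<close> the codifferential of h, \<open>emb\<close> the inclusion of n[1], and A the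
  action of g' on n[1]. The condition \<open>lam_codiff\<close> is the component in g'[1] of the
  square of the codifferential.\<close>

locale twisted = degree_one_action A
  for A :: "'e::koszul_grading sym \<Rightarrow> 'n::koszul_grading \<Rightarrow> 'n" +
  fixes lam :: "'e sym \<Rightarrow> 'e" and d :: "'h::koszul_grading sym \<Rightarrow> 'h sym" and emb :: "'n \<Rightarrow> 'e"
  assumes lam: "lam \<in> Hom 1" and lam_codiff: "\<And>z. lam (codiff lam z) = 0"
    and d: "coderivation 1 d" and dd: "\<And>z. d (d z) = 0"
    and emb: "emb \<in> Hom 0" "inj emb"
    and emb_A: "\<And>x v. emb (A x v) = lam (x \<or>\<^sub>S sym_incl (emb v))"
begin

lemmas lin_d = coderivation_linear[OF d]

text \<open>\<open>wder A\<close> is a derivation of the exterior algebra and \<open>d\<close> a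
  coderivation of S(h[1]). The sign arises from moving an operator of degree 1 past
  \<alpha>.\<close>

lemma leibniz:
  assumes F: "F \<in> Hom 0" and \<alpha>: "\<alpha> \<in> Hom q" and Y: "linear Y"
  shows "tdiff (wder A) F d (q + r) (star \<alpha> r Y) z =
    star (tdiff A F d q \<alpha>) r Y z + sg q *\<^sub>R star \<alpha> (r + 1) (tdiff (wder A) F d r Y) z"
proof -
  note l0 = bilinearI trilinearI linear_rules linear_app[OF HomD(1)[OF F]] linear_app[OF HomD(1)[OF \<alpha>]]
    linear_app[OF Y] linear_app[OF lin_d] linear_sw_param bilinear_left[OF bil_A] bilinear_right[OF bil_A]
    bilinear_left[OF bilinear_wder] bilinear_right[OF bilinear_wder]
  let ?t = "\<lambda>v x y. wcons (\<alpha> (kp (r + 1) y)) (wder A (F (kp r x)) (Y v))"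
  have t: "bilinear (?t v)" for v by (intro l0)
  note l1 = l0 braid_linear_left[OF t] braid_linear_right[OF t] braid_linear_left[OF bilinear_wcons_wder]
    braid_linear_right[OF bilinear_wcons_wder] braid_linear_param
  \<comment> \<open>Moving F x past \<alpha> y and shifting the sign operators to the arguments
    leaves only the constant (-1)^q, because F has degree 0.\<close>
  have br: "braid (\<lambda>x v'. wcons (kp 1 v') (wder A x (Y v))) (F (kp (q + r) x)) (\<alpha> (kp r y)) = sg q *\<^sub>R braid (?t v) x y"
    for v x y
  proof -
    have "(\<lambda>x. braid (\<lambda>x v'. wcons (kp 1 v') (wder A x (Y v))) (F (kp (q + r) x)) (\<alpha> (kp r y))) =
        (\<lambda>x. sg q *\<^sub>R braid (?t v) x y)"
    proof (rule hom_ext)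
      fix m and x :: "'h sym" assume x: "x \<in> gr m"
      have Fx: "F (kp (q + r) x) \<in> gr m" using HomD(2)[OF F kp_mem_gr[OF x]] by simp
      have "braid (\<lambda>x v'. wcons (kp 1 v') (wder A x (Y v))) (F (kp (q + r) x)) (\<alpha> (kp r y)) =
          (sg ((m + 1) * q) * sg (q * m)) *\<^sub>R wcons (\<alpha> (kp (r + 1 + m) y)) (wder A (F (kp r x)) (Y v))"
      proof -
        have "kp (q + r) x = sg (q * m) *\<^sub>R kp r x"
          using kp_gr[OF kp_mem_gr[OF x, of r], of q] by (simp add: kp_kp)
        moreover have "kp 1 (kp m (\<alpha> (kp r y))) = sg ((m + 1) * q) *\<^sub>R \<alpha> (kp (r + 1 + m) y)"
        proof -
          have "kp 1 (kp m (\<alpha> (kp r y))) = kp (m + 1) (\<alpha> (kp r y))"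
            by (simp add: kp_kp add.commute)
          also have "\<dots> = sg ((m + 1) * q) *\<^sub>R \<alpha> (kp (m + 1) (kp r y))" by (rule Hom_kp[OF \<alpha>])
          finally show ?thesis by (simp add: kp_kp ac_simps)
        qed
        ultimately show ?thesis
          unfolding braid_gr[OF bilinear_wcons_wder Fx]
          by (simp add: linear_scale[OF HomD(1)[OF F]]
              bilinear_lmul[OF bilinear_wder] bilinear_lmul[OF bilinear_wcons] bilinear_rmul[OF bilinear_wcons])
      qed
      also have "sg ((m + 1) * q) * sg (q * m) = sg q" by (simp add: sg_def)
      finally show "braid (\<lambda>x v'. wcons (kp 1 v') (wder A x (Y v))) (F (kp (q + r) x)) (\<alpha> (kp r y)) = sg q *\<^sub>R braid (?t v) x y"
        by (simp add: braid_gr[OF t x] kp_kp)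
    qed (intro l1)+
    then show ?thesis by (rule fun_cong)
  qed
  \<comment> \<open>The four contributions: the action hits \<alpha> in \<open>S1\<close> and Y in
    \<open>S2\<close>, while \<open>d\<close> stands under \<alpha> in \<open>U1\<close> and under Y
    in \<open>U2\<close>.\<close>
  define S1 where "S1 = sw (\<lambda>w v. wcons (sw (\<lambda>x y. A (F (kp (q + r) x)) (\<alpha> (kp r y))) w) (Y v)) z"
  define S2 where "S2 = sw (\<lambda>x w. wcons (\<alpha> (kp (r + 1) x)) (sw (\<lambda>y v. wder A (F (kp r y)) (Y v)) w)) z"
  define U1 where "U1 = sw (\<lambda>x y. wcons (\<alpha> (d (kp r x))) (Y y)) z"
  define U2 where "U2 = sw (\<lambda>x y. wcons (\<alpha> (kp (r + 1) x)) (Y (d y))) z"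
  have T1: "sw (\<lambda>x w. wder A (F (kp (q + r) x)) (star \<alpha> r Y w)) z = S1 + sg q *\<^sub>R S2"
  proof -
    have "sw (\<lambda>x w. wder A (F (kp (q + r) x)) (star \<alpha> r Y w)) z =
        sw (\<lambda>x w. sw (\<lambda>y v. wder A (F (kp (q + r) x)) (wcons (\<alpha> (kp r y)) (Y v))) w) z"
      unfolding star_def by (rule sw_cong, rule sw_linear) (intro l1)+
    also have "\<dots> = sw (\<lambda>x w. sw (\<lambda>y v. wcons (A (F (kp (q + r) x)) (\<alpha> (kp r y))) (Y v)) w
        + sg q *\<^sub>R sw (\<lambda>y v. braid (?t v) x y) w) z"
      unfolding wder_wcons br by (rule sw_cong, subst sw_add, (intro l1)+, subst sw_scale, (intro l1)[1], rule refl)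
    also have "\<dots> = sw (\<lambda>x w. sw (\<lambda>y v. wcons (A (F (kp (q + r) x)) (\<alpha> (kp r y))) (Y v)) w) z
        + sg q *\<^sub>R sw (\<lambda>x w. sw (\<lambda>y v. braid (?t v) x y) w) z"
      by (subst sw_add, (intro l1)+, subst sw_scale, (intro l1)[1], rule refl)
    also have "sw (\<lambda>x w. sw (\<lambda>y v. wcons (A (F (kp (q + r) x)) (\<alpha> (kp r y))) (Y v)) w) z =
        sw (\<lambda>w v. sw (\<lambda>x y. wcons (A (F (kp (q + r) x)) (\<alpha> (kp r y))) (Y v)) w) z"
      by (rule sw_assoc) (intro l1)
    also have "\<dots> = S1"
      unfolding S1_def by (rule sw_cong, rule sw_linear[symmetric]) (intro l1)+
    also have "sw (\<lambda>x w. sw (\<lambda>y v. braid (?t v) x y) w) z = sw (\<lambda>w v. sw (\<lambda>x y. braid (?t v) x y) w) z"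
      by (rule sw_assoc) (intro l1)
    also have "\<dots> = sw (\<lambda>w v. sw (\<lambda>x y. ?t v y x) w) z"
      by (rule sw_cong, rule sw_braid[OF t])
    also have "\<dots> = sw (\<lambda>x w. sw (\<lambda>y v. ?t v y x) w) z"
      by (rule sw_assoc[symmetric]) (intro l1)
    also have "\<dots> = S2"
      unfolding S2_def by (rule sw_cong, rule sw_linear[symmetric]) (intro l1)+
    finally show ?thesis .
  qed
  have T2: "star \<alpha> r Y (d z) = sg r *\<^sub>R U1 + U2"
  proof -
    have "star \<alpha> r Y (d z) = sw (\<lambda>x y. wcons (\<alpha> (kp r (d x))) (Y y) + wcons (\<alpha> (kp r (kp 1 x))) (Y (d y))) z"
      unfolding star_def by (rule coderivation_sw[OF d]) (intro l1)
    also have "\<dots> = sw (\<lambda>x y. sg r *\<^sub>R wcons (\<alpha> (d (kp r x))) (Y y) + wcons (\<alpha> (kp (r + 1) x)) (Y (d y))) z"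
      by (simp add: kp_kp Hom_kp[OF coderivation_Hom[OF d]] linear_scale[OF HomD(1)[OF \<alpha>]] bilinear_lmul[OF bilinear_wcons])
    also have "\<dots> = sg r *\<^sub>R U1 + U2"
      unfolding U1_def U2_def by (subst sw_add, (intro l1)+, subst sw_scale, (intro l1)[1], rule refl)
    finally show ?thesis .
  qed
  have R1: "star (tdiff A F d q \<alpha>) r Y z = S1 - sg q *\<^sub>R U1"
  proof -
    have "sw (\<lambda>x y. A (F (kp q x)) (\<alpha> y)) (kp r w) = sw (\<lambda>x y. A (F (kp (q + r) x)) (\<alpha> (kp r y))) w" for w
      by (subst sw_kp, (intro l1)[1]) (simp add: kp_kp)
    then have "star (tdiff A F d q \<alpha>) r Y z = sw (\<lambda>w v. wcons (sw (\<lambda>x y. A (F (kp (q + r) x)) (\<alpha> (kp r y))) w) (Y v)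
        - sg q *\<^sub>R wcons (\<alpha> (d (kp r w))) (Y v)) z"
      by (simp add: star_def tdiff_def bilinear_lsub[OF bilinear_wcons] bilinear_lmul[OF bilinear_wcons])
    also have "\<dots> = S1 - sg q *\<^sub>R U1"
      unfolding S1_def U1_def by (subst sw_diff, (intro l1)+, subst sw_scale, (intro l1)[1], rule refl)
    finally show ?thesis .
  qed
  have R2: "star \<alpha> (r + 1) (tdiff (wder A) F d r Y) z = S2 - sg r *\<^sub>R U2"
  proof -
    have "star \<alpha> (r + 1) (tdiff (wder A) F d r Y) z = sw (\<lambda>x w. wcons (\<alpha> (kp (r + 1) x)) (sw (\<lambda>y v. wder A (F (kp r y)) (Y v)) w)
        - sg r *\<^sub>R wcons (\<alpha> (kp (r + 1) x)) (Y (d w))) z"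
      by (simp add: star_def tdiff_def bilinear_rsub[OF bilinear_wcons] bilinear_rmul[OF bilinear_wcons])
    also have "\<dots> = S2 - sg r *\<^sub>R U2"
      unfolding S2_def U2_def by (subst sw_diff, (intro l1)+, subst sw_scale, (intro l1)[1], rule refl)
    finally show ?thesis .
  qed
  show ?thesis
    unfolding tdiff_def[of "wder A" F d "q + r"] T1 T2 R1 R2
    by (simp add: sg_add algebra_simps)
qed

text \<open>In a codifferential the vector of n stands on the left, in the action on the right.
  Cocommutativity exchanges the two places, and the remaining sign is \<open>kp q\<close>.\<close>

lemma lam_emb:
  fixes \<alpha> :: "'h sym \<Rightarrow> 'n"
  assumes F: "F \<in> Hom 0" and \<alpha>: "\<alpha> \<in> Hom q"
  shows "sw (\<lambda>x y. lam (emb (\<alpha> x) \<rhd> F y)) z = emb (sw (\<lambda>x y. A (F (kp q x)) (\<alpha> y)) z)"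
proof -
  note l = bilinearI linear_rules linear_app[OF HomD(1)[OF F]] linear_app[OF HomD(1)[OF \<alpha>]]
    bilinear_left[OF bil_A] bilinear_right[OF bil_A] linear_app[OF HomD(1)[OF lam]] linear_app[OF HomD(1)[OF emb(1)]]
    HomD(1)[OF emb(1)]
  have "sw (\<lambda>x y. lam (emb (\<alpha> x) \<rhd> F y)) z = sw (\<lambda>x y. emb (A (F (kp q x)) (\<alpha> y))) z"
  proof (rule sw_comm)
    fix i j and x y :: "'h sym" assume x: "x \<in> gr i" and y: "y \<in> gr j"
    have "emb (\<alpha> x) \<in> gr (i + q)" "F y \<in> gr j"
      using HomD(2)[OF emb(1) HomD(2)[OF \<alpha> x]] HomD(2)[OF F y] by simp_all
    from vee_incl_right[OF this]
    show "emb (A (F (kp q y)) (\<alpha> x)) = sg (i * j) *\<^sub>R lam (emb (\<alpha> x) \<rhd> F y)"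
      by (simp add: emb_A kp_gr[OF y] linear_scale[OF HomD(1)[OF F]] bilinear_lmul[OF bilinear_vee]
          linear_scale[OF HomD(1)[OF lam]]) (simp add: sg_def)
  qed (intro l)+
  also have "\<dots> = emb (sw (\<lambda>x y. A (F (kp q x)) (\<alpha> y)) z)"
    by (rule sw_linear[symmetric]) (intro l)+
  finally show ?thesis .
qed

text \<open>A relation instead of a formula for K: \<open>emb\<close> is injective, so K is
  determined, and no inverse of \<open>emb\<close> enters the calculations.\<close>

definition curv :: "('h sym \<Rightarrow> 'e) \<Rightarrow> ('h sym \<Rightarrow> 'n) \<Rightarrow> bool" where
  "curv \<phi> K \<longleftrightarrow> cogenerator \<phi> \<and> K \<in> Hom 1 \<and> (\<forall>z. emb (K z) = lam (expc \<phi> z) - \<phi> (d z))"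

text \<open>With F = \<open>expc \<phi>\<close>, the difference of \<open>codiff lam\<close> after F
  and F after \<open>d\<close> is the convolution of \<open>emb K\<close> with F. Applying
  \<open>lam\<close> kills the first composite, and \<open>lam (F (d z))\<close> is
  \<open>emb (K (d z))\<close> because \<open>d\<close> squares to zero. \<open>lam_emb\<close>
  turns what is left into the action on K.\<close>

lemma bianchi:
  assumes "curv \<phi> K"
  shows "tdiff A (expc \<phi>) d 1 K z = 0"
proof -
  interpret cogenerator \<phi> using assms by (simp add: curv_def)
  have K: "K \<in> Hom 1" and eK: "\<And>z. emb (K z) = lam (expc \<phi> z) - \<phi> (d z)"
    using assms by (simp_all add: curv_def)
  note l = bilinearI linear_rules linear_app[OF linear_expc] linear_app[OF HomD(1)[OF K]] linear_app[OF lin_\<phi>]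
    linear_app[OF HomD(1)[OF lam]] linear_app[OF HomD(1)[OF emb(1)]] linear_app[OF lin_d]
  have "lam (expc \<phi> (d z)) = - sw (\<lambda>x y. lam (emb (K x) \<rhd> expc \<phi> y)) z"
  proof -
    have b: "bilinear (\<lambda>x y. lam x \<rhd> y)" by (intro l)
    have "codiff lam (expc \<phi> z) - expc \<phi> (d z) = sw (\<lambda>x y. lam (expc \<phi> x) \<rhd> expc \<phi> y) z - sw (\<lambda>x y. \<phi> (d x) \<rhd> expc \<phi> y) z"
      by (simp add: codiff_sw[OF HomD(1)[OF lam]] sw_morphismD[OF expc_sw_morphism b]
          expc_coderivation[OF d] vconv_def)
    also have "\<dots> = sw (\<lambda>x y. lam (expc \<phi> x) \<rhd> expc \<phi> y - \<phi> (d x) \<rhd> expc \<phi> y) z"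
      by (rule sw_diff[symmetric]) (intro l)+
    also have "\<dots> = sw (\<lambda>x y. emb (K x) \<rhd> expc \<phi> y) z"
      by (simp add: eK linear_diff[OF linear_vee_left[OF linear_sym_incl]])
    finally have "expc \<phi> (d z) = codiff lam (expc \<phi> z) - sw (\<lambda>x y. emb (K x) \<rhd> expc \<phi> y) z"
      by (simp add: algebra_simps)
    then have "lam (expc \<phi> (d z)) = - lam (sw (\<lambda>x y. emb (K x) \<rhd> expc \<phi> y) z)"
      by (simp add: linear_diff[OF HomD(1)[OF lam]] lam_codiff)
    also have "lam (sw (\<lambda>x y. emb (K x) \<rhd> expc \<phi> y) z) = sw (\<lambda>x y. lam (emb (K x) \<rhd> expc \<phi> y)) z"
      by (rule sw_linear) (intro l HomD(1)[OF lam])+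
    finally show ?thesis .
  qed
  moreover have "emb (K (d z)) = lam (expc \<phi> (d z))"
    by (simp add: eK dd linear_0[OF lin_\<phi>])
  ultimately have "emb (K (d z)) = - emb (sw (\<lambda>x y. A (expc \<phi> (kp 1 x)) (K y)) z)"
    by (simp only: lam_emb[OF expc_Hom K])
  then have "emb (K (d z)) = emb (- sw (\<lambda>x y. A (expc \<phi> (kp 1 x)) (K y)) z)"
    by (simp add: linear_neg[OF HomD(1)[OF emb(1)]])
  then have "K (d z) = - sw (\<lambda>x y. A (expc \<phi> (kp 1 x)) (K y)) z"
    using emb(2) by (simp add: inj_eq)
  then show ?thesis by (simp add: tdiff_def)
qed

lemma tdiff_wpow:
  assumes "curv \<phi> K"
  shows "tdiff (wder A) (expc \<phi>) d (int k) (wpow K k) z = 0"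
proof (induction k arbitrary: z)
  case 0
  show ?case
    by (simp add: tdiff_def bilinear_rmul[OF bilinear_wder] wder_one sw_zero coderivation_eps[OF d])
next
  case (Suc k)
  interpret cogenerator \<phi> using assms by (simp add: curv_def)
  have K: "K \<in> Hom 1" using assms by (simp_all add: curv_def)
  have "tdiff A (expc \<phi>) d 1 K = (\<lambda>z. 0)" "tdiff (wder A) (expc \<phi>) d (int k) (wpow K k) = (\<lambda>z. 0)"
    using bianchi[OF assms] Suc by (simp_all add: fun_eq_iff)
  then show ?case
    using leibniz[OF expc_Hom K linear_wpow[OF HomD(1)[OF K]], of "int k" k z]
    by (simp add: star_zero_left star_zero_right)
qed

lemma linear_tdiff:
  assumes B: "bilinear B" and F: "linear F" and Y: "linear Y"
  shows "linear (tdiff B F d r Y)"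
  unfolding tdiff_def[abs_def]
  by (intro linear_compose_sub linear_sw_arg bilinearI linear_rules bilinear_left[OF B] bilinear_right[OF B]
      linear_app[OF F] linear_app[OF Y] lin_d Y)

text \<open>Both K and its powers are closed, so the Leibniz rule leaves one term for each summand
  of \<open>transg\<close>; the minus sign there cancels the one from moving past K. The result is
  the recursion for the derivative of \<open>wpow\<close>.\<close>

lemma tdiff_transg_Suc:
  assumes "curv \<phi> K" and a: "a \<in> Hom 0"
  shows "tdiff (wder A) (expc \<phi>) d (int k) (transg a K (Suc k)) z =
    star (tdiff A (expc \<phi>) d 0 a) (int k) (wpow K k) z +
    star K (int k) (tdiff (wder A) (expc \<phi>) d (int k - 1) (transg a K k)) z"
proof -
  interpret cogenerator \<phi> using assms by (simp add: curv_def)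
  have K: "K \<in> Hom 1" using assms by (simp_all add: curv_def)
  note lt = linear_transg[OF HomD(1)[OF a] HomD(1)[OF K]] and lw = linear_wpow[OF HomD(1)[OF K]]
  have 0: "tdiff A (expc \<phi>) d 1 K = (\<lambda>z. 0)" "tdiff (wder A) (expc \<phi>) d (int k) (wpow K k) = (\<lambda>z. 0)"
    using bianchi[OF assms(1)] tdiff_wpow[OF assms(1)] by (simp_all add: fun_eq_iff)
  let ?Y = "star a (int k) (wpow K k)" and ?Y' = "star K (int k - 1) (transg a K k)"
  note l = bilinearI linear_rules linear_app[OF linear_expc] bilinear_left[OF bilinear_wder]
    bilinear_right[OF bilinear_wder] linear_app[OF linear_star[OF HomD(1)[OF a] lw]]
    linear_app[OF linear_star[OF HomD(1)[OF K] lt]]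
  have "tdiff (wder A) (expc \<phi>) d (int k) (transg a K (Suc k)) z =
      tdiff (wder A) (expc \<phi>) d (int k) ?Y z - tdiff (wder A) (expc \<phi>) d (int k) ?Y' z"
    unfolding tdiff_def transg.simps bilinear_rsub[OF bilinear_wder]
    by (subst sw_diff, (intro l)+) (simp add: algebra_simps)
  also have "tdiff (wder A) (expc \<phi>) d (int k) ?Y z = star (tdiff A (expc \<phi>) d 0 a) (int k) (wpow K k) z"
    using leibniz[OF expc_Hom a lw, of "int k" k z] by (simp add: 0 star_zero_right)
  also have "tdiff (wder A) (expc \<phi>) d (int k) ?Y' z =
      - star K (int k) (tdiff (wder A) (expc \<phi>) d (int k - 1) (transg a K k)) z"
    using leibniz[OF expc_Hom K lt, of "int k - 1" k z] by (simp add: 0 star_zero_left)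
  finally show ?thesis by simp
qed

end

section \<open>Segments of lifts and the derivatives of their curvatures\<close>

locale twisted_family = twisted A lam d emb
  for A :: "'e::koszul_grading sym \<Rightarrow> 'n::koszul_grading \<Rightarrow> 'n" and lam :: "'e sym \<Rightarrow> 'e"
    and d :: "'h::koszul_grading sym \<Rightarrow> 'h sym" and emb :: "'n \<Rightarrow> 'e" +
  fixes \<phi> :: "'h sym \<Rightarrow> 'e" and a :: "'h sym \<Rightarrow> 'n" and K :: "real \<Rightarrow> 'h sym \<Rightarrow> 'n"
  assumes a: "a \<in> Hom 0" "a (sprod []) = 0"
    and curv: "\<And>u. curv (\<lambda>x. \<phi> x + u *\<^sub>R emb (a x)) (K u)"
begin

abbreviation F :: "real \<Rightarrow> 'h sym \<Rightarrow> 'e sym" where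
  "F u \<equiv> expc (\<lambda>x. \<phi> x + u *\<^sub>R emb (a x))"

lemma cogen: "cogenerator (\<lambda>x. \<phi> x + u *\<^sub>R emb (a x))"
  using curv[of u] by (simp add: curv_def)

lemmas F_Hom = cogenerator.expc_Hom[OF cogen]

lemma K_Hom: "K u \<in> Hom 1"
  using curv[of u] by (simp add: curv_def)

lemma cogen_\<phi>: "cogenerator \<phi>"
  using cogen[of 0] by simp

lemma emb_a_Hom: "(\<lambda>x. emb (a x)) \<in> Hom 0"
  using HomD[OF emb(1)] HomD[OF a(1)] by (auto simp: Hom_def intro: linear_app)

lemma poly_deriv_F: "poly_deriv (\<lambda>u. F u z) (\<lambda>u. vconv (\<lambda>x. emb (a x)) (F u) z)"
  by (rule poly_deriv_expc[OF cogen_\<phi> emb_a_Hom]) (simp add: a linear_0[OF HomD(1)[OF emb(1)]])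

text \<open>A linear left inverse j of \<open>emb\<close> recovers K from its image, where the
  derivative of the exponential applies. The outcome is the twisted differential of the direction
  \<open>a\<close>.\<close>

lemma poly_deriv_K: "poly_deriv (\<lambda>u. K u z) (\<lambda>u. tdiff A (F u) d 0 a z)"
proof -
  obtain j where j: "linear j" "j \<circ> emb = id"
    using linear_injective_left_inverse[OF HomD(1)[OF emb(1)] emb(2)] by blast
  have je: "j (emb v) = v" for v using j(2) by (simp add: fun_eq_iff)
  have "poly_deriv (\<lambda>u. j (lam (F u z) - (\<phi> (d z) + u *\<^sub>R emb (a (d z)))))
      (\<lambda>u. j (lam (vconv (\<lambda>x. emb (a x)) (F u) z) - emb (a (d z))))"
    by (intro poly_deriv_linear[OF j(1)] poly_deriv_diff poly_deriv_linear[OF HomD(1)[OF lam]] poly_deriv_F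
        poly_deriv_line)
  moreover have "j (lam (F u z) - (\<phi> (d z) + u *\<^sub>R emb (a (d z)))) = K u z" for u
  proof -
    have "emb (K u z) = lam (F u z) - (\<phi> (d z) + u *\<^sub>R emb (a (d z)))"
      using curv[of u] unfolding curv_def by blast
    then show ?thesis using je[of "K u z"] by (simp only:)
  qed
  moreover have "lam (vconv (\<lambda>x. emb (a x)) (F u) z) = emb (sw (\<lambda>x y. A (F u (kp 0 x)) (a y)) z)" for u
  proof -
    have "lam (vconv (\<lambda>x. emb (a x)) (F u) z) = sw (\<lambda>x y. lam (emb (a x) \<rhd> F u y)) z"
      unfolding vconv_def
      by (rule sw_linear[OF _ HomD(1)[OF lam]])
        (intro bilinearI linear_rules linear_app[OF HomD(1)[OF emb(1)]] linear_app[OF HomD(1)[OF a(1)]]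
          linear_app[OF HomD(1)[OF F_Hom]])
    then show ?thesis by (simp only: lam_emb[OF F_Hom a(1)])
  qed
  ultimately show ?thesis
    by (simp add: tdiff_def je linear_diff[OF j(1)])
qed

text \<open>The product rule for \<open>star\<close> gives the recursion of
  \<open>tdiff_transg_Suc\<close>, so both sides agree by induction on k.\<close>

lemma poly_deriv_wpow:
  "poly_deriv (\<lambda>u. wpow (K u) k z) (\<lambda>u. tdiff (wder A) (F u) d (int k - 1) (transg a (K u) k) z)"
proof (induction k arbitrary: z)
  case 0
  show ?case using poly_deriv_const
    by (simp add: tdiff_def bilinear_rzero[OF bilinear_wder] sw_zero)
next
  case (Suc k)
  have "poly_deriv (\<lambda>u. star (K u) (int k) (wpow (K u) k) z)
      (\<lambda>u. star (tdiff A (F u) d 0 a) (int k) (wpow (K u) k) z +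
        star (K u) (int k) (tdiff (wder A) (F u) d (int k - 1) (transg a (K u) k)) z)"
    by (rule poly_deriv_star)
      (rule HomD(1)[OF K_Hom] linear_tdiff[OF bil_A HomD(1)[OF F_Hom] HomD(1)[OF a(1)]]
        linear_wpow[OF HomD(1)[OF K_Hom]] poly_deriv_K Suc
        linear_tdiff[OF bilinear_wder HomD(1)[OF F_Hom] linear_transg[OF HomD(1)[OF a(1)] HomD(1)[OF K_Hom]]])+
  then show ?case
    by (simp add: tdiff_transg_Suc[OF curv a(1)] del: transg.simps)
qed

text \<open>Differentiability gives integrability, since a differentiable curve is polynomial.
  Linearity of \<open>Q u\<close> is carried along because the product rule for \<open>star\<close>
  asks for it.\<close>

lemma poly_curve_transg: "\<exists>Q. (\<forall>u. linear (Q u)) \<and> (\<forall>z. poly_deriv (\<lambda>u. transg a (K u) k z) (\<lambda>u. Q u z))"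
proof (induction k)
  case 0
  show ?case
    by (rule exI[of _ "\<lambda>u z. 0"]) (auto intro: poly_deriv_const linear_zero)
next
  case (Suc k)
  then obtain Q where Q: "\<And>u. linear (Q u)" "\<And>z. poly_deriv (\<lambda>u. transg a (K u) k z) (\<lambda>u. Q u z)" by blast
  note lK = HomD(1)[OF K_Hom] and la = HomD(1)[OF a(1)]
  note lK' = linear_tdiff[OF bil_A HomD(1)[OF F_Hom] la, of _ 0] and lt = linear_transg[OF la lK]
    and lw' = linear_tdiff[OF bilinear_wder HomD(1)[OF F_Hom] linear_transg[OF la lK]] and lw = linear_wpow[OF lK]
  let ?Q' = "\<lambda>u z. (star (\<lambda>z. 0) (int k) (wpow (K u) k) z +
        star a (int k) (tdiff (wder A) (F u) d (int k - 1) (transg a (K u) k)) z) -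
        (star (tdiff A (F u) d 0 a) (int k - 1) (transg a (K u) k) z + star (K u) (int k - 1) (Q u) z)"
  have "poly_deriv (\<lambda>u. star a (int k) (wpow (K u) k) z)
      (\<lambda>u. star (\<lambda>z. 0) (int k) (wpow (K u) k) z +
        star a (int k) (tdiff (wder A) (F u) d (int k - 1) (transg a (K u) k)) z)" for z
    by (rule poly_deriv_star) (rule la lw lw' linear_zero poly_deriv_const poly_deriv_wpow)+
  moreover have "poly_deriv (\<lambda>u. star (K u) (int k - 1) (transg a (K u) k) z)
      (\<lambda>u. star (tdiff A (F u) d 0 a) (int k - 1) (transg a (K u) k) z + star (K u) (int k - 1) (Q u) z)" for z
    by (rule poly_deriv_star) (rule lK lK' lt Q poly_deriv_K)+
  ultimately have "poly_deriv (\<lambda>u. transg a (K u) (Suc k) z) (\<lambda>u. ?Q' u z)" for z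
    unfolding transg.simps by (rule poly_deriv_diff)
  moreover have "linear (?Q' u)" for u
    by (intro linear_compose_add linear_compose_sub linear_star la lK lK' lt lw lw' Q linear_zero)
  ultimately show ?case by (intro exI[of _ ?Q'] conjI allI)
qed

end

text \<open>Equivariance turns the twisted differential into the differential of the cochain complex.\<close>

lemma tdiff_equivariant:
  fixes R :: "'h::koszul_grading sym \<Rightarrow> 'w::real_vector \<Rightarrow> 'w" and F :: "'h sym \<Rightarrow> 'e::koszul_grading sym"
  assumes g: "linear g" and B: "bilinear B" and R: "bilinear R" and F: "linear F" and Y: "linear Y"
    and eq: "\<And>x y. g (B (F x) y) = sg p *\<^sub>R R (kp p x) (g y)"
  shows "sw (\<lambda>x y. R (kp (p + r) x) (g (Y y))) z - sg (p + r) *\<^sub>R g (Y (d z)) = sg p *\<^sub>R g (tdiff B F d r Y z)"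
proof -
  note l = bilinearI linear_rules linear_app[OF F] linear_app[OF g] linear_app[OF Y] bilinear_left[OF B]
    bilinear_right[OF B] bilinear_left[OF R] bilinear_right[OF R]
  have "g (sw (\<lambda>x y. B (F (kp r x)) (Y y)) z) = sw (\<lambda>x y. g (B (F (kp r x)) (Y y))) z"
    by (rule sw_linear[OF _ g]) (intro l)
  also have "\<dots> = sg p *\<^sub>R sw (\<lambda>x y. R (kp (p + r) x) (g (Y y))) z"
    unfolding eq kp_kp by (rule sw_scale) (intro l)
  finally show ?thesis
    by (simp add: tdiff_def linear_diff[OF g] linear_scale[OF g] scaleR_diff_right sg_add)
qed

lemma linear_pint:
  assumes "\<And>u. linear (B u)" "\<And>x. poly_curve (\<lambda>u. B u x)"
  shows "linear (\<lambda>x. pint (\<lambda>u. B u x))"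
proof (rule linearI)
  show "pint (\<lambda>u. B u (x + y)) = pint (\<lambda>u. B u x) + pint (\<lambda>u. B u y)" for x y
    by (simp add: linear_add[OF assms(1)] pint_add assms(2))
  show "pint (\<lambda>u. B u (c *\<^sub>R x)) = c *\<^sub>R pint (\<lambda>u. B u x)" for c x
    by (simp add: linear_scale[OF assms(1)] pint_linear[OF linear_scaleR] assms(2))
qed

context twisted_family
begin

text \<open>By \<open>poly_deriv_wpow\<close> the derivative of \<open>g (wpow (K u) k)\<close> is g
  of a twisted differential, and equivariance makes this an ordinary differential. Since R does not
  depend on u, the integral can be pulled inside.\<close>

lemma transgression:
  fixes g :: "'n ext \<Rightarrow> 'w::graded_vector" and R :: "'h sym \<Rightarrow> 'w \<Rightarrow> 'w"
  assumes g: "g \<in> Hom p" and R: "bilinear R"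
    and eq: "\<And>u x y. g (wder A (F u x) y) = sg p *\<^sub>R R (kp p x) (g y)"
  shows "\<exists>\<beta> \<in> Hom (int k + p - 1). \<forall>z. sw (\<lambda>x y. R (kp (int k + p - 1) x) (\<beta> y)) z - sg (int k + p - 1) *\<^sub>R \<beta> (d z) =
    g (wpow (K 1) k z) - g (wpow (K 0) k z)"
proof -
  define B where "B u z = g (transg a (K u) k z)" for u z
  let ?r = "p + (int k - 1)"
  have lt: "linear (transg a (K u) k)" for u
    by (rule linear_transg[OF HomD(1)[OF a(1)] HomD(1)[OF K_Hom]])
  have lB: "linear (B u)" for u unfolding B_def by (rule linear_app[OF HomD(1)[OF g] lt])
  have curve: "poly_curve (\<lambda>u. B u z)" for z
  proof -
    obtain Q where "poly_deriv (\<lambda>u. transg a (K u) k z) (\<lambda>u. Q u z)"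
      using poly_curve_transg[of k] by blast
    then show ?thesis unfolding B_def by (rule poly_deriv_curve[OF poly_deriv_linear[OF HomD(1)[OF g]]])
  qed
  have lP: "linear (\<lambda>z. pint (\<lambda>u. B u z))" by (rule linear_pint[OF lB curve])
  \<comment> \<open>The factor \<open>sg p\<close> compensates the sign that
    \<open>tdiff_equivariant\<close> produces.\<close>
  let ?\<beta> = "\<lambda>z. sg p *\<^sub>R pint (\<lambda>u. B u z)"
  have "B u z \<in> gr (n + ?r)" if "z \<in> gr n" for u z n
    using HomD(2)[OF g transg_gr[OF a(1) K_Hom[of u] that]] by (simp add: B_def algebra_simps)
  then have "?\<beta> \<in> Hom ?r"
    by (auto simp: Hom_def intro!: linear_rules lP gr_scaleR pint_gr curve)
  moreover have "sw (\<lambda>x y. R (kp ?r x) (?\<beta> y)) z - sg ?r *\<^sub>R ?\<beta> (d z) = g (wpow (K 1) k z) - g (wpow (K 0) k z)" for z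
  proof -
    note ps = pint_sw[OF lB curve R linear_kp lP, of ?r z]
    have bl: "bilinear (\<lambda>x y. R (kp ?r x) (pint (\<lambda>u. B u y)))"
      by (intro bilinearI linear_rules bilinear_left[OF R] bilinear_right[OF R] linear_app[OF lP] lP)
    have "sw (\<lambda>x y. R (kp ?r x) (?\<beta> y)) z = sg p *\<^sub>R sw (\<lambda>x y. R (kp ?r x) (pint (\<lambda>u. B u y))) z"
      unfolding bilinear_rmul[OF R] by (rule sw_scale[OF bl])
    then have "sw (\<lambda>x y. R (kp ?r x) (?\<beta> y)) z - sg ?r *\<^sub>R ?\<beta> (d z) =
        sg p *\<^sub>R (pint (\<lambda>u. sw (\<lambda>x y. R (kp ?r x) (B u y)) z) + pint (\<lambda>u. (- sg ?r) *\<^sub>R B u (d z)))"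
      using ps pint_linear[OF linear_scaleR[of "- sg ?r"] curve, of "d z"]
      by (simp add: scaleR_add_right scaleR_diff_right mult.commute)
    also have "pint (\<lambda>u. sw (\<lambda>x y. R (kp ?r x) (B u y)) z) + pint (\<lambda>u. (- sg ?r) *\<^sub>R B u (d z)) =
        pint (\<lambda>u. sw (\<lambda>x y. R (kp ?r x) (B u y)) z + (- sg ?r) *\<^sub>R B u (d z))"
      using ps poly_curve_linear[OF linear_scaleR[of "- sg ?r"] curve[of "d z"]]
      by (intro pint_add[symmetric]) blast+
    also have "(\<lambda>u. sw (\<lambda>x y. R (kp ?r x) (B u y)) z + (- sg ?r) *\<^sub>R B u (d z)) =
        (\<lambda>u. sg p *\<^sub>R g (tdiff (wder A) (F u) d (int k - 1) (transg a (K u) k) z))"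
    proof
      fix u
      have "sw (\<lambda>x y. R (kp ?r x) (g (transg a (K u) k y))) z - sg ?r *\<^sub>R g (transg a (K u) k (d z)) =
          sg p *\<^sub>R g (tdiff (wder A) (F u) d (int k - 1) (transg a (K u) k) z)"
        by (rule tdiff_equivariant[where B="wder A" and F="F u"])
          (rule HomD(1)[OF g] bilinear_wder R HomD(1)[OF F_Hom] lt eq)+
      then
      show "sw (\<lambda>x y. R (kp ?r x) (B u y)) z + (- sg ?r) *\<^sub>R B u (d z) =
          sg p *\<^sub>R g (tdiff (wder A) (F u) d (int k - 1) (transg a (K u) k) z)"
        by (simp add: B_def)
    qed
    also have "pint \<dots> = sg p *\<^sub>R (g (wpow (K 1) k z) - g (wpow (K 0) k z))"
    proof -
      have "poly_deriv (\<lambda>u. sg p *\<^sub>R g (wpow (K u) k z))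
          (\<lambda>u. sg p *\<^sub>R g (tdiff (wder A) (F u) d (int k - 1) (transg a (K u) k) z))"
        by (rule poly_deriv_linear[OF linear_scaleR], rule poly_deriv_linear[OF HomD(1)[OF g]], rule poly_deriv_wpow)
      from pint_eq[OF this] show ?thesis by (simp add: scaleR_diff_right)
    qed
    finally show ?thesis by simp
  qed
  moreover have "?r = int k + p - 1" by simp
  ultimately show ?thesis by metis
qed

end


section \<open>Comparison with the constructions on extensions\<close>

lemma sw_mem:
  assumes b: "bilinear b" and S: "subspace S" and mem: "\<And>x y. b x y \<in> S"
  shows "sw b z \<in> S"
proof -
  have "tensor_lift b t \<in> S" for t
    by (induction t rule: tensor_induct)
      (simp_all add: tensor_lift_tensor[OF b] mem linear_add[OF linear_tensor_lift[OF b]]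
        linear_scale[OF linear_tensor_lift[OF b]] subspace_add[OF S] subspace_scale[OF S])
  then show ?thesis by (simp add: sw_def)
qed

text \<open>The sign of \<open>tens_map 1 K\<close> distributed over the entries: an entry is passed
  by one K of degree 1 for each entry after it. This form makes sense for lists that are not
  homogeneous.\<close>

primrec kmap :: "('a::koszul_grading \<Rightarrow> 'b::real_vector) \<Rightarrow> 'a list \<Rightarrow> 'b list" where
  "kmap K [] = []"
| "kmap K (x # xs) = K (kp (int (length xs)) x) # kmap K xs"

lemma multilinear_tens_kmap:
  assumes K: "linear K"
  shows "multilinear (\<lambda>xs. tens (kmap K xs))"
proof -
  have "linear (\<lambda>v. tens (ps @ kmap K (us @ v # ws)))" for ps us ws
  proof (induction us arbitrary: ps)
    case Nil
    have "linear (\<lambda>v. K (kp (int (length ws)) v))" by (rule linear_app[OF K linear_kp])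
    from linear_app[OF multilinearD[OF multilinear_tens] this] show ?case by simp
  next
    case (Cons u us)
    from Cons[of "ps @ [K (kp (int (length us + Suc (length ws))) u)]"] show ?case by simp
  qed
  from this[of "[]"] show ?thesis by (simp add: multilinear_def)
qed

lemma tens_kmap_sign:
  assumes K: "linear K" and "homs ds xs"
  shows "tens (ps @ kmap K xs) =
    sg (\<Sum>i<length xs. int (length xs - 1 - i) * ds ! i) *\<^sub>R tens (ps @ map K xs)"
  using assms(2)
proof (induction xs arbitrary: ds ps)
  case Nil
  then show ?case by simp
next
  case (Cons x xs)
  then obtain d es where ds: "ds = d # es" "x \<in> gr d" "homs es xs" by (auto elim: homs_ConsE)
  have "tens (ps @ kmap K (x # xs)) = sg (int (length xs) * d) *\<^sub>R tens (ps @ K x # kmap K xs)"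
    using linear_scale[OF multilinearD[OF multilinear_tens, of ps "kmap K xs"]]
    by (simp add: kp_gr[OF ds(2)] linear_scale[OF K])
  also have "tens (ps @ K x # kmap K xs) =
      sg (\<Sum>i<length xs. int (length xs - 1 - i) * es ! i) *\<^sub>R tens (ps @ map K (x # xs))"
    using Cons.IH[OF ds(3), of "ps @ [K x]"] by simp
  also have "(\<Sum>i<length xs. int (length xs - 1 - i) * es ! i) =
      (\<Sum>i<length xs. int (length (x # xs) - 1 - Suc i) * ds ! Suc i)"
    by (simp add: ds)
  finally show ?case
    unfolding length_Cons sum.lessThan_Suc_shift by (simp add: ds sg_add)
qed

lemma tens_map_unique:
  fixes K :: "'a::koszul_grading \<Rightarrow> 'b::real_vector"
  assumes K: "linear K"
  shows "\<exists>!L. linear L \<and> (\<forall>ds vs. homs ds vs \<longrightarrow> L (tens vs) =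
    ((-1) powi (1 * (\<Sum>i<length vs. int (length vs - 1 - i) * ds ! i))) *\<^sub>R tens (map K vs))"
    and "linear (tens_map 1 K)" and "tens_map 1 K (tens xs) = tens (kmap K xs)"
proof -
  obtain L where L: "linear L" "\<And>xs. L (tens xs) = tens (kmap K xs)"
    using tens_exists[OF multilinear_tens_kmap[OF K]] by blast
  let ?Q = "\<lambda>L. linear L \<and> (\<forall>ds vs. homs ds vs \<longrightarrow> L (tens vs) =
    ((-1) powi (1 * (\<Sum>i<length vs. int (length vs - 1 - i) * ds ! i))) *\<^sub>R tens (map K vs))"
  have Q: "?Q L"
    using L tens_kmap_sign[OF K, of _ _ "[]"] by (simp add: powi_sg)
  have uniq: "L' = L" if "?Q L'" for L'
  proof (rule tens_ext)
    have lin: "linear L'" using that by blast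
    show "L' (tens vs) = L (tens vs)" for vs
    proof (rule multilinear_hom_eqI[OF multilinear_app[OF lin multilinear_tens] multilinear_app[OF L(1) multilinear_tens]])
      show "L' (tens vs) = L (tens vs)" if "homs ds vs" for ds vs
        using \<open>?Q L'\<close>[THEN conjunct2, rule_format, OF that] Q[THEN conjunct2, rule_format, OF that] by (simp only:)
    qed
  qed (use that L(1) in blast)+
  show "\<exists>!L. ?Q L" by (rule ex1I[of ?Q, OF Q uniq])
  have "tens_map 1 K = L" unfolding tens_map_def by (rule the_equality[of ?Q, OF Q uniq])
  then show "linear (tens_map 1 K)" "tens_map 1 K (tens xs) = tens (kmap K xs)" using L by simp_all
qed

section \<open>Iterated coproducts and powers of the curvature\<close>

lemma linear_tens_single: "linear (\<lambda>a. tens [a])"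
  using multilinearD[OF multilinear_tens, of "[]" "[]"] by simp

lemma linear_iter_coprod: "linear (iter_coprod m :: 'a::koszul_grading sym \<Rightarrow> _)"
  and iter_coprod_Suc: "iter_coprod (Suc m) (z :: 'a sym) = sw (\<lambda>a b. tens_mult (tens [a]) (iter_coprod m b)) z"
  and bilinear_iter_coprod: "bilinear (\<lambda>a b :: 'a sym. tens_mult (tens [a]) (iter_coprod m b))"
proof -
  have b: "bilinear (\<lambda>a b :: 'a sym. tens_mult (tens [a]) (iter_coprod m b))" if "linear (iter_coprod m :: 'a sym \<Rightarrow> _)" for m
    by (intro bilinearI bilinear_left[OF bilinear_tens_mult] bilinear_right[OF bilinear_tens_mult] that linear_tens_single)
  have "linear (iter_coprod m :: 'a sym \<Rightarrow> _)" for m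
  proof (induction m)
    case 0
    show ?case using linear_tens_single by simp
  next
    case (Suc m)
    show ?case using linear_sw_arg[OF b[OF Suc]] by (simp add: sw_def[abs_def])
  qed
  then show "linear (iter_coprod m :: 'a sym \<Rightarrow> _)" "bilinear (\<lambda>a b :: 'a sym. tens_mult (tens [a]) (iter_coprod m b))"
    using b by blast+
  show "iter_coprod (Suc m) z = sw (\<lambda>a b. tens_mult (tens [a]) (iter_coprod m b)) z"
    by (simp add: sw_def)
qed

text \<open>The exact number of factors is recorded because it determines the sign in front of the
  next factor in \<open>wedge_power_eq\<close>.\<close>

lemma iter_coprod_span: "iter_coprod m z \<in> span {tens xs |xs. length xs = Suc m}" for z :: "'a::koszul_grading sym"
proof (induction m arbitrary: z)
  case 0
  show ?case by (force intro: span_base)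
next
  case (Suc m)
  show ?case unfolding iter_coprod_Suc
  proof (rule sw_mem[OF bilinear_iter_coprod subspace_span])
    fix x y :: "'a sym"
    from Suc[of y] show "tens_mult (tens [x]) (iter_coprod m y) \<in> span {tens xs |xs. length xs = Suc (Suc m)}"
    proof (induction rule: span_induct_alt)
      case base
      show ?case by (simp add: bilinear_rzero[OF bilinear_tens_mult] span_zero)
    next
      case (step c t y)
      then obtain xs where "t = tens xs" "length xs = Suc m" by blast
      then have "tens_mult (tens [x]) t \<in> span {tens xs |xs. length xs = Suc (Suc m)}"
        by (auto simp: tens_mult_tens intro!: span_base)
      with step show ?case
        by (simp add: bilinear_radd[OF bilinear_tens_mult] bilinear_rmul[OF bilinear_tens_mult] span_add span_mul)
    qed
  qed
qed

lemma wedge_power_eq: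
  fixes K :: "'a::koszul_grading sym \<Rightarrow> 'n::koszul_grading"
  assumes K: "linear K" and k: "k \<ge> 1"
  shows "wedge_power K k z = wpow K k z"
proof -
  let ?W = "\<lambda>t. abs_ext (tens_map 1 K t)"
  have lW: "linear ?W" by (rule linear_app[OF linear_abs_ext tens_map_unique(2)[OF K]])
  have W: "?W (tens xs) = wprod (kmap K xs)" for xs
    by (simp add: tens_map_unique(3)[OF K] wprod_def)
  have cons: "?W (tens_mult (tens [a]) t) = wcons (K (kp (int m) a)) (?W t)" if "t \<in> span {tens xs |xs. length xs = m}" for a t m
    using that
  proof (induction rule: span_induct_alt)
    case base
    show ?case by (simp add: bilinear_rzero[OF bilinear_tens_mult] linear_0[OF lW] bilinear_rzero[OF bilinear_wcons])
  next
    case (step c t y)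
    then obtain xs where "t = tens xs" "length xs = m" by blast
    then have "?W (tens_mult (tens [a]) t) = wcons (K (kp (int m) a)) (?W t)"
      by (simp add: tens_mult_tens W wcons_wprod)
    with step show ?case
      by (simp add: bilinear_radd[OF bilinear_tens_mult] bilinear_rmul[OF bilinear_tens_mult] linear_add[OF lW]
          linear_scale[OF lW] bilinear_radd[OF bilinear_wcons] bilinear_rmul[OF bilinear_wcons])
  qed
  \<comment> \<open>The m-fold iterated coproduct has m + 1 factors, hence the shift. For m = 0 the
    counit law removes the trailing 1.\<close>
  have "?W (iter_coprod m z) = wpow K (Suc m) z" for m z
  proof (induction m arbitrary: z)
    case 0
    have "wpow K (Suc 0) z = sw (\<lambda>x y. eps y *\<^sub>R wcons (K x) (wprod [])) z"
      by (simp add: star_def bilinear_rmul[OF bilinear_wcons])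
    also have "\<dots> = wcons (K z) (wprod [])"
      by (rule sw_counit_right) (intro linear_rules K)
    finally show ?case by (simp only: iter_coprod.simps W) (simp add: wcons_wprod)
  next
    case (Suc m)
    have "?W (iter_coprod (Suc m) z) = sw (\<lambda>a b. ?W (tens_mult (tens [a]) (iter_coprod m b))) z"
      unfolding iter_coprod_Suc by (rule sw_linear[OF bilinear_iter_coprod lW])
    also have "\<dots> = sw (\<lambda>a b. wcons (K (kp (int (Suc m)) a)) (wpow K (Suc m) b)) z"
      by (simp only: cons[OF iter_coprod_span] Suc)
    also have "\<dots> = wpow K (Suc (Suc m)) z"
      by (simp only: wpow.simps(2)[of K "Suc m"] star_def)
    finally show ?case .
  qed
  from this[of "k - 1" z] k show ?thesis by (simp add: wedge_power_def)
qed

lemma wpow_morphism: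
  assumes T: "sw_morphism T" "T \<in> Hom 0" and K: "linear K"
  shows "wpow K k (T z) = wpow (\<lambda>x. K (T x)) k z"
proof (induction k arbitrary: z)
  case 0
  show ?case by (simp add: sw_morphism_eps[OF T(1)])
next
  case (Suc k)
  have "star K (int k) (wpow K k) (T z) = sw (\<lambda>x y. wcons (K (kp (int k) (T x))) (wpow K k (T y))) z"
    unfolding star_def
    by (rule sw_morphismD[OF T(1)]) (intro bilinearI linear_rules linear_app[OF K] linear_app[OF linear_wpow[OF K]])
  then show ?case by (simp add: Suc Hom_kp[OF T(2)] star_def)
qed

section \<open>The action on the exterior algebra and invariant maps\<close>

context degree_one_action
begin

lemma wder_list_sum:
  assumes x: "x \<in> gr m" and "homs ds vs"
  shows "wder_list A x vs =
    (\<Sum>i<length vs. sg ((m + 1) * sum_list (take i ds)) *\<^sub>R wprod (vs[i := A x (vs ! i)]))"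
  using assms(2)
proof (induction vs arbitrary: ds)
  case (Cons v vs)
  then obtain d es where ds: "ds = d # es" "v \<in> gr d" "homs es vs" by (auto elim: homs_ConsE)
  have "wcons (kp (m + 1) v) (wder_list A x vs) =
      (\<Sum>i<length vs. sg ((m + 1) * sum_list (take (Suc i) ds)) *\<^sub>R wprod ((v # vs)[Suc i := A x ((v # vs) ! Suc i)]))"
    unfolding Cons.IH[OF ds(3)] kp_gr[OF ds(2)] bilinear_lmul[OF bilinear_wcons]
    by (simp add: linear_sum[OF linear_wcons_right[OF linear_ident]] bilinear_lmul[OF bilinear_wcons]
        bilinear_rmul[OF bilinear_wcons] wcons_wprod ds distrib_left sg_add scaleR_sum_right)
  then show ?case
    unfolding wder_list_Cons[OF x] length_Cons sum.lessThan_Suc_shift by (simp add: wcons_wprod)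
qed simp

end

lemma ext_ad_eq:
  fixes A :: "'e::koszul_grading sym \<Rightarrow> 'n::koszul_grading \<Rightarrow> 'n"
  assumes "degree_one_action A"
  shows "ext_ad (tensor_lift A) = tensor_lift (wder A)"
proof -
  interpret degree_one_action A by fact
  let ?L = "tensor_lift (wder A)"
  have L: "linear ?L" "\<And>x w. ?L (x \<otimes>\<^sub>\<real> w) = wder A x w"
    by (simp_all add: linear_tensor_lift[OF bilinear_wder] tensor_lift_tensor[OF bilinear_wder])
  let ?Q = "\<lambda>L. linear L \<and> (\<forall>m ds x vs. x \<in> gr m \<and> homs ds vs \<longrightarrow>
     L (x \<otimes>\<^sub>\<real> wprod vs) = (\<Sum>i<length vs.
       ((-1) powi ((m + 1) * sum_list (take i ds))) *\<^sub>R wprod (vs[i := tensor_lift A (x \<otimes>\<^sub>\<real> (vs ! i))])))"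
  have Q: "?Q ?L"
    by (simp add: L wder_wprod wder_list_sum powi_sg tensor_lift_tensor[OF bil_A])
  have "L' = ?L" if Q': "?Q L'" for L'
  proof (rule tensor_ext)
    have lin: "linear L'" using Q' by blast
    have "(\<lambda>x. L' (x \<otimes>\<^sub>\<real> w)) = (\<lambda>x. ?L (x \<otimes>\<^sub>\<real> w))" for w
    proof (rule hom_ext)
      fix m and x :: "'e sym" assume x: "x \<in> gr m"
      have "(\<lambda>w. L' (x \<otimes>\<^sub>\<real> w)) = (\<lambda>w. ?L (x \<otimes>\<^sub>\<real> w))"
      proof (rule ext_hom_ext)
        show "L' (x \<otimes>\<^sub>\<real> wprod vs) = ?L (x \<otimes>\<^sub>\<real> wprod vs)" if "homs ds vs" for ds vs
          using Q[THEN conjunct2, rule_format, OF conjI[OF x that]] Q'[THEN conjunct2, rule_format, OF conjI[OF x that]]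
          by (simp only:)
      qed (intro linear_app[OF lin] linear_app[OF L(1)] linear_rules)+
      then show "L' (x \<otimes>\<^sub>\<real> w) = ?L (x \<otimes>\<^sub>\<real> w)" by (rule fun_cong)
    qed (intro linear_app[OF lin] linear_app[OF L(1)] linear_rules)+
    then show "L' (x \<otimes>\<^sub>\<real> w) = ?L (x \<otimes>\<^sub>\<real> w)" for x w by (rule fun_cong)
  qed (use Q' L(1) in blast)+
  then show ?thesis unfolding ext_ad_def by (intro the_equality[of ?Q, OF Q])
qed

lemma invariants_iff:
  fixes \<pi> :: "'e::koszul_grading sym \<Rightarrow> 'g::koszul_grading sym" and \<rho> :: "('g sym, 'v::koszul_grading) tensor \<Rightarrow> 'v"
    and \<iota> :: "'n::koszul_grading sym \<Rightarrow> 'e sym"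
  assumes ad: "ad lam \<iota> = tensor_lift A" and A: "degree_one_action A" and \<pi>: "linear \<pi>" and \<rho>: "linear \<rho>"
  shows "f \<in> invariants lam \<iota> \<pi> \<rho> k p \<longleftrightarrow>
    f \<in> Hom_ext k p \<and> (\<forall>x w. f (wder A x w) = sg p *\<^sub>R \<rho> (\<pi> (kp p x) \<otimes>\<^sub>\<real> f w))"
proof -
  interpret degree_one_action A by fact
  have "(\<forall>x. f (ext_ad (ad lam \<iota>) x) = ((-1) powi p) *\<^sub>R \<rho> (tensor_map 0 \<pi> id (tensor_map p id f x))) \<longleftrightarrow>
      (\<forall>x w. f (wder A x w) = sg p *\<^sub>R \<rho> (\<pi> (kp p x) \<otimes>\<^sub>\<real> f w))" (is "?l \<longleftrightarrow> ?r") if "f \<in> Hom_ext k p"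
  proof -
    have f: "linear f" using that by (simp add: Hom_ext_def Hom_def)
    have lid: "linear (id :: 'v \<Rightarrow> 'v)" "linear (id :: 'e sym \<Rightarrow> 'e sym)" by (simp_all add: linear_id)
    have pure: "f (ext_ad (ad lam \<iota>) (x \<otimes>\<^sub>\<real> w)) = f (wder A x w)"
      "\<rho> (tensor_map 0 \<pi> id (tensor_map p id f (x \<otimes>\<^sub>\<real> w))) = \<rho> (\<pi> (kp p x) \<otimes>\<^sub>\<real> f w)" for x w
      by (simp_all add: ad ext_ad_eq[OF A] tensor_lift_tensor[OF bilinear_wder] tensor_map_tensor[OF lid(2) f]
          tensor_map_tensor[OF \<pi> lid(1)])
    show ?thesis
    proof
      assume ?l
      then show ?r by (metis pure powi_sg)
    next
      assume r: ?r
      have "(\<lambda>x. f (ext_ad (ad lam \<iota>) x)) = (\<lambda>x. ((-1) powi p) *\<^sub>R \<rho> (tensor_map 0 \<pi> id (tensor_map p id f x)))"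
      proof (rule tensor_ext)
        show "linear (\<lambda>x. f (ext_ad (ad lam \<iota>) x))"
          unfolding ad ext_ad_eq[OF A] by (intro linear_app[OF f] linear_tensor_lift bilinear_wder)
        show "linear (\<lambda>x. ((-1) powi p) *\<^sub>R \<rho> (tensor_map 0 \<pi> id (tensor_map p id f x)))"
          by (intro linear_rules linear_app[OF \<rho>] linear_app[OF linear_tensor_map[OF \<pi> lid(1)]]
              linear_tensor_map[OF lid(2) f])
      qed (simp add: pure r powi_sg)
      then show ?l by meson
    qed
  qed
  then show ?thesis by (auto simp: invariants_def)
qed


section \<open>Cochains and cohomology\<close>

lemma ruth_diff_sw:
  assumes "linear \<rho>" "linear \<alpha>"
  shows "ruth_diff lam \<rho> P \<alpha> z = sw (\<lambda>x y. \<rho> (kp P x \<otimes>\<^sub>\<real> \<alpha> y)) z - sg P *\<^sub>R \<alpha> (codiff lam z)"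
  using tensor_map_coprod[OF assms(1) linear_id assms(2), of P z]
  by (simp add: ruth_diff_def powi_sg)

lemma bilinear_cochain:
  "linear \<rho> \<Longrightarrow> linear \<alpha> \<Longrightarrow> bilinear (\<lambda>(x :: 'a::koszul_grading sym) y. \<rho> (kp P x \<otimes>\<^sub>\<real> \<alpha> y))"
  by (rule bilinearI; rule linear_app[of \<rho>], assumption; intro linear_rules; assumption)

lemma ruth_diff_diff:
  assumes "linear \<rho>" "linear \<alpha>" "linear \<beta>"
  shows "ruth_diff lam \<rho> P (\<lambda>x. \<alpha> x - \<beta> x) z = ruth_diff lam \<rho> P \<alpha> z - ruth_diff lam \<rho> P \<beta> z"
  using sw_diff[OF bilinear_cochain[OF assms(1,2), of P] bilinear_cochain[OF assms(1,3), of P], of z]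
  by (simp add: ruth_diff_sw assms linear_compose_sub bilinear_rsub[OF bilinear_tensor] linear_diff[OF assms(1)]
      scaleR_diff_right)

lemma Hom_diff:
  fixes \<alpha> :: "'a::grading \<Rightarrow> 'b::graded_vector"
  shows "\<alpha> \<in> Hom p \<Longrightarrow> \<beta> \<in> Hom p \<Longrightarrow> (\<lambda>x. \<alpha> x - \<beta> x) \<in> Hom p"
  by (auto simp: Hom_def linear_compose_sub gr_diff)

lemma Hom_zero: "(\<lambda>x. 0 :: 'b::graded_vector) \<in> Hom p"
  by (auto simp: Hom_def linear_zero zero_gr)

lemma coboundaries_diff:
  assumes \<rho>: "linear \<rho>" and "\<alpha> \<in> coboundaries lam \<rho> P" "\<beta> \<in> coboundaries lam \<rho> P"
  shows "(\<lambda>x. \<alpha> x - \<beta> x) \<in> coboundaries lam \<rho> P"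
proof -
  obtain \<alpha>' \<beta>' where *: "\<alpha>' \<in> Hom (P - 1)" "\<alpha> = ruth_diff lam \<rho> (P - 1) \<alpha>'" "\<beta>' \<in> Hom (P - 1)" "\<beta> = ruth_diff lam \<rho> (P - 1) \<beta>'"
    using assms(2,3) by (auto simp: coboundaries_def)
  then have "(\<lambda>x. \<alpha> x - \<beta> x) = ruth_diff lam \<rho> (P - 1) (\<lambda>x. \<alpha>' x - \<beta>' x)"
    by (simp add: fun_eq_iff ruth_diff_diff[OF \<rho>] HomD(1))
  then show ?thesis using Hom_diff[OF *(1,3)] by (simp add: coboundaries_def)
qed

lemma coboundaries_zero:
  assumes \<rho>: "linear \<rho>"
  shows "(\<lambda>x. 0) \<in> coboundaries lam \<rho> P"
proof -
  have "(\<lambda>x. 0) = ruth_diff lam \<rho> (P - 1) (\<lambda>x. 0)"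
    by (simp add: fun_eq_iff ruth_diff_sw[OF \<rho> linear_zero] bilinear_rzero[OF bilinear_tensor] linear_0[OF \<rho>] sw_zero)
  then show ?thesis using Hom_zero by (auto simp: coboundaries_def)
qed

lemma equiv_cohomologous:
  assumes \<rho>: "linear \<rho>"
  shows "equiv (cocycles lam \<rho> P) (cohomologous lam \<rho> P)"
proof (rule equivI)
  show "refl_on (cocycles lam \<rho> P) (cohomologous lam \<rho> P)"
    using coboundaries_zero[OF \<rho>] by (auto simp: refl_on_def cohomologous_def)
  show "sym (cohomologous lam \<rho> P)"
    using coboundaries_diff[OF \<rho> coboundaries_zero[OF \<rho>]] by (fastforce simp: sym_def cohomologous_def)
  show "trans (cohomologous lam \<rho> P)"
  proof (rule transI)
    fix \<alpha> \<beta> \<gamma> assume *: "(\<alpha>, \<beta>) \<in> cohomologous lam \<rho> P" "(\<beta>, \<gamma>) \<in> cohomologous lam \<rho> P"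
    then have "(\<lambda>x. \<gamma> x - \<beta> x) \<in> coboundaries lam \<rho> P"
      using coboundaries_diff[OF \<rho> coboundaries_zero[OF \<rho>]] by (fastforce simp: cohomologous_def)
    with * have "(\<lambda>x. (\<alpha> x - \<beta> x) - (\<gamma> x - \<beta> x)) \<in> coboundaries lam \<rho> P"
      by (intro coboundaries_diff[OF \<rho>, where \<alpha>="\<lambda>x. \<alpha> x - \<beta> x" and \<beta>="\<lambda>x. \<gamma> x - \<beta> x"])
        (auto simp: cohomologous_def)
    with * show "(\<alpha>, \<gamma>) \<in> cohomologous lam \<rho> P" by (simp add: cohomologous_def)
  qed
qed (auto simp: cohomologous_def)

lemma coho_class_eq:
  assumes "linear \<rho>" "(\<alpha>, \<beta>) \<in> cohomologous lam \<rho> P"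
  shows "coho_class lam \<rho> P \<alpha> = coho_class lam \<rho> P \<beta>"
  unfolding coho_class_def by (rule equiv_class_eq[OF equiv_cohomologous[OF assms(1)] assms(2)])

lemma coho_class_in_cohomology: "\<alpha> \<in> cocycles lam \<rho> P \<Longrightarrow> coho_class lam \<rho> P \<alpha> \<in> cohomology lam \<rho> P"
  unfolding coho_class_def cohomology_def by (rule quotientI)

text \<open>Used for the given ruth morphism and also for the identity of (V, \<rho>), which brings
  the upper row of the square under the same statements.\<close>

locale ruth_pullback =
  fixes lamh :: "'h::graded_vector shift sym \<Rightarrow> 'h shift" and \<tau> :: "('h shift sym, 'w::graded_vector) tensor \<Rightarrow> 'w"
    and lamg :: "'g::graded_vector shift sym \<Rightarrow> 'g shift" and \<rho> :: "('g shift sym, 'v::graded_vector) tensor \<Rightarrow> 'v"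
    and T :: "'h shift sym \<Rightarrow> 'g shift sym" and t :: "'v \<Rightarrow> 'w"
  assumes T: "sw_morphism T" "T \<in> Hom 0" and T_codiff: "\<And>z. T (codiff lamh z) = codiff lamg (T z)"
    and t: "t \<in> Hom 0" and lin_\<rho>: "linear \<rho>" and lin_\<tau>: "linear \<tau>"
    and t_\<rho>: "\<And>x w. t (\<rho> (T x \<otimes>\<^sub>\<real> w)) = \<tau> (x \<otimes>\<^sub>\<real> t w)"
begin

lemma Hom_pullback: "\<alpha> \<in> Hom P \<Longrightarrow> t \<circ> \<alpha> \<circ> T \<in> Hom P"
proof -
  assume \<alpha>: "\<alpha> \<in> Hom P"
  have "linear (\<lambda>z. t (\<alpha> (T z)))"
    by (rule linear_app[OF HomD(1)[OF t] linear_app[OF HomD(1)[OF \<alpha>] HomD(1)[OF T(2)]]])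
  then show ?thesis using HomD(2)[OF t] HomD(2)[OF T(2)] HomD(2)[OF \<alpha>] by (fastforce simp: Hom_def o_def)
qed

lemma ruth_diff_pullback:
  assumes \<alpha>: "linear \<alpha>"
  shows "ruth_diff lamh \<tau> P (t \<circ> \<alpha> \<circ> T) z = t (ruth_diff lamg \<rho> P \<alpha> (T z))"
proof -
  have lin: "linear (\<lambda>z. t (\<alpha> (T z)))"
    by (intro linear_app[OF HomD(1)[OF t]] linear_app[OF \<alpha>] HomD(1)[OF T(2)])
  have "t (sw (\<lambda>x y. \<rho> (kp P x \<otimes>\<^sub>\<real> \<alpha> y)) (T z)) = sw (\<lambda>x y. t (\<rho> (kp P x \<otimes>\<^sub>\<real> \<alpha> y))) (T z)"
    by (rule sw_linear[OF bilinear_cochain[OF lin_\<rho> \<alpha>] HomD(1)[OF t]])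
  also have "\<dots> = sw (\<lambda>x y. t (\<rho> (kp P (T x) \<otimes>\<^sub>\<real> \<alpha> (T y)))) z"
    by (rule sw_morphismD[OF T(1)])
      (intro bilinearI linear_app[OF HomD(1)[OF t]] linear_app[OF lin_\<rho>] linear_rules \<alpha>)
  also have "\<dots> = sw (\<lambda>x y. \<tau> (kp P x \<otimes>\<^sub>\<real> t (\<alpha> (T y)))) z"
    by (simp add: Hom_kp[OF T(2)] t_\<rho>)
  finally show ?thesis
    using ruth_diff_sw[OF lin_\<tau> lin, of lamh P z]
    by (simp add: o_def ruth_diff_sw[OF lin_\<rho> \<alpha>] linear_diff[OF HomD(1)[OF t]] linear_scale[OF HomD(1)[OF t]] T_codiff)
qed

lemma cocycles_pullback: "\<alpha> \<in> cocycles lamg \<rho> P \<Longrightarrow> t \<circ> \<alpha> \<circ> T \<in> cocycles lamh \<tau> P"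
  using Hom_pullback by (auto simp: cocycles_def ruth_diff_pullback HomD(1) linear_0[OF HomD(1)[OF t]])

lemma cohomologous_pullback:
  assumes "(\<alpha>, \<beta>) \<in> cohomologous lamg \<rho> P"
  shows "(t \<circ> \<alpha> \<circ> T, t \<circ> \<beta> \<circ> T) \<in> cohomologous lamh \<tau> P"
proof -
  obtain \<gamma> where \<gamma>: "\<gamma> \<in> Hom (P - 1)" "(\<lambda>x. \<alpha> x - \<beta> x) = ruth_diff lamg \<rho> (P - 1) \<gamma>"
    using assms by (auto simp: cohomologous_def coboundaries_def)
  have "(\<lambda>x. (t \<circ> \<alpha> \<circ> T) x - (t \<circ> \<beta> \<circ> T) x) = ruth_diff lamh \<tau> (P - 1) (t \<circ> \<gamma> \<circ> T)"
    using fun_cong[OF \<gamma>(2)] by (simp add: fun_eq_iff ruth_diff_pullback[OF HomD(1)[OF \<gamma>(1)]] flip: linear_diff[OF HomD(1)[OF t]])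
  then have "(\<lambda>x. (t \<circ> \<alpha> \<circ> T) x - (t \<circ> \<beta> \<circ> T) x) \<in> coboundaries lamh \<tau> P"
    using Hom_pullback[OF \<gamma>(1)] by (simp add: coboundaries_def)
  then show ?thesis using assms cocycles_pullback by (simp add: cohomologous_def)
qed

text \<open>The union runs over a nonempty class, on which the pulled back class is
  constant.\<close>

lemma coho_pullback_class:
  assumes "\<alpha> \<in> cocycles lamg \<rho> P"
  shows "coho_pullback lamh \<tau> T t P (coho_class lamg \<rho> P \<alpha>) = coho_class lamh \<tau> P (t \<circ> \<alpha> \<circ> T)"
proof -
  have "\<alpha> \<in> coho_class lamg \<rho> P \<alpha>"
    unfolding coho_class_def using equiv_class_self[OF equiv_cohomologous[OF lin_\<rho>] assms] .
  moreover have "coho_class lamh \<tau> P (t \<circ> \<beta> \<circ> T) = coho_class lamh \<tau> P (t \<circ> \<alpha> \<circ> T)" if "\<beta> \<in> coho_class lamg \<rho> P \<alpha>" for \<beta>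
    using that by (intro coho_class_eq[OF lin_\<tau>, symmetric] cohomologous_pullback) (simp add: coho_class_def)
  ultimately show ?thesis unfolding coho_pullback_def by blast
qed

end


section \<open>Extensions\<close>

text \<open>For maps defined through \<open>inv e\<close>: linearity is checked after composition
  with the injection.\<close>

lemma linear_inj_cancel:
  assumes e: "linear e" "inj e" and f: "linear (\<lambda>x. e (f x))"
  shows "linear f"
proof (rule linearI)
  show "f (x + y) = f x + f y" for x y
    using linear_add[OF f, of x y] e(2) by (simp add: linear_add[OF e(1), symmetric] inj_eq)
  show "f (c *\<^sub>R x) = c *\<^sub>R f x" for c x
    using linear_scale[OF f, of c x] e(2) by (simp add: linear_scale[OF e(1), symmetric] inj_eq)
qed

lemma Hom_component:
  fixes e :: "'a::graded_vector \<Rightarrow> 'b::graded_vector"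
  assumes e: "e \<in> Hom 0"
  shows "component m (e v) = e (component m v)"
proof (rule component_eqI[OF finite_component])
  show "e (component n v) \<in> gr n" for n using HomD(2)[OF e component_gr[of n v]] by simp
  show "e v = (\<Sum>n | component n v \<noteq> 0. e (component n v))"
    by (simp add: linear_sum[OF HomD(1)[OF e], symmetric] sum_component)
qed (simp add: linear_0[OF HomD(1)[OF e]])

text \<open>A degree-preserving map commutes with taking components, so an injective one also
  reflects degrees.\<close>

lemma inj_Hom_gr:
  fixes e :: "'a::graded_vector \<Rightarrow> 'b::graded_vector"
  assumes e: "e \<in> Hom 0" "inj e" and v: "e v \<in> gr n"
  shows "v \<in> gr n"
  unfolding gr_iff_component
proof (intro allI impI)
  fix m assume "m \<noteq> n"
  then have "e (component m v) = e 0"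
    using v by (simp add: Hom_component[OF e(1), symmetric] component_of_gr linear_0[OF HomD(1)[OF e(1)]])
  then show "component m v = 0" using e(2) by (simp add: inj_eq)
qed

lemma Hom_comp: "F \<in> Hom 0 \<Longrightarrow> G \<in> Hom p \<Longrightarrow> (\<lambda>x. F (G x)) \<in> Hom p"
  by (auto simp: Hom_def linear_app)

lemma comp1_Hom:
  fixes F :: "'a::koszul_grading sym \<Rightarrow> 'b::koszul_grading sym"
  assumes "F \<in> Hom 0"
  shows "comp1 F \<in> Hom 0"
proof -
  have "(sym_incl :: 'a \<Rightarrow> 'a sym) \<in> Hom 0" by (auto simp: Hom_def linear_sym_incl sym_incl_gr)
  from Hom_comp[OF sym_proj_Hom Hom_comp[OF assms this]] show ?thesis by (simp add: comp1_def o_def)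
qed

lemma comp1_sym_map:
  fixes f :: "'a::koszul_grading \<Rightarrow> 'b::koszul_grading"
  shows "f \<in> Hom 0 \<Longrightarrow> comp1 (sym_map f) = f"
  by (simp add: comp1_def fun_eq_iff sym_incl_def sym_map_sprod sym_proj_single)

text \<open>Both sides are coalgebra morphisms with the same projection to the vectors, and
  \<open>sw_morphism_unique\<close> applies.\<close>

lemma strict_eq_sym_map:
  fixes F :: "'a::koszul_grading sym \<Rightarrow> 'b::koszul_grading sym"
  assumes F: "coalgebra_morphism F" "strict F"
  shows "F = sym_map (comp1 F)"
proof -
  have hF: "F \<in> Hom 0" and sF: "sw_morphism F" using F(1) by (simp_all add: coalgebra_morphism_iff)
  note hc = comp1_Hom[OF hF]
  have "(\<lambda>x. sym_proj (F x)) = (\<lambda>x. comp1 F (sym_proj x))"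
  proof (rule sym_hom_ext)
    fix ds and vs :: "'a list"
    consider "vs = []" | v where "vs = [v]" | "length vs \<ge> 2"
      by (cases vs; cases "tl vs") auto
    then show "sym_proj (F (sprod vs)) = comp1 F (sym_proj (sprod vs))"
    proof cases
      case 1
      then show ?thesis by (simp add: sw_morphism_one[OF sF] linear_0[OF HomD(1)[OF hc]])
    next
      case 2
      then show ?thesis by (simp add: sym_proj_single comp1_def sym_incl_def)
    next
      case 3
      have "sprod vs \<in> sym_pow (length vs)" unfolding sym_pow_def by (rule span_base) blast
      then have "sym_proj (F (sprod vs)) = 0" using F(2) 3 by (simp add: strict_def)
      then show ?thesis using 3 by (simp add: sym_proj_other linear_0[OF HomD(1)[OF hc]])
    qed
  qed (intro linear_rules HomD(1)[OF hF] linear_app[OF HomD(1)[OF hc]] linear_sym_proj)+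
  then show ?thesis
    by (intro sw_morphism_unique[OF sF sw_morphism_sym_map[OF hc]]) (simp add: sym_proj_sym_map[OF hc] fun_eq_iff)
qed

lemma sym_proj_codiff:
  fixes lam :: "'a::koszul_grading sym \<Rightarrow> 'a"
  assumes "linear lam"
  shows "sym_proj (codiff lam z) = lam z"
proof -
  have "sym_proj (codiff lam z) = sw (\<lambda>x y. eps y *\<^sub>R lam x) z"
    unfolding codiff_sw[OF assms]
    by (subst sw_linear[OF _ linear_sym_proj])
      (auto intro!: bilinearI linear_rules linear_app[OF assms] simp: sym_proj_vcons)
  then show ?thesis by (simp add: sw_counit_right[OF assms])
qed

lemma sym_map_vee_incl:
  fixes f :: "'a::koszul_grading \<Rightarrow> 'b::koszul_grading"
  assumes f: "f \<in> Hom 0"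
  shows "sym_map f (x \<or>\<^sub>S sym_incl w) = sym_map f x \<or>\<^sub>S sym_incl (f w)"
proof -
  have "(\<lambda>x. sym_map f (x \<or>\<^sub>S sym_incl w)) = (\<lambda>x. sym_map f x \<or>\<^sub>S sym_incl (f w))"
    by (intro sym_hom_ext linear_app[OF linear_sym_map[OF f]] linear_rules linear_sym_map[OF f])
      (simp add: sym_incl_def vee_sprod sym_map_sprod[OF f])
  then show ?thesis by (rule fun_cong)
qed

lemma sym_incl_0 [simp]: "sym_incl 0 = 0"
  by (rule linear_0[OF linear_sym_incl])

text \<open>The signs in the derivation depend on the degree of x only, and F preserves it.\<close>

lemma wder_comp:
  fixes A :: "'e::koszul_grading sym \<Rightarrow> 'n::koszul_grading \<Rightarrow> 'n" and F :: "'h::koszul_grading sym \<Rightarrow> 'e sym"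
  assumes A: "degree_one_action A" and F: "F \<in> Hom 0"
  shows "degree_one_action (\<lambda>x. A (F x))" and "wder (\<lambda>x. A (F x)) x w = wder A (F x) w"
proof -
  interpret degree_one_action A by fact
  show AF: "degree_one_action (\<lambda>x. A (F x))"
  proof
    show "bilinear (\<lambda>x. A (F x))"
      by (intro bilinearI bilinear_left[OF bil_A] bilinear_right[OF bil_A] HomD(1)[OF F] linear_ident)
    show "A (F x) v \<in> gr (m + d + 1)" if "x \<in> gr m" "v \<in> gr d" for m d x v
      using A_gr[OF _ that(2)] HomD(2)[OF F that(1)] by simp
  qed
  interpret AF: degree_one_action "\<lambda>x. A (F x)" by (rule AF)
  have "wder_list (\<lambda>x. A (F x)) x vs = wder_list A (F x) vs" if x: "x \<in> gr m" for x m and vs :: "'n list"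
  proof (induction vs)
    case (Cons v vs)
    have "F x \<in> gr m" using HomD(2)[OF F x] by simp
    then show ?case by (simp only: AF.wder_list_Cons[OF x] wder_list_Cons Cons)
  qed simp
  then have "(\<lambda>w. wder (\<lambda>x. A (F x)) x w) = (\<lambda>w. wder A (F x) w)" if "x \<in> gr m" for x m
    using that
    by (intro ext_hom_ext) (auto simp: AF.wder_wprod wder_wprod intro: bilinear_right[OF bilinear_wder]
      bilinear_right[OF AF.bilinear_wder] linear_ident)
  then have "(\<lambda>x. wder (\<lambda>x. A (F x)) x w) = (\<lambda>x. wder A (F x) w)" for w
    by (intro hom_ext bilinear_left[OF bilinear_wder] bilinear_left[OF AF.bilinear_wder] linear_ident HomD(1)[OF F])
      simp
  then show "wder (\<lambda>x. A (F x)) x w = wder A (F x) w" by (rule fun_cong)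
qed

section \<open>An extension described by the first components of its maps\<close>

locale extension_setting =
  fixes lamn :: "'n::graded_vector shift sym \<Rightarrow> 'n shift" and lame :: "'e::graded_vector shift sym \<Rightarrow> 'e shift"
    and lamg :: "'g::graded_vector shift sym \<Rightarrow> 'g shift"
    and \<iota> :: "'n shift sym \<Rightarrow> 'e shift sym" and \<pi> :: "'e shift sym \<Rightarrow> 'g shift sym"
  assumes extension: "extension lamn lame lamg \<iota> \<pi>"
begin

abbreviation "e \<equiv> comp1 \<iota>"
abbreviation "p1 \<equiv> comp1 \<pi>"

lemma lame_Hom: "lame \<in> Hom 1" and lamg_Hom: "lamg \<in> Hom 1"
  and codiff_lame: "codiff lame (codiff lame z) = 0"
  and \<pi>_codiff: "\<pi> (codiff lame z) = codiff lamg (\<pi> z)"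
  and e_Hom: "e \<in> Hom 0" and p1_Hom: "p1 \<in> Hom 0" and inj_e: "inj e"
  and e_range: "y \<in> range e \<longleftrightarrow> p1 y = 0" and \<pi>_eq: "\<pi> = sym_map p1"
  using extension strict_eq_sym_map[of \<pi>]
  by (auto simp: extension_def Linfty_algebra_def Linfty_morphism_def coalgebra_morphism_iff fun_eq_iff
      intro!: comp1_Hom)

lemma e_inv: "p1 y = 0 \<Longrightarrow> e (inv e y) = y"
  by (rule f_inv_into_f) (simp add: e_range)

lemma inv_e: "inv e (e v) = v"
  by (rule inv_f_f[OF inj_e])

lemma p1_e: "p1 (e v) = 0"
  using e_range[of "e v"] by simp

lemma \<pi>_morphism: "sw_morphism \<pi>" and \<pi>_Hom: "\<pi> \<in> Hom 0"
  using sw_morphism_sym_map[OF p1_Hom] sym_map_Hom[OF p1_Hom] by (simp_all only: \<pi>_eq[symmetric])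

lemma sym_proj_\<pi>: "sym_proj (\<pi> x) = p1 (sym_proj x)"
  using sym_proj_sym_map[OF p1_Hom, of x] by (simp only: \<pi>_eq[symmetric])

lemma p1_lame: "p1 (lame x) = lamg (\<pi> x)"
proof -
  have "p1 (lame x) = sym_proj (\<pi> (codiff lame x))"
    by (simp add: sym_proj_\<pi> sym_proj_codiff[OF HomD(1)[OF lame_Hom]])
  then show ?thesis by (simp add: \<pi>_codiff sym_proj_codiff[OF HomD(1)[OF lamg_Hom]])
qed

definition act :: "'e shift sym \<Rightarrow> 'n shift \<Rightarrow> 'n shift" where
  "act x v = inv e (lame (x \<or>\<^sub>S sym_incl (e v)))"

text \<open>n is an ideal: \<pi> kills a product with a vector of n, and \<pi> commutes with the
  structure maps, so \<open>lame\<close> of such a product lies in the image of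
  \<open>e\<close>.\<close>

lemma e_act: "e (act x v) = lame (x \<or>\<^sub>S sym_incl (e v))"
  unfolding act_def
proof (rule e_inv)
  have "\<pi> (x \<or>\<^sub>S sym_incl (e v)) = 0"
    using sym_map_vee_incl[OF p1_Hom, of x "e v"]
    by (simp add: p1_e bilinear_rzero[OF bilinear_vee] flip: \<pi>_eq)
  then show "p1 (lame (x \<or>\<^sub>S sym_incl (e v))) = 0"
    by (simp add: p1_lame linear_0[OF HomD(1)[OF lamg_Hom]])
qed

lemma ad_eq: "ad lame \<iota> = tensor_lift act"
  by (simp add: ad_def act_def[abs_def])

lemma degree_one_act: "degree_one_action act"
proof
  note l = linear_rules linear_app[OF HomD(1)[OF lame_Hom]] linear_app[OF HomD(1)[OF e_Hom]] HomD(1)[OF e_Hom]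
  show "bilinear act"
    by (intro bilinearI; rule linear_inj_cancel[OF HomD(1)[OF e_Hom] inj_e]; unfold e_act; intro l)
  fix m d and x :: "'e shift sym" and v :: "'n shift" assume x: "x \<in> gr m" and v: "v \<in> gr d"
  have ev: "e v \<in> gr d" using HomD(2)[OF e_Hom v] by simp
  have "x \<or>\<^sub>S sym_incl (e v) \<in> gr (d + m)"
    unfolding vee_incl_right[OF ev x] by (intro gr_scaleR vcons_gr ev x)
  from HomD(2)[OF lame_Hom this] show "act x v \<in> gr (m + d + 1)"
    by (intro inj_Hom_gr[OF e_Hom inj_e]) (simp add: e_act add.commute)
qed

lemma lame_codiff: "lame (codiff lame z) = 0"
  using sym_proj_codiff[OF HomD(1)[OF lame_Hom], of "codiff lame z"]
  by (simp add: codiff_lame linear_0[OF linear_sym_proj])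

lemma twisted_act:
  fixes lamh :: "'h::graded_vector shift sym \<Rightarrow> 'h shift"
  assumes "Linfty_algebra lamh"
  shows "twisted act lame (codiff lamh) e"
  using degree_one_act assms
  by (auto simp: twisted_def twisted_axioms_def lame_Hom lame_codiff e_Hom inj_e e_act Linfty_algebra_def
      intro: coderivation_codiff)

text \<open>The curvature of a lift. For the lift attached to a section it is the curvature of the
  section composed with T, see \<open>kcurv_section\<close>.\<close>

definition kcurv :: "('h::graded_vector shift sym \<Rightarrow> 'h shift) \<Rightarrow> ('h shift sym \<Rightarrow> 'e shift) \<Rightarrow> 'h shift sym \<Rightarrow> 'n shift" where
  "kcurv lamh \<phi> z = inv e (lame (expc \<phi> z) - \<phi> (codiff lamh z))"

end

text \<open>A lift \<open>\<phi>\<close> of \<open>T\<close> plays the role of a section: it generates a coalgebra morphism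
  \<open>expc \<phi>\<close> with \<open>\<pi> \<circ> expc \<phi> = T\<close>.\<close>

locale lift_setting = extension_setting lamn lame lamg \<iota> \<pi> + ruth_pullback lamh \<tau> lamg \<rho> T t
  for lamn :: "'n::graded_vector shift sym \<Rightarrow> 'n shift" and lame :: "'e::graded_vector shift sym \<Rightarrow> 'e shift"
    and lamg :: "'g::graded_vector shift sym \<Rightarrow> 'g shift"
    and \<iota> :: "'n shift sym \<Rightarrow> 'e shift sym" and \<pi> :: "'e shift sym \<Rightarrow> 'g shift sym"
    and lamh :: "'h::graded_vector shift sym \<Rightarrow> 'h shift" and \<tau> :: "('h shift sym, 'w::graded_vector) tensor \<Rightarrow> 'w"
    and \<rho> :: "('g shift sym, 'v::graded_vector) tensor \<Rightarrow> 'v"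
    and T :: "'h shift sym \<Rightarrow> 'g shift sym" and t :: "'v \<Rightarrow> 'w" +
  assumes lamh: "Linfty_algebra lamh"
begin

lemma lamh_Hom: "lamh \<in> Hom 1"
  using lamh by (simp add: Linfty_algebra_def)

definition lift :: "('h shift sym \<Rightarrow> 'e shift) \<Rightarrow> bool" where
  "lift \<phi> \<longleftrightarrow> cogenerator \<phi> \<and> (\<forall>x. p1 (\<phi> x) = sym_proj (T x))"

lemma \<pi>_expc:
  assumes "lift \<phi>"
  shows "\<pi> (expc \<phi> x) = T x"
proof -
  interpret cogenerator \<phi> using assms by (simp add: lift_def)
  have "(\<lambda>x. \<pi> (expc \<phi> x)) = T"
    using assms by (intro sw_morphism_unique[OF sw_morphism_comp[OF \<pi>_morphism expc_sw_morphism] T(1)])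
      (simp add: sym_proj_\<pi> sym_proj_expc lift_def)
  then show ?thesis by (rule fun_cong)
qed

lemma sym_proj_T_codiff: "sym_proj (T (codiff lamh z)) = lamg (T z)"
  by (simp add: T_codiff sym_proj_codiff[OF HomD(1)[OF lamg_Hom]])

text \<open>The bracket lies in the image of n[1]: p1 sends it to the difference of the two sides of
  the compatibility of T with the codifferentials.\<close>

lemma e_kcurv:
  assumes "lift \<phi>"
  shows "e (kcurv lamh \<phi> z) = lame (expc \<phi> z) - \<phi> (codiff lamh z)"
  unfolding kcurv_def
  using assms by (intro e_inv) (simp add: linear_diff[OF HomD(1)[OF p1_Hom]] p1_lame \<pi>_expc sym_proj_T_codiff lift_def)

lemma kcurv_Hom:
  assumes "lift \<phi>"
  shows "kcurv lamh \<phi> \<in> Hom 1"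
proof -
  interpret cogenerator \<phi> using assms by (simp add: lift_def)
  have h: "(\<lambda>z. lame (expc \<phi> z) - \<phi> (codiff lamh z)) \<in> Hom 1"
  proof (rule Hom_diff)
    show "(\<lambda>z. lame (expc \<phi> z)) \<in> Hom 1"
      using HomD[OF lame_Hom] HomD[OF expc_Hom] by (fastforce simp: Hom_def intro: linear_app[OF HomD(1)[OF lame_Hom]])
    show "(\<lambda>z. \<phi> (codiff lamh z)) \<in> Hom 1"
      by (rule Hom_comp[OF \<phi>_Hom coderivation_Hom[OF coderivation_codiff[OF lamh_Hom]]])
  qed
  have "linear (kcurv lamh \<phi>)"
    by (rule linear_inj_cancel[OF HomD(1)[OF e_Hom] inj_e]) (simp add: e_kcurv[OF assms] HomD(1)[OF h])
  moreover have "kcurv lamh \<phi> z \<in> gr (n + 1)" if "z \<in> gr n" for z n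
    using HomD(2)[OF h that] by (intro inj_Hom_gr[OF e_Hom inj_e]) (simp add: e_kcurv[OF assms])
  ultimately show ?thesis by (simp add: Hom_def)
qed

text \<open>Invariance of f involves \<open>expc \<phi>\<close> only through its composite with
  \<pi>, which is T; the ruth morphism then moves t past \<rho>. The right-hand side is therefore
  the same for all lifts.\<close>

lemma equivariant:
  assumes f: "f \<in> invariants lame \<iota> \<pi> \<rho> k p" and \<phi>: "lift \<phi>"
  shows "t (f (wder act (expc \<phi> x) w)) = sg p *\<^sub>R \<tau> (kp p x \<otimes>\<^sub>\<real> t (f w))"
proof -
  interpret cogenerator \<phi> using \<phi> by (simp add: lift_def)
  have "f (wder act (expc \<phi> x) w) = sg p *\<^sub>R \<rho> (\<pi> (kp p (expc \<phi> x)) \<otimes>\<^sub>\<real> f w)"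
    using f invariants_iff[OF ad_eq degree_one_act HomD(1)[OF \<pi>_Hom] lin_\<rho>] by blast
  then show ?thesis
    by (simp add: Hom_kp[OF expc_Hom] \<pi>_expc[OF \<phi>] t_\<rho> linear_scale[OF HomD(1)[OF t]])
qed

lemma invariants_Hom: "f \<in> invariants lame \<iota> \<pi> \<rho> k p \<Longrightarrow> (\<lambda>w. t (f w)) \<in> Hom p"
  by (rule Hom_comp[OF t]) (simp add: invariants_def Hom_ext_def)

lemma bilinear_\<tau>: "bilinear (\<lambda>x w. \<tau> (x \<otimes>\<^sub>\<real> w))"
  by (intro bilinearI linear_app[OF lin_\<tau>] linear_rules)

lemma cw_cocycle:
  assumes f: "f \<in> invariants lame \<iota> \<pi> \<rho> k p" and \<phi>: "lift \<phi>"
  shows "(\<lambda>z. t (f (wpow (kcurv lamh \<phi>) k z))) \<in> cocycles lamh \<tau> (int k + p)"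
proof -
  interpret tw: twisted act lame "codiff lamh" e by (rule twisted_act[OF lamh])
  interpret cogenerator \<phi> using \<phi> by (simp add: lift_def)
  note g = invariants_Hom[OF f] and K = kcurv_Hom[OF \<phi>]
  note lw = linear_wpow[OF HomD(1)[OF K], of k]
  have cu: "tw.curv \<phi> (kcurv lamh \<phi>)"
    unfolding tw.curv_def using e_kcurv[OF \<phi>] K cogenerator_axioms by blast
  have lin: "linear (\<lambda>z. t (f (wpow (kcurv lamh \<phi>) k z)))"
    by (rule linear_app[OF HomD(1)[OF g] lw])
  have "t (f (wpow (kcurv lamh \<phi>) k z)) \<in> gr (n + (int k + p))" if "z \<in> gr n" for z n
    using HomD(2)[OF g wpow_gr[OF K that, of k]] by (simp add: algebra_simps)
  moreover have "ruth_diff lamh \<tau> (int k + p) (\<lambda>z. t (f (wpow (kcurv lamh \<phi>) k z))) z = 0" for z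
  proof -
    have "sw (\<lambda>x y. \<tau> (kp (p + int k) x \<otimes>\<^sub>\<real> t (f (wpow (kcurv lamh \<phi>) k y)))) z -
        sg (p + int k) *\<^sub>R t (f (wpow (kcurv lamh \<phi>) k (codiff lamh z))) =
        sg p *\<^sub>R t (f (tdiff (wder act) (expc \<phi>) (codiff lamh) (int k) (wpow (kcurv lamh \<phi>) k) z))"
      by (rule tdiff_equivariant[where g="\<lambda>w. t (f w)" and R="\<lambda>x w. \<tau> (x \<otimes>\<^sub>\<real> w)" and B="wder act"])
        (rule HomD(1)[OF g] tw.bilinear_wder bilinear_\<tau> linear_expc lw equivariant[OF f \<phi>])+
    then show ?thesis
      by (simp add: ruth_diff_sw[OF lin_\<tau> lin] add.commute tw.tdiff_wpow[OF cu] linear_0[OF HomD(1)[OF g]])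
  qed
  ultimately show ?thesis by (simp add: cocycles_def Hom_def lin)
qed

lemma cw_cohomologous:
  assumes f: "f \<in> invariants lame \<iota> \<pi> \<rho> k p" and \<phi>: "lift \<phi>" and \<psi>: "lift \<psi>"
  shows "((\<lambda>z. t (f (wpow (kcurv lamh \<psi>) k z))), (\<lambda>z. t (f (wpow (kcurv lamh \<phi>) k z)))) \<in>
    cohomologous lamh \<tau> (int k + p)"
proof -
  \<comment> \<open>Two lifts agree under p1, so their difference takes values in n[1].\<close>
  define a where "a x = inv e (\<psi> x - \<phi> x)" for x
  have ea: "e (a x) = \<psi> x - \<phi> x" for x
    unfolding a_def using \<phi> \<psi> by (intro e_inv) (simp add: linear_diff[OF HomD(1)[OF p1_Hom]] lift_def)
  have h: "\<phi> \<in> Hom 0" "\<psi> \<in> Hom 0" and one: "\<phi> (sprod []) = 0" "\<psi> (sprod []) = 0"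
    using \<phi> \<psi> by (simp_all add: lift_def cogenerator_def)
  have hd: "(\<lambda>x. \<psi> x - \<phi> x) \<in> Hom 0" by (rule Hom_diff[OF h(2,1)])
  have a: "a \<in> Hom 0"
  proof -
    have "linear a" by (rule linear_inj_cancel[OF HomD(1)[OF e_Hom] inj_e]) (simp add: ea HomD(1)[OF hd])
    moreover have "a z \<in> gr n" if "z \<in> gr n" for z n
      using HomD(2)[OF hd that] by (intro inj_Hom_gr[OF e_Hom inj_e]) (simp add: ea)
    ultimately show ?thesis by (simp add: Hom_def)
  qed
  have a1: "a (sprod []) = 0"
    using inv_e[of 0] by (simp add: a_def one linear_0[OF HomD(1)[OF e_Hom]])
  let ?\<phi> = "\<lambda>u x. \<phi> x + u *\<^sub>R e (a x)"
  \<comment> \<open>Lifts form an affine space, because p1 vanishes on the image of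
    \<open>e\<close>.\<close>
  have lift_u: "lift (?\<phi> u)" for u
  proof -
    have "?\<phi> u \<in> Hom 0" using HomD[OF h(1)] HomD[OF hd]
      by (auto simp: Hom_def ea intro!: linear_rules gr_add gr_scaleR)
    moreover have "p1 (?\<phi> u x) = sym_proj (T x)" for x
      using \<phi> by (simp add: linear_add[OF HomD(1)[OF p1_Hom]] linear_scale[OF HomD(1)[OF p1_Hom]] p1_e lift_def)
    ultimately show ?thesis by (simp add: lift_def cogenerator_def one a1 linear_0[OF HomD(1)[OF e_Hom]])
  qed
  interpret tw: twisted act lame "codiff lamh" e by (rule twisted_act[OF lamh])
  have cu: "tw.curv (?\<phi> u) (kcurv lamh (?\<phi> u))" for u
    unfolding tw.curv_def using e_kcurv[OF lift_u] kcurv_Hom[OF lift_u] lift_u by (simp add: lift_def)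
  interpret tf: twisted_family act lame "codiff lamh" e \<phi> a "\<lambda>u. kcurv lamh (?\<phi> u)"
    by standard (rule a a1 cu)+
  obtain \<beta> where \<beta>: "\<beta> \<in> Hom (int k + p - 1)"
    "\<And>z. sw (\<lambda>x y. \<tau> (kp (int k + p - 1) x \<otimes>\<^sub>\<real> \<beta> y)) z - sg (int k + p - 1) *\<^sub>R \<beta> (codiff lamh z) =
      t (f (wpow (kcurv lamh (?\<phi> 1)) k z)) - t (f (wpow (kcurv lamh (?\<phi> 0)) k z))"
    using tf.transgression[OF invariants_Hom[OF f] bilinear_\<tau> equivariant[OF f lift_u], of k] by blast
  have 01: "?\<phi> 0 = \<phi>" "?\<phi> 1 = \<psi>" by (simp_all add: ea)
  have "(\<lambda>z. t (f (wpow (kcurv lamh \<psi>) k z)) - t (f (wpow (kcurv lamh \<phi>) k z))) = ruth_diff lamh \<tau> (int k + p - 1) \<beta>"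
    using \<beta>(2) unfolding 01 by (simp add: fun_eq_iff ruth_diff_sw[OF lin_\<tau> HomD(1)[OF \<beta>(1)]])
  then have "(\<lambda>z. t (f (wpow (kcurv lamh \<psi>) k z)) - t (f (wpow (kcurv lamh \<phi>) k z))) \<in> coboundaries lamh \<tau> (int k + p)"
    using \<beta>(1) by (simp add: coboundaries_def)
  then show ?thesis using cw_cocycle[OF f \<phi>] cw_cocycle[OF f \<psi>] by (simp add: cohomologous_def)
qed

end


section \<open>The pullback extension\<close>

lemma pb_fst_Hom: "(pb_fst :: ('h::graded_vector \<times> 'n::graded_vector) shift \<Rightarrow> 'h shift) \<in> Hom 0"
  and pb_snd_Hom: "(pb_snd :: ('h \<times> 'n) shift \<Rightarrow> 'n shift) \<in> Hom 0"
  and pb_pair_0_Hom: "(pb_pair 0 :: 'n shift \<Rightarrow> ('h \<times> 'n) shift) \<in> Hom 0"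
  by (auto simp: Hom_def pb_fst_def pb_snd_def pb_pair_def gr_shift_def gr_prod_def shift_inverse plus_shift_def
      scaleR_shift_def zero_shift_def zero_gr zero_prod_def plus_prod_def scaleR_prod_def
      plus_shift.rep_eq scaleR_shift.rep_eq zero_shift.rep_eq intro!: linearI)

lemma pb_fst_pair [simp]: "pb_fst (pb_pair x y) = x" and pb_snd_pair [simp]: "pb_snd (pb_pair x y) = y"
  and pb_pair_fst_snd: "pb_pair (pb_fst z) (pb_snd z) = z"
  by (simp_all add: pb_fst_def pb_snd_def pb_pair_def shift_inverse unshift_inverse)

lemma inv_pb_pair [simp]: "inv (pb_pair 0) (pb_pair 0 y) = y"
  by (rule inv_f_f) (metis injI pb_snd_pair)

lemma pb_pair_diff: "pb_pair a b - pb_pair c d = pb_pair (a - c) (b - d)"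
  by (simp add: pb_pair_def minus_shift_def minus_shift.rep_eq shift_inverse)

section \<open>Lifts that come from sections of the two extensions\<close>

context lift_setting
begin

text \<open>The exponential is S(s) after T because both are coalgebra morphisms with the same
  projection to g'[1].\<close>

lemma lift_section:
  assumes "is_section \<pi> s"
  shows "s \<in> Hom 0" and "p1 (s x) = x" and "lift (\<lambda>x. s (sym_proj (T x)))"
    and "expc (\<lambda>x. s (sym_proj (T x))) = (\<lambda>x. sym_map s (T x))"
proof -
  show s: "s \<in> Hom 0" and ps: "p1 (s x) = x" for x
    using assms by (auto simp: is_section_def fun_eq_iff)
  have "(\<lambda>x. s (sym_proj (T x))) \<in> Hom 0"
    by (rule Hom_comp[OF s Hom_comp[OF sym_proj_Hom T(2)]])
  then have c: "cogenerator (\<lambda>x. s (sym_proj (T x)))"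
    by (simp add: cogenerator_def sw_morphism_one[OF T(1)] linear_0[OF HomD(1)[OF s]])
  then show "lift (\<lambda>x. s (sym_proj (T x)))" by (simp add: lift_def ps)
  show "expc (\<lambda>x. s (sym_proj (T x))) = (\<lambda>x. sym_map s (T x))"
    by (rule cogenerator.expc_unique[OF c, symmetric])
      (simp_all add: sw_morphism_comp[OF sw_morphism_sym_map[OF s] T(1)] sym_proj_sym_map[OF s])
qed

lemma kcurv_section:
  assumes "is_section \<pi> s"
  shows "kcurv lamh (\<lambda>x. s (sym_proj (T x))) z = curvature lame lamg \<iota> s (T z)"
  by (simp add: kcurv_def curvature_def lift_section(4)[OF assms] sym_proj_T_codiff)

context
  fixes s :: "'g shift \<Rightarrow> 'e shift"
  assumes s: "is_section \<pi> s"
begin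

abbreviation \<phi>T :: "('h \<times> 'n) shift sym \<Rightarrow> 'e shift" where
  "\<phi>T x \<equiv> s (sym_proj (T (pb_proj x))) + e (pb_snd (sym_proj x))"

lemmas s_Hom = lift_section(1)[OF s] and p1_s = lift_section(2)[OF s]

lemma pb_proj_Hom: "(pb_proj :: ('h \<times> 'n) shift sym \<Rightarrow> 'h shift sym) \<in> Hom 0"
  and pb_proj_morphism: "sw_morphism (pb_proj :: ('h \<times> 'n) shift sym \<Rightarrow> 'h shift sym)"
  unfolding pb_proj_def by (rule sym_map_Hom[OF pb_fst_Hom] sw_morphism_sym_map[OF pb_fst_Hom])+

lemma cogenerator_\<phi>T: "cogenerator \<phi>T"
proof
  have "(\<lambda>x :: ('h \<times> 'n) shift sym. s (sym_proj (T (pb_proj x)))) \<in> Hom 0"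
    by (rule Hom_comp[OF s_Hom Hom_comp[OF sym_proj_Hom Hom_comp[OF T(2) pb_proj_Hom]]])
  moreover have "(\<lambda>x :: ('h \<times> 'n) shift sym. e (pb_snd (sym_proj x))) \<in> Hom 0"
    by (rule Hom_comp[OF e_Hom Hom_comp[OF pb_snd_Hom sym_proj_Hom]])
  ultimately show "\<phi>T \<in> Hom 0"
    by (auto simp: Hom_def gr_add intro: linear_compose_add)
  show "\<phi>T (sprod []) = 0"
    by (simp add: sw_morphism_one[OF pb_proj_morphism] sw_morphism_one[OF T(1)] linear_0[OF HomD(1)[OF s_Hom]]
        linear_0[OF HomD(1)[OF e_Hom]] linear_0[OF HomD(1)[OF pb_snd_Hom]])
qed

lemma pb_T_eq: "pb_T \<iota> s T = expc \<phi>T"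
proof -
  interpret cogenerator \<phi>T by (rule cogenerator_\<phi>T)
  show ?thesis unfolding pb_T_def
  proof (rule the_equality)
    show "coalgebra_morphism (expc \<phi>T) \<and> (\<forall>x. sym_proj (expc \<phi>T x) = \<phi>T x)"
      by (simp add: coalgebra_morphism_iff expc_Hom expc_sw_morphism sym_proj_expc)
  qed (auto simp: coalgebra_morphism_iff intro: expc_unique)
qed

lemma p1_\<phi>T: "p1 (\<phi>T x) = sym_proj (T (pb_proj x))"
  by (simp add: linear_add[OF HomD(1)[OF p1_Hom]] p1_s p1_e)

lemma \<pi>_pb_T: "\<pi> (expc \<phi>T x) = T (pb_proj x)"
proof -
  interpret cogenerator \<phi>T by (rule cogenerator_\<phi>T)
  have "(\<lambda>x. \<pi> (expc \<phi>T x)) = (\<lambda>x. T (pb_proj x))"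
    by (rule sw_morphism_unique[OF sw_morphism_comp[OF \<pi>_morphism expc_sw_morphism]
          sw_morphism_comp[OF T(1) pb_proj_morphism]]) (simp only: sym_proj_\<pi> sym_proj_expc p1_\<phi>T)
  then show ?thesis by (rule fun_cong)
qed

text \<open>Left multiplication by a vector of n is a coderivation. The projection to h kills such
  products, so composing with \<open>\<phi>T\<close> leaves \<open>eps x\<close> times the vector,
  and \<open>expc_coderivation\<close> with the counit law gives the formula for multiplication from
  the left.\<close>

lemma pb_T_vee_incl: "expc \<phi>T (x \<or>\<^sub>S sym_incl (pb_pair 0 y)) = expc \<phi>T x \<or>\<^sub>S sym_incl (e y)"
proof -
  interpret cogenerator \<phi>T by (rule cogenerator_\<phi>T)
  note l = bilinearI linear_rules linear_app[OF linear_expc] HomD(1)[OF pb_pair_0_Hom] linear_app[OF HomD(1)[OF e_Hom]]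
    HomD(1)[OF e_Hom] linear_expc
  have "(\<lambda>x y. expc \<phi>T (x \<or>\<^sub>S sym_incl (pb_pair 0 y))) = (\<lambda>x y. expc \<phi>T x \<or>\<^sub>S sym_incl (e y))"
  proof (rule bilinear_hom_eqI)
    fix i j and x :: "('h \<times> 'n) shift sym" and y :: "'n shift" assume x: "x \<in> gr i" and y: "y \<in> gr j"
    have w: "(pb_pair 0 y :: ('h \<times> 'n) shift) \<in> gr j" and ey: "e y \<in> gr j" and Fx: "expc \<phi>T x \<in> gr i"
      using HomD(2)[OF pb_pair_0_Hom y] HomD(2)[OF e_Hom y] HomD(2)[OF expc_Hom x] by simp_all
    have "\<phi>T (pb_pair 0 y \<rhd> x) = eps x *\<^sub>R e y" for x
    proof -
      have "pb_proj (pb_pair 0 y \<rhd> x) = 0"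
        unfolding pb_proj_def by (simp add: sym_map_vcons[OF pb_fst_Hom] bilinear_lzero[OF bilinear_vee])
      then show ?thesis
        by (simp add: sym_proj_vcons linear_0[OF HomD(1)[OF T(2)]] linear_0[OF linear_sym_proj]
            linear_0[OF HomD(1)[OF s_Hom]] linear_scale[OF HomD(1)[OF pb_snd_Hom]] linear_scale[OF HomD(1)[OF e_Hom]])
    qed
    then have "expc \<phi>T (pb_pair 0 y \<rhd> x) = sw (\<lambda>x' x''. eps x' *\<^sub>R (e y \<rhd> expc \<phi>T x'')) x"
      unfolding expc_coderivation[OF coderivation_vcons[OF w]] vconv_def
      by (simp add: linear_scale[OF linear_sym_incl] bilinear_lmul[OF bilinear_vee])
    also have "\<dots> = e y \<rhd> expc \<phi>T x"
      by (rule sw_counit_left) (intro l)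
    finally show "expc \<phi>T (x \<or>\<^sub>S sym_incl (pb_pair 0 y)) = expc \<phi>T x \<or>\<^sub>S sym_incl (e y)"
      by (simp add: vee_incl_right[OF w x] vee_incl_right[OF ey Fx] linear_scale[OF linear_expc])
  qed (intro l)+
  then show ?thesis by (meson fun_cong)
qed

abbreviation "lamp \<equiv> pb_lam lame lamg \<iota> s lamh T"

text \<open>The h-component of the structure map vanishes on products with a vector of n, and so
  does the correction by \<open>s\<close> in the n-component. What remains is the action of g'
  pulled back along \<open>pb_T\<close>.\<close>

lemma pb_ad: "ad lamp pb_incl = tensor_lift (\<lambda>x. act (expc \<phi>T x))"
proof -
  have i: "comp1 (pb_incl :: 'n shift sym \<Rightarrow> ('h \<times> 'n) shift sym) = pb_pair 0"
    unfolding pb_incl_def by (rule comp1_sym_map[OF pb_pair_0_Hom])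
  have "lamp (x \<or>\<^sub>S sym_incl (pb_pair 0 y)) = pb_pair 0 (act (expc \<phi>T x) y)" for x y
  proof -
    have "pb_proj (x \<or>\<^sub>S sym_incl (pb_pair 0 y)) = 0"
      unfolding pb_proj_def sym_map_vee_incl[OF pb_fst_Hom] by (simp add: bilinear_rzero[OF bilinear_vee])
    then show ?thesis
      by (simp add: pb_lam_def pb_T_eq pb_T_vee_incl act_def linear_0[OF HomD(1)[OF lamh_Hom]]
          linear_0[OF HomD(1)[OF T(2)]] linear_0[OF HomD(1)[OF lamg_Hom]] linear_0[OF HomD(1)[OF s_Hom]])
  qed
  then show ?thesis by (simp add: ad_def i)
qed

lemma pb_invariants:
  assumes f: "f \<in> invariants lame \<iota> \<pi> \<rho> k p"
  shows "t \<circ> f \<in> invariants lamp pb_incl pb_proj \<tau> k p"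
proof -
  interpret cogenerator \<phi>T by (rule cogenerator_\<phi>T)
  note w = wder_comp[OF degree_one_act expc_Hom]
  have f': "f \<in> Hom_ext k p" "\<And>x w. f (wder act x w) = sg p *\<^sub>R \<rho> (\<pi> (kp p x) \<otimes>\<^sub>\<real> f w)"
    using f invariants_iff[OF ad_eq degree_one_act HomD(1)[OF \<pi>_Hom] lin_\<rho>] by blast+
  have "t \<circ> f \<in> Hom_ext k p"
    using f'(1) Hom_comp[OF t, of f p] by (auto simp: Hom_ext_def o_def linear_0[OF HomD(1)[OF t]])
  moreover have "t (f (wder act (expc \<phi>T x) w)) = sg p *\<^sub>R \<tau> (pb_proj (kp p x) \<otimes>\<^sub>\<real> t (f w))" for x w
    by (simp only: f'(2) Hom_kp[OF expc_Hom] mult_zero_right sg_0 scaleR_one \<pi>_pb_T t_\<rho>[symmetric] linear_scale[OF HomD(1)[OF t]])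
  ultimately show ?thesis
    unfolding invariants_iff[OF pb_ad w(1) HomD(1)[OF pb_proj_Hom] lin_\<tau>] by (simp add: w(2))
qed

text \<open>The lift is the corestriction of \<open>pb_T\<close> after S(s2). In the curvature of s2
  the h-component cancels since \<open>pb_fst\<close> after s2 is the identity, and the n-component
  is compared in the last step.\<close>

lemma pb_section:
  assumes s2: "is_section (pb_proj :: ('h \<times> 'n) shift sym \<Rightarrow> 'h shift sym) s2"
  shows "lift (\<lambda>x. \<phi>T (sym_map s2 x))"
    and "curvature lamp lamh pb_incl s2 z = kcurv lamh (\<lambda>x. \<phi>T (sym_map s2 x)) z"
proof -
  interpret T: cogenerator \<phi>T by (rule cogenerator_\<phi>T)
  have "comp1 (pb_proj :: ('h \<times> 'n) shift sym \<Rightarrow> 'h shift sym) = pb_fst"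
    unfolding pb_proj_def by (rule comp1_sym_map[OF pb_fst_Hom])
  with s2 have h: "s2 \<in> Hom 0" and ps: "pb_fst (s2 x) = x" for x
    by (auto simp: is_section_def fun_eq_iff)
  note S = sw_morphism_sym_map[OF h]
  have "(\<lambda>x. pb_proj (sym_map s2 x)) = (\<lambda>x. x)"
  proof (rule sw_morphism_unique[OF sw_morphism_comp[OF pb_proj_morphism S]])
    show "sw_morphism (\<lambda>x :: 'h shift sym. x)"
      by (rule sw_morphismI) (simp_all add: linear_ident)
    show "sym_proj (pb_proj (sym_map s2 x)) = sym_proj x" for x
      by (simp add: pb_proj_def sym_proj_sym_map[OF pb_fst_Hom] sym_proj_sym_map[OF h] ps)
  qed
  then have pS: "pb_proj (sym_map s2 x) = x" for x by meson
  have c: "cogenerator (\<lambda>x. \<phi>T (sym_map s2 x))"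
    using Hom_comp[OF T.\<phi>_Hom sym_map_Hom[OF h]] T.\<phi>_one by (simp add: cogenerator_def sw_morphism_one[OF S])
  show l: "lift (\<lambda>x. \<phi>T (sym_map s2 x))"
  proof -
    have "p1 (\<phi>T (sym_map s2 x)) = sym_proj (T x)" for x
      using p1_\<phi>T[of "sym_map s2 x"] by (simp add: pS)
    then show ?thesis unfolding lift_def using c by blast
  qed
  have ex: "expc (\<lambda>x. \<phi>T (sym_map s2 x)) = (\<lambda>x. expc \<phi>T (sym_map s2 x))"
    by (rule cogenerator.expc_unique[OF c, symmetric])
      (simp_all only: sw_morphism_comp[OF T.expc_sw_morphism S] T.sym_proj_expc)
  \<comment> \<open>The n-part \<open>?v\<close> of s2 is subtracted in n[1] on one side and inside
    g'[1] on the other. Both \<open>?Y\<close> and the image of \<open>?v\<close> lie in the image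
    of \<open>e\<close>, where \<open>inv e\<close> respects differences.\<close>
  let ?Y = "lame (expc \<phi>T (sym_map s2 z)) - s (lamg (T z))"
  let ?v = "pb_snd (s2 (lamh z))"
  have "p1 ?Y = 0"
    by (simp add: linear_diff[OF HomD(1)[OF p1_Hom]] p1_lame \<pi>_pb_T pS p1_s)
  then have "e (inv e ?Y - ?v) = ?Y - e ?v"
    by (simp only: linear_diff[OF HomD(1)[OF e_Hom]] e_inv)
  from arg_cong[OF this, of "inv e"] have "inv e (?Y - e ?v) = inv e ?Y - ?v"
    unfolding inv_e by (rule sym)
  moreover have "kcurv lamh (\<lambda>x. \<phi>T (sym_map s2 x)) z = inv e (?Y - e ?v)"
    unfolding kcurv_def ex
    by (simp add: pS sym_proj_T_codiff sym_proj_sym_map[OF h] sym_proj_codiff[OF HomD(1)[OF lamh_Hom]]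
        diff_diff_eq)
  moreover have "curvature lamp lamh pb_incl s2 z = inv e ?Y - ?v"
  proof -
    have "lamp (sym_map s2 z) - s2 (lamh z) = pb_pair (lamh z) (inv e ?Y) - pb_pair (pb_fst (s2 (lamh z))) ?v"
      by (simp add: pb_lam_def pb_T_eq pS pb_pair_fst_snd)
    then show ?thesis
      by (simp add: curvature_def pb_incl_def comp1_sym_map[OF pb_pair_0_Hom] ps pb_pair_diff)
  qed
  ultimately show "curvature lamp lamh pb_incl s2 z = kcurv lamh (\<lambda>x. \<phi>T (sym_map s2 x)) z" by simp
qed

end

end

section \<open>The commuting square\<close>

lemma ruth_pullbackI:
  assumes "ruth_morphism lamh \<tau> lamg \<rho> T t" "ruth lamg \<rho>" "ruth lamh \<tau>"
  shows "ruth_pullback lamh \<tau> lamg \<rho> T t"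
proof (rule ruth_pullback.intro)
  show T: "sw_morphism T" "T \<in> Hom 0" and t: "t \<in> Hom 0" and \<rho>: "linear \<rho>" and \<tau>: "linear \<tau>"
    using assms by (simp_all add: ruth_morphism_def Linfty_morphism_def coalgebra_morphism_iff ruth_def Hom_def)
  show "T (codiff lamh z) = codiff lamg (T z)" for z
    using assms(1) by (simp add: ruth_morphism_def Linfty_morphism_def fun_eq_iff)
  fix x w
  have "t (\<rho> (tensor_map 0 T id (x \<otimes>\<^sub>\<real> w))) = \<tau> (tensor_map 0 id t (x \<otimes>\<^sub>\<real> w))"
    using assms(1) by (simp add: ruth_morphism_def fun_eq_iff)
  then show "t (\<rho> (T x \<otimes>\<^sub>\<real> w)) = \<tau> (x \<otimes>\<^sub>\<real> t w)"
    by (simp add: tensor_map_tensor[OF HomD(1)[OF T(2)] linear_id] tensor_map_tensor[OF linear_id HomD(1)[OF t]])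
qed

lemma ruth_pullback_id:
  assumes "ruth lam \<rho>"
  shows "ruth_pullback lam \<rho> lam \<rho> (\<lambda>x. x) (\<lambda>v. v)"
proof (rule ruth_pullback.intro)
  show "sw_morphism (\<lambda>x :: 'a shift sym. x)"
    by (rule sw_morphismI) (simp_all add: linear_ident)
qed (use assms in \<open>simp_all add: Hom_def linear_ident ruth_def\<close>)

text \<open>\<open>s\<close> builds the model of the pullback, \<open>s1\<close> and
  \<open>s2\<close> compute the two rows; as they are arbitrary, independence of the choice of
  section is included. Membership in the cohomology is claimed because \<open>coho_class\<close> of
  a cochain that is not a cocycle is empty.\<close>

theorem theorem4p9:
  fixes lamn :: "'n::graded_vector shift sym \<Rightarrow> 'n shift"
    and lame :: "'e::graded_vector shift sym \<Rightarrow> 'e shift"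
    and lamg :: "'g::graded_vector shift sym \<Rightarrow> 'g shift"
    and lamh :: "'h::graded_vector shift sym \<Rightarrow> 'h shift"
    and \<iota> :: "'n shift sym \<Rightarrow> 'e shift sym"
    and \<pi> :: "'e shift sym \<Rightarrow> 'g shift sym"
    and \<rho> :: "('g shift sym, 'v::graded_vector) tensor \<Rightarrow> 'v"
    and \<tau> :: "('h shift sym, 'w::graded_vector) tensor \<Rightarrow> 'w"
    and T :: "'h shift sym \<Rightarrow> 'g shift sym"
    and t :: "'v \<Rightarrow> 'w"
    and s s1 :: "'g shift \<Rightarrow> 'e shift"
    and s2 :: "'h shift \<Rightarrow> ('h \<times> 'n) shift"
    and k :: nat and p :: int
  assumes "extension lamn lame lamg \<iota> \<pi>"
    and "Linfty_algebra lamh"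
    and "ruth lamg \<rho>"
    and "ruth lamh \<tau>"
    and "ruth_morphism lamh \<tau> lamg \<rho> T t"
    and "is_section \<pi> s"
    and "is_section \<pi> s1"
    and "is_section (pb_proj :: ('h \<times> 'n) shift sym \<Rightarrow> 'h shift sym) s2"
    and "k \<ge> 1"
  shows "\<forall>f \<in> invariants lame \<iota> \<pi> \<rho> k p.
    t \<circ> f \<in> invariants (pb_lam lame lamg \<iota> s lamh T) pb_incl pb_proj \<tau> k p \<and>
    cw lame lamg \<iota> \<rho> s1 k p f \<in> cohomology lamg \<rho> (int k + p) \<and>
    cw (pb_lam lame lamg \<iota> s lamh T) lamh pb_incl \<tau> s2 k p (t \<circ> f) \<in> cohomology lamh \<tau> (int k + p) \<and>
    coho_pullback lamh \<tau> T t (int k + p) (cw lame lamg \<iota> \<rho> s1 k p f) =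
      cw (pb_lam lame lamg \<iota> s lamh T) lamh pb_incl \<tau> s2 k p (t \<circ> f)"
proof
  fix f assume f: "f \<in> invariants lame \<iota> \<pi> \<rho> k p"
  interpret extension_setting lamn lame lamg \<iota> \<pi> by standard (rule assms(1))
  interpret ruth_pullback lamh \<tau> lamg \<rho> T t by (rule ruth_pullbackI[OF assms(5,3,4)])
  interpret h: lift_setting lamn lame lamg \<iota> \<pi> lamh \<tau> \<rho> T t by standard (rule assms(2))
  have lamg: "Linfty_algebra lamg" using assms(1) by (simp add: extension_def)
  interpret idg: ruth_pullback lamg \<rho> lamg \<rho> "\<lambda>x. x" "\<lambda>v. v" by (rule ruth_pullback_id[OF assms(3)])
  \<comment> \<open>With T the identity, the upper row is itself given by a lift.\<close>
  interpret g: lift_setting lamn lame lamg \<iota> \<pi> lamg \<rho> \<rho> "\<lambda>x. x" "\<lambda>v. v" by standard (rule lamg)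
  let ?lamp = "pb_lam lame lamg \<iota> s lamh T"
  let ?K1 = "curvature lame lamg \<iota> s1"
  let ?\<phi>1 = "\<lambda>x. s1 (sym_proj (T x))"
  let ?\<phi>2 = "\<lambda>x. s (sym_proj (T (pb_proj (sym_map s2 x)))) + comp1 \<iota> (pb_snd (sym_proj (sym_map s2 x)))"
  note l1 = h.lift_section(3)[OF assms(7)] and l2 = h.pb_section(1)[OF assms(6,8)]
  have K1: "?K1 = kcurv lamg (\<lambda>x. s1 (sym_proj x))"
    using g.kcurv_section[OF assms(7)] by (simp add: fun_eq_iff)
  note lK1 = HomD(1)[OF g.kcurv_Hom[OF g.lift_section(3)[OF assms(7)]]]
  have fw1: "f \<circ> wedge_power ?K1 k = (\<lambda>z. f (wpow (kcurv lamg (\<lambda>x. s1 (sym_proj x))) k z))"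
    by (simp add: fun_eq_iff K1 wedge_power_eq[OF lK1 assms(9)])
  have K2: "curvature ?lamp lamh pb_incl s2 = kcurv lamh ?\<phi>2"
    using h.pb_section(2)[OF assms(6,8)] by (simp add: fun_eq_iff)
  have fw2: "t \<circ> f \<circ> wedge_power (curvature ?lamp lamh pb_incl s2) k = (\<lambda>z. t (f (wpow (kcurv lamh ?\<phi>2) k z)))"
    by (simp add: fun_eq_iff K2 wedge_power_eq[OF HomD(1)[OF h.kcurv_Hom[OF l2]] assms(9)])
  have co1: "f \<circ> wedge_power ?K1 k \<in> cocycles lamg \<rho> (int k + p)"
    unfolding fw1 by (rule g.cw_cocycle[OF f g.lift_section(3)[OF assms(7)]])
  have co2: "t \<circ> f \<circ> wedge_power (curvature ?lamp lamh pb_incl s2) k \<in> cocycles lamh \<tau> (int k + p)"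
    unfolding fw2 by (rule h.cw_cocycle[OF f l2])
  \<comment> \<open>Pulling back the representative of the upper row gives exactly the cocycle of
    the lift \<open>?\<phi>1\<close>. The lower row is that of \<open>?\<phi>2\<close>, and
    \<open>cw_cohomologous\<close> compares them.\<close>
  have pull: "t \<circ> (f \<circ> wedge_power ?K1 k) \<circ> T = (\<lambda>z. t (f (wpow (kcurv lamh ?\<phi>1) k z)))"
  proof -
    have "(\<lambda>x. kcurv lamg (\<lambda>x. s1 (sym_proj x)) (T x)) = kcurv lamh ?\<phi>1"
      using h.kcurv_section[OF assms(7)] by (simp add: fun_eq_iff K1[symmetric])
    then show ?thesis
      unfolding fw1 by (simp add: fun_eq_iff wpow_morphism[OF T lK1])
  qed
  have "coho_pullback lamh \<tau> T t (int k + p) (cw lame lamg \<iota> \<rho> s1 k p f) =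
      coho_class lamh \<tau> (int k + p) (\<lambda>z. t (f (wpow (kcurv lamh ?\<phi>1) k z)))"
    unfolding cw_def coho_pullback_class[OF co1] pull ..
  also have "\<dots> = cw ?lamp lamh pb_incl \<tau> s2 k p (t \<circ> f)"
    unfolding cw_def fw2 by (rule coho_class_eq[OF lin_\<tau> h.cw_cohomologous[OF f l2 l1]])
  finally show "t \<circ> f \<in> invariants ?lamp pb_incl pb_proj \<tau> k p \<and>
    cw lame lamg \<iota> \<rho> s1 k p f \<in> cohomology lamg \<rho> (int k + p) \<and>
    cw ?lamp lamh pb_incl \<tau> s2 k p (t \<circ> f) \<in> cohomology lamh \<tau> (int k + p) \<and>
    coho_pullback lamh \<tau> T t (int k + p) (cw lame lamg \<iota> \<rho> s1 k p f) =
      cw ?lamp lamh pb_incl \<tau> s2 k p (t \<circ> f)"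
    using h.pb_invariants[OF assms(6) f] coho_class_in_cohomology[OF co1] coho_class_in_cohomology[OF co2]
    by (simp add: cw_def)
qed

end
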